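(* Let $A$ be a regular weak multiplier bialgebra over a field $k$ with right full comultiplication, and let $R$ be its base algebra. Then there is a faithful functor $M^{(A)}\to {}_RM_R$ from the category of full right $A$-comodules to the category of firm $R$-bimodules.
   Context: Conventions. All vector spaces are over a field $k$; $\otimes$ is $\otimes_k$; the identity map of a space $V$ is also denoted by $V$; composition is juxtaposition; $\mathsf{Lin}(V,W)$ is the space of linear maps; $\mathsf{tw}$ is the flip; $\langle\ldots\rangle$ denotes linear span. For a linear map $f:V\otimes W\to V'\otimes W'$ put $f^{13}=(V'\otimes\mathsf{tw})(f\otimes Z)(V\otimes\mathsf{tw}):V\otimes Z\otimes W\to V'\otimes Z\otimes W'$ for any space $Z$. An associative, possibly non-unital algebra $A$ with multiplication $\mu$ is idempotent if $\mu:A\otimes A\to A$ is surjective, and non-degenerate if each of ($ab=0\ \forall b\in A$) and ($ba=0\ \forall b\in A$) implies $a=0$. For such $A$, $\mathbb M(A)$ is the multiplier algebra of pairs $(\lambda,\varrho)$ of linear maps $A\to A$ with $a\lambda(b)=\varrho(a)b$; it is unital and contains $A$ as a two-sided ideal via $(\lambda,\varrho)a=\lambda(a)$, $a(\lambda,\varrho)=\varrho(a)$. A regular weak multiplier bialgebra is an idempotent non-degenerate $k$-algebra $A$ with linear maps $E_1,E_2,T_1,T_2,T_3,T_4:A\otimes A\to A\otimes A$ and $\epsilon:A\to k$ such that for all $a,b,c,d\in A$: (i) $(a\otimes b)E_1(c\otimes d)=E_2(a\otimes b)(c\otimes d)$; (ii) $E_1^2=E_1$; (iii) $(T_2\otimes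 A)(A\otimes T_1)=(A\otimes T_1)(T_2\otimes A)$; (iv) $(\epsilon\otimes A)T_1=\mu=(A\otimes\epsilon)T_2$; (v) $(\mu\otimes A)T_1^{13}(A\otimes T_1)=T_1(\mu\otimes A)$; (vi) $\langle T_1(a\otimes c)(b\otimes 1)\mid a,b,c\in A\rangle=\langle E_1(b\otimes c)\mid b,c\in A\rangle$ and $\langle(1\otimes c)T_2(b\otimes a)\mid a,b,c\in A\rangle=\langle E_2(b\otimes c)\mid b,c\in A\rangle$; (vii) $(E_1\otimes A)(A\otimes T_1)=(A\otimes T_1)(E_1\otimes A)$ and $(E_2\otimes A)(A\otimes T_2)=(A\otimes T_2)E_2^{13}$; (viii) $(\epsilon\otimes A)((1\otimes a)E_1(b\otimes c))=(\epsilon\otimes A)(T_1(a\otimes c)(b\otimes1))$ and $(\epsilon\otimes A)(E_2(a\otimes b)(1\otimes c))=(\epsilon\otimes A)((1\otimes b)T_2(a\otimes c))$; (ix) $(1\otimes a)T_1(c\otimes b)=T_3(c\otimes a)(1\otimes b)$ and $T_2(a\otimes c)(b\otimes1)=(a\otimes1)T_4(b\otimes c)$. The maps $\overline\sqcap^R,\sqcap^R:A\to\mathbb M(A)$ are given by $\overline\sqcap^R(a)b=(A\otimes\epsilon)E_1(b\otimes a)$, $b\overline\sqcap^R(a)=(A\otimes\epsilon)T_1(b\otimes a)$, $\sqcap^R(a)b=(A\otimes\epsilon)T_3(b\otimes a)$, $b\sqcap^R(a)=(A\otimes\epsilon)E_2(b\otimes a)$. The comultiplication is right full if $A=\langle(A\otimes\omega)T_1(a\otimes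 b)\mid a,b\in A,\ \omega\in\mathsf{Lin}(A,k)\rangle$. In that case the ranges of $\sqcap^R$ and $\overline\sqcap^R$ coincide; this common range $R\subseteq\mathbb M(A)$ is a (non-unital) subalgebra with local units, called the base algebra. An (associative) one-sided $R$-module $M$ is firm if the action induces an isomorphism $M\otimes_RR\to M$ (resp. $R\otimes_RM\to M$); as $R$ has local units this amounts to surjectivity of the action. An $R$-bimodule is firm if it is firm on both sides; ${}_RM_R$ is the category of firm $R$-bimodules and bimodule maps. A right $A$-comodule is a vector space $V$ with linear maps $\lambda,\varrho:V\otimes A\to V\otimes A$ such that $(1\otimes a)\lambda(v\otimes b)=\varrho(v\otimes a)(1\otimes b)$ for all $v\in V$, $a,b\in A$ (where $(1\otimes a)(v\otimes b)=v\otimes ab$, $(v\otimes b)(1\otimes a)=v\otimes ba$), $(\lambda\otimes A)\lambda^{13}(V\otimes E_1)=(\lambda\otimes A)\lambda^{13}$ and $(\lambda\otimes A)\lambda^{13}(V\otimes T_1)=(V\otimes T_1)(\lambda\otimes A)$. A morphism $f:V\to V'$ of comodules is a linear map with $\lambda'(f\otimes A)=(f\otimes A)\lambda$ (equivalently $\varrho'(f\otimes A)=(f\otimes A)\varrho$). The comodule is full if $V=\langle(V\otimes\omega)\lambda(v\otimes a)\mid v\in V,a\in A,\omega\in\mathsf{Lin}(A,k)\rangle$ (equivalently, the same with $\varrho$ in place of $\lambda$). $M^{(A)}$ is the full subcategory of full comodules in the category of right $A$-comodules. *)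

theory Defs
  imports "HOL-Algebra.Module" "HOL-Algebra.AbelCoset"
begin

text \<open>
  A vector space over \<open>K\<close> is a \<^locale>\<open>module\<close> over a \<^locale>\<open>field\<close> \<open>K\<close>. The \<^typ>\<open>('k, 'v) module\<close>
  record also has the ring fields \<^const>\<open>mult\<close> and \<^const>\<open>one\<close>. For a non-unital algebra only
  \<^const>\<open>mult\<close> is meaningful, for a mere vector space neither is. Linear maps are functions whose
  values outside the carrier are irrelevant, except in sets of maps in which equality matters
  (multipliers and morphisms), where they are required to be extensional.
\<close>

section \<open>Linear maps, spans, quotients and tensor products\<close>

type_synonym ('v, 'w, 'k) tensor = "('v \<times> 'w \<Rightarrow> 'k) set"

context
  fixes K :: "('k, 'm) ring_scheme"
begin

definition lin_map ::
    "('k, 'v, 'a) module_scheme \<Rightarrow> ('k, 'w, 'b) module_scheme \<Rightarrow> ('v \<Rightarrow> 'w) set" where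
  "lin_map V W = {f \<in> carrier V \<rightarrow> carrier W.
     (\<forall>x\<in>carrier V. \<forall>y\<in>carrier V. f (x \<oplus>\<^bsub>V\<^esub> y) = f x \<oplus>\<^bsub>W\<^esub> f y) \<and>
     (\<forall>c\<in>carrier K. \<forall>x\<in>carrier V. f (c \<odot>\<^bsub>V\<^esub> x) = c \<odot>\<^bsub>W\<^esub> f x)}"

definition lin_iso ::
    "('k, 'v, 'a) module_scheme \<Rightarrow> ('k, 'w, 'b) module_scheme \<Rightarrow> ('v \<Rightarrow> 'w) \<Rightarrow> bool" where
  "lin_iso V W f \<longleftrightarrow> f \<in> lin_map V W \<and> bij_betw f (carrier V) (carrier W)"

definition bilin_map ::
    "('k, 'u, 'a) module_scheme \<Rightarrow> ('k, 'v, 'b) module_scheme \<Rightarrow> ('k, 'w, 'c) module_scheme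
      \<Rightarrow> ('u \<Rightarrow> 'v \<Rightarrow> 'w) \<Rightarrow> bool" where
  "bilin_map U V W \<beta> \<longleftrightarrow>
     (\<forall>u\<in>carrier U. \<beta> u \<in> lin_map V W) \<and> (\<forall>v\<in>carrier V. (\<lambda>u. \<beta> u v) \<in> lin_map U W)"

definition span_of :: "('k, 'v, 'a) module_scheme \<Rightarrow> 'v set \<Rightarrow> 'v set" where
  "span_of V S = \<Inter> {U. submodule U K V \<and> S \<subseteq> U}"

definition scalars :: "('k, 'k) module" where
  "scalars = \<lparr>carrier = carrier K, mult = mult K, one = one K, zero = zero K, add = add K,
     smult = mult K\<rparr>"

definition quot_space :: "('k, 'v, 'a) module_scheme \<Rightarrow> 'v set \<Rightarrow> ('k, 'v set) module" where
  "quot_space V U = \<lparr>carrier = a_rcosets\<^bsub>V\<^esub> U, mult = undefined, one = undefined,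
     zero = U, add = set_add V, smult = (\<lambda>c X. \<Union>x\<in>X. U +>\<^bsub>V\<^esub> (c \<odot>\<^bsub>V\<^esub> x))\<rparr>"

definition quot_lift :: "('v \<Rightarrow> 'w) \<Rightarrow> 'v set \<Rightarrow> 'w" where
  "quot_lift f X = f (SOME x. x \<in> X)"

definition free_space :: "'x set \<Rightarrow> ('k, 'x \<Rightarrow> 'k) module" where
  "free_space X = \<lparr>
     carrier = {p. (\<forall>x\<in>X. p x \<in> carrier K) \<and> (\<forall>x. x \<notin> X \<longrightarrow> p x = \<zero>\<^bsub>K\<^esub>) \<and>
       finite {x. p x \<noteq> \<zero>\<^bsub>K\<^esub>}},
     mult = undefined, one = undefined,
     zero = (\<lambda>x. \<zero>\<^bsub>K\<^esub>), add = (\<lambda>p q x. p x \<oplus>\<^bsub>K\<^esub> q x), smult = (\<lambda>c p x. c \<otimes>\<^bsub>K\<^esub> p x)\<rparr>"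

definition free_gen :: "'x \<Rightarrow> 'x \<Rightarrow> 'k" where
  "free_gen x = (\<lambda>y. if y = x then \<one>\<^bsub>K\<^esub> else \<zero>\<^bsub>K\<^esub>)"

definition tensor_rels ::
    "('k, 'v, 'a) module_scheme \<Rightarrow> ('k, 'w, 'b) module_scheme \<Rightarrow> ('v \<times> 'w \<Rightarrow> 'k) set" where
  "tensor_rels V W = (let F = free_space (carrier V \<times> carrier W) in
     {free_gen (v \<oplus>\<^bsub>V\<^esub> v', w) \<ominus>\<^bsub>F\<^esub> (free_gen (v, w) \<oplus>\<^bsub>F\<^esub> free_gen (v', w)) | v v' w.
        v \<in> carrier V \<and> v' \<in> carrier V \<and> w \<in> carrier W} \<union>
     {free_gen (v, w \<oplus>\<^bsub>W\<^esub> w') \<ominus>\<^bsub>F\<^esub> (free_gen (v, w) \<oplus>\<^bsub>F\<^esub> free_gen (v, w')) | v w w'.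
        v \<in> carrier V \<and> w \<in> carrier W \<and> w' \<in> carrier W} \<union>
     {free_gen (c \<odot>\<^bsub>V\<^esub> v, w) \<ominus>\<^bsub>F\<^esub> (c \<odot>\<^bsub>F\<^esub> free_gen (v, w)) | c v w.
        c \<in> carrier K \<and> v \<in> carrier V \<and> w \<in> carrier W} \<union>
     {free_gen (v, c \<odot>\<^bsub>W\<^esub> w) \<ominus>\<^bsub>F\<^esub> (c \<odot>\<^bsub>F\<^esub> free_gen (v, w)) | c v w.
        c \<in> carrier K \<and> v \<in> carrier V \<and> w \<in> carrier W})"

definition tensor_kernel ::
    "('k, 'v, 'a) module_scheme \<Rightarrow> ('k, 'w, 'b) module_scheme \<Rightarrow> ('v \<times> 'w \<Rightarrow> 'k) set" where
  "tensor_kernel V W = span_of (free_space (carrier V \<times> carrier W)) (tensor_rels V W)"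

definition tensor_space ::
    "('k, 'v, 'a) module_scheme \<Rightarrow> ('k, 'w, 'b) module_scheme \<Rightarrow> ('k, ('v, 'w, 'k) tensor) module"
    (infixl \<open>\<boxtimes>\<close> 72) where
  "V \<boxtimes> W = quot_space (free_space (carrier V \<times> carrier W)) (tensor_kernel V W)"

definition pure_tensor ::
    "('k, 'v, 'a) module_scheme \<Rightarrow> ('k, 'w, 'b) module_scheme \<Rightarrow> 'v \<Rightarrow> 'w \<Rightarrow> ('v, 'w, 'k) tensor"
    where
  "pure_tensor V W v w =
     tensor_kernel V W +>\<^bsub>free_space (carrier V \<times> carrier W)\<^esub> free_gen (v, w)"

text \<open>The linear map \<open>V \<boxtimes> W \<rightarrow> U\<close> induced by a bilinear map \<open>\<beta>\<close>; meaningless for any other \<open>\<beta>\<close>.\<close>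

definition tensor_lift ::
    "('k, 'u, 'a) module_scheme \<Rightarrow> ('v \<Rightarrow> 'w \<Rightarrow> 'u) \<Rightarrow> ('v, 'w, 'k) tensor \<Rightarrow> 'u" where
  "tensor_lift U \<beta> =
     quot_lift (\<lambda>p. \<Oplus>\<^bsub>U\<^esub>z\<in>{z. p z \<noteq> \<zero>\<^bsub>K\<^esub>}. p z \<odot>\<^bsub>U\<^esub> \<beta> (fst z) (snd z))"

text \<open>\<open>tensor_map V' W' f g\<close> is \<open>f \<otimes> g : V \<otimes> W \<rightarrow> V' \<otimes> W'\<close>.\<close>

definition tensor_map ::
    "('k, 'v2, 'a) module_scheme \<Rightarrow> ('k, 'w2, 'b) module_scheme
      \<Rightarrow> ('v \<Rightarrow> 'v2) \<Rightarrow> ('w \<Rightarrow> 'w2) \<Rightarrow> ('v, 'w, 'k) tensor \<Rightarrow> ('v2, 'w2, 'k) tensor" where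
  "tensor_map V' W' f g = tensor_lift (V' \<boxtimes> W') (\<lambda>v w. pure_tensor V' W' (f v) (g w))"

definition tensor_flip ::
    "('k, 'v, 'a) module_scheme \<Rightarrow> ('k, 'w, 'b) module_scheme
      \<Rightarrow> ('v, 'w, 'k) tensor \<Rightarrow> ('w, 'v, 'k) tensor" where
  "tensor_flip V W = tensor_lift (W \<boxtimes> V) (\<lambda>v w. pure_tensor W V w v)"

definition tensor_assoc ::
    "('k, 'u, 'a) module_scheme \<Rightarrow> ('k, 'v, 'b) module_scheme \<Rightarrow> ('k, 'w, 'c) module_scheme
      \<Rightarrow> (('u, 'v, 'k) tensor, 'w, 'k) tensor \<Rightarrow> ('u, ('v, 'w, 'k) tensor, 'k) tensor" where
  "tensor_assoc U V W = tensor_lift (U \<boxtimes> (V \<boxtimes> W))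
     (\<lambda>x w. tensor_lift (U \<boxtimes> (V \<boxtimes> W))
        (\<lambda>u v. pure_tensor U (V \<boxtimes> W) u (pure_tensor V W v w)) x)"

definition tensor_unassoc ::
    "('k, 'u, 'a) module_scheme \<Rightarrow> ('k, 'v, 'b) module_scheme \<Rightarrow> ('k, 'w, 'c) module_scheme
      \<Rightarrow> ('u, ('v, 'w, 'k) tensor, 'k) tensor \<Rightarrow> (('u, 'v, 'k) tensor, 'w, 'k) tensor" where
  "tensor_unassoc U V W = tensor_lift (U \<boxtimes> V \<boxtimes> W)
     (\<lambda>u y. tensor_lift (U \<boxtimes> V \<boxtimes> W)
        (\<lambda>v w. pure_tensor (U \<boxtimes> V) W (pure_tensor U V u v) w) y)"

text \<open>
  Leg numbering on triple tensor products, which are bracketed to the left. The map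
  \<open>leg12 V' W' Z f\<close> is \<open>f \<otimes> Z\<close> for \<open>f : V \<otimes> W \<rightarrow> V' \<otimes> W'\<close>, the map \<open>leg23 U V W V' W' f\<close> is
  \<open>U \<otimes> f\<close> for \<open>f : V \<otimes> W \<rightarrow> V' \<otimes> W'\<close>, and \<open>leg13 V Z W f\<close> is
  \<open>(V \<otimes> tw) (f \<otimes> Z) (V \<otimes> tw)\<close> for an endomorphism \<open>f\<close> of \<open>V \<otimes> W\<close>.
\<close>

definition leg12 ::
    "('k, 'v2, 'a) module_scheme \<Rightarrow> ('k, 'w2, 'b) module_scheme \<Rightarrow> ('k, 'z, 'c) module_scheme
      \<Rightarrow> (('v, 'w, 'k) tensor \<Rightarrow> ('v2, 'w2, 'k) tensor)
      \<Rightarrow> (('v, 'w, 'k) tensor, 'z, 'k) tensor \<Rightarrow> (('v2, 'w2, 'k) tensor, 'z, 'k) tensor" where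
  "leg12 V' W' Z f = tensor_map (V' \<boxtimes> W') Z f (\<lambda>z. z)"

definition leg23 ::
    "('k, 'u, 'a) module_scheme \<Rightarrow> ('k, 'v, 'b) module_scheme \<Rightarrow> ('k, 'w, 'c) module_scheme
      \<Rightarrow> ('k, 'v2, 'd) module_scheme \<Rightarrow> ('k, 'w2, 'e) module_scheme
      \<Rightarrow> (('v, 'w, 'k) tensor \<Rightarrow> ('v2, 'w2, 'k) tensor)
      \<Rightarrow> (('u, 'v, 'k) tensor, 'w, 'k) tensor \<Rightarrow> (('u, 'v2, 'k) tensor, 'w2, 'k) tensor" where
  "leg23 U V W V' W' f =
     tensor_unassoc U V' W' \<circ> tensor_map U (V' \<boxtimes> W') (\<lambda>u. u) f \<circ> tensor_assoc U V W"

definition leg13 ::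
    "('k, 'v, 'a) module_scheme \<Rightarrow> ('k, 'z, 'b) module_scheme \<Rightarrow> ('k, 'w, 'c) module_scheme
      \<Rightarrow> (('v, 'w, 'k) tensor \<Rightarrow> ('v, 'w, 'k) tensor)
      \<Rightarrow> (('v, 'z, 'k) tensor, 'w, 'k) tensor \<Rightarrow> (('v, 'z, 'k) tensor, 'w, 'k) tensor" where
  "leg13 V Z W f =
     leg23 V W Z Z W (tensor_flip W Z) \<circ> leg12 V W Z f \<circ> leg23 V Z W W Z (tensor_flip Z W)"

text \<open>\<open>contract_right V \<omega>\<close> is \<open>V \<otimes> \<omega> : V \<otimes> W \<rightarrow> V\<close> and \<open>contract_left W \<omega>\<close> is
  \<open>\<omega> \<otimes> W : V \<otimes> W \<rightarrow> W\<close>, for a functional \<open>\<omega>\<close>.\<close>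

definition contract_right ::
    "('k, 'v, 'a) module_scheme \<Rightarrow> ('w \<Rightarrow> 'k) \<Rightarrow> ('v, 'w, 'k) tensor \<Rightarrow> 'v" where
  "contract_right V \<omega> = tensor_lift V (\<lambda>v w. \<omega> w \<odot>\<^bsub>V\<^esub> v)"

definition contract_left ::
    "('k, 'w, 'a) module_scheme \<Rightarrow> ('v \<Rightarrow> 'k) \<Rightarrow> ('v, 'w, 'k) tensor \<Rightarrow> 'w" where
  "contract_left W \<omega> = tensor_lift W (\<lambda>v w. \<omega> v \<odot>\<^bsub>W\<^esub> w)"

section \<open>Non-unital algebras and multipliers\<close>

definition nonunital_algebra :: "('k, 'a, 'c) module_scheme \<Rightarrow> bool" where
  "nonunital_algebra A \<longleftrightarrow> module K A \<and> bilin_map A A A (mult A) \<and>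
     (\<forall>a\<in>carrier A. \<forall>b\<in>carrier A. \<forall>c\<in>carrier A.
        (a \<otimes>\<^bsub>A\<^esub> b) \<otimes>\<^bsub>A\<^esub> c = a \<otimes>\<^bsub>A\<^esub> (b \<otimes>\<^bsub>A\<^esub> c))"

definition mult_map :: "('k, 'a, 'c) module_scheme \<Rightarrow> ('a, 'a, 'k) tensor \<Rightarrow> 'a" where
  "mult_map A = tensor_lift A (mult A)"

definition idempotent_algebra :: "('k, 'a, 'c) module_scheme \<Rightarrow> bool" where
  "idempotent_algebra A \<longleftrightarrow> mult_map A ` carrier (A \<boxtimes> A) = carrier A"

definition nondegenerate_algebra :: "('k, 'a, 'c) module_scheme \<Rightarrow> bool" where
  "nondegenerate_algebra A \<longleftrightarrow> (\<forall>a\<in>carrier A.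
     ((\<forall>b\<in>carrier A. a \<otimes>\<^bsub>A\<^esub> b = \<zero>\<^bsub>A\<^esub>) \<longrightarrow> a = \<zero>\<^bsub>A\<^esub>) \<and>
     ((\<forall>b\<in>carrier A. b \<otimes>\<^bsub>A\<^esub> a = \<zero>\<^bsub>A\<^esub>) \<longrightarrow> a = \<zero>\<^bsub>A\<^esub>))"

definition tensor_mult ::
    "('k, 'a, 'c) module_scheme \<Rightarrow> ('a, 'a, 'k) tensor \<Rightarrow> ('a, 'a, 'k) tensor
      \<Rightarrow> ('a, 'a, 'k) tensor" where
  "tensor_mult A x y = tensor_lift (A \<boxtimes> A)
     (\<lambda>a b. tensor_map A A (\<lambda>c. a \<otimes>\<^bsub>A\<^esub> c) (\<lambda>d. b \<otimes>\<^bsub>A\<^esub> d) y) x"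

text \<open>\<open>lmul1 A W a x = (a \<otimes> 1) x\<close> and \<open>rmul1 A W a x = x (a \<otimes> 1)\<close> on \<open>A \<otimes> W\<close>;
  \<open>lmul2 V A a x = (1 \<otimes> a) x\<close> and \<open>rmul2 V A a x = x (1 \<otimes> a)\<close> on \<open>V \<otimes> A\<close>.\<close>

definition lmul1 ::
    "('k, 'a, 'c) module_scheme \<Rightarrow> ('k, 'w, 'd) module_scheme \<Rightarrow> 'a
      \<Rightarrow> ('a, 'w, 'k) tensor \<Rightarrow> ('a, 'w, 'k) tensor" where
  "lmul1 A W a = tensor_map A W (\<lambda>b. a \<otimes>\<^bsub>A\<^esub> b) (\<lambda>w. w)"

definition rmul1 ::
    "('k, 'a, 'c) module_scheme \<Rightarrow> ('k, 'w, 'd) module_scheme \<Rightarrow> 'a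
      \<Rightarrow> ('a, 'w, 'k) tensor \<Rightarrow> ('a, 'w, 'k) tensor" where
  "rmul1 A W a = tensor_map A W (\<lambda>b. b \<otimes>\<^bsub>A\<^esub> a) (\<lambda>w. w)"

definition lmul2 ::
    "('k, 'v, 'c) module_scheme \<Rightarrow> ('k, 'a, 'd) module_scheme \<Rightarrow> 'a
      \<Rightarrow> ('v, 'a, 'k) tensor \<Rightarrow> ('v, 'a, 'k) tensor" where
  "lmul2 V A a = tensor_map V A (\<lambda>v. v) (\<lambda>b. a \<otimes>\<^bsub>A\<^esub> b)"

definition rmul2 ::
    "('k, 'v, 'c) module_scheme \<Rightarrow> ('k, 'a, 'd) module_scheme \<Rightarrow> 'a
      \<Rightarrow> ('v, 'a, 'k) tensor \<Rightarrow> ('v, 'a, 'k) tensor" where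
  "rmul2 V A a = tensor_map V A (\<lambda>v. v) (\<lambda>b. b \<otimes>\<^bsub>A\<^esub> a)"

definition multiplier_algebra ::
    "('k, 'a, 'c) module_scheme \<Rightarrow> ('k, ('a \<Rightarrow> 'a) \<times> ('a \<Rightarrow> 'a)) module" where
  "multiplier_algebra A = \<lparr>
     carrier = {(l, r). l \<in> lin_map A A \<inter> extensional (carrier A) \<and>
       r \<in> lin_map A A \<inter> extensional (carrier A) \<and>
       (\<forall>a\<in>carrier A. \<forall>b\<in>carrier A. a \<otimes>\<^bsub>A\<^esub> l b = r a \<otimes>\<^bsub>A\<^esub> b)},
     mult = (\<lambda>(l, r) (l', r'). (compose (carrier A) l l', compose (carrier A) r' r)),
     one = (\<lambda>a\<in>carrier A. a, \<lambda>a\<in>carrier A. a),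
     zero = (\<lambda>a\<in>carrier A. \<zero>\<^bsub>A\<^esub>, \<lambda>a\<in>carrier A. \<zero>\<^bsub>A\<^esub>),
     add = (\<lambda>(l, r) (l', r').
       (\<lambda>a\<in>carrier A. l a \<oplus>\<^bsub>A\<^esub> l' a, \<lambda>a\<in>carrier A. r a \<oplus>\<^bsub>A\<^esub> r' a)),
     smult = (\<lambda>c (l, r). (\<lambda>a\<in>carrier A. c \<odot>\<^bsub>A\<^esub> l a, \<lambda>a\<in>carrier A. c \<odot>\<^bsub>A\<^esub> r a))\<rparr>"

end

section \<open>Regular weak multiplier bialgebras\<close>

record ('k, 'a) wmb = "('k, 'a) module" +
  E1 :: "('a, 'a, 'k) tensor \<Rightarrow> ('a, 'a, 'k) tensor"
  E2 :: "('a, 'a, 'k) tensor \<Rightarrow> ('a, 'a, 'k) tensor"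
  T1 :: "('a, 'a, 'k) tensor \<Rightarrow> ('a, 'a, 'k) tensor"
  T2 :: "('a, 'a, 'k) tensor \<Rightarrow> ('a, 'a, 'k) tensor"
  T3 :: "('a, 'a, 'k) tensor \<Rightarrow> ('a, 'a, 'k) tensor"
  T4 :: "('a, 'a, 'k) tensor \<Rightarrow> ('a, 'a, 'k) tensor"
  counit :: "'a \<Rightarrow> 'k"

locale regular_weak_multiplier_bialgebra =
  fixes K :: "('k, 'm) ring_scheme" and A :: "('k, 'a, 'n) wmb_scheme"
  assumes base_field: "field K"
    and algebra_A: "nonunital_algebra K A"
    and idempotent_A: "idempotent_algebra K A"
    and nondegenerate_A: "nondegenerate_algebra A"
    and E1_linear: "E1 A \<in> lin_map K (tensor_space K A A) (tensor_space K A A)"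
    and E2_linear: "E2 A \<in> lin_map K (tensor_space K A A) (tensor_space K A A)"
    and T1_linear: "T1 A \<in> lin_map K (tensor_space K A A) (tensor_space K A A)"
    and T2_linear: "T2 A \<in> lin_map K (tensor_space K A A) (tensor_space K A A)"
    and T3_linear: "T3 A \<in> lin_map K (tensor_space K A A) (tensor_space K A A)"
    and T4_linear: "T4 A \<in> lin_map K (tensor_space K A A) (tensor_space K A A)"
    and counit_linear: "counit A \<in> lin_map K A (scalars K)"
    and E1_E2: "\<lbrakk>a \<in> carrier A; b \<in> carrier A; c \<in> carrier A; d \<in> carrier A\<rbrakk> \<Longrightarrow>
      tensor_mult K A (pure_tensor K A A a b) (E1 A (pure_tensor K A A c d)) =
      tensor_mult K A (E2 A (pure_tensor K A A a b)) (pure_tensor K A A c d)"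
    and E1_idem: "\<And>x. x \<in> carrier (tensor_space K A A) \<Longrightarrow> E1 A (E1 A x) = E1 A x"
    and T2_T1_commute: "\<And>x. x \<in> carrier (tensor_space K (tensor_space K A A) A) \<Longrightarrow>
      leg12 K A A A (T2 A) (leg23 K A A A A A (T1 A) x) =
      leg23 K A A A A A (T1 A) (leg12 K A A A (T2 A) x)"
    and counit_T1: "\<And>x. x \<in> carrier (tensor_space K A A) \<Longrightarrow>
      contract_left K A (counit A) (T1 A x) = mult_map K A x"
    and counit_T2: "\<And>x. x \<in> carrier (tensor_space K A A) \<Longrightarrow>
      contract_right K A (counit A) (T2 A x) = mult_map K A x"
    and T1_mult: "\<And>x. x \<in> carrier (tensor_space K (tensor_space K A A) A) \<Longrightarrow>
      tensor_map K A A (mult_map K A) (\<lambda>a. a)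
        (leg13 K A A A (T1 A) (leg23 K A A A A A (T1 A) x)) =
      T1 A (tensor_map K A A (mult_map K A) (\<lambda>a. a) x)"
    and T1_E1_range:
      "span_of K (tensor_space K A A)
         {rmul1 K A A b (T1 A (pure_tensor K A A a c)) | a b c.
            a \<in> carrier A \<and> b \<in> carrier A \<and> c \<in> carrier A} =
       span_of K (tensor_space K A A)
         {E1 A (pure_tensor K A A b c) | b c. b \<in> carrier A \<and> c \<in> carrier A}"
    and T2_E2_range:
      "span_of K (tensor_space K A A)
         {lmul2 K A A c (T2 A (pure_tensor K A A b a)) | a b c.
            a \<in> carrier A \<and> b \<in> carrier A \<and> c \<in> carrier A} =
       span_of K (tensor_space K A A)
         {E2 A (pure_tensor K A A b c) | b c. b \<in> carrier A \<and> c \<in> carrier A}"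
    and E1_T1: "\<And>x. x \<in> carrier (tensor_space K (tensor_space K A A) A) \<Longrightarrow>
      leg12 K A A A (E1 A) (leg23 K A A A A A (T1 A) x) =
      leg23 K A A A A A (T1 A) (leg12 K A A A (E1 A) x)"
    and E2_T2: "\<And>x. x \<in> carrier (tensor_space K (tensor_space K A A) A) \<Longrightarrow>
      leg12 K A A A (E2 A) (leg23 K A A A A A (T2 A) x) =
      leg23 K A A A A A (T2 A) (leg13 K A A A (E2 A) x)"
    and counit_E1: "\<lbrakk>a \<in> carrier A; b \<in> carrier A; c \<in> carrier A\<rbrakk> \<Longrightarrow>
      contract_left K A (counit A) (lmul2 K A A a (E1 A (pure_tensor K A A b c))) =
      contract_left K A (counit A) (rmul1 K A A b (T1 A (pure_tensor K A A a c)))"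
    and counit_E2: "\<lbrakk>a \<in> carrier A; b \<in> carrier A; c \<in> carrier A\<rbrakk> \<Longrightarrow>
      contract_left K A (counit A) (rmul2 K A A c (E2 A (pure_tensor K A A a b))) =
      contract_left K A (counit A) (lmul2 K A A b (T2 A (pure_tensor K A A a c)))"
    and T1_T3: "\<lbrakk>a \<in> carrier A; b \<in> carrier A; c \<in> carrier A\<rbrakk> \<Longrightarrow>
      lmul2 K A A a (T1 A (pure_tensor K A A c b)) =
      rmul2 K A A b (T3 A (pure_tensor K A A c a))"
    and T2_T4: "\<lbrakk>a \<in> carrier A; b \<in> carrier A; c \<in> carrier A\<rbrakk> \<Longrightarrow>
      rmul1 K A A b (T2 A (pure_tensor K A A a c)) =
      lmul1 K A A a (T4 A (pure_tensor K A A b c))"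

context
  fixes K :: "('k, 'm) ring_scheme" and A :: "('k, 'a, 'n) wmb_scheme"
begin

definition right_full :: bool where
  "right_full \<longleftrightarrow> carrier A = span_of K A
     {contract_right K A \<omega> (T1 A (pure_tensor K A A a b)) | \<omega> a b.
        a \<in> carrier A \<and> b \<in> carrier A \<and> \<omega> \<in> lin_map K A (scalars K)}"

definition sqcap_R_bar :: "'a \<Rightarrow> ('a \<Rightarrow> 'a) \<times> ('a \<Rightarrow> 'a)" where
  "sqcap_R_bar a =
     (\<lambda>b\<in>carrier A. contract_right K A (counit A) (E1 A (pure_tensor K A A b a)),
      \<lambda>b\<in>carrier A. contract_right K A (counit A) (T1 A (pure_tensor K A A b a)))"

definition sqcap_R :: "'a \<Rightarrow> ('a \<Rightarrow> 'a) \<times> ('a \<Rightarrow> 'a)" where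
  "sqcap_R a =
     (\<lambda>b\<in>carrier A. contract_right K A (counit A) (T3 A (pure_tensor K A A b a)),
      \<lambda>b\<in>carrier A. contract_right K A (counit A) (E2 A (pure_tensor K A A b a)))"

text \<open>For a right full comultiplication, the ranges of \<^const>\<open>sqcap_R\<close> and \<^const>\<open>sqcap_R_bar\<close>
  coincide. The \<^const>\<open>one\<close> of the base algebra, inherited from the multiplier algebra, need not
  lie in its carrier.\<close>

definition base_algebra :: "('k, ('a \<Rightarrow> 'a) \<times> ('a \<Rightarrow> 'a)) module" where
  "base_algebra = multiplier_algebra K A \<lparr>carrier := sqcap_R ` carrier A\<rparr>"

end

section \<open>Categories and functors\<close>

record ('o, 'h) category =
  Obj :: "'o set"
  Hom :: "'o \<Rightarrow> 'o \<Rightarrow> 'h set"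
  Id :: "'o \<Rightarrow> 'h"
  Comp :: "'o \<Rightarrow> 'o \<Rightarrow> 'o \<Rightarrow> 'h \<Rightarrow> 'h \<Rightarrow> 'h"

text \<open>\<open>Comp C X Y Z g f\<close> is the composite of \<open>f : X \<rightarrow> Y\<close> and \<open>g : Y \<rightarrow> Z\<close>.\<close>

definition is_category :: "('o, 'h) category \<Rightarrow> bool" where
  "is_category C \<longleftrightarrow>
     (\<forall>X\<in>Obj C. Id C X \<in> Hom C X X) \<and>
     (\<forall>X\<in>Obj C. \<forall>Y\<in>Obj C. \<forall>Z\<in>Obj C. \<forall>f\<in>Hom C X Y. \<forall>g\<in>Hom C Y Z.
        Comp C X Y Z g f \<in> Hom C X Z) \<and>
     (\<forall>X\<in>Obj C. \<forall>Y\<in>Obj C. \<forall>f\<in>Hom C X Y.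
        Comp C X X Y f (Id C X) = f \<and> Comp C X Y Y (Id C Y) f = f) \<and>
     (\<forall>W\<in>Obj C. \<forall>X\<in>Obj C. \<forall>Y\<in>Obj C. \<forall>Z\<in>Obj C.
        \<forall>f\<in>Hom C W X. \<forall>g\<in>Hom C X Y. \<forall>h\<in>Hom C Y Z.
        Comp C W Y Z h (Comp C W X Y g f) = Comp C W X Z (Comp C X Y Z h g) f)"

definition is_functor ::
    "('o, 'h) category \<Rightarrow> ('p, 'i) category \<Rightarrow> ('o \<Rightarrow> 'p) \<Rightarrow> ('o \<Rightarrow> 'o \<Rightarrow> 'h \<Rightarrow> 'i) \<Rightarrow> bool" where
  "is_functor C D Fo Fm \<longleftrightarrow> is_category C \<and> is_category D \<and>
     Fo \<in> Obj C \<rightarrow> Obj D \<and>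
     (\<forall>X\<in>Obj C. \<forall>Y\<in>Obj C. Fm X Y \<in> Hom C X Y \<rightarrow> Hom D (Fo X) (Fo Y)) \<and>
     (\<forall>X\<in>Obj C. Fm X X (Id C X) = Id D (Fo X)) \<and>
     (\<forall>X\<in>Obj C. \<forall>Y\<in>Obj C. \<forall>Z\<in>Obj C. \<forall>f\<in>Hom C X Y. \<forall>g\<in>Hom C Y Z.
        Fm X Z (Comp C X Y Z g f) = Comp D (Fo X) (Fo Y) (Fo Z) (Fm Y Z g) (Fm X Y f))"

definition is_faithful :: "('o, 'h) category \<Rightarrow> ('o \<Rightarrow> 'o \<Rightarrow> 'h \<Rightarrow> 'i) \<Rightarrow> bool" where
  "is_faithful C Fm \<longleftrightarrow> (\<forall>X\<in>Obj C. \<forall>Y\<in>Obj C. inj_on (Fm X Y) (Hom C X Y))"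

section \<open>Comodules\<close>

record ('k, 'v, 'a) comodule = "('k, 'v) module" +
  colam :: "('v, 'a, 'k) tensor \<Rightarrow> ('v, 'a, 'k) tensor"
  corho :: "('v, 'a, 'k) tensor \<Rightarrow> ('v, 'a, 'k) tensor"

context
  fixes K :: "('k, 'm) ring_scheme" and A :: "('k, 'a, 'n) wmb_scheme"
begin

definition right_comodule :: "('k, 'v, 'a) comodule \<Rightarrow> bool" where
  "right_comodule V \<longleftrightarrow> module K V \<and>
     colam V \<in> lin_map K (tensor_space K V A) (tensor_space K V A) \<and>
     corho V \<in> lin_map K (tensor_space K V A) (tensor_space K V A) \<and>
     (\<forall>v\<in>carrier V. \<forall>a\<in>carrier A. \<forall>b\<in>carrier A.
        lmul2 K V A a (colam V (pure_tensor K V A v b)) =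
        rmul2 K V A b (corho V (pure_tensor K V A v a))) \<and>
     (\<forall>x\<in>carrier (tensor_space K (tensor_space K V A) A).
        leg12 K V A A (colam V) (leg13 K V A A (colam V) (leg23 K V A A A A (E1 A) x)) =
        leg12 K V A A (colam V) (leg13 K V A A (colam V) x)) \<and>
     (\<forall>x\<in>carrier (tensor_space K (tensor_space K V A) A).
        leg12 K V A A (colam V) (leg13 K V A A (colam V) (leg23 K V A A A A (T1 A) x)) =
        leg23 K V A A A A (T1 A) (leg12 K V A A (colam V) x))"

definition full_comodule :: "('k, 'v, 'a) comodule \<Rightarrow> bool" where
  "full_comodule V \<longleftrightarrow> right_comodule V \<and> carrier V = span_of K V
     {contract_right K V \<omega> (colam V (pure_tensor K V A v a)) | \<omega> v a.
        v \<in> carrier V \<and> a \<in> carrier A \<and> \<omega> \<in> lin_map K A (scalars K)}"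

definition comodule_hom ::
    "('k, 'v, 'a) comodule \<Rightarrow> ('k, 'v, 'a) comodule \<Rightarrow> ('v \<Rightarrow> 'v) set" where
  "comodule_hom V V' = {f \<in> lin_map K V V' \<inter> extensional (carrier V).
     \<forall>x\<in>carrier (tensor_space K V A).
       colam V' (tensor_map K V' A f (\<lambda>a. a) x) = tensor_map K V' A f (\<lambda>a. a) (colam V x)}"

definition full_comodule_category :: "(('k, 'v, 'a) comodule, 'v \<Rightarrow> 'v) category" where
  "full_comodule_category = \<lparr>Obj = {V. full_comodule V}, Hom = comodule_hom,
     Id = (\<lambda>V. \<lambda>v\<in>carrier V. v), Comp = (\<lambda>U V W g f. compose (carrier U) g f)\<rparr>"

end

section \<open>Firm bimodules\<close>

record ('k, 'r, 'v) bimodule = "('k, 'v) module" +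
  lact :: "'r \<Rightarrow> 'v \<Rightarrow> 'v"
  ract :: "'v \<Rightarrow> 'r \<Rightarrow> 'v"

context
  fixes K :: "('k, 'm) ring_scheme" and R :: "('k, 'r) module"
begin

text \<open>\<open>M \<otimes>\<^sub>R N\<close> for a right action \<open>\<rho>\<close> of \<open>R\<close> on \<open>M\<close> and a left action \<open>l\<close> of \<open>R\<close> on \<open>N\<close>.\<close>

definition balanced_tensor ::
    "('k, 'v, 'a) module_scheme \<Rightarrow> ('v \<Rightarrow> 'r \<Rightarrow> 'v) \<Rightarrow>
     ('k, 'w, 'b) module_scheme \<Rightarrow> ('r \<Rightarrow> 'w \<Rightarrow> 'w) \<Rightarrow> ('k, ('v, 'w, 'k) tensor set) module" where
  "balanced_tensor M \<rho> N l = quot_space (tensor_space K M N) (span_of K (tensor_space K M N)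
     {pure_tensor K M N (\<rho> m r) n \<ominus>\<^bsub>tensor_space K M N\<^esub> pure_tensor K M N m (l r n) | m r n.
        m \<in> carrier M \<and> r \<in> carrier R \<and> n \<in> carrier N})"

definition is_bimodule :: "('k, 'r, 'v) bimodule \<Rightarrow> bool" where
  "is_bimodule M \<longleftrightarrow> module K M \<and>
     bilin_map K R M M (lact M) \<and> bilin_map K M R M (ract M) \<and>
     (\<forall>r\<in>carrier R. \<forall>s\<in>carrier R. \<forall>m\<in>carrier M.
        lact M (r \<otimes>\<^bsub>R\<^esub> s) m = lact M r (lact M s m) \<and>
        ract M m (r \<otimes>\<^bsub>R\<^esub> s) = ract M (ract M m r) s \<and>
        ract M (lact M r m) s = lact M r (ract M m s))"

definition firm_bimodule :: "('k, 'r, 'v) bimodule \<Rightarrow> bool" where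
  "firm_bimodule M \<longleftrightarrow> is_bimodule M \<and>
     lin_iso K (balanced_tensor M (ract M) R (mult R)) M (quot_lift (tensor_lift K M (ract M))) \<and>
     lin_iso K (balanced_tensor R (mult R) M (lact M)) M (quot_lift (tensor_lift K M (lact M)))"

definition bimodule_hom ::
    "('k, 'r, 'v) bimodule \<Rightarrow> ('k, 'r, 'v) bimodule \<Rightarrow> ('v \<Rightarrow> 'v) set" where
  "bimodule_hom M N = {f \<in> lin_map K M N \<inter> extensional (carrier M).
     \<forall>r\<in>carrier R. \<forall>m\<in>carrier M.
       f (lact M r m) = lact N r (f m) \<and> f (ract M m r) = ract N (f m) r}"

definition firm_bimodule_category :: "(('k, 'r, 'v) bimodule, 'v \<Rightarrow> 'v) category" where
  "firm_bimodule_category = \<lparr>Obj = {M. firm_bimodule M}, Hom = bimodule_hom,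
     Id = (\<lambda>M. \<lambda>m\<in>carrier M. m), Comp = (\<lambda>L M N g f. compose (carrier L) g f)\<rparr>"

end

end

theory Submission
  imports Defs
begin

text \<open>
  A functional \<open>\<beta>\<close> on \<open>A\<close> and an element \<open>p\<close> of \<open>A\<close> turn a linear map \<open>\<lambda>\<close> of \<open>V \<otimes> A\<close> into an
  endomorphism of \<open>V\<close>, the slice \<open>v \<mapsto> (V \<otimes> \<beta>) (\<lambda> (v \<otimes> p))\<close>. For a full comodule \<open>V\<close> the slices of
  \<open>\<lambda>\<close> and \<open>\<rho>\<close> at the counit give a right and a left action of the base algebra on \<open>V\<close>: the
  multiplier \<open>\<sqinter>\<^sup>R (a)\<close> acts from the left by the slice of \<open>\<rho>\<close> at \<open>a\<close>, and its barred variant acts from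
  the right by the slice of \<open>\<lambda>\<close> at \<open>a\<close>. A morphism of comodules commutes with all slices, so it is a
  bimodule map for these actions. Hence the functor can be the identity on maps, and it is faithful
  for that reason. What has to be proved is that the actions turn \<open>V\<close> into a firm bimodule.

  There is no unit in \<open>A\<close>, so every computation is a computation with multipliers. Two devices
  replace them. First, functionals separate the points of \<open>A\<close>, of \<open>V\<close> and of tensor products
  (\<open>functional_separation\<close>, \<open>tensor_eqI\<close>), so that an identity between maps on tensor products can
  be read off its slices. Secondly, the functionals \<open>\<beta> (b _)\<close> and \<open>\<beta> (_ c)\<close> link \<open>T1\<close> with \<open>T3\<close> and
  \<open>\<lambda>\<close> with \<open>\<rho>\<close>; an identity is proved for such functionals, and the factor \<open>b\<close> or \<open>c\<close> is then
  cancelled by non-degeneracy. In this way the axioms yield a list of identities between slices that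
  is symmetric under passing to the opposite multiplication. It is the locale \<open>wmb_slices\<close>. The
  comodule axioms for \<open>\<lambda>\<close> imply those for \<open>\<rho>\<close> (\<open>comodule_maps_op\<close>), so that all statements on the
  left action are mirror images of statements on the right action.

  The heart of the matter is two formulas for iterated slices, in which one of the slices is taken
  at the counit: \<open>XV_eps_XV\<close>, where the outer slice is, and \<open>XV_XV_eps\<close>, where the inner one is. By
  the former the slice at the counit and \<open>a\<close> depends on the multiplier of \<open>a\<close> only (\<open>XV_eps_zero\<close>,
  \<open>right_act_barR\<close>), the right and the left action commute (\<open>left_right_act\<close>), and the action is
  surjective (\<open>XV_eps_span\<close>); by the latter the right action is associative (\<open>right_act_mult\<close>).

  For firmness it remains to see that a tensor \<open>x\<close> of \<open>V \<otimes> R\<close> that acts as zero vanishes in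
  \<open>V \<otimes>\<^sub>R R\<close>. Let \<open>c\<close> be the linear map \<open>\<sqinter>\<^sup>R\<close> from \<open>A\<close> onto \<open>R\<close>. Every \<open>x\<close> is congruent to
  \<open>(V \<otimes> c) z\<close> for some \<open>z\<close> in \<open>V \<otimes> A\<close> whose contractions with the functionals \<open>\<epsilon> (_ y)\<close> are all
  determined by the image of \<open>x\<close> in \<open>V\<close>. If that image is zero, so are the contractions, and then
  \<open>(V \<otimes> c) z = 0\<close> since \<open>c\<close> kills the elements that these functionals do not see (\<open>right_kernel\<close>).
\<close>

section \<open>Linear maps\<close>

locale vector_spaces =
  fixes K :: "('k, 'm) ring_scheme" (structure)
  assumes field_K: "field K"

sublocale vector_spaces \<subseteq> K?: field K by (rule field_K)

context vector_spaces
begin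

abbreviation dual :: "('k, 'v, 'a) module_scheme \<Rightarrow> ('v \<Rightarrow> 'k) set" where
  "dual V \<equiv> lin_map K V (scalars K)"

abbreviation tensor_product (infixl \<open>\<boxtimes>\<close> 72) where
  "V \<boxtimes> W \<equiv> tensor_space K V W"

lemma lin_mapI:
  assumes "\<And>x. x \<in> carrier V \<Longrightarrow> f x \<in> carrier W"
    and "\<And>x y. x \<in> carrier V \<Longrightarrow> y \<in> carrier V \<Longrightarrow> f (x \<oplus>\<^bsub>V\<^esub> y) = f x \<oplus>\<^bsub>W\<^esub> f y"
    and "\<And>c x. c \<in> carrier K \<Longrightarrow> x \<in> carrier V \<Longrightarrow> f (c \<odot>\<^bsub>V\<^esub> x) = c \<odot>\<^bsub>W\<^esub> f x"
  shows "f \<in> lin_map K V W"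
  using assms unfolding lin_map_def by auto

lemma lin_closed: "f \<in> lin_map K V W \<Longrightarrow> x \<in> carrier V \<Longrightarrow> f x \<in> carrier W"
  unfolding lin_map_def by auto

lemma lin_add:
  "f \<in> lin_map K V W \<Longrightarrow> x \<in> carrier V \<Longrightarrow> y \<in> carrier V \<Longrightarrow> f (x \<oplus>\<^bsub>V\<^esub> y) = f x \<oplus>\<^bsub>W\<^esub> f y"
  unfolding lin_map_def by auto

lemma lin_smult:
  "f \<in> lin_map K V W \<Longrightarrow> c \<in> carrier K \<Longrightarrow> x \<in> carrier V \<Longrightarrow> f (c \<odot>\<^bsub>V\<^esub> x) = c \<odot>\<^bsub>W\<^esub> f x"
  unfolding lin_map_def by auto

lemma lin_zero:
  assumes "module K V" "module K W" "f \<in> lin_map K V W"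
  shows "f \<zero>\<^bsub>V\<^esub> = \<zero>\<^bsub>W\<^esub>"
proof -
  interpret V: module K V by fact
  interpret W: module K W by fact
  have "f (\<zero> \<odot>\<^bsub>V\<^esub> \<zero>\<^bsub>V\<^esub>) = \<zero> \<odot>\<^bsub>W\<^esub> f \<zero>\<^bsub>V\<^esub>"
    using assms(3) by (intro lin_smult) auto
  then show ?thesis using lin_closed[OF assms(3), of "\<zero>\<^bsub>V\<^esub>"] by simp
qed

lemma neg_eq_smult:
  assumes "module K V" "x \<in> carrier V"
  shows "\<ominus>\<^bsub>V\<^esub> x = (\<ominus> \<one>) \<odot>\<^bsub>V\<^esub> x"
proof -
  interpret V: module K V by fact
  show ?thesis using assms V.smult_l_minus[of \<one> x] by simp
qed

lemma lin_neg:
  assumes "module K V" "module K W" "f \<in> lin_map K V W" "x \<in> carrier V"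
  shows "f (\<ominus>\<^bsub>V\<^esub> x) = \<ominus>\<^bsub>W\<^esub> f x"
  using assms by (simp add: neg_eq_smult lin_smult lin_closed)

lemma lin_minus:
  assumes "module K V" "module K W" "f \<in> lin_map K V W" "x \<in> carrier V" "y \<in> carrier V"
  shows "f (x \<ominus>\<^bsub>V\<^esub> y) = f x \<ominus>\<^bsub>W\<^esub> f y"
proof -
  interpret V: module K V by fact
  show ?thesis using assms by (simp add: a_minus_def lin_add lin_neg)
qed

lemma minus_zero_iff:
  assumes "module K V" "x \<in> carrier V" "y \<in> carrier V"
  shows "x \<ominus>\<^bsub>V\<^esub> y = \<zero>\<^bsub>V\<^esub> \<longleftrightarrow> x = y"
proof -
  interpret V: module K V by fact
  show ?thesis
    using assms V.minus_equality[of x "\<ominus>\<^bsub>V\<^esub> y"] by (auto simp: a_minus_def V.r_neg)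
qed

lemma lin_id: "(\<lambda>x. x) \<in> lin_map K V V"
  by (rule lin_mapI) auto

lemma lin_comp: "f \<in> lin_map K V W \<Longrightarrow> g \<in> lin_map K U V \<Longrightarrow> (\<lambda>x. f (g x)) \<in> lin_map K U W"
  by (rule lin_mapI) (auto simp: lin_closed lin_add lin_smult)

lemma lin_const_zero: "module K W \<Longrightarrow> (\<lambda>x. \<zero>\<^bsub>W\<^esub>) \<in> lin_map K V W"
proof -
  assume "module K W"
  then interpret W: module K W .
  show ?thesis by (rule lin_mapI) auto
qed

lemma lin_sum:
  assumes "module K W" "f \<in> lin_map K V W" "g \<in> lin_map K V W"
  shows "(\<lambda>x. f x \<oplus>\<^bsub>W\<^esub> g x) \<in> lin_map K V W"
proof -
  interpret W: module K W by fact
  note c = lin_closed[OF assms(2)] lin_closed[OF assms(3)]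
  show ?thesis
    by (rule lin_mapI)
      (use assms c in \<open>auto simp: lin_add lin_smult W.smult_r_distr W.a_ac\<close>)
qed

lemma lin_scale:
  assumes "module K W" "f \<in> lin_map K V W" "c \<in> carrier K"
  shows "(\<lambda>x. c \<odot>\<^bsub>W\<^esub> f x) \<in> lin_map K V W"
proof -
  interpret W: module K W by fact
  note cl = lin_closed[OF assms(2)]
  show ?thesis
    by (rule lin_mapI)
      (use assms cl in \<open>auto simp: lin_add lin_smult W.smult_r_distr W.smult_assoc1[symmetric] m_comm\<close>)
qed

lemma scalars_simps [simp]:
  "carrier (scalars K) = carrier K" "zero (scalars K) = \<zero>" "add (scalars K) = add K"
  "smult (scalars K) = mult K"
  by (auto simp: scalars_def)

lemma scalars_module: "module K (scalars K)"
proof (rule moduleI)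
  show "cring K" by (rule is_cring)
  show "abelian_group (scalars K)"
    by (rule abelian_groupI) (auto simp: a_ac intro!: bexI[where P="\<lambda>y. y \<oplus> _ = \<zero>", OF l_neg])
qed (auto simp: l_distr r_distr m_ac)

lemma dual_closed: "f \<in> dual V \<Longrightarrow> x \<in> carrier V \<Longrightarrow> f x \<in> carrier K"
  using lin_closed[of f V "scalars K"] by simp

lemma bilinI:
  assumes "\<And>u. u \<in> carrier U \<Longrightarrow> b u \<in> lin_map K V W"
    and "\<And>v. v \<in> carrier V \<Longrightarrow> (\<lambda>u. b u v) \<in> lin_map K U W"
  shows "bilin_map K U V W b"
  using assms unfolding bilin_map_def by auto

lemma bilinD1: "bilin_map K U V W b \<Longrightarrow> u \<in> carrier U \<Longrightarrow> b u \<in> lin_map K V W"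
  and bilinD2: "bilin_map K U V W b \<Longrightarrow> v \<in> carrier V \<Longrightarrow> (\<lambda>u. b u v) \<in> lin_map K U W"
  unfolding bilin_map_def by auto

section \<open>Subspaces and spans\<close>

lemma subspaceI:
  assumes "module K V" "H \<subseteq> carrier V" "\<zero>\<^bsub>V\<^esub> \<in> H"
    and "\<And>a b. a \<in> H \<Longrightarrow> b \<in> H \<Longrightarrow> a \<oplus>\<^bsub>V\<^esub> b \<in> H"
    and "\<And>c x. c \<in> carrier K \<Longrightarrow> x \<in> H \<Longrightarrow> c \<odot>\<^bsub>V\<^esub> x \<in> H"
  shows "submodule H K V"
proof -
  interpret V: module K V by fact
  show ?thesis
    by (rule V.submoduleI) (use assms in \<open>auto simp: neg_eq_smult subset_iff\<close>)
qed

lemma subspace_subset: "submodule H K V \<Longrightarrow> H \<subseteq> carrier V"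
  using subgroup.subset[OF submodule.axioms(1), of H K V] by simp

lemma subspace_zero: "submodule H K V \<Longrightarrow> \<zero>\<^bsub>V\<^esub> \<in> H"
  using subgroup.one_closed[OF submodule.axioms(1), of H K V] by simp

lemma subspace_add: "submodule H K V \<Longrightarrow> x \<in> H \<Longrightarrow> y \<in> H \<Longrightarrow> x \<oplus>\<^bsub>V\<^esub> y \<in> H"
  using subgroup.m_closed[OF submodule.axioms(1), of H K V] by simp

lemma subspace_smult: "submodule H K V \<Longrightarrow> c \<in> carrier K \<Longrightarrow> x \<in> H \<Longrightarrow> c \<odot>\<^bsub>V\<^esub> x \<in> H"
  by (rule submodule.smult_closed)

lemma subspace_neg: "module K V \<Longrightarrow> submodule H K V \<Longrightarrow> x \<in> H \<Longrightarrow> \<ominus>\<^bsub>V\<^esub> x \<in> H"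
  using subspace_subset[of H V] by (simp add: neg_eq_smult subset_iff subspace_smult)

lemma subspace_minus:
  "module K V \<Longrightarrow> submodule H K V \<Longrightarrow> x \<in> H \<Longrightarrow> y \<in> H \<Longrightarrow> x \<ominus>\<^bsub>V\<^esub> y \<in> H"
  by (simp add: a_minus_def subspace_neg subspace_add)

lemma carrier_subspace: "module K V \<Longrightarrow> submodule (carrier V) K V"
  by (rule module.carrier_is_submodule)

lemma span_subset: "S \<subseteq> span_of K V S"
  unfolding span_of_def by auto

lemma span_minimal: "submodule U K V \<Longrightarrow> S \<subseteq> U \<Longrightarrow> span_of K V S \<subseteq> U"
  unfolding span_of_def by auto

lemma span_in_carrier: "module K V \<Longrightarrow> S \<subseteq> carrier V \<Longrightarrow> span_of K V S \<subseteq> carrier V"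
  by (intro span_minimal carrier_subspace)

lemma span_subspace:
  assumes V: "module K V" and S: "S \<subseteq> carrier V"
  shows "submodule (span_of K V S) K V"
proof (rule subspaceI[OF V span_in_carrier[OF V S]])
qed (auto simp: span_of_def subspace_zero subspace_add subspace_smult)

lemma span_induct [consumes 3, case_names gen zero add smult]:
  assumes V: "module K V" and S: "S \<subseteq> carrier V" and x: "x \<in> span_of K V S"
    and gen: "\<And>s. s \<in> S \<Longrightarrow> P s" and zero: "P \<zero>\<^bsub>V\<^esub>"
    and add: "\<And>x y. x \<in> carrier V \<Longrightarrow> y \<in> carrier V \<Longrightarrow> P x \<Longrightarrow> P y \<Longrightarrow> P (x \<oplus>\<^bsub>V\<^esub> y)"
    and smult: "\<And>c x. c \<in> carrier K \<Longrightarrow> x \<in> carrier V \<Longrightarrow> P x \<Longrightarrow> P (c \<odot>\<^bsub>V\<^esub> x)"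
  shows "P x"
proof -
  interpret V: module K V by fact
  have "submodule {x \<in> carrier V. P x} K V"
    by (rule subspaceI[OF V]) (auto intro: zero add smult)
  from span_minimal[OF this, of S] show ?thesis using x S gen by auto
qed

lemma equalizer_subspace:
  assumes "module K V" "module K W" "f \<in> lin_map K V W" "g \<in> lin_map K V W"
  shows "submodule {x \<in> carrier V. f x = g x} K V"
proof -
  interpret V: module K V by fact
  show ?thesis
    by (rule subspaceI) (use assms in \<open>auto simp: lin_zero lin_add lin_smult\<close>)
qed

lemma lin_eq_on_span:
  assumes "module K V" "module K W" "f \<in> lin_map K V W" "g \<in> lin_map K V W"
    and "\<And>s. s \<in> S \<Longrightarrow> s \<in> carrier V \<and> f s = g s" "x \<in> span_of K V S"
  shows "f x = g x"
  using span_minimal[OF equalizer_subspace[OF assms(1-4)], of S] assms(5,6) by auto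

lemma preimage_subspace:
  assumes "module K V" "module K W" "f \<in> lin_map K V W" "submodule U K W"
  shows "submodule {x \<in> carrier V. f x \<in> U} K V"
proof -
  interpret V: module K V by fact
  show ?thesis
    by (rule subspaceI)
      (use assms in \<open>auto simp: lin_zero lin_add lin_smult subspace_zero subspace_add subspace_smult\<close>)
qed

lemma image_subspace:
  assumes "module K V" "module K W" "f \<in> lin_map K V W" "submodule U K V"
  shows "submodule (f ` U) K W"
proof (rule subspaceI[OF assms(2)])
  note c = subsetD[OF subspace_subset[OF assms(4)]]
  show "f ` U \<subseteq> carrier W" using c lin_closed[OF assms(3)] by auto
  show "\<zero>\<^bsub>W\<^esub> \<in> f ` U"
    using lin_zero[OF assms(1-3)] subspace_zero[OF assms(4)] by (metis imageI)
  show "a \<oplus>\<^bsub>W\<^esub> b \<in> f ` U" if "a \<in> f ` U" "b \<in> f ` U" for a b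
    using that c assms by (auto simp: lin_add[symmetric] subspace_add)
  show "k \<odot>\<^bsub>W\<^esub> x \<in> f ` U" if "k \<in> carrier K" "x \<in> f ` U" for k x
    using that c assms by (auto simp: lin_smult[symmetric] subspace_smult)
qed

section \<open>Quotients\<close>

lemma subspace_abelian_subgroup:
  assumes "module K V" "submodule U K V"
  shows "abelian_subgroup U V"
proof (rule abelian_subgroupI3)
  show "additive_subgroup U V"
    using assms(2) by (simp add: additive_subgroupI submodule.axioms(1))
  show "abelian_group V" using assms(1) by (rule module.axioms(2))
qed

context
  fixes V :: "('k, 'v, 'a) module_scheme" and U :: "'v set"
  assumes V: "module K V" and U: "submodule U K V"
begin

interpretation V: module K V by (rule V)
interpretation U: abelian_subgroup U V by (rule subspace_abelian_subgroup[OF V U])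

lemma coset_eq_iff:
  assumes "x \<in> carrier V" "y \<in> carrier V"
  shows "U +>\<^bsub>V\<^esub> x = U +>\<^bsub>V\<^esub> y \<longleftrightarrow> x \<ominus>\<^bsub>V\<^esub> y \<in> U"
proof -
  have "U +>\<^bsub>V\<^esub> x = U +>\<^bsub>V\<^esub> y \<longleftrightarrow> x \<in> U +>\<^bsub>V\<^esub> y"
    by (metis U.a_rcos_self U.a_repr_independence' assms)
  then show ?thesis
    using U.a_rcos_module[OF assms(2,1)] assms by (simp add: a_minus_def)
qed

lemma coset_self: "x \<in> carrier V \<Longrightarrow> x \<in> U +>\<^bsub>V\<^esub> x"
  by (rule U.a_rcos_self)

lemma coset_mem: "x \<in> carrier V \<Longrightarrow> y \<in> U +>\<^bsub>V\<^esub> x \<Longrightarrow> y \<in> carrier V \<and> U +>\<^bsub>V\<^esub> y = U +>\<^bsub>V\<^esub> x"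
  using U.a_elemrcos_carrier[of x y] U.a_repr_independence'[of y x] by simp

lemma quot_carrier: "X \<in> carrier (quot_space V U) \<longleftrightarrow> (\<exists>x\<in>carrier V. X = U +>\<^bsub>V\<^esub> x)"
  by (auto simp: quot_space_def A_RCOSETS_def' a_r_coset_def')

lemma coset_zero: "U = U +>\<^bsub>V\<^esub> \<zero>\<^bsub>V\<^esub>"
  using V.a_coset_add_zero[OF subspace_subset[OF U]] by simp

lemma quot_zero: "zero (quot_space V U) = U +>\<^bsub>V\<^esub> \<zero>\<^bsub>V\<^esub>"
  using coset_zero by (simp add: quot_space_def)

lemma quot_add: 
  "x \<in> carrier V \<Longrightarrow> y \<in> carrier V \<Longrightarrow>
    (U +>\<^bsub>V\<^esub> x) \<oplus>\<^bsub>quot_space V U\<^esub> (U +>\<^bsub>V\<^esub> y) = U +>\<^bsub>V\<^esub> (x \<oplus>\<^bsub>V\<^esub> y)"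
  by (simp add: quot_space_def U.a_rcos_sum)

lemma quot_smult: 
  assumes c: "c \<in> carrier K" and x: "x \<in> carrier V"
  shows "c \<odot>\<^bsub>quot_space V U\<^esub> (U +>\<^bsub>V\<^esub> x) = U +>\<^bsub>V\<^esub> (c \<odot>\<^bsub>V\<^esub> x)"
proof -
  have "U +>\<^bsub>V\<^esub> (c \<odot>\<^bsub>V\<^esub> y) = U +>\<^bsub>V\<^esub> (c \<odot>\<^bsub>V\<^esub> x)" if "y \<in> U +>\<^bsub>V\<^esub> x" for y
  proof -
    have y: "y \<in> carrier V" and "y \<ominus>\<^bsub>V\<^esub> x \<in> U"
      using coset_mem[OF x that] x coset_eq_iff by auto
    then have "c \<odot>\<^bsub>V\<^esub> (y \<ominus>\<^bsub>V\<^esub> x) \<in> U" using c subspace_smult[OF U] by blast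
    moreover have "c \<odot>\<^bsub>V\<^esub> (y \<ominus>\<^bsub>V\<^esub> x) = c \<odot>\<^bsub>V\<^esub> y \<ominus>\<^bsub>V\<^esub> c \<odot>\<^bsub>V\<^esub> x"
      using c x y by (simp add: a_minus_def V.smult_r_distr V.smult_r_minus)
    ultimately show ?thesis using c x y by (simp add: coset_eq_iff)
  qed
  then have "(\<Union>y\<in>U +>\<^bsub>V\<^esub> x. U +>\<^bsub>V\<^esub> (c \<odot>\<^bsub>V\<^esub> y)) = (\<Union>y\<in>U +>\<^bsub>V\<^esub> x. U +>\<^bsub>V\<^esub> (c \<odot>\<^bsub>V\<^esub> x))"
    by (rule SUP_cong[OF refl])
  also have "\<dots> = U +>\<^bsub>V\<^esub> (c \<odot>\<^bsub>V\<^esub> x)" using coset_self[OF x] by blast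
  finally show ?thesis by (simp add: quot_space_def)
qed

lemma quot_module: "module K (quot_space V U)"
proof (rule moduleI)
  show "cring K" by (rule is_cring)
  show "abelian_group (quot_space V U)"
  proof (rule abelian_groupI)
    show "\<exists>y\<in>carrier (quot_space V U). y \<oplus>\<^bsub>quot_space V U\<^esub> x = \<zero>\<^bsub>quot_space V U\<^esub>"
      if x: "x \<in> carrier (quot_space V U)" for x
    proof -
      from x obtain x' where x': "x' \<in> carrier V" "x = U +>\<^bsub>V\<^esub> x'" by (auto simp: quot_carrier)
      then show ?thesis
        by (intro bexI[of _ "U +>\<^bsub>V\<^esub> (\<ominus>\<^bsub>V\<^esub> x')"]) (auto simp: quot_carrier quot_add quot_zero V.l_neg)
    qed
  next
    fix x assume "x \<in> carrier (quot_space V U)"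
    then obtain x' where *: "x' \<in> carrier V" "x = U +>\<^bsub>V\<^esub> x'" by (auto simp: quot_carrier)
    show "\<zero>\<^bsub>quot_space V U\<^esub> \<oplus>\<^bsub>quot_space V U\<^esub> x = x"
      using * by (simp add: quot_add quot_zero)
  next
    fix x y assume "x \<in> carrier (quot_space V U)" "y \<in> carrier (quot_space V U)"
    then obtain x' y' where *: "x' \<in> carrier V" "x = U +>\<^bsub>V\<^esub> x'" "y' \<in> carrier V" "y = U +>\<^bsub>V\<^esub> y'"
      by (auto simp: quot_carrier)
    then show "x \<oplus>\<^bsub>quot_space V U\<^esub> y \<in> carrier (quot_space V U)"
      by (auto simp: quot_carrier quot_add)
    show "x \<oplus>\<^bsub>quot_space V U\<^esub> y = y \<oplus>\<^bsub>quot_space V U\<^esub> x"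
      using * by (simp add: quot_add V.a_comm)
    fix z assume "z \<in> carrier (quot_space V U)"
    then obtain z' where "z' \<in> carrier V" "z = U +>\<^bsub>V\<^esub> z'" by (auto simp: quot_carrier)
    then show "x \<oplus>\<^bsub>quot_space V U\<^esub> y \<oplus>\<^bsub>quot_space V U\<^esub> z = x \<oplus>\<^bsub>quot_space V U\<^esub> (y \<oplus>\<^bsub>quot_space V U\<^esub> z)"
      using * by (simp add: quot_add V.a_assoc)
  qed (auto simp: quot_carrier quot_zero)
next
  fix a x y
  assume ab: "a \<in> carrier K"
    and "x \<in> carrier (quot_space V U)" "y \<in> carrier (quot_space V U)"
  then obtain x' y' where *: "x' \<in> carrier V" "x = U +>\<^bsub>V\<^esub> x'" "y' \<in> carrier V" "y = U +>\<^bsub>V\<^esub> y'"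
    by (auto simp: quot_carrier)
  show "a \<odot>\<^bsub>quot_space V U\<^esub> (x \<oplus>\<^bsub>quot_space V U\<^esub> y) = a \<odot>\<^bsub>quot_space V U\<^esub> x \<oplus>\<^bsub>quot_space V U\<^esub> a \<odot>\<^bsub>quot_space V U\<^esub> y"
    using * ab by (simp add: quot_add quot_smult V.smult_r_distr)
next
  fix a b x
  assume ab: "a \<in> carrier K" "b \<in> carrier K" and "x \<in> carrier (quot_space V U)"
  then obtain x' where *: "x' \<in> carrier V" "x = U +>\<^bsub>V\<^esub> x'"
    by (auto simp: quot_carrier)
  show "(a \<oplus> b) \<odot>\<^bsub>quot_space V U\<^esub> x = a \<odot>\<^bsub>quot_space V U\<^esub> x \<oplus>\<^bsub>quot_space V U\<^esub> b \<odot>\<^bsub>quot_space V U\<^esub> x"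
    using * ab by (simp add: quot_add quot_smult V.smult_l_distr)
  show "(a \<otimes> b) \<odot>\<^bsub>quot_space V U\<^esub> x = a \<odot>\<^bsub>quot_space V U\<^esub> (b \<odot>\<^bsub>quot_space V U\<^esub> x)"
    using * ab by (simp add: quot_smult V.smult_assoc1)
next
  fix a x assume a: "a \<in> carrier K" and "x \<in> carrier (quot_space V U)"
  then obtain x' where *: "x' \<in> carrier V" "x = U +>\<^bsub>V\<^esub> x'" by (auto simp: quot_carrier)
  then show "a \<odot>\<^bsub>quot_space V U\<^esub> x \<in> carrier (quot_space V U)"
    using a by (auto simp: quot_smult quot_carrier)
next
  fix x assume "x \<in> carrier (quot_space V U)"
  then obtain x' where *: "x' \<in> carrier V" "x = U +>\<^bsub>V\<^esub> x'" by (auto simp: quot_carrier)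
  then show "\<one> \<odot>\<^bsub>quot_space V U\<^esub> x = x" by (simp add: quot_smult)
qed

lemma quot_proj_lin: "(\<lambda>x. U +>\<^bsub>V\<^esub> x) \<in> lin_map K V (quot_space V U)"
  by (rule lin_mapI) (auto simp: quot_carrier quot_add quot_smult)

context
  fixes W :: "('k, 'w, 'b) module_scheme" and f
  assumes W: "module K W" and f: "f \<in> lin_map K V W" and ker: "\<And>u. u \<in> U \<Longrightarrow> f u = \<zero>\<^bsub>W\<^esub>"
begin

lemma quot_lift_coset:
  assumes x: "x \<in> carrier V"
  shows "quot_lift f (U +>\<^bsub>V\<^esub> x) = f x"
proof -
  interpret W: module K W by (rule W)
  have "(SOME y. y \<in> U +>\<^bsub>V\<^esub> x) \<in> U +>\<^bsub>V\<^esub> x" by (rule someI[of "\<lambda>y. y \<in> U +>\<^bsub>V\<^esub> x", OF coset_self[OF x]])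
  then obtain y where y: "y = (SOME y. y \<in> U +>\<^bsub>V\<^esub> x)" "y \<in> carrier V" "y \<ominus>\<^bsub>V\<^esub> x \<in> U"
    using coset_mem[OF x, of "SOME y. y \<in> U +>\<^bsub>V\<^esub> x"] coset_eq_iff[of "SOME y. y \<in> U +>\<^bsub>V\<^esub> x" x] x by blast
  then have "f y \<ominus>\<^bsub>W\<^esub> f x = \<zero>\<^bsub>W\<^esub>" using ker[OF y(3)] lin_minus[OF V W f y(2) x] by simp
  then have "f y = f x" using minus_zero_iff[OF W] lin_closed[OF f] x y(2) by simp
  then show ?thesis by (simp add: quot_lift_def y(1))
qed

lemma quot_lift_lin: "quot_lift f \<in> lin_map K (quot_space V U) W"
  by (rule lin_mapI)
    (auto simp: quot_carrier quot_lift_coset quot_add quot_smult lin_closed[OF f] lin_add[OF f] lin_smult[OF f])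

end

end

section \<open>Free spaces\<close>

lemma free_simps:
  "zero (free_space K X) = (\<lambda>x. \<zero>)" "add (free_space K X) = (\<lambda>p q x. p x \<oplus> q x)"
  "smult (free_space K X) = (\<lambda>c p x. c \<otimes> p x)"
  "carrier (free_space K X) = {p. (\<forall>x\<in>X. p x \<in> carrier K) \<and> (\<forall>x. x \<notin> X \<longrightarrow> p x = \<zero>) \<and> finite {x. p x \<noteq> \<zero>}}"
  by (auto simp: free_space_def)

lemma free_val: "p \<in> carrier (free_space K X) \<Longrightarrow> p x \<in> carrier K"
  by (cases "x \<in> X") (auto simp: free_simps)

lemma free_supp: "p \<in> carrier (free_space K X) \<Longrightarrow> finite {x. p x \<noteq> \<zero>} \<and> {x. p x \<noteq> \<zero>} \<subseteq> X"
  by (auto simp: free_simps)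

lemma free_module: "module K (free_space K X)"
proof (rule moduleI)
  show "cring K" by (rule is_cring)
  have fin_add: "finite {x. p x \<oplus> q x \<noteq> \<zero>}" if "finite {x. p x \<noteq> \<zero>}" "finite {x. q x \<noteq> \<zero>}" for p q :: "'a \<Rightarrow> 'k"
    by (rule finite_subset[OF _ finite_UnI[OF that]]) auto
  have fin_smult: "finite {x. c \<otimes> p x \<noteq> \<zero>}" if "finite {x. p x \<noteq> \<zero>}" "c \<in> carrier K" for c and p :: "'a \<Rightarrow> 'k"
    by (rule finite_subset[OF _ that(1)]) (use that(2) in auto)
  have fv: "\<And>x y. x \<in> carrier (free_space K X) \<Longrightarrow> x y \<in> carrier K" by (rule free_val)
  show "abelian_group (free_space K X)"
  proof (rule abelian_groupI)
    show "\<exists>q\<in>carrier (free_space K X). q \<oplus>\<^bsub>free_space K X\<^esub> p = \<zero>\<^bsub>free_space K X\<^esub>"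
      if p: "p \<in> carrier (free_space K X)" for p
    proof (rule bexI)
      show "(\<lambda>x. (\<ominus> \<one>) \<otimes> p x) \<in> carrier (free_space K X)"
        using p fin_smult[of p "\<ominus> \<one>"] by (auto simp: free_simps)
      show "(\<lambda>x. (\<ominus> \<one>) \<otimes> p x) \<oplus>\<^bsub>free_space K X\<^esub> p = \<zero>\<^bsub>free_space K X\<^esub>"
        using free_val[OF p] by (auto simp: free_simps l_minus l_neg)
    qed
  next
    show "x \<oplus>\<^bsub>free_space K X\<^esub> y \<in> carrier (free_space K X)"
      if "x \<in> carrier (free_space K X)" "y \<in> carrier (free_space K X)" for x y
      using that fin_add by (auto simp: free_simps)
    show "x \<oplus>\<^bsub>free_space K X\<^esub> y \<oplus>\<^bsub>free_space K X\<^esub> z = x \<oplus>\<^bsub>free_space K X\<^esub> (y \<oplus>\<^bsub>free_space K X\<^esub> z)"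
      if "x \<in> carrier (free_space K X)" "y \<in> carrier (free_space K X)" "z \<in> carrier (free_space K X)" for x y z
      using that[THEN fv] by (auto simp: free_simps a_ac)
    show "x \<oplus>\<^bsub>free_space K X\<^esub> y = y \<oplus>\<^bsub>free_space K X\<^esub> x"
      if "x \<in> carrier (free_space K X)" "y \<in> carrier (free_space K X)" for x y
      using that[THEN fv] by (auto simp: free_simps a_ac)
    show "\<zero>\<^bsub>free_space K X\<^esub> \<oplus>\<^bsub>free_space K X\<^esub> x = x" if "x \<in> carrier (free_space K X)" for x
      using that[THEN fv] by (auto simp: free_simps)
    show "\<zero>\<^bsub>free_space K X\<^esub> \<in> carrier (free_space K X)" by (simp add: free_simps)
  qed
  show "a \<odot>\<^bsub>free_space K X\<^esub> x \<in> carrier (free_space K X)"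
    if "a \<in> carrier K" "x \<in> carrier (free_space K X)" for a x
    using that fin_smult by (auto simp: free_simps)
qed (auto simp: free_simps(1-3) l_distr r_distr m_assoc free_val)

lemma free_gen_closed: "x \<in> X \<Longrightarrow> free_gen K x \<in> carrier (free_space K X)"
  by (auto simp: free_simps free_gen_def)

lemma free_induct [consumes 1, case_names gen zero add smult]:
  assumes p: "p \<in> carrier (free_space K X)"
    and gen: "\<And>x. x \<in> X \<Longrightarrow> P (free_gen K x)" and zero: "P (\<lambda>x. \<zero>)"
    and add: "\<And>p q. p \<in> carrier (free_space K X) \<Longrightarrow> q \<in> carrier (free_space K X) \<Longrightarrow> P p \<Longrightarrow> P q
        \<Longrightarrow> P (p \<oplus>\<^bsub>free_space K X\<^esub> q)"
    and smult: "\<And>c p. c \<in> carrier K \<Longrightarrow> p \<in> carrier (free_space K X) \<Longrightarrow> P p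
        \<Longrightarrow> P (c \<odot>\<^bsub>free_space K X\<^esub> p)"
  shows "P p"
proof -
  have "\<forall>p \<in> carrier (free_space K X). {x. p x \<noteq> \<zero>} \<subseteq> S \<longrightarrow> P p" if "finite S" "S \<subseteq> X" for S
    using that
  proof (induction S rule: finite_induct)
    case empty
    have "P p" if "{x. p x \<noteq> \<zero>} \<subseteq> {}" for p
    proof -
      have "p = (\<lambda>x. \<zero>)" using that by auto
      then show ?thesis using zero by simp
    qed
    then show ?case by blast
  next
    case (insert s S)
    show ?case
    proof (intro ballI impI)
      fix p assume p: "p \<in> carrier (free_space K X)" and sub: "{x. p x \<noteq> \<zero>} \<subseteq> insert s S"
      define q where "q = p(s := \<zero>)"
      have "finite {x. q x \<noteq> \<zero>}"
        by (rule finite_subset[of _ "{x. p x \<noteq> \<zero>}"]) (use p in \<open>auto simp: q_def free_simps\<close>)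
      then have q: "q \<in> carrier (free_space K X)" using p by (auto simp: free_simps q_def)
      have "{x. q x \<noteq> \<zero>} \<subseteq> S" using sub by (auto simp: q_def)
      then have "P q" using insert q by auto
      have g: "free_gen K s \<in> carrier (free_space K X)" "P (free_gen K s)"
        using insert.prems gen free_gen_closed by auto
      have ps: "p s \<in> carrier K" by (rule free_val[OF p])
      have "p = q \<oplus>\<^bsub>free_space K X\<^esub> (p s \<odot>\<^bsub>free_space K X\<^esub> free_gen K s)"
        using free_val[OF p] by (auto simp: free_simps(1-3) q_def free_gen_def fun_eq_iff)
      then show "P p"
        using add[OF q _ \<open>P q\<close> smult[OF ps g]] module.smult_closed[OF free_module ps g(1)] by simp
    qed
  qed
  then show ?thesis using free_supp[OF p] p by blast
qed

definition free_eval :: "('k, 'u, 'b) module_scheme \<Rightarrow> ('x \<Rightarrow> 'u) \<Rightarrow> ('x \<Rightarrow> 'k) \<Rightarrow> 'u" where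
  "free_eval U g p = (\<Oplus>\<^bsub>U\<^esub>z\<in>{z. p z \<noteq> \<zero>}. p z \<odot>\<^bsub>U\<^esub> g z)"

context
  fixes U :: "('k, 'u, 'b) module_scheme" and g :: "'x \<Rightarrow> 'u" and X
  assumes U: "module K U" and g: "g \<in> X \<rightarrow> carrier U"
begin

interpretation U: module K U by (rule U)

private lemma gc: "x \<in> X \<Longrightarrow> g x \<in> carrier U" using g by auto

lemma free_eval_superset:
  assumes p: "p \<in> carrier (free_space K X)" and S: "finite S" "S \<subseteq> X" "{x. p x \<noteq> \<zero>} \<subseteq> S"
  shows "free_eval U g p = (\<Oplus>\<^bsub>U\<^esub>z\<in>S. p z \<odot>\<^bsub>U\<^esub> g z)"
  unfolding free_eval_def
  by (rule U.add.finprod_mono_neutral_cong_left) (use S free_val[OF p] in \<open>auto simp: subset_iff gc\<close>)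

lemma free_eval_lin: "free_eval U g \<in> lin_map K (free_space K X) U"
proof (rule lin_mapI)
  fix p assume p: "p \<in> carrier (free_space K X)"
  note fp = free_supp[OF p]
  have c: "(\<lambda>z. p z \<odot>\<^bsub>U\<^esub> g z) \<in> {z. p z \<noteq> \<zero>} \<rightarrow> carrier U" using g free_val[OF p] fp by auto
  then show "free_eval U g p \<in> carrier U" unfolding free_eval_def by (rule U.finsum_closed)
  show "free_eval U g (c \<odot>\<^bsub>free_space K X\<^esub> p) = c \<odot>\<^bsub>U\<^esub> free_eval U g p" if k: "c \<in> carrier K" for c
  proof -
    have cp: "c \<odot>\<^bsub>free_space K X\<^esub> p \<in> carrier (free_space K X)"
      using module.smult_closed[OF free_module k p] .
    have sub: "{x. (c \<odot>\<^bsub>free_space K X\<^esub> p) x \<noteq> \<zero>} \<subseteq> {z. p z \<noteq> \<zero>}"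
      using k by (auto simp: free_simps(3))
    have "free_eval U g (c \<odot>\<^bsub>free_space K X\<^esub> p)
        = (\<Oplus>\<^bsub>U\<^esub>z\<in>{z. p z \<noteq> \<zero>}. (c \<otimes> p z) \<odot>\<^bsub>U\<^esub> g z)"
      using free_eval_superset[OF cp _ _ sub] fp by (simp add: free_simps(3))
    also have "\<dots> = (\<Oplus>\<^bsub>U\<^esub>z\<in>{z. p z \<noteq> \<zero>}. c \<odot>\<^bsub>U\<^esub> (p z \<odot>\<^bsub>U\<^esub> g z))"
      by (rule U.finsum_cong') (use fp k free_val[OF p] in \<open>auto simp: U.smult_assoc1 subset_iff gc\<close>)
    also have "\<dots> = c \<odot>\<^bsub>U\<^esub> free_eval U g p"
      unfolding free_eval_def by (rule U.finsum_smult_ldistr[symmetric]) (use fp k c in auto)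
    finally show ?thesis .
  qed
  fix q assume q: "q \<in> carrier (free_space K X)"
  note fq = free_supp[OF q]
  let ?S = "{z. p z \<noteq> \<zero>} \<union> {z. q z \<noteq> \<zero>}"
  have pq: "p \<oplus>\<^bsub>free_space K X\<^esub> q \<in> carrier (free_space K X)"
    using abelian_groupE(1)[OF module.axioms(2)[OF free_module] p q] .
  have sub: "{x. (p \<oplus>\<^bsub>free_space K X\<^esub> q) x \<noteq> \<zero>} \<subseteq> ?S" by (auto simp: free_simps(2))
  have S: "finite ?S" "?S \<subseteq> X" using fp fq by auto
  have "free_eval U g (p \<oplus>\<^bsub>free_space K X\<^esub> q) = (\<Oplus>\<^bsub>U\<^esub>z\<in>?S. (p z \<oplus> q z) \<odot>\<^bsub>U\<^esub> g z)"
    using free_eval_superset[OF pq S sub] by (simp add: free_simps(2))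
  also have "\<dots> = (\<Oplus>\<^bsub>U\<^esub>z\<in>?S. p z \<odot>\<^bsub>U\<^esub> g z \<oplus>\<^bsub>U\<^esub> q z \<odot>\<^bsub>U\<^esub> g z)"
    by (rule U.finsum_cong') (use S free_val[OF p] free_val[OF q] in \<open>auto simp: U.smult_l_distr subset_iff gc\<close>)
  also have "\<dots> = (\<Oplus>\<^bsub>U\<^esub>z\<in>?S. p z \<odot>\<^bsub>U\<^esub> g z) \<oplus>\<^bsub>U\<^esub> (\<Oplus>\<^bsub>U\<^esub>z\<in>?S. q z \<odot>\<^bsub>U\<^esub> g z)"
    by (rule U.finsum_addf) (use S free_val[OF p] free_val[OF q] in \<open>auto simp: subset_iff gc\<close>)
  also have "\<dots> = free_eval U g p \<oplus>\<^bsub>U\<^esub> free_eval U g q"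
    using free_eval_superset[OF p S] free_eval_superset[OF q S] by simp
  finally show "free_eval U g (p \<oplus>\<^bsub>free_space K X\<^esub> q) = free_eval U g p \<oplus>\<^bsub>U\<^esub> free_eval U g q" .
qed

lemma free_eval_gen: "x \<in> X \<Longrightarrow> free_eval U g (free_gen K x) = g x"
proof -
  assume x: "x \<in> X"
  then have "free_eval U g (free_gen K x) = (\<Oplus>\<^bsub>U\<^esub>z\<in>{x}. free_gen K x z \<odot>\<^bsub>U\<^esub> g z)"
    using free_eval_superset[OF free_gen_closed[OF x], of "{x}"] by (auto simp: free_gen_def)
  then show ?thesis using x g by (auto simp: free_gen_def Pi_def)
qed

end

section \<open>Tensor products\<close>

context
  fixes V :: "('k, 'v, 'a) module_scheme" and W :: "('k, 'w, 'b) module_scheme"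
  assumes V: "module K V" and W: "module K W"
begin

interpretation V: module K V by (rule V)
interpretation W: module K W by (rule W)

private abbreviation "F \<equiv> free_space K (carrier V \<times> carrier W)"
private abbreviation "N \<equiv> tensor_kernel K V W"

interpretation F: module K F by (rule free_module)

private lemma gen_closed: "v \<in> carrier V \<Longrightarrow> w \<in> carrier W \<Longrightarrow> free_gen K (v, w) \<in> carrier F"
  by (rule free_gen_closed) simp

lemma tensor_rels_subset: "tensor_rels K V W \<subseteq> carrier F"
  unfolding tensor_rels_def Let_def by (auto intro!: F.minus_closed gen_closed)

private lemma kernel_subspace: "submodule N K F"
  unfolding tensor_kernel_def by (rule span_subspace[OF free_module tensor_rels_subset])

private lemma kernel_rel: "r \<in> tensor_rels K V W \<Longrightarrow> r \<in> N"
  unfolding tensor_kernel_def by (rule subsetD[OF span_subset])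

lemma tensor_module: "module K (V \<boxtimes> W)"
  unfolding tensor_space_def by (rule quot_module[OF free_module kernel_subspace])

private lemma pure_eq: "pure_tensor K V W v w = N +>\<^bsub>F\<^esub> free_gen K (v, w)"
  by (simp add: pure_tensor_def)

lemma pure_closed:
  "v \<in> carrier V \<Longrightarrow> w \<in> carrier W \<Longrightarrow> pure_tensor K V W v w \<in> carrier (V \<boxtimes> W)"
  unfolding tensor_space_def pure_eq
  using quot_carrier[OF free_module kernel_subspace] gen_closed by blast

private lemma rel_eq:
  assumes "p \<in> carrier F" "q \<in> carrier F" "p \<ominus>\<^bsub>F\<^esub> q \<in> tensor_rels K V W"
  shows "N +>\<^bsub>F\<^esub> p = N +>\<^bsub>F\<^esub> q"
  using coset_eq_iff[OF free_module kernel_subspace assms(1,2)] kernel_rel[OF assms(3)] by blast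

lemma pure_add1:
  assumes "v \<in> carrier V" "v' \<in> carrier V" "w \<in> carrier W"
  shows "pure_tensor K V W (v \<oplus>\<^bsub>V\<^esub> v') w
    = pure_tensor K V W v w \<oplus>\<^bsub>V \<boxtimes> W\<^esub> pure_tensor K V W v' w"
proof -
  have "N +>\<^bsub>F\<^esub> free_gen K (v \<oplus>\<^bsub>V\<^esub> v', w) = N +>\<^bsub>F\<^esub> (free_gen K (v, w) \<oplus>\<^bsub>F\<^esub> free_gen K (v', w))"
    by (rule rel_eq) (use assms in \<open>auto intro!: gen_closed simp: tensor_rels_def Let_def\<close>)
  then show ?thesis
    using assms by (simp add: pure_eq tensor_space_def quot_add[OF free_module kernel_subspace]
      quot_smult[OF free_module kernel_subspace] gen_closed)
qed

lemma pure_add2: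
  assumes "v \<in> carrier V" "w \<in> carrier W" "w' \<in> carrier W"
  shows "pure_tensor K V W v (w \<oplus>\<^bsub>W\<^esub> w')
    = pure_tensor K V W v w \<oplus>\<^bsub>V \<boxtimes> W\<^esub> pure_tensor K V W v w'"
proof -
  have "N +>\<^bsub>F\<^esub> free_gen K (v, w \<oplus>\<^bsub>W\<^esub> w') = N +>\<^bsub>F\<^esub> (free_gen K (v, w) \<oplus>\<^bsub>F\<^esub> free_gen K (v, w'))"
    by (rule rel_eq) (use assms in \<open>auto intro!: gen_closed simp: tensor_rels_def Let_def\<close>)
  then show ?thesis
    using assms by (simp add: pure_eq tensor_space_def quot_add[OF free_module kernel_subspace]
      quot_smult[OF free_module kernel_subspace] gen_closed)
qed

lemma pure_smult1:
  assumes "c \<in> carrier K" "v \<in> carrier V" "w \<in> carrier W"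
  shows "pure_tensor K V W (c \<odot>\<^bsub>V\<^esub> v) w = c \<odot>\<^bsub>V \<boxtimes> W\<^esub> pure_tensor K V W v w"
proof -
  have "N +>\<^bsub>F\<^esub> free_gen K (c \<odot>\<^bsub>V\<^esub> v, w) = N +>\<^bsub>F\<^esub> (c \<odot>\<^bsub>F\<^esub> free_gen K (v, w))"
    by (rule rel_eq) (use assms in \<open>auto intro!: gen_closed simp: tensor_rels_def Let_def\<close>)
  then show ?thesis
    using assms by (simp add: pure_eq tensor_space_def quot_add[OF free_module kernel_subspace]
      quot_smult[OF free_module kernel_subspace] gen_closed)
qed

lemma pure_smult2:
  assumes "c \<in> carrier K" "v \<in> carrier V" "w \<in> carrier W"
  shows "pure_tensor K V W v (c \<odot>\<^bsub>W\<^esub> w) = c \<odot>\<^bsub>V \<boxtimes> W\<^esub> pure_tensor K V W v w"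
proof -
  have "N +>\<^bsub>F\<^esub> free_gen K (v, c \<odot>\<^bsub>W\<^esub> w) = N +>\<^bsub>F\<^esub> (c \<odot>\<^bsub>F\<^esub> free_gen K (v, w))"
    by (rule rel_eq) (use assms in \<open>auto intro!: gen_closed simp: tensor_rels_def Let_def\<close>)
  then show ?thesis
    using assms by (simp add: pure_eq tensor_space_def quot_add[OF free_module kernel_subspace]
      quot_smult[OF free_module kernel_subspace] gen_closed)
qed

lemma pure_lin1: "w \<in> carrier W \<Longrightarrow> (\<lambda>v. pure_tensor K V W v w) \<in> lin_map K V (V \<boxtimes> W)"
  by (rule lin_mapI) (auto simp: pure_closed pure_add1 pure_smult1)

lemma pure_lin2: "v \<in> carrier V \<Longrightarrow> pure_tensor K V W v \<in> lin_map K W (V \<boxtimes> W)"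
  by (rule lin_mapI) (auto simp: pure_closed pure_add2 pure_smult2)

lemma pure_zero1:
  "w \<in> carrier W \<Longrightarrow> pure_tensor K V W \<zero>\<^bsub>V\<^esub> w = \<zero>\<^bsub>V \<boxtimes> W\<^esub>"
  by (rule lin_zero[OF V tensor_module pure_lin1])

lemma tensor_induct [consumes 1, case_names pure add]:
  assumes x: "x \<in> carrier (V \<boxtimes> W)"
    and pure: "\<And>v w. v \<in> carrier V \<Longrightarrow> w \<in> carrier W \<Longrightarrow> P (pure_tensor K V W v w)"
    and add: "\<And>x y. x \<in> carrier (V \<boxtimes> W) \<Longrightarrow> y \<in> carrier (V \<boxtimes> W)
      \<Longrightarrow> P x \<Longrightarrow> P y \<Longrightarrow> P (x \<oplus>\<^bsub>V \<boxtimes> W\<^esub> y)"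
  shows "P x"
proof -
  interpret T: module K "V \<boxtimes> W" by (rule tensor_module)
  let ?c = "\<lambda>p. N +>\<^bsub>F\<^esub> p"
  have lin: "?c \<in> lin_map K F (V \<boxtimes> W)"
    unfolding tensor_space_def by (rule quot_proj_lin[OF free_module kernel_subspace])
  have all: "\<forall>k\<in>carrier K. P (k \<odot>\<^bsub>V \<boxtimes> W\<^esub> ?c p)" if "p \<in> carrier F" for p
    using that
  proof (induction rule: free_induct)
    case (gen z)
    then obtain v w where z: "z = (v, w)" "v \<in> carrier V" "w \<in> carrier W" by auto
    show ?case
    proof
      fix k assume "k \<in> carrier K"
      then show "P (k \<odot>\<^bsub>V \<boxtimes> W\<^esub> ?c (free_gen K z))"
        using z pure[of "k \<odot>\<^bsub>V\<^esub> v" w] by (simp add: pure_smult1 pure_eq[symmetric])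
    qed
  next
    case zero
    have "?c (\<lambda>x. \<zero>) = \<zero>\<^bsub>V \<boxtimes> W\<^esub>"
      using lin_zero[OF free_module tensor_module lin] by (simp add: free_simps(1))
    then show ?case using pure[of "\<zero>\<^bsub>V\<^esub>" "\<zero>\<^bsub>W\<^esub>"] by (simp add: pure_zero1)
  next
    case (add p q)
    then show ?case
      by (auto simp: lin_add[OF lin] T.smult_r_distr lin_closed[OF lin] intro!: assms(3))
  next
    case (smult c p)
    show ?case
    proof
      fix k assume "k \<in> carrier K"
      then show "P (k \<odot>\<^bsub>V \<boxtimes> W\<^esub> ?c (c \<odot>\<^bsub>F\<^esub> p))"
        using smult by (simp add: lin_smult[OF lin] lin_closed[OF lin] T.smult_assoc1[symmetric])
    qed
  qed
  from x obtain p where p: "p \<in> carrier F" "x = ?c p"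
    unfolding tensor_space_def quot_carrier[OF free_module kernel_subspace] by blast
  then have "x = \<one> \<odot>\<^bsub>V \<boxtimes> W\<^esub> ?c p" using lin_closed[OF lin] by simp
  then show ?thesis using all[OF p(1)] by simp
qed

context
  fixes U :: "('k, 'u, 'c) module_scheme" and b
  assumes U: "module K U" and b: "bilin_map K V W U b"
begin

interpretation U: module K U by (rule U)

private definition "ev = free_eval U (\<lambda>z. b (fst z) (snd z))"

private lemma bcl: "v \<in> carrier V \<Longrightarrow> w \<in> carrier W \<Longrightarrow> b v w \<in> carrier U"
  using lin_closed[OF bilinD1[OF b]] .

private lemma cl: "(\<lambda>z. b (fst z) (snd z)) \<in> carrier V \<times> carrier W \<rightarrow> carrier U"
  by (auto simp: bcl)

private lemma ev_lin: "ev \<in> lin_map K F U"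
  unfolding ev_def by (rule free_eval_lin[OF U cl])

private lemma ev_gen: "v \<in> carrier V \<Longrightarrow> w \<in> carrier W \<Longrightarrow> ev (free_gen K (v, w)) = b v w"
  unfolding ev_def by (subst free_eval_gen[OF U cl]) auto

private lemma ev_kernel: "p \<in> N \<Longrightarrow> ev p = \<zero>\<^bsub>U\<^esub>"
proof -
  have "ev r = \<zero>\<^bsub>U\<^esub>" if "r \<in> tensor_rels K V W" for r
    using that unfolding tensor_rels_def Let_def
    by (auto simp: lin_minus[OF free_module U ev_lin] lin_add[OF ev_lin] lin_smult[OF ev_lin] gen_closed ev_gen
        lin_add[OF bilinD1[OF b]] lin_smult[OF bilinD1[OF b]] lin_add[OF bilinD2[OF b]] lin_smult[OF bilinD2[OF b]]
        minus_zero_iff[OF U] bcl)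
  then show "ev p = \<zero>\<^bsub>U\<^esub>" if "p \<in> N"
    using lin_eq_on_span[OF free_module U ev_lin lin_const_zero[OF U], of "tensor_rels K V W" p]
      that tensor_rels_subset unfolding tensor_kernel_def by blast
qed

private lemma tensor_lift_eq: "tensor_lift K U b = quot_lift ev"
  by (simp add: tensor_lift_def ev_def free_eval_def[abs_def])

lemma tensor_lift_lin: "tensor_lift K U b \<in> lin_map K (V \<boxtimes> W) U"
  unfolding tensor_lift_eq tensor_space_def
  by (rule quot_lift_lin[OF free_module kernel_subspace U ev_lin ev_kernel])

lemma tensor_lift_pure:
  "v \<in> carrier V \<Longrightarrow> w \<in> carrier W \<Longrightarrow> tensor_lift K U b (pure_tensor K V W v w) = b v w"
  unfolding tensor_lift_eq pure_eq
  by (simp add: quot_lift_coset[OF free_module kernel_subspace U ev_lin ev_kernel] gen_closed ev_gen)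

end

lemma tensor_ext:
  assumes U: "module K U" and fg: "f \<in> lin_map K (V \<boxtimes> W) U" "g \<in> lin_map K (V \<boxtimes> W) U"
    and eq: "\<And>v w. v \<in> carrier V \<Longrightarrow> w \<in> carrier W \<Longrightarrow> f (pure_tensor K V W v w) = g (pure_tensor K V W v w)"
    and x: "x \<in> carrier (V \<boxtimes> W)"
  shows "f x = g x"
  using x by (induction rule: tensor_induct) (auto simp: eq lin_add[OF fg(1)] lin_add[OF fg(2)])

end

section \<open>Maps on tensor products\<close>

lemma lin_pure1:
  "module K V \<Longrightarrow> module K W \<Longrightarrow> f \<in> lin_map K U V \<Longrightarrow> w \<in> carrier W
    \<Longrightarrow> (\<lambda>x. pure_tensor K V W (f x) w) \<in> lin_map K U (V \<boxtimes> W)"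
  by (rule lin_comp[OF pure_lin1])

lemma lin_pure2:
  "module K V \<Longrightarrow> module K W \<Longrightarrow> f \<in> lin_map K U W \<Longrightarrow> v \<in> carrier V
    \<Longrightarrow> (\<lambda>x. pure_tensor K V W v (f x)) \<in> lin_map K U (V \<boxtimes> W)"
  by (rule lin_comp[OF pure_lin2])

lemma lin_scalar:
  assumes "module K V" "f \<in> lin_map K U (scalars K)" "v \<in> carrier V"
  shows "(\<lambda>x. f x \<odot>\<^bsub>V\<^esub> v) \<in> lin_map K U V"
proof -
  interpret V: module K V by fact
  show ?thesis
    by (rule lin_mapI)
      (use assms in \<open>auto simp: dual_closed lin_add[OF assms(2)] lin_smult[OF assms(2)] V.smult_l_distr V.smult_assoc1\<close>)
qed

text \<open>Linearity of an expression in one of its arguments.\<close>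

named_theorems lin_intros

lemmas [lin_intros] = lin_id

lemma lin_lift_comp:
  assumes "module K V" "module K W" "module K U" "module K U'"
    and b: "bilin_map K V W U b" and h: "h \<in> lin_map K U U'" and x: "x \<in> carrier (V \<boxtimes> W)"
  shows "h (tensor_lift K U b x) = tensor_lift K U' (\<lambda>v w. h (b v w)) x"
proof (rule tensor_ext[OF assms(1,2,4) _ _ _ x])
  have b': "bilin_map K V W U' (\<lambda>v w. h (b v w))"
    by (intro bilinI lin_comp[OF h] bilinD1[OF b] bilinD2[OF b])
  show "tensor_lift K U' (\<lambda>v w. h (b v w)) \<in> lin_map K (V \<boxtimes> W) U'"
    by (rule tensor_lift_lin[OF assms(1,2,4) b'])
  show "(\<lambda>x. h (tensor_lift K U b x)) \<in> lin_map K (V \<boxtimes> W) U'"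
    by (rule lin_comp[OF h tensor_lift_lin[OF assms(1-3) b]])
  show "h (tensor_lift K U b (pure_tensor K V W v w)) = tensor_lift K U' (\<lambda>v w. h (b v w)) (pure_tensor K V W v w)"
    if "v \<in> carrier V" "w \<in> carrier W" for v w
    using that by (simp add: tensor_lift_pure[OF assms(1-3) b] tensor_lift_pure[OF assms(1,2,4) b'])
qed

lemma bilin_cong:
  assumes "module K V" "module K W" "bilin_map K V W U b"
    and "\<And>v w. v \<in> carrier V \<Longrightarrow> w \<in> carrier W \<Longrightarrow> b v w = b' v w"
  shows "bilin_map K V W U b'"
proof -
  interpret V: module K V by fact
  interpret W: module K W by fact
  show ?thesis
    using assms(3,4) unfolding bilin_map_def lin_map_def by (auto simp: Pi_def)
qed

lemma tensor_lift_cong: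
  assumes "module K V" "module K W" "module K U" "bilin_map K V W U b"
    and eq: "\<And>v w. v \<in> carrier V \<Longrightarrow> w \<in> carrier W \<Longrightarrow> b v w = b' v w"
    and x: "x \<in> carrier (V \<boxtimes> W)"
  shows "tensor_lift K U b x = tensor_lift K U b' x"
proof -
  have b': "bilin_map K V W U b'" by (rule bilin_cong[OF assms(1,2,4) eq])
  show ?thesis
    by (rule tensor_ext[OF assms(1-3) _ _ _ x])
      (simp_all add: tensor_lift_lin tensor_lift_pure assms(1-4) b' eq)
qed

lemma tensor_map_bilin:
  assumes "module K V'" "module K W'" "f \<in> lin_map K V V'" "g \<in> lin_map K W W'"
  shows "bilin_map K V W (V' \<boxtimes> W') (\<lambda>v w. pure_tensor K V' W' (f v) (g w))"
  using assms by (intro bilinI lin_pure1 lin_pure2) (auto simp: lin_closed)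

lemma tensor_map_lin:
  assumes "module K V" "module K W" "module K V'" "module K W'" "f \<in> lin_map K V V'" "g \<in> lin_map K W W'"
  shows "tensor_map K V' W' f g \<in> lin_map K (V \<boxtimes> W) (V' \<boxtimes> W')"
  unfolding tensor_map_def
  by (rule tensor_lift_lin) (use assms tensor_map_bilin tensor_module in auto)

lemma tensor_map_pure:
  assumes "module K V" "module K W" "module K V'" "module K W'" "f \<in> lin_map K V V'" "g \<in> lin_map K W W'"
    and "v \<in> carrier V" "w \<in> carrier W"
  shows "tensor_map K V' W' f g (pure_tensor K V W v w) = pure_tensor K V' W' (f v) (g w)"
  unfolding tensor_map_def
  by (rule tensor_lift_pure) (use assms tensor_map_bilin tensor_module in auto)

context
  fixes V :: "('k, 'v, 'a) module_scheme" and W :: "('k, 'w, 'b) module_scheme"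
  assumes V: "module K V" and W: "module K W"
begin

interpretation V: module K V by (rule V)
interpretation W: module K W by (rule W)

lemma contract_right_bilin: "\<omega> \<in> dual W \<Longrightarrow> bilin_map K V W V (\<lambda>v w. \<omega> w \<odot>\<^bsub>V\<^esub> v)"
  by (intro bilinI lin_scalar[OF V] lin_scale[OF V] lin_id) (auto simp: dual_closed)

lemma contract_left_bilin: "\<omega> \<in> dual V \<Longrightarrow> bilin_map K V W W (\<lambda>v w. \<omega> v \<odot>\<^bsub>W\<^esub> w)"
  by (intro bilinI lin_scalar[OF W] lin_scale[OF W] lin_id) (auto simp: dual_closed)

lemma contract_right_lin: "\<omega> \<in> dual W \<Longrightarrow> contract_right K V \<omega> \<in> lin_map K (V \<boxtimes> W) V"
  unfolding contract_right_def by (rule tensor_lift_lin[OF V W V contract_right_bilin])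

lemma contract_left_lin: "\<omega> \<in> dual V \<Longrightarrow> contract_left K W \<omega> \<in> lin_map K (V \<boxtimes> W) W"
  unfolding contract_left_def by (rule tensor_lift_lin[OF V W W contract_left_bilin])

lemma contract_right_pure:
  "\<omega> \<in> dual W \<Longrightarrow> v \<in> carrier V \<Longrightarrow> w \<in> carrier W
    \<Longrightarrow> contract_right K V \<omega> (pure_tensor K V W v w) = \<omega> w \<odot>\<^bsub>V\<^esub> v"
  unfolding contract_right_def by (rule tensor_lift_pure[OF V W V contract_right_bilin])

lemma contract_left_pure:
  "\<omega> \<in> dual V \<Longrightarrow> v \<in> carrier V \<Longrightarrow> w \<in> carrier W
    \<Longrightarrow> contract_left K W \<omega> (pure_tensor K V W v w) = \<omega> v \<odot>\<^bsub>W\<^esub> w"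
  unfolding contract_left_def by (rule tensor_lift_pure[OF V W W contract_left_bilin])

lemma contract_comm:
  assumes "\<alpha> \<in> dual V" "\<beta> \<in> dual W" "x \<in> carrier (V \<boxtimes> W)"
  shows "\<alpha> (contract_right K V \<beta> x) = \<beta> (contract_left K W \<alpha> x)"
  by (rule tensor_ext[OF V W scalars_module _ _ _ assms(3)])
    (use assms(1,2) in \<open>auto simp: contract_right_pure contract_left_pure dual_closed m_comm
      lin_smult[OF assms(1)] lin_smult[OF assms(2)]
      intro: lin_comp[OF assms(1) contract_right_lin] lin_comp[OF assms(2) contract_left_lin]\<close>)

lemma tensor_flip_bilin: "bilin_map K V W (W \<boxtimes> V) (\<lambda>v w. pure_tensor K W V w v)"
  by (intro bilinI lin_pure1[OF W V] lin_pure2[OF W V] lin_id)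

lemma tensor_flip_lin: "tensor_flip K V W \<in> lin_map K (V \<boxtimes> W) (W \<boxtimes> V)"
  unfolding tensor_flip_def by (rule tensor_lift_lin[OF V W tensor_module[OF W V] tensor_flip_bilin])

lemma tensor_flip_pure:
  "v \<in> carrier V \<Longrightarrow> w \<in> carrier W \<Longrightarrow> tensor_flip K V W (pure_tensor K V W v w) = pure_tensor K W V w v"
  unfolding tensor_flip_def by (rule tensor_lift_pure[OF V W tensor_module[OF W V] tensor_flip_bilin])

end

section \<open>Separation by functionals\<close>

text \<open>
  A subspace that is maximal among those that contain \<open>U\<close> and avoid \<open>v\<close> is a hyperplane
  complementary to \<open>v\<close>; the coordinate along \<open>v\<close> is the functional.
\<close>

lemma functional_separation:
  assumes V: "module K V" and U: "submodule U K V" and v: "v \<in> carrier V" "v \<notin> U"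
  shows "\<exists>\<alpha>\<in>dual V. (\<forall>u\<in>U. \<alpha> u = \<zero>) \<and> \<alpha> v = \<one>"
proof -
  interpret V: module K V by (rule V)
  let ?A = "{H. submodule H K V \<and> U \<subseteq> H \<and> v \<notin> H}"
  have "\<exists>H\<in>?A. \<forall>X\<in>?A. H \<subseteq> X \<longrightarrow> X = H"
  proof (rule subset_Zorn_nonempty)
    show "?A \<noteq> {}" using U v by blast
    fix C assume C: "C \<noteq> {}" "subset.chain ?A C"
    have sub: "\<And>H. H \<in> C \<Longrightarrow> H \<in> ?A" using C(2) unfolding subset.chain_def by blast
    have cmp: "X \<subseteq> Y \<or> Y \<subseteq> X" if "X \<in> C" "Y \<in> C" for X Y
      using subset.chain_total[OF C(2) that] by auto
    have dir: "\<exists>H\<in>C. x \<in> H \<and> y \<in> H" if "x \<in> \<Union>C" "y \<in> \<Union>C" for x y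
    proof -
      from that obtain X Y where "X \<in> C" "Y \<in> C" "x \<in> X" "y \<in> Y" by auto
      then show ?thesis using cmp[of X Y] by blast
    qed
    have "submodule (\<Union>C) K V"
    proof (rule subspaceI[OF V])
      show "\<Union>C \<subseteq> carrier V" using sub by (auto dest!: subspace_subset)
      show "\<zero>\<^bsub>V\<^esub> \<in> \<Union>C" using C(1) sub subspace_zero[of _ V] by auto
      show "a \<oplus>\<^bsub>V\<^esub> b \<in> \<Union>C" if "a \<in> \<Union>C" "b \<in> \<Union>C" for a b
      proof -
        obtain H where "H \<in> C" "a \<in> H" "b \<in> H" using dir[OF \<open>a \<in> \<Union>C\<close> \<open>b \<in> \<Union>C\<close>] by blast
        then show ?thesis using sub[of H] subspace_add[of H V a b] by auto
      qed
      show "c \<odot>\<^bsub>V\<^esub> x \<in> \<Union>C" if "c \<in> carrier K" "x \<in> \<Union>C" for c x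
      proof -
        obtain H where "H \<in> C" "x \<in> H" using \<open>x \<in> \<Union>C\<close> by blast
        then show ?thesis using sub[of H] subspace_smult[of H V c x] \<open>c \<in> carrier K\<close> by auto
      qed
    qed
    then show "\<Union>C \<in> ?A" using C(1) sub by fastforce
  qed
  then obtain H where H0: "H \<in> ?A" and max0: "\<And>X. X \<in> ?A \<Longrightarrow> H \<subseteq> X \<Longrightarrow> X = H" by (elim bexE) simp
  have H: "submodule H K V" "U \<subseteq> H" "v \<notin> H" using H0 by simp_all
  have max: "X = H" if "submodule X K V" "H \<subseteq> X" "v \<notin> X" for X
    by (rule max0) (use that H in auto)
  note Hc = subsetD[OF subspace_subset[OF H(1)]]
  have vmult: "c = \<zero>" if "c \<in> carrier K" "c \<odot>\<^bsub>V\<^esub> v \<in> H" for c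
  proof (rule ccontr)
    assume "c \<noteq> \<zero>"
    then have i: "inv c \<in> carrier K" "inv c \<otimes> c = \<one>" using that(1) by (auto simp: field_Units)
    have "inv c \<odot>\<^bsub>V\<^esub> (c \<odot>\<^bsub>V\<^esub> v) \<in> H" using subspace_smult[OF H(1) i(1) that(2)] .
    then show False using H(3) i v(1) that(1) by (simp add: V.smult_assoc1[symmetric])
  qed
  have uniq: "c = d" if "c \<in> carrier K" "d \<in> carrier K" "x \<in> carrier V"
    "x \<ominus>\<^bsub>V\<^esub> c \<odot>\<^bsub>V\<^esub> v \<in> H" "x \<ominus>\<^bsub>V\<^esub> d \<odot>\<^bsub>V\<^esub> v \<in> H" for c d x
  proof -
    have "(x \<ominus>\<^bsub>V\<^esub> d \<odot>\<^bsub>V\<^esub> v) \<ominus>\<^bsub>V\<^esub> (x \<ominus>\<^bsub>V\<^esub> c \<odot>\<^bsub>V\<^esub> v) \<in> H"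
      by (rule subspace_minus[OF V H(1) that(5,4)])
    also have "(x \<ominus>\<^bsub>V\<^esub> d \<odot>\<^bsub>V\<^esub> v) \<ominus>\<^bsub>V\<^esub> (x \<ominus>\<^bsub>V\<^esub> c \<odot>\<^bsub>V\<^esub> v)
        = (c \<odot>\<^bsub>V\<^esub> v \<ominus>\<^bsub>V\<^esub> d \<odot>\<^bsub>V\<^esub> v) \<oplus>\<^bsub>V\<^esub> (x \<ominus>\<^bsub>V\<^esub> x)"
      using that v(1) by (simp add: a_minus_def V.minus_add V.a_ac V.minus_minus)
    also have "\<dots> = (c \<ominus> d) \<odot>\<^bsub>V\<^esub> v"
      using that v(1) by (simp add: a_minus_def V.r_neg V.smult_l_distr V.smult_l_minus)
    finally have "c \<ominus> d = \<zero>" using that vmult[of "c \<ominus> d"] by simp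
    then have "c \<oplus> \<ominus> d = \<zero>" by (simp add: a_minus_def)
    then show ?thesis using that by (metis add.inv_closed add.inv_solve_right' l_zero minus_minus r_neg add.m_comm add.inv_equality)
  qed
  have ex: "\<exists>c\<in>carrier K. x \<ominus>\<^bsub>V\<^esub> c \<odot>\<^bsub>V\<^esub> v \<in> H" if x: "x \<in> carrier V" for x
  proof (cases "x \<in> H")
    case True
    then show ?thesis using x v by (intro bexI[of _ \<zero>]) (auto simp: a_minus_def neg_eq_smult[OF V])
  next
    case False
    let ?X = "{h \<oplus>\<^bsub>V\<^esub> k \<odot>\<^bsub>V\<^esub> x | h k. h \<in> H \<and> k \<in> carrier K}"
    have X: "submodule ?X K V"
    proof (rule subspaceI[OF V])
      show "?X \<subseteq> carrier V" using Hc x by auto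
      have "\<zero>\<^bsub>V\<^esub> = \<zero>\<^bsub>V\<^esub> \<oplus>\<^bsub>V\<^esub> \<zero> \<odot>\<^bsub>V\<^esub> x" using x by simp
      then show "\<zero>\<^bsub>V\<^esub> \<in> ?X" using subspace_zero[OF H(1)] by blast
      show "a \<oplus>\<^bsub>V\<^esub> b \<in> ?X" if a: "a \<in> ?X" and b: "b \<in> ?X" for a b
      proof -
        from a b obtain h k h' k' where ab: "a = h \<oplus>\<^bsub>V\<^esub> k \<odot>\<^bsub>V\<^esub> x" "b = h' \<oplus>\<^bsub>V\<^esub> k' \<odot>\<^bsub>V\<^esub> x"
          and hk: "h \<in> H" "k \<in> carrier K" "h' \<in> H" "k' \<in> carrier K" by blast
        have "a \<oplus>\<^bsub>V\<^esub> b = (h \<oplus>\<^bsub>V\<^esub> h') \<oplus>\<^bsub>V\<^esub> (k \<oplus> k') \<odot>\<^bsub>V\<^esub> x"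
          using hk Hc x by (simp add: ab V.smult_l_distr V.a_ac)
        then show ?thesis using hk subspace_add[OF H(1)] by blast
      qed
      show "c \<odot>\<^bsub>V\<^esub> a \<in> ?X" if c: "c \<in> carrier K" and a: "a \<in> ?X" for c a
      proof -
        from a obtain h k where ab: "a = h \<oplus>\<^bsub>V\<^esub> k \<odot>\<^bsub>V\<^esub> x"
          and hk: "h \<in> H" "k \<in> carrier K" by blast
        have "c \<odot>\<^bsub>V\<^esub> a = c \<odot>\<^bsub>V\<^esub> h \<oplus>\<^bsub>V\<^esub> (c \<otimes> k) \<odot>\<^bsub>V\<^esub> x"
          using hk Hc x c by (simp add: ab V.smult_r_distr V.smult_assoc1)
        then show ?thesis using hk c subspace_smult[OF H(1)] by blast
      qed
    qed
    have HX: "H \<subseteq> ?X"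
    proof
      fix h assume h: "h \<in> H"
      then have "h = h \<oplus>\<^bsub>V\<^esub> \<zero> \<odot>\<^bsub>V\<^esub> x" using x Hc by simp
      then show "h \<in> ?X" using h by blast
    qed
    have "x = \<zero>\<^bsub>V\<^esub> \<oplus>\<^bsub>V\<^esub> \<one> \<odot>\<^bsub>V\<^esub> x" using x by simp
    then have "x \<in> ?X" using subspace_zero[OF H(1)] by blast
    then have "v \<in> ?X" using max[OF X HX] False by blast
    then obtain h k where hk: "v = h \<oplus>\<^bsub>V\<^esub> k \<odot>\<^bsub>V\<^esub> x" "h \<in> H" "k \<in> carrier K" by blast
    have "k \<noteq> \<zero>" using hk H(3) x Hc by auto
    then have i: "inv k \<in> carrier K" "inv k \<otimes> k = \<one>" using hk(3) by (auto simp: field_Units)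
    have "inv k \<odot>\<^bsub>V\<^esub> v = inv k \<odot>\<^bsub>V\<^esub> h \<oplus>\<^bsub>V\<^esub> x"
      using hk i x Hc by (simp add: V.smult_r_distr V.smult_assoc1[symmetric])
    then have "x \<ominus>\<^bsub>V\<^esub> inv k \<odot>\<^bsub>V\<^esub> v = \<ominus>\<^bsub>V\<^esub> (inv k \<odot>\<^bsub>V\<^esub> h)"
      using hk i x Hc v(1)
      by (simp add: a_minus_def V.minus_add V.a_ac V.r_neg V.r_neg1 V.r_neg2)
    then show ?thesis
      using i(1) subspace_neg[OF V H(1) subspace_smult[OF H(1) i(1) hk(2)]]
      by (intro bexI[of _ "inv k"]) simp_all
  qed
  define \<alpha> where "\<alpha> x = (THE c. c \<in> carrier K \<and> x \<ominus>\<^bsub>V\<^esub> c \<odot>\<^bsub>V\<^esub> v \<in> H)" for x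
  have eqI: "\<alpha> x = c" if "x \<in> carrier V" "c \<in> carrier K" "x \<ominus>\<^bsub>V\<^esub> c \<odot>\<^bsub>V\<^esub> v \<in> H" for x c
    unfolding \<alpha>_def by (rule the_equality) (use that uniq in blast)+
  have spec: "\<alpha> x \<in> carrier K" "x \<ominus>\<^bsub>V\<^esub> \<alpha> x \<odot>\<^bsub>V\<^esub> v \<in> H" if "x \<in> carrier V" for x
    using ex[OF that] eqI[OF that] by auto
  have "\<alpha> \<in> dual V"
  proof (rule lin_mapI)
    fix x assume x: "x \<in> carrier V"
    show "\<alpha> x \<in> carrier (scalars K)" using spec[OF x] by simp
    show "\<alpha> (c \<odot>\<^bsub>V\<^esub> x) = c \<odot>\<^bsub>scalars K\<^esub> \<alpha> x" if c: "c \<in> carrier K" for c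
    proof (simp, rule eqI)
      have "c \<odot>\<^bsub>V\<^esub> (x \<ominus>\<^bsub>V\<^esub> \<alpha> x \<odot>\<^bsub>V\<^esub> v) \<in> H" by (rule subspace_smult[OF H(1) c spec(2)[OF x]])
      then show "c \<odot>\<^bsub>V\<^esub> x \<ominus>\<^bsub>V\<^esub> (c \<otimes> \<alpha> x) \<odot>\<^bsub>V\<^esub> v \<in> H"
        using c x spec[OF x] v(1) by (simp add: a_minus_def V.smult_r_distr V.smult_r_minus V.smult_assoc1)
    qed (use c x spec[OF x] in auto)
    fix y assume y: "y \<in> carrier V"
    have "\<alpha> (x \<oplus>\<^bsub>V\<^esub> y) = \<alpha> x \<oplus> \<alpha> y"
    proof (rule eqI)
      have "(x \<ominus>\<^bsub>V\<^esub> \<alpha> x \<odot>\<^bsub>V\<^esub> v) \<oplus>\<^bsub>V\<^esub> (y \<ominus>\<^bsub>V\<^esub> \<alpha> y \<odot>\<^bsub>V\<^esub> v) \<in> H"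
        by (rule subspace_add[OF H(1) spec(2)[OF x] spec(2)[OF y]])
      then show "x \<oplus>\<^bsub>V\<^esub> y \<ominus>\<^bsub>V\<^esub> (\<alpha> x \<oplus> \<alpha> y) \<odot>\<^bsub>V\<^esub> v \<in> H"
        using x y spec v(1) by (simp add: a_minus_def V.smult_l_distr V.minus_add V.a_ac)
    qed (use x y spec in auto)
    then show "\<alpha> (x \<oplus>\<^bsub>V\<^esub> y) = \<alpha> x \<oplus>\<^bsub>scalars K\<^esub> \<alpha> y" by simp
  qed
  moreover have "\<alpha> u = \<zero>" if "u \<in> U" for u
    by (rule eqI) (use that H(2) Hc v in \<open>auto simp: a_minus_def neg_eq_smult[OF V]\<close>)
  moreover have "\<alpha> v = \<one>"
    by (rule eqI) (use v subspace_zero[OF H(1)] in \<open>auto simp: a_minus_def V.r_neg\<close>)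
  ultimately show ?thesis by blast
qed

lemma dual_separates:
  assumes V: "module K V" and v: "v \<in> carrier V" "\<And>\<alpha>. \<alpha> \<in> dual V \<Longrightarrow> \<alpha> v = \<zero>"
  shows "v = \<zero>\<^bsub>V\<^esub>"
proof (rule ccontr)
  interpret V: module K V by (rule V)
  have "submodule {\<zero>\<^bsub>V\<^esub>} K V" by (rule subspaceI[OF V]) auto
  moreover assume "v \<noteq> \<zero>\<^bsub>V\<^esub>"
  ultimately obtain \<alpha> where "\<alpha> \<in> dual V" "\<alpha> v = \<one>"
    using functional_separation[OF V _ v(1), of "{\<zero>\<^bsub>V\<^esub>}"] by blast
  then show False using v(2)[of \<alpha>] one_not_zero by simp
qed

lemma dual_eqI:
  assumes V: "module K V" and v: "v \<in> carrier V" "w \<in> carrier V"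
    and eq: "\<And>\<alpha>. \<alpha> \<in> dual V \<Longrightarrow> \<alpha> v = \<alpha> w"
  shows "v = w"
proof -
  interpret V: module K V by (rule V)
  have "v \<ominus>\<^bsub>V\<^esub> w = \<zero>\<^bsub>V\<^esub>"
  proof (rule dual_separates[OF V])
    fix \<alpha> assume a: "\<alpha> \<in> dual V"
    have "\<alpha> (v \<ominus>\<^bsub>V\<^esub> w) = \<alpha> v \<ominus>\<^bsub>scalars K\<^esub> \<alpha> w" by (rule lin_minus[OF V scalars_module a v])
    then show "\<alpha> (v \<ominus>\<^bsub>V\<^esub> w) = \<zero>"
      using minus_zero_iff[OF scalars_module, of "\<alpha> v" "\<alpha> w"] a v eq[OF a] by (simp add: dual_closed)
  qed (use v in auto)
  then show ?thesis using minus_zero_iff[OF V v] by simp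
qed

text \<open>
  Fullness conditions are compared through annihilators: a set spans as soon as every
  functional that kills it also kills a set that is known to span.
\<close>

lemma span_eq_carrierI:
  assumes V: "module K V" and S: "S \<subseteq> carrier V"
    and S': "span_of K V S' = carrier V"
    and ann: "\<And>\<alpha> s. \<alpha> \<in> dual V \<Longrightarrow> (\<And>s. s \<in> S \<Longrightarrow> \<alpha> s = \<zero>) \<Longrightarrow> s \<in> S' \<Longrightarrow> \<alpha> s = \<zero>"
  shows "span_of K V S = carrier V"
proof (rule ccontr)
  assume "span_of K V S \<noteq> carrier V"
  then obtain v where v: "v \<in> carrier V" "v \<notin> span_of K V S" using span_in_carrier[OF V S] by blast
  obtain \<alpha> where a: "\<alpha> \<in> dual V" "\<And>u. u \<in> span_of K V S \<Longrightarrow> \<alpha> u = \<zero>" "\<alpha> v = \<one>"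
    using functional_separation[OF V span_subspace[OF V S] v] by (elim bexE conjE) simp
  have "\<alpha> s = \<zero>" if "s \<in> S'" for s
    by (rule ann[OF a(1) _ that]) (rule a(2)[OF subsetD[OF span_subset]])
  moreover have "S' \<subseteq> carrier V" using S' span_subset[of S' V] by simp
  ultimately have "\<alpha> v = \<zero>"
    using lin_eq_on_span[OF V scalars_module a(1) lin_const_zero[OF scalars_module], of S' v] S' v(1) by auto
  then show False using a(3) by simp
qed

context
  fixes V :: "('k, 'v, 'a) module_scheme" and W :: "('k, 'w, 'b) module_scheme"
  assumes V: "module K V" and W: "module K W"
begin

interpretation V: module K V by (rule V)
interpretation W: module K W by (rule W)
interpretation T: module K "V \<boxtimes> W" by (rule tensor_module[OF V W])

text \<open>
  Fixing the right factors allows an induction on the number of terms of a tensor that does not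
  depend on the choice of a basis of \<open>W\<close>.
\<close>

private primrec sums :: "'w list \<Rightarrow> ('v, 'w, 'k) tensor set" where
  "sums [] = {\<zero>\<^bsub>V \<boxtimes> W\<^esub>}"
| "sums (w # ws) = {pure_tensor K V W v w \<oplus>\<^bsub>V \<boxtimes> W\<^esub> y | v y. v \<in> carrier V \<and> y \<in> sums ws}"

private lemma sums_subspace: "set ws \<subseteq> carrier W \<Longrightarrow> submodule (sums ws) K (V \<boxtimes> W)"
proof (induction ws)
  case Nil
  show ?case by (rule subspaceI[OF T.module_axioms]) auto
next
  case (Cons w ws)
  then have w: "w \<in> carrier W" and IH: "submodule (sums ws) K (V \<boxtimes> W)" by auto
  note c = subsetD[OF subspace_subset[OF IH]] and p = pure_closed[OF V W _ w]
  show ?case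
  proof (rule subspaceI[OF T.module_axioms])
    show "sums (w # ws) \<subseteq> carrier (V \<boxtimes> W)" using c p by auto
    have "\<zero>\<^bsub>V \<boxtimes> W\<^esub> = pure_tensor K V W \<zero>\<^bsub>V\<^esub> w \<oplus>\<^bsub>V \<boxtimes> W\<^esub> \<zero>\<^bsub>V \<boxtimes> W\<^esub>"
      by (simp add: pure_zero1[OF V W w])
    then show "\<zero>\<^bsub>V \<boxtimes> W\<^esub> \<in> sums (w # ws)" using subspace_zero[OF IH] by auto
    show "a \<oplus>\<^bsub>V \<boxtimes> W\<^esub> b \<in> sums (w # ws)" if "a \<in> sums (w # ws)" "b \<in> sums (w # ws)" for a b
    proof -
      from that obtain v y v' y' where *: "a = pure_tensor K V W v w \<oplus>\<^bsub>V \<boxtimes> W\<^esub> y"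
        "b = pure_tensor K V W v' w \<oplus>\<^bsub>V \<boxtimes> W\<^esub> y'" "v \<in> carrier V" "v' \<in> carrier V" "y \<in> sums ws" "y' \<in> sums ws"
        by auto
      have "a \<oplus>\<^bsub>V \<boxtimes> W\<^esub> b = pure_tensor K V W (v \<oplus>\<^bsub>V\<^esub> v') w \<oplus>\<^bsub>V \<boxtimes> W\<^esub> (y \<oplus>\<^bsub>V \<boxtimes> W\<^esub> y')"
        using * c p w by (simp add: pure_add1[OF V W] T.a_ac)
      moreover have "y \<oplus>\<^bsub>V \<boxtimes> W\<^esub> y' \<in> sums ws" using subspace_add[OF IH *(5,6)] .
      ultimately show ?thesis using *(3,4) V.a_closed unfolding sums.simps by blast
    qed
    show "k \<odot>\<^bsub>V \<boxtimes> W\<^esub> a \<in> sums (w # ws)" if "k \<in> carrier K" "a \<in> sums (w # ws)" for k a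
    proof -
      from that obtain v y where *: "a = pure_tensor K V W v w \<oplus>\<^bsub>V \<boxtimes> W\<^esub> y"
        "v \<in> carrier V" "y \<in> sums ws" by auto
      have "k \<odot>\<^bsub>V \<boxtimes> W\<^esub> a = pure_tensor K V W (k \<odot>\<^bsub>V\<^esub> v) w \<oplus>\<^bsub>V \<boxtimes> W\<^esub> k \<odot>\<^bsub>V \<boxtimes> W\<^esub> y"
        using * c p w that by (simp add: pure_smult1[OF V W] T.smult_r_distr)
      moreover have "k \<odot>\<^bsub>V \<boxtimes> W\<^esub> y \<in> sums ws" using subspace_smult[OF IH that(1) *(3)] .
      ultimately show ?thesis using *(2) that(1) V.smult_closed unfolding sums.simps by blast
    qed
  qed
qed

private lemma sums_Cons_superset: "set ws \<subseteq> carrier W \<Longrightarrow> w \<in> carrier W \<Longrightarrow> sums ws \<subseteq> sums (w # ws)"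
proof
  fix y assume ws: "set ws \<subseteq> carrier W" "w \<in> carrier W" "y \<in> sums ws"
  then have "y = pure_tensor K V W \<zero>\<^bsub>V\<^esub> w \<oplus>\<^bsub>V \<boxtimes> W\<^esub> y"
    using subspace_subset[OF sums_subspace[OF ws(1)]] by (auto simp: pure_zero1[OF V W])
  then show "y \<in> sums (w # ws)" using ws by auto
qed

private lemma sums_pure: "set ws \<subseteq> carrier W \<Longrightarrow> w \<in> set ws \<Longrightarrow> v \<in> carrier V \<Longrightarrow> pure_tensor K V W v w \<in> sums ws"
proof (induction ws)
  case (Cons u ws)
  show ?case
  proof (cases "w = u")
    case True
    have "pure_tensor K V W v w = pure_tensor K V W v w \<oplus>\<^bsub>V \<boxtimes> W\<^esub> \<zero>\<^bsub>V \<boxtimes> W\<^esub>"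
      using Cons.prems True by (simp add: pure_closed[OF V W])
    then show ?thesis using True Cons.prems subspace_zero[OF sums_subspace, of ws] by auto
  next
    case False
    then show ?thesis using Cons sums_Cons_superset[of ws u] by auto
  qed
qed simp

private lemma sums_exhaust:
  "x \<in> carrier (V \<boxtimes> W) \<Longrightarrow> \<exists>ws. set ws \<subseteq> carrier W \<and> x \<in> sums ws"
proof (induction rule: tensor_induct[OF V W, consumes 1, case_names pure add])
  case (pure v w)
  then show ?case using sums_pure[of "[w]" w v] by (intro exI[of _ "[w]"]) auto
next
  case (add x y)
  then obtain us ws where *: "set us \<subseteq> carrier W" "x \<in> sums us" "set ws \<subseteq> carrier W" "y \<in> sums ws" by blast
  have 1: "sums ws \<subseteq> sums (us @ ws)"
    using *(1)
  proof (induction us)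
    case (Cons a us)
    then show ?case using sums_Cons_superset[of "us @ ws" a] *(3) by auto
  qed simp
  have 2: "sums us \<subseteq> sums (us @ ws)" using *(1)
  proof (induction us)
    case Nil
    then show ?case using subspace_zero[OF sums_subspace[OF *(3)]] by auto
  next
    case (Cons a us)
    then show ?case by auto
  qed
  have "set (us @ ws) \<subseteq> carrier W" using * by auto
  then show ?case using subspace_add[OF sums_subspace[of "us @ ws"], of x y] 1 2 * by (intro exI[of _ "us @ ws"]) auto
qed

text \<open>
  In a sum of pure tensors, a term whose right factor \<open>w\<close> lies in the span of the other
  right factors can be absorbed into the other terms. Otherwise some functional is 1 at \<open>w\<close> and
  vanishes on the others; contracting with it isolates the left factor at \<open>w\<close>, which is therefore
  zero.
\<close>

lemma contract_right_separates:
  assumes x: "x \<in> carrier (V \<boxtimes> W)"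
    and z: "\<And>\<beta>. \<beta> \<in> dual W \<Longrightarrow> contract_right K V \<beta> x = \<zero>\<^bsub>V\<^esub>"
  shows "x = \<zero>\<^bsub>V \<boxtimes> W\<^esub>"
proof -
  have "x = \<zero>\<^bsub>V \<boxtimes> W\<^esub>" if "set ws \<subseteq> carrier W" "x \<in> sums ws" for ws
    using that x z
  proof (induction ws arbitrary: x)
    case (Cons w ws)
    then have w: "w \<in> carrier W" and ws: "set ws \<subseteq> carrier W" by auto
    from Cons.prems obtain v y where vy: "x = pure_tensor K V W v w \<oplus>\<^bsub>V \<boxtimes> W\<^esub> y" "v \<in> carrier V" "y \<in> sums ws"
      by auto
    have y: "y \<in> carrier (V \<boxtimes> W)" using vy(3) subspace_subset[OF sums_subspace[OF ws]] by blast
    have "x \<in> sums ws"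
    proof (cases "w \<in> span_of K W (set ws)")
      case True
      let ?P = "{u \<in> carrier W. pure_tensor K V W v u \<in> sums ws}"
      have "submodule ?P K W"
        by (rule preimage_subspace[OF W tensor_module[OF V W] pure_lin2[OF V W vy(2)] sums_subspace[OF ws]])
      moreover have "set ws \<subseteq> ?P" using ws sums_pure[OF ws _ vy(2)] by auto
      ultimately have "w \<in> ?P" using span_minimal True by blast
      then show ?thesis using subspace_add[OF sums_subspace[OF ws] _ vy(3)] vy(1) by simp
    next
      case False
      obtain \<beta> where b: "\<beta> \<in> dual W" "\<And>u. u \<in> span_of K W (set ws) \<Longrightarrow> \<beta> u = \<zero>" "\<beta> w = \<one>"
        using functional_separation[OF W span_subspace[OF W ws] w False] by (elim bexE conjE) simp
      have "contract_right K V \<beta> y = \<zero>\<^bsub>V\<^esub>" if "set us \<subseteq> set ws" "y \<in> sums us" for us y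
        using that
      proof (induction us arbitrary: y)
        case Nil
        then show ?case using lin_zero[OF tensor_module[OF V W] V contract_right_lin[OF V W b(1)]] by simp
      next
        case (Cons u us)
        then obtain v' y' where *: "y = pure_tensor K V W v' u \<oplus>\<^bsub>V \<boxtimes> W\<^esub> y'" "v' \<in> carrier V" "y' \<in> sums us"
          by auto
        have u: "u \<in> carrier W" "\<beta> u = \<zero>" using Cons.prems ws b(2) span_subset[of "set ws" W] by auto
        have "y' \<in> carrier (V \<boxtimes> W)" using * Cons.prems ws subspace_subset[OF sums_subspace[of us]] by auto
        then show ?case
          using * u Cons by (simp add: lin_add[OF contract_right_lin[OF V W b(1)]] contract_right_pure[OF V W b(1)] pure_closed[OF V W])
      qed
      then have "contract_right K V \<beta> y = \<zero>\<^bsub>V\<^esub>" using vy(3) by blast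
      then have "contract_right K V \<beta> x = v"
        using vy y w b(3) by (simp add: lin_add[OF contract_right_lin[OF V W b(1)]] contract_right_pure[OF V W b(1)] pure_closed[OF V W])
      then have "v = \<zero>\<^bsub>V\<^esub>" using Cons.prems(4)[OF b(1)] by simp
      then show ?thesis using vy y w by (simp add: pure_zero1[OF V W])
    qed
    then show ?case using Cons.IH[OF ws _ Cons.prems(3,4)] by blast
  qed simp
  then show ?thesis using sums_exhaust[OF x] by blast
qed

lemma tensor_zeroI:
  assumes x: "x \<in> carrier (V \<boxtimes> W)"
    and z: "\<And>\<alpha> \<beta>. \<alpha> \<in> dual V \<Longrightarrow> \<beta> \<in> dual W \<Longrightarrow> \<alpha> (contract_right K V \<beta> x) = \<zero>"
  shows "x = \<zero>\<^bsub>V \<boxtimes> W\<^esub>"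
  by (rule contract_right_separates[OF x], rule dual_separates[OF V])
    (auto simp: z lin_closed[OF contract_right_lin[OF V W] x])

lemma tensor_eqI:
  assumes x: "x \<in> carrier (V \<boxtimes> W)" "y \<in> carrier (V \<boxtimes> W)"
    and z: "\<And>\<alpha> \<beta>. \<alpha> \<in> dual V \<Longrightarrow> \<beta> \<in> dual W \<Longrightarrow> \<alpha> (contract_right K V \<beta> x) = \<alpha> (contract_right K V \<beta> y)"
  shows "x = y"
proof -
  have "x \<ominus>\<^bsub>V \<boxtimes> W\<^esub> y = \<zero>\<^bsub>V \<boxtimes> W\<^esub>"
  proof (rule contract_right_separates)
    show "x \<ominus>\<^bsub>V \<boxtimes> W\<^esub> y \<in> carrier (V \<boxtimes> W)" using x by simp
    fix \<beta> assume b: "\<beta> \<in> dual W"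
    note c = contract_right_lin[OF V W b]
    have "contract_right K V \<beta> x = contract_right K V \<beta> y"
      by (rule dual_eqI[OF V]) (auto simp: z b lin_closed[OF c] x)
    then show "contract_right K V \<beta> (x \<ominus>\<^bsub>V \<boxtimes> W\<^esub> y) = \<zero>\<^bsub>V\<^esub>"
      using lin_minus[OF tensor_module[OF V W] V c x] minus_zero_iff[OF V] lin_closed[OF c] x by simp
  qed
  then show ?thesis using minus_zero_iff[OF tensor_module[OF V W] x] by simp
qed

end

end

section \<open>Slices\<close>

text \<open>
  The matrix coefficients of a map of \<open>V \<otimes> W\<close> with respect to one of the two legs. In
  Sweedler's notation \<open>y\<^sub>1 \<otimes> y\<^sub>2\<close> for the comultiplication, \<open>rslice K A A T1 \<beta> p y\<close> is \<open>\<beta> (y\<^sub>2 p) y\<^sub>1\<close>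
  and \<open>lslice K A A T2 \<beta> p y\<close> is \<open>\<beta> (p y\<^sub>1) y\<^sub>2\<close>.
\<close>

definition rslice ::
    "('k, 'm) ring_scheme \<Rightarrow> ('k, 'v, 'a) module_scheme \<Rightarrow> ('k, 'w, 'b) module_scheme
      \<Rightarrow> (('v, 'w, 'k) tensor \<Rightarrow> ('v, 'w, 'k) tensor) \<Rightarrow> ('w \<Rightarrow> 'k) \<Rightarrow> 'w \<Rightarrow> 'v \<Rightarrow> 'v" where
  "rslice K V W t \<beta> p v = contract_right K V \<beta> (t (pure_tensor K V W v p))"

definition lslice ::
    "('k, 'm) ring_scheme \<Rightarrow> ('k, 'v, 'a) module_scheme \<Rightarrow> ('k, 'w, 'b) module_scheme
      \<Rightarrow> (('v, 'w, 'k) tensor \<Rightarrow> ('v, 'w, 'k) tensor) \<Rightarrow> ('v \<Rightarrow> 'k) \<Rightarrow> 'v \<Rightarrow> 'w \<Rightarrow> 'w" where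
  "lslice K V W t \<alpha> p w = contract_left K W \<alpha> (t (pure_tensor K V W p w))"

text \<open>
  \<open>\<alpha> \<otimes> V \<otimes> W\<close> on a triple tensor product bracketed to the left.
\<close>

definition contract_first ::
    "('k, 'm) ring_scheme \<Rightarrow> ('k, 'v, 'b) module_scheme \<Rightarrow> ('k, 'w, 'c) module_scheme
      \<Rightarrow> ('u \<Rightarrow> 'k) \<Rightarrow> (('u, 'v, 'k) tensor, 'w, 'k) tensor \<Rightarrow> ('v, 'w, 'k) tensor" where
  "contract_first K V W \<alpha> = tensor_map K V W (contract_left K V \<alpha>) (\<lambda>w. w)"

context vector_spaces
begin

lemmas [lin_intros] = lin_pure1 lin_pure2 lin_scalar lin_scale

lemma rslice_lin1 [lin_intros]:
  assumes "module K V" "module K W" "t \<in> lin_map K (V \<boxtimes> W) (V \<boxtimes> W)"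
    "\<beta> \<in> dual W" "f \<in> lin_map K U V" "p \<in> carrier W"
  shows "(\<lambda>x. rslice K V W t \<beta> p (f x)) \<in> lin_map K U V"
  unfolding rslice_def by (intro lin_intros lin_comp[OF contract_right_lin[OF assms(1,2,4)]] lin_comp[OF assms(3)] assms)

lemma rslice_lin2 [lin_intros]:
  assumes "module K V" "module K W" "t \<in> lin_map K (V \<boxtimes> W) (V \<boxtimes> W)"
    "\<beta> \<in> dual W" "f \<in> lin_map K U W" "p \<in> carrier V"
  shows "(\<lambda>x. rslice K V W t \<beta> (f x) p) \<in> lin_map K U V"
  unfolding rslice_def by (intro lin_intros lin_comp[OF contract_right_lin[OF assms(1,2,4)]] lin_comp[OF assms(3)] assms)

lemma lslice_lin1 [lin_intros]:
  assumes "module K V" "module K W" "t \<in> lin_map K (V \<boxtimes> W) (V \<boxtimes> W)"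
    "\<beta> \<in> dual V" "f \<in> lin_map K U W" "p \<in> carrier V"
  shows "(\<lambda>x. lslice K V W t \<beta> p (f x)) \<in> lin_map K U W"
  unfolding lslice_def by (intro lin_intros lin_comp[OF contract_left_lin[OF assms(1,2,4)]] lin_comp[OF assms(3)] assms)

lemma lslice_lin2 [lin_intros]:
  assumes "module K V" "module K W" "t \<in> lin_map K (V \<boxtimes> W) (V \<boxtimes> W)"
    "\<beta> \<in> dual V" "f \<in> lin_map K U V" "p \<in> carrier W"
  shows "(\<lambda>x. lslice K V W t \<beta> (f x) p) \<in> lin_map K U W"
  unfolding lslice_def by (intro lin_intros lin_comp[OF contract_left_lin[OF assms(1,2,4)]] lin_comp[OF assms(3)] assms)

lemma rslice_closed:
  assumes "module K V" "module K W" "t \<in> lin_map K (V \<boxtimes> W) (V \<boxtimes> W)"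
    "\<beta> \<in> dual W" "p \<in> carrier W" "v \<in> carrier V"
  shows "rslice K V W t \<beta> p v \<in> carrier V"
  using lin_closed[OF rslice_lin1[OF assms(1-4) lin_id assms(5)] assms(6)] .

lemma lslice_closed:
  assumes "module K V" "module K W" "t \<in> lin_map K (V \<boxtimes> W) (V \<boxtimes> W)"
    "\<beta> \<in> dual V" "p \<in> carrier V" "w \<in> carrier W"
  shows "lslice K V W t \<beta> p w \<in> carrier W"
  using lin_closed[OF lslice_lin1[OF assms(1-4) lin_id assms(5)] assms(6)] .

section \<open>Slices of maps on threefold tensor products\<close>

context
  fixes U :: "('k, 'u, 'a) module_scheme" and V :: "('k, 'v, 'b) module_scheme"
    and W :: "('k, 'w, 'c) module_scheme"
  assumes U: "module K U" and V: "module K V" and W: "module K W"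
begin

private lemma UV: "module K (U \<boxtimes> V)" by (rule tensor_module[OF U V])
private lemma VW: "module K (V \<boxtimes> W)" by (rule tensor_module[OF V W])
private lemma UVW: "module K ((U \<boxtimes> V) \<boxtimes> W)" by (rule tensor_module[OF UV W])
private lemma U_VW: "module K (U \<boxtimes> (V \<boxtimes> W))" by (rule tensor_module[OF U VW])

private lemmas mods = U V W UV VW UVW U_VW

private lemma assoc_inner:
  assumes w: "w \<in> carrier W"
  shows "bilin_map K U V (U \<boxtimes> (V \<boxtimes> W))
    (\<lambda>u v. pure_tensor K U (V \<boxtimes> W) u (pure_tensor K V W v w))"
  by (intro bilinI lin_intros mods pure_closed w) 

private lemma assoc_outer:
  "bilin_map K (U \<boxtimes> V) W (U \<boxtimes> (V \<boxtimes> W))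
     (\<lambda>x w. tensor_lift K (U \<boxtimes> (V \<boxtimes> W))
        (\<lambda>u v. pure_tensor K U (V \<boxtimes> W) u (pure_tensor K V W v w)) x)"
proof (rule bilinI)
  show "(\<lambda>x. tensor_lift K (U \<boxtimes> (V \<boxtimes> W))
        (\<lambda>u v. pure_tensor K U (V \<boxtimes> W) u (pure_tensor K V W v w)) x)
      \<in> lin_map K (U \<boxtimes> V) (U \<boxtimes> (V \<boxtimes> W))" if "w \<in> carrier W" for w
    by (rule tensor_lift_lin[OF U V U_VW assoc_inner[OF that]])
  fix x assume x: "x \<in> carrier (U \<boxtimes> V)"
  interpret T: module K "U \<boxtimes> (V \<boxtimes> W)" by (rule U_VW)
  from x show "(\<lambda>w. tensor_lift K (U \<boxtimes> (V \<boxtimes> W))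
        (\<lambda>u v. pure_tensor K U (V \<boxtimes> W) u (pure_tensor K V W v w)) x)
      \<in> lin_map K W (U \<boxtimes> (V \<boxtimes> W))"
  proof (induction rule: tensor_induct[OF U V, consumes 1, case_names pure add])
    case (pure u v)
    have "(\<lambda>w. pure_tensor K U (V \<boxtimes> W) u (pure_tensor K V W v w))
        \<in> lin_map K W (U \<boxtimes> (V \<boxtimes> W))"
      by (intro lin_intros mods pure)
    then show ?case
      unfolding lin_map_def
      using pure by (auto simp: tensor_lift_pure[OF U V U_VW assoc_inner] Pi_def abelian_monoid.a_closed[OF abelian_group.axioms(1)[OF module.axioms(2)[OF W]]] module.smult_closed[OF W])
  next
    case (add x y)
    from lin_sum[OF U_VW add(3,4)]
    show ?case
      unfolding lin_map_def
      using add(1,2) by (auto simp: lin_add[OF tensor_lift_lin[OF U V U_VW assoc_inner]] Pi_def abelian_monoid.a_closed[OF abelian_group.axioms(1)[OF module.axioms(2)[OF W]]] module.smult_closed[OF W])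
  qed
qed

lemma tensor_assoc_lin:
  "tensor_assoc K U V W \<in> lin_map K ((U \<boxtimes> V) \<boxtimes> W) (U \<boxtimes> (V \<boxtimes> W))"
  unfolding tensor_assoc_def by (rule tensor_lift_lin[OF UV W U_VW assoc_outer])

lemma tensor_assoc_pure:
  "u \<in> carrier U \<Longrightarrow> v \<in> carrier V \<Longrightarrow> w \<in> carrier W \<Longrightarrow>
    tensor_assoc K U V W (pure_tensor K (U \<boxtimes> V) W (pure_tensor K U V u v) w)
      = pure_tensor K U (V \<boxtimes> W) u (pure_tensor K V W v w)"
  unfolding tensor_assoc_def
  by (simp add: tensor_lift_pure[OF UV W U_VW assoc_outer] tensor_lift_pure[OF U V U_VW assoc_inner] pure_closed[OF U V])

private lemma unassoc_inner:
  assumes u: "u \<in> carrier U"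
  shows "bilin_map K V W ((U \<boxtimes> V) \<boxtimes> W)
    (\<lambda>v w. pure_tensor K (U \<boxtimes> V) W (pure_tensor K U V u v) w)"
  by (intro bilinI lin_intros mods pure_closed u)

private lemma unassoc_outer:
  "bilin_map K U (V \<boxtimes> W) ((U \<boxtimes> V) \<boxtimes> W)
     (\<lambda>u y. tensor_lift K ((U \<boxtimes> V) \<boxtimes> W)
        (\<lambda>v w. pure_tensor K (U \<boxtimes> V) W (pure_tensor K U V u v) w) y)"
proof (rule bilinI)
  show "(\<lambda>y. tensor_lift K ((U \<boxtimes> V) \<boxtimes> W)
        (\<lambda>v w. pure_tensor K (U \<boxtimes> V) W (pure_tensor K U V u v) w) y)
      \<in> lin_map K (V \<boxtimes> W) ((U \<boxtimes> V) \<boxtimes> W)" if "u \<in> carrier U" for u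
    by (rule tensor_lift_lin[OF V W UVW unassoc_inner[OF that]])
  fix y assume y: "y \<in> carrier (V \<boxtimes> W)"
  from y show "(\<lambda>u. tensor_lift K ((U \<boxtimes> V) \<boxtimes> W)
        (\<lambda>v w. pure_tensor K (U \<boxtimes> V) W (pure_tensor K U V u v) w) y)
      \<in> lin_map K U ((U \<boxtimes> V) \<boxtimes> W)"
  proof (induction rule: tensor_induct[OF V W, consumes 1, case_names pure add])
    case (pure v w)
    have "(\<lambda>u. pure_tensor K (U \<boxtimes> V) W (pure_tensor K U V u v) w)
        \<in> lin_map K U ((U \<boxtimes> V) \<boxtimes> W)"
      by (intro lin_intros mods pure)
    then show ?case
      unfolding lin_map_def
      using pure by (auto simp: tensor_lift_pure[OF V W UVW unassoc_inner] Pi_def abelian_monoid.a_closed[OF abelian_group.axioms(1)[OF module.axioms(2)[OF U]]] module.smult_closed[OF U])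
  next
    case (add x y)
    from lin_sum[OF UVW add(3,4)]
    show ?case
      unfolding lin_map_def
      using add(1,2) by (auto simp: lin_add[OF tensor_lift_lin[OF V W UVW unassoc_inner]] Pi_def abelian_monoid.a_closed[OF abelian_group.axioms(1)[OF module.axioms(2)[OF U]]] module.smult_closed[OF U])
  qed
qed

lemma tensor_unassoc_lin:
  "tensor_unassoc K U V W \<in> lin_map K (U \<boxtimes> (V \<boxtimes> W)) ((U \<boxtimes> V) \<boxtimes> W)"
  unfolding tensor_unassoc_def by (rule tensor_lift_lin[OF U VW UVW unassoc_outer])

lemma tensor_unassoc_pure:
  "u \<in> carrier U \<Longrightarrow> v \<in> carrier V \<Longrightarrow> w \<in> carrier W \<Longrightarrow>
    tensor_unassoc K U V W (pure_tensor K U (V \<boxtimes> W) u (pure_tensor K V W v w))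
      = pure_tensor K (U \<boxtimes> V) W (pure_tensor K U V u v) w"
  unfolding tensor_unassoc_def
  by (simp add: tensor_lift_pure[OF U VW UVW unassoc_outer] tensor_lift_pure[OF V W UVW unassoc_inner] pure_closed[OF V W])

lemma contract_right_unassoc:
  assumes g: "\<gamma> \<in> dual W" and u: "u \<in> carrier U" and y: "y \<in> carrier (V \<boxtimes> W)"
  shows "contract_right K (U \<boxtimes> V) \<gamma>
      (tensor_unassoc K U V W (pure_tensor K U (V \<boxtimes> W) u y))
    = pure_tensor K U V u (contract_right K V \<gamma> y)"
proof (rule tensor_ext[OF V W UV _ _ _ y])
  show "(\<lambda>y. contract_right K (U \<boxtimes> V) \<gamma>
      (tensor_unassoc K U V W (pure_tensor K U (V \<boxtimes> W) u y))) \<in> lin_map K (V \<boxtimes> W) (U \<boxtimes> V)"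
    by (intro lin_comp[OF contract_right_lin[OF UV W g]] lin_comp[OF tensor_unassoc_lin] lin_intros mods u)
  show "(\<lambda>y. pure_tensor K U V u (contract_right K V \<gamma> y)) \<in> lin_map K (V \<boxtimes> W) (U \<boxtimes> V)"
    by (intro lin_intros mods u contract_right_lin[OF V W g])
qed (simp add: u g tensor_unassoc_pure contract_right_pure UV V W pure_closed U pure_smult2[OF U V dual_closed[OF g]])

lemma contract_first_lin:
  "\<alpha> \<in> dual U \<Longrightarrow> contract_first K V W \<alpha> \<in> lin_map K ((U \<boxtimes> V) \<boxtimes> W) (V \<boxtimes> W)"
  unfolding contract_first_def by (intro tensor_map_lin mods contract_left_lin lin_id)

lemma contract_first_pure:
  "\<alpha> \<in> dual U \<Longrightarrow> x \<in> carrier (U \<boxtimes> V) \<Longrightarrow> w \<in> carrier W \<Longrightarrow>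
    contract_first K V W \<alpha> (pure_tensor K (U \<boxtimes> V) W x w) = pure_tensor K V W (contract_left K V \<alpha> x) w"
  unfolding contract_first_def by (intro tensor_map_pure mods contract_left_lin lin_id)

lemma contract_first_unassoc:
  assumes a: "\<alpha> \<in> dual U" and u: "u \<in> carrier U" and y: "y \<in> carrier (V \<boxtimes> W)"
  shows "contract_first K V W \<alpha> (tensor_unassoc K U V W (pure_tensor K U (V \<boxtimes> W) u y))
    = \<alpha> u \<odot>\<^bsub>V \<boxtimes> W\<^esub> y"
proof (rule tensor_ext[OF V W VW _ _ _ y])
  show "(\<lambda>y. contract_first K V W \<alpha> (tensor_unassoc K U V W (pure_tensor K U (V \<boxtimes> W) u y)))
      \<in> lin_map K (V \<boxtimes> W) (V \<boxtimes> W)"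
    by (intro lin_comp[OF contract_first_lin[OF a]] lin_comp[OF tensor_unassoc_lin] lin_intros mods u)
  show "(\<lambda>y. \<alpha> u \<odot>\<^bsub>V \<boxtimes> W\<^esub> y) \<in> lin_map K (V \<boxtimes> W) (V \<boxtimes> W)"
    by (intro lin_intros mods dual_closed[OF a u])
qed (simp add: a u tensor_unassoc_pure contract_first_pure contract_left_pure V W pure_closed U pure_smult1[OF V W dual_closed[OF a]])

lemma contract_first_right:
  assumes a: "\<alpha> \<in> dual U" and g: "\<gamma> \<in> dual W" and z: "z \<in> carrier ((U \<boxtimes> V) \<boxtimes> W)"
  shows "contract_left K V \<alpha> (contract_right K (U \<boxtimes> V) \<gamma> z) = contract_right K V \<gamma> (contract_first K V W \<alpha> z)"
  by (rule tensor_ext[OF UV W V _ _ _ z],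
      intro lin_comp[OF contract_left_lin[OF U V a]] contract_right_lin UV W g,
      intro lin_comp[OF contract_right_lin[OF V W g]] contract_first_lin a)
    (simp add: contract_right_pure[OF UV W g] contract_first_pure[OF a] contract_right_pure[OF V W g]
      lin_smult[OF contract_left_lin[OF U V a]] dual_closed[OF g] lin_closed[OF contract_left_lin[OF U V a]])

end

lemma leg12_lin:
  assumes "module K V" "module K W" "module K V'" "module K W'" "module K Z"
    "f \<in> lin_map K (V \<boxtimes> W) (V' \<boxtimes> W')"
  shows "leg12 K V' W' Z f \<in> lin_map K ((V \<boxtimes> W) \<boxtimes> Z) ((V' \<boxtimes> W') \<boxtimes> Z)"
  unfolding leg12_def by (intro tensor_map_lin tensor_module assms lin_id)

lemma leg12_pure:
  assumes "module K V" "module K W" "module K V'" "module K W'" "module K Z"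
    "f \<in> lin_map K (V \<boxtimes> W) (V' \<boxtimes> W')"
    "x \<in> carrier (V \<boxtimes> W)" "z \<in> carrier Z"
  shows "leg12 K V' W' Z f (pure_tensor K (V \<boxtimes> W) Z x z)
    = pure_tensor K (V' \<boxtimes> W') Z (f x) z"
  unfolding leg12_def by (intro tensor_map_pure tensor_module assms lin_id)

lemma contract_right_leg12:
  assumes m: "module K V" "module K W" "module K V'" "module K W'" "module K Z"
    and f: "f \<in> lin_map K (V \<boxtimes> W) (V' \<boxtimes> W')" and g: "\<gamma> \<in> dual Z"
    and z: "z \<in> carrier ((V \<boxtimes> W) \<boxtimes> Z)"
  shows "contract_right K (V' \<boxtimes> W') \<gamma> (leg12 K V' W' Z f z)
    = f (contract_right K (V \<boxtimes> W) \<gamma> z)"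
proof (rule tensor_ext[OF tensor_module[OF m(1,2)] m(5) tensor_module[OF m(3,4)] _ _ _ z])
  show "(\<lambda>z. contract_right K (V' \<boxtimes> W') \<gamma> (leg12 K V' W' Z f z))
    \<in> lin_map K ((V \<boxtimes> W) \<boxtimes> Z) (V' \<boxtimes> W')"
    by (rule lin_comp[OF contract_right_lin[OF tensor_module[OF m(3,4)] m(5) g] leg12_lin[OF m f]])
  show "(\<lambda>z. f (contract_right K (V \<boxtimes> W) \<gamma> z))
    \<in> lin_map K ((V \<boxtimes> W) \<boxtimes> Z) (V' \<boxtimes> W')"
    by (intro lin_comp[OF f] contract_right_lin tensor_module m g)
qed (simp add: leg12_pure[OF m f] contract_right_pure tensor_module m g lin_closed[OF f] lin_smult[OF f] dual_closed[OF g])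

lemma leg23_pure_left:
  assumes m: "module K U" "module K V" "module K W" "module K V'" "module K W'"
    and f: "f \<in> lin_map K (V \<boxtimes> W) (V' \<boxtimes> W')"
    and u: "u \<in> carrier U" "v \<in> carrier V" "w \<in> carrier W"
  shows "leg23 K U V W V' W' f (pure_tensor K (U \<boxtimes> V) W (pure_tensor K U V u v) w)
    = tensor_unassoc K U V' W' (pure_tensor K U (V' \<boxtimes> W') u (f (pure_tensor K V W v w)))"
  using u by (simp add: leg23_def tensor_assoc_pure m pure_closed tensor_map_pure tensor_module f lin_id)

lemma leg23_lin:
  assumes m: "module K U" "module K V" "module K W" "module K V'" "module K W'"
    and f: "f \<in> lin_map K (V \<boxtimes> W) (V' \<boxtimes> W')"
  shows "leg23 K U V W V' W' f \<in> lin_map K ((U \<boxtimes> V) \<boxtimes> W) ((U \<boxtimes> V') \<boxtimes> W')"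
  unfolding leg23_def comp_def
  by (rule lin_comp[OF tensor_unassoc_lin lin_comp[OF tensor_map_lin tensor_assoc_lin]])
    (intro tensor_module m f lin_id)+

lemma triple_ext:
  assumes m: "module K U" "module K V" "module K W" "module K X"
    and fg: "f \<in> lin_map K ((U \<boxtimes> V) \<boxtimes> W) X" "g \<in> lin_map K ((U \<boxtimes> V) \<boxtimes> W) X"
    and eq: "\<And>u v w. u \<in> carrier U \<Longrightarrow> v \<in> carrier V \<Longrightarrow> w \<in> carrier W \<Longrightarrow>
      f (pure_tensor K (U \<boxtimes> V) W (pure_tensor K U V u v) w)
       = g (pure_tensor K (U \<boxtimes> V) W (pure_tensor K U V u v) w)"
    and z: "z \<in> carrier ((U \<boxtimes> V) \<boxtimes> W)"
  shows "f z = g z"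
proof (rule tensor_ext[OF tensor_module[OF m(1,2)] m(3,4) fg _ z])
  fix x w assume x: "x \<in> carrier (U \<boxtimes> V)" and w: "w \<in> carrier W"
  show "f (pure_tensor K (U \<boxtimes> V) W x w) = g (pure_tensor K (U \<boxtimes> V) W x w)"
    by (rule tensor_ext[OF m(1,2,4) _ _ _ x])
      (auto simp: eq w intro!: lin_comp[OF fg(1)] lin_comp[OF fg(2)] pure_lin1 tensor_module m w)
qed

lemma contract_first_leg23:
  assumes m: "module K U" "module K V" "module K W" "module K V'" "module K W'"
    and f: "f \<in> lin_map K (V \<boxtimes> W) (V' \<boxtimes> W')" and a: "\<alpha> \<in> dual U"
    and z: "z \<in> carrier ((U \<boxtimes> V) \<boxtimes> W)"
  shows "contract_first K V' W' \<alpha> (leg23 K U V W V' W' f z) = f (contract_first K V W \<alpha> z)"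
  by (rule triple_ext[OF m(1-3) tensor_module[OF m(4,5)] _ _ _ z],
      intro lin_comp[OF contract_first_lin[OF m(1,4,5) a]] leg23_lin m f,
      intro lin_comp[OF f] contract_first_lin m a)
    (simp add: leg23_pure_left[OF m f] contract_first_unassoc contract_first_pure contract_left_pure m a
      lin_closed[OF f] pure_closed tensor_module pure_smult1 dual_closed[OF a] lin_smult[OF f])

lemma contract_right_leg23_flip:
  assumes m: "module K V" "module K W" "module K Z" and g: "\<gamma> \<in> dual W"
    and x: "x \<in> carrier (V \<boxtimes> W)" and z: "z \<in> carrier Z"
  shows "contract_right K (V \<boxtimes> Z) \<gamma>
     (leg23 K V W Z Z W (tensor_flip K W Z) (pure_tensor K (V \<boxtimes> W) Z x z))
   = pure_tensor K V Z (contract_right K V \<gamma> x) z"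
proof (rule tensor_ext[OF m(1,2) tensor_module[OF m(1,3)] _ _ _ x])
  show "(\<lambda>x. contract_right K (V \<boxtimes> Z) \<gamma>
     (leg23 K V W Z Z W (tensor_flip K W Z) (pure_tensor K (V \<boxtimes> W) Z x z)))
     \<in> lin_map K (V \<boxtimes> W) (V \<boxtimes> Z)"
    by (intro lin_comp[OF contract_right_lin[OF tensor_module[OF m(1,3)] m(2) g]] lin_comp[OF leg23_lin[OF m(1,2,3,3,2) tensor_flip_lin[OF m(2,3)]]] pure_lin1 tensor_module m g z)
  show "(\<lambda>x. pure_tensor K V Z (contract_right K V \<gamma> x) z) \<in> lin_map K (V \<boxtimes> W) (V \<boxtimes> Z)"
    by (intro lin_intros m contract_right_lin g z)
qed (simp add: leg23_pure_left tensor_flip_lin tensor_flip_pure contract_right_unassoc contract_right_pure pure_closed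
    m g z pure_smult1[OF m(1,3) dual_closed[OF g]] pure_smult2[OF m(1,3) dual_closed[OF g]])

lemma contract_right_leg13_pure:
  assumes m: "module K V" "module K Z" "module K W"
    and f: "f \<in> lin_map K (V \<boxtimes> W) (V \<boxtimes> W)" and g: "\<gamma> \<in> dual W"
    and v: "v \<in> carrier V" "z \<in> carrier Z" "w \<in> carrier W"
  shows "contract_right K (V \<boxtimes> Z) \<gamma>
      (leg13 K V Z W f (pure_tensor K (V \<boxtimes> Z) W (pure_tensor K V Z v z) w))
    = pure_tensor K V Z (contract_right K V \<gamma> (f (pure_tensor K V W v w))) z"
  using v by (simp add: leg13_def leg23_pure_left tensor_flip_lin tensor_flip_pure tensor_unassoc_pure m
    leg12_pure[OF _ _ _ _ _ f] pure_closed lin_closed[OF f] contract_right_leg23_flip g tensor_module)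

lemma leg13_lin:
  assumes m: "module K V" "module K Z" "module K W"
    and f: "f \<in> lin_map K (V \<boxtimes> W) (V \<boxtimes> W)"
  shows "leg13 K V Z W f \<in> lin_map K ((V \<boxtimes> Z) \<boxtimes> W) ((V \<boxtimes> Z) \<boxtimes> W)"
  unfolding leg13_def comp_def
  by (rule lin_comp[OF leg23_lin[OF m(1,3,2,2,3) tensor_flip_lin[OF m(3,2)]]
        lin_comp[OF leg12_lin[OF m(1,3,1,3,2) f] leg23_lin[OF m(1-3,3,2) tensor_flip_lin[OF m(2,3)]]]])

section \<open>Bilinear maps and slices with parameters\<close>

lemma contract_right_map:
  assumes m: "module K V" "module K W" "module K V'" "module K W'"
    and fg: "f \<in> lin_map K V V'" "g \<in> lin_map K W W'" and w: "\<omega> \<in> dual W'"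
    and x: "x \<in> carrier (V \<boxtimes> W)"
  shows "contract_right K V' \<omega> (tensor_map K V' W' f g x) = f (contract_right K V (\<lambda>y. \<omega> (g y)) x)"
proof -
  have wg: "(\<lambda>y. \<omega> (g y)) \<in> dual W" by (rule lin_comp[OF w fg(2)])
  show ?thesis
    by (rule tensor_ext[OF m(1-3) _ _ _ x],
        rule lin_comp[OF contract_right_lin[OF m(3,4) w] tensor_map_lin[OF m fg]],
        rule lin_comp[OF fg(1) contract_right_lin[OF m(1,2) wg]])
      (simp add: tensor_map_pure[OF m fg] contract_right_pure m w wg lin_closed[OF fg(1)] lin_closed[OF fg(2)]
        lin_smult[OF fg(1)] dual_closed[OF w])
qed

lemma contract_left_map:
  assumes m: "module K V" "module K W" "module K V'" "module K W'"
    and fg: "f \<in> lin_map K V V'" "g \<in> lin_map K W W'" and w: "\<omega> \<in> dual V'"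
    and x: "x \<in> carrier (V \<boxtimes> W)"
  shows "contract_left K W' \<omega> (tensor_map K V' W' f g x) = g (contract_left K W (\<lambda>y. \<omega> (f y)) x)"
proof -
  have wf: "(\<lambda>y. \<omega> (f y)) \<in> dual V" by (rule lin_comp[OF w fg(1)])
  show ?thesis
    by (rule tensor_ext[OF m(1,2,4) _ _ _ x],
        rule lin_comp[OF contract_left_lin[OF m(3,4) w] tensor_map_lin[OF m fg]],
        rule lin_comp[OF fg(2) contract_left_lin[OF m(1,2) wf]])
      (simp add: tensor_map_pure[OF m fg] contract_left_pure m w wf lin_closed[OF fg(1)] lin_closed[OF fg(2)]
        lin_smult[OF fg(2)] dual_closed[OF w])
qed

lemma tensor_lift_map:
  assumes m: "module K V" "module K W" "module K V'" "module K W'" "module K U"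
    and fg: "f \<in> lin_map K V V'" "g \<in> lin_map K W W'" and b: "bilin_map K V' W' U b"
    and x: "x \<in> carrier (V \<boxtimes> W)"
  shows "tensor_lift K U b (tensor_map K V' W' f g x) = tensor_lift K U (\<lambda>v w. b (f v) (g w)) x"
proof -
  have bf: "bilin_map K V W U (\<lambda>v w. b (f v) (g w))"
    by (intro bilinI lin_comp[OF bilinD1[OF b] fg(2)] lin_comp[OF bilinD2[OF b] fg(1)] lin_closed[OF fg(1)] lin_closed[OF fg(2)])
  show ?thesis
    by (rule tensor_ext[OF m(1,2,5) _ _ _ x],
        rule lin_comp[OF tensor_lift_lin[OF m(3-5) b] tensor_map_lin[OF m(1-4) fg]],
        rule tensor_lift_lin[OF m(1,2,5) bf])
      (simp add: tensor_map_pure[OF m(1-4) fg] tensor_lift_pure[OF m(3-5) b] tensor_lift_pure[OF m(1,2,5) bf]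
        lin_closed[OF fg(1)] lin_closed[OF fg(2)])
qed

lemma lin_map_cong:
  assumes "module K V" "f \<in> lin_map K V W" "\<And>x. x \<in> carrier V \<Longrightarrow> f x = g x"
  shows "g \<in> lin_map K V W"
proof -
  interpret V: module K V by fact
  show ?thesis using assms(2,3) unfolding lin_map_def by (auto simp: Pi_def)
qed

text \<open>
  A tensor is a sum of pure ones, and on these the induced map is the bilinear one.
\<close>

lemma lin_lift_param:
  assumes V: "module K V" and W: "module K W" and U: "module K U" and P: "module K P"
    and b: "\<And>p. p \<in> carrier P \<Longrightarrow> bilin_map K V W U (b p)"
    and lin: "\<And>v w. v \<in> carrier V \<Longrightarrow> w \<in> carrier W \<Longrightarrow> (\<lambda>p. b p v w) \<in> lin_map K P U"
    and x: "x \<in> carrier (V \<boxtimes> W)"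
  shows "(\<lambda>p. tensor_lift K U (b p) x) \<in> lin_map K P U"
  using x
proof (induction rule: tensor_induct[OF V W, consumes 1, case_names pure add])
  case (pure v w)
  show ?case
    by (rule lin_map_cong[OF P lin[OF pure]]) (simp add: tensor_lift_pure[OF V W U b] pure)
next
  case (add x y)
  show ?case
    by (rule lin_map_cong[OF P lin_sum[OF U add(3,4)]])
      (simp add: lin_add[OF tensor_lift_lin[OF V W U b]] add)
qed

lemma contract_right_cong:
  assumes m: "module K V" "module K W" and w: "\<omega> \<in> dual W"
    and eq: "\<And>y. y \<in> carrier W \<Longrightarrow> \<omega> y = \<omega>' y" and x: "x \<in> carrier (V \<boxtimes> W)"
  shows "contract_right K V \<omega> x = contract_right K V \<omega>' x"
  unfolding contract_right_def
  by (rule tensor_lift_cong[OF m m(1) contract_right_bilin[OF m w] _ x]) (simp add: eq)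

lemma rslice_cong:
  assumes "module K V" "module K W" "t \<in> lin_map K (V \<boxtimes> W) (V \<boxtimes> W)"
    "\<beta> \<in> dual W" "p \<in> carrier W" "v \<in> carrier V" "\<And>y. y \<in> carrier W \<Longrightarrow> \<beta> y = \<beta>' y"
  shows "rslice K V W t \<beta> p v = rslice K V W t \<beta>' p v"
  unfolding rslice_def
  by (rule contract_right_cong[OF assms(1,2,4,7) lin_closed[OF assms(3)]]) (use assms pure_closed in auto)

section \<open>Images and quotients\<close>

text \<open>
  The base algebra is a subset of the multiplier algebra that is given as a linear image of
  \<open>A\<close>; this makes it a vector space without a study of the whole multiplier algebra.
\<close>

lemma module_image:
  fixes A :: "('k, 'a, 'n) module_scheme" and B :: "('k, 'b, 'p) module_scheme"
  assumes A: "module K A" and B: "carrier B = f ` carrier A"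
    and add: "\<And>x y. x \<in> carrier A \<Longrightarrow> y \<in> carrier A \<Longrightarrow> f (x \<oplus>\<^bsub>A\<^esub> y) = f x \<oplus>\<^bsub>B\<^esub> f y"
    and smult: "\<And>c x. c \<in> carrier K \<Longrightarrow> x \<in> carrier A \<Longrightarrow> f (c \<odot>\<^bsub>A\<^esub> x) = c \<odot>\<^bsub>B\<^esub> f x"
    and zero: "f \<zero>\<^bsub>A\<^esub> = \<zero>\<^bsub>B\<^esub>"
  shows "module K B"
proof -
  interpret A: module K A by (rule A)
  show ?thesis
  proof (rule moduleI)
    show "cring K" by (rule is_cring)
    show "abelian_group B"
    proof (rule abelian_groupI)
      show "\<exists>y\<in>carrier B. y \<oplus>\<^bsub>B\<^esub> x = \<zero>\<^bsub>B\<^esub>" if "x \<in> carrier B" for x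
      proof -
        from that obtain a where a: "a \<in> carrier A" "x = f a" by (auto simp: B)
        then have "f (\<ominus>\<^bsub>A\<^esub> a) \<oplus>\<^bsub>B\<^esub> x = \<zero>\<^bsub>B\<^esub>" by (simp add: add[symmetric] A.l_neg zero)
        then show ?thesis using a by (auto simp: B)
      qed
    qed (auto simp: B add[symmetric] zero[symmetric] A.a_ac)
  qed (auto simp: B add[symmetric] smult[symmetric] A.smult_l_distr A.smult_r_distr A.smult_assoc1)
qed

lemma quot_lift_iso:
  assumes T: "module K T" and U: "module K U" and S: "S \<subseteq> carrier T"
    and f: "f \<in> lin_map K T U" and kerS: "\<And>s. s \<in> S \<Longrightarrow> f s = \<zero>\<^bsub>U\<^esub>"
    and ker: "\<And>x. x \<in> carrier T \<Longrightarrow> f x = \<zero>\<^bsub>U\<^esub> \<Longrightarrow> x \<in> span_of K T S"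
    and surj: "\<And>u. u \<in> carrier U \<Longrightarrow> \<exists>x\<in>carrier T. f x = u"
  shows "lin_iso K (quot_space T (span_of K T S)) U (quot_lift f)"
proof -
  interpret T: module K T by (rule T)
  interpret U: module K U by (rule U)
  note sub = span_subspace[OF T S]
  have ker0: "f s = \<zero>\<^bsub>U\<^esub>" if "s \<in> span_of K T S" for s
    by (rule lin_eq_on_span[OF T U f lin_const_zero[OF U] _ that]) (use S kerS in auto)
  have ql: "quot_lift f (span_of K T S +>\<^bsub>T\<^esub> x) = f x" if "x \<in> carrier T" for x
    by (rule quot_lift_coset[OF T sub U f _ that]) (rule ker0)
  note qc = quot_carrier[OF T sub]
  have lin: "quot_lift f \<in> lin_map K (quot_space T (span_of K T S)) U"
    by (rule quot_lift_lin[OF T sub U f]) (rule ker0)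
  have "inj_on (quot_lift f) (carrier (quot_space T (span_of K T S)))"
  proof (rule inj_onI)
    fix P Q assume "P \<in> carrier (quot_space T (span_of K T S))" "Q \<in> carrier (quot_space T (span_of K T S))"
      and eq: "quot_lift f P = quot_lift f Q"
    then obtain p q where pq: "p \<in> carrier T" "q \<in> carrier T"
      "P = span_of K T S +>\<^bsub>T\<^esub> p" "Q = span_of K T S +>\<^bsub>T\<^esub> q" by (auto simp: qc)
    then have "f p = f q" using eq by (simp add: ql)
    then have "f (p \<ominus>\<^bsub>T\<^esub> q) = \<zero>\<^bsub>U\<^esub>"
      using pq lin_minus[OF T U f] minus_zero_iff[OF U] lin_closed[OF f] by simp
    then have "p \<ominus>\<^bsub>T\<^esub> q \<in> span_of K T S" using ker pq by simp
    then show "P = Q" using pq coset_eq_iff[OF T sub] by simp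
  qed
  moreover have "quot_lift f ` carrier (quot_space T (span_of K T S)) = carrier U"
  proof
    show "quot_lift f ` carrier (quot_space T (span_of K T S)) \<subseteq> carrier U" using lin_closed[OF lin] by auto
    show "carrier U \<subseteq> quot_lift f ` carrier (quot_space T (span_of K T S))"
    proof
      fix u assume "u \<in> carrier U"
      then obtain x where x: "x \<in> carrier T" "f x = u" using surj by blast
      then show "u \<in> quot_lift f ` carrier (quot_space T (span_of K T S))"
        using ql[OF x(1)] qc by (intro image_eqI[of _ _ "span_of K T S +>\<^bsub>T\<^esub> x"]) auto
    qed
  qed
  ultimately show ?thesis using lin by (simp add: lin_iso_def bij_betw_def)
qed

text \<open>
  The shape of the induction in the proof of firmness: the tensors that have a partner with
  prescribed linear images form a subspace, so partners are needed for generators only.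
\<close>

lemma related_subspace:
  assumes X: "module K X" and Z: "module K Z" and U: "\<And>i. i \<in> I \<Longrightarrow> module K (U i)"
    and f: "\<And>i. i \<in> I \<Longrightarrow> f i \<in> lin_map K X (U i)" and g: "\<And>i. i \<in> I \<Longrightarrow> g i \<in> lin_map K Z (U i)"
    and Q: "module K Q" and q: "q \<in> lin_map K X Q" and p: "p \<in> lin_map K Z Q"
  shows "submodule {x \<in> carrier X. \<exists>z\<in>carrier Z. (\<forall>i\<in>I. f i x = g i z) \<and> q x = p z} K X"
proof (rule subspaceI[OF X])
  interpret X: module K X by (rule X)
  interpret Z: module K Z by (rule Z)
  show "\<zero>\<^bsub>X\<^esub> \<in> {x \<in> carrier X. \<exists>z\<in>carrier Z. (\<forall>i\<in>I. f i x = g i z) \<and> q x = p z}"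
  proof -
    have "f i \<zero>\<^bsub>X\<^esub> = g i \<zero>\<^bsub>Z\<^esub>" if "i \<in> I" for i
      using lin_zero[OF X U[OF that] f[OF that]] lin_zero[OF Z U[OF that] g[OF that]] by simp
    then show ?thesis
      by (auto intro!: bexI[of _ "\<zero>\<^bsub>Z\<^esub>"] simp: lin_zero[OF X Q q] lin_zero[OF Z Q p])
  qed
  fix a b assume "a \<in> {x \<in> carrier X. \<exists>z\<in>carrier Z. (\<forall>i\<in>I. f i x = g i z) \<and> q x = p z}"
    "b \<in> {x \<in> carrier X. \<exists>z\<in>carrier Z. (\<forall>i\<in>I. f i x = g i z) \<and> q x = p z}"
  then obtain z z' where "a \<in> carrier X" "b \<in> carrier X" "z \<in> carrier Z" "z' \<in> carrier Z"
    "\<forall>i\<in>I. f i a = g i z" "q a = p z" "\<forall>i\<in>I. f i b = g i z'" "q b = p z'" by blast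
  then show "a \<oplus>\<^bsub>X\<^esub> b \<in> {x \<in> carrier X. \<exists>z\<in>carrier Z. (\<forall>i\<in>I. f i x = g i z) \<and> q x = p z}"
    by (auto intro!: bexI[of _ "z \<oplus>\<^bsub>Z\<^esub> z'"] simp: lin_add[OF f] lin_add[OF g] lin_add[OF q] lin_add[OF p])
next
  interpret X: module K X by (rule X)
  interpret Z: module K Z by (rule Z)
  fix c a assume c: "c \<in> carrier K" and "a \<in> {x \<in> carrier X. \<exists>z\<in>carrier Z. (\<forall>i\<in>I. f i x = g i z) \<and> q x = p z}"
  then obtain z where "a \<in> carrier X" "z \<in> carrier Z" "\<forall>i\<in>I. f i a = g i z" "q a = p z" by blast
  then show "c \<odot>\<^bsub>X\<^esub> a \<in> {x \<in> carrier X. \<exists>z\<in>carrier Z. (\<forall>i\<in>I. f i x = g i z) \<and> q x = p z}"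
    using c by (auto intro!: bexI[of _ "c \<odot>\<^bsub>Z\<^esub> z"] simp: lin_smult[OF f] lin_smult[OF g] lin_smult[OF q] lin_smult[OF p])
qed auto

section \<open>Slices of commuting legs\<close>

lemma contract_first_leg13_pure:
  assumes m: "module K V" "module K Z" "module K W"
    and f: "f \<in> lin_map K (V \<boxtimes> W) (V \<boxtimes> W)" and a: "\<alpha> \<in> dual V"
    and v: "v \<in> carrier V" "z \<in> carrier Z" "w \<in> carrier W"
  shows "contract_first K Z W \<alpha>
      (leg13 K V Z W f (pure_tensor K (V \<boxtimes> Z) W (pure_tensor K V Z v z) w))
    = pure_tensor K Z W z (contract_left K W \<alpha> (f (pure_tensor K V W v w)))"
proof -
  have "contract_first K Z W \<alpha> (leg23 K V W Z Z W (tensor_flip K W Z) (pure_tensor K (V \<boxtimes> W) Z x z))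
      = pure_tensor K Z W z (contract_left K W \<alpha> x)" if x: "x \<in> carrier (V \<boxtimes> W)" for x
    using v by (simp add: contract_first_leg23[OF m(1,3,2,2,3) tensor_flip_lin[OF m(3,2)] a] pure_closed tensor_module m x
        contract_first_pure[OF m(1,3,2) a] tensor_flip_pure lin_closed[OF contract_left_lin[OF m(1,3) a]])
  then show ?thesis
    using v by (simp add: leg13_def leg23_pure_left tensor_flip_lin tensor_flip_pure tensor_unassoc_pure m
        leg12_pure[OF _ _ _ _ _ f] pure_closed lin_closed[OF f] tensor_module)
qed

text \<open>
  Contracting the two outer legs turns the commutation of maps that share the middle leg into
  a commutation of endomorphisms of \<open>A\<close>.
\<close>

lemma slices_commute:
  assumes A: "module K A" and f: "f \<in> lin_map K (A \<boxtimes> A) (A \<boxtimes> A)"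
    and g: "g \<in> lin_map K (A \<boxtimes> A) (A \<boxtimes> A)"
    and fg: "\<And>x. x \<in> carrier ((A \<boxtimes> A) \<boxtimes> A) \<Longrightarrow>
      leg12 K A A A f (leg23 K A A A A A g x) = leg23 K A A A A A g (leg12 K A A A f x)"
    and d: "\<beta> \<in> dual A" "\<gamma> \<in> dual A" and c: "b \<in> carrier A" "c \<in> carrier A" "y \<in> carrier A"
  shows "lslice K A A f \<beta> c (rslice K A A g \<gamma> b y) = rslice K A A g \<gamma> b (lslice K A A f \<beta> c y)"
proof -
  note AA = tensor_module[OF A A]
  let ?x = "pure_tensor K (A \<boxtimes> A) A (pure_tensor K A A c y) b"
  have x: "?x \<in> carrier ((A \<boxtimes> A) \<boxtimes> A)" using c by (simp add: pure_closed A AA)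
  have "contract_left K A \<beta> (contract_right K (A \<boxtimes> A) \<gamma> (leg12 K A A A f (leg23 K A A A A A g ?x)))
      = lslice K A A f \<beta> c (rslice K A A g \<gamma> b y)"
    using c d x by (simp add: contract_right_leg12[OF A A A A A f] leg23_pure_left[OF A A A A A g] lin_closed[OF leg23_lin[OF A A A A A g]]
      contract_right_unassoc A lin_closed[OF g] pure_closed lslice_def rslice_def lin_closed[OF tensor_unassoc_lin] AA)
  moreover have "contract_left K A \<beta> (contract_right K (A \<boxtimes> A) \<gamma> (leg23 K A A A A A g (leg12 K A A A f ?x)))
      = contract_right K A \<gamma> (g (contract_first K A A \<beta> (leg12 K A A A f ?x)))"
    by (subst contract_first_right[OF A A A d lin_closed[OF leg23_lin[OF A A A A A g] lin_closed[OF leg12_lin[OF A A A A A f] x]]])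
      (simp only: contract_first_leg23[OF A A A A A g d(1) lin_closed[OF leg12_lin[OF A A A A A f] x]])
  moreover have "\<dots> = rslice K A A g \<gamma> b (lslice K A A f \<beta> c y)"
    using c d by (simp add: leg12_pure[OF A A A A A f] contract_first_pure A lin_closed[OF f] pure_closed lslice_def rslice_def)
  ultimately show ?thesis using fg[OF x] by simp
qed

end

section \<open>The identities between the slices\<close>

text \<open>
  A weak multiplier bialgebra, seen through the slices of its structure maps. Write
  \<open>y\<^sub>1 \<otimes> y\<^sub>2\<close> for the comultiplication of \<open>y\<close> and \<open>E\<^sub>1 \<otimes> E\<^sub>2\<close> for the idempotent multiplier of which
  \<open>e1\<close> and \<open>e2\<close> are the left and right multiplications. Then
  \<^item> \<open>X \<beta> p y = \<beta> (y\<^sub>2 p) y\<^sub>1\<close> and \<open>Y \<beta> p y = \<beta> (p y\<^sub>2) y\<^sub>1\<close>,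
  \<^item> \<open>Z \<beta> p y = \<beta> (p y\<^sub>1) y\<^sub>2\<close> and \<open>W \<beta> p y = \<beta> (y\<^sub>1 p) y\<^sub>2\<close>,
  \<^item> \<open>El \<beta> p y = \<beta> (E\<^sub>1 p) (E\<^sub>2 y)\<close> and \<open>Er \<beta> p y = \<beta> (E\<^sub>2 p) (E\<^sub>1 y)\<close>,
  \<^item> \<open>Fl \<beta> p y = \<beta> (p E\<^sub>1) (y E\<^sub>2)\<close> and \<open>Fr \<beta> p y = \<beta> (p E\<^sub>2) (y E\<^sub>1)\<close>.

  The list of assumptions is invariant under passing to the opposite multiplication while
  exchanging \<open>e1\<close> with \<open>e2\<close>, \<open>t1\<close> with \<open>t3\<close> and \<open>t2\<close> with \<open>t4\<close>. The defining axioms of a regular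
  weak multiplier bialgebra do not have this symmetry on their face, and it is what provides every
  statement about the right action with a mirror image.
\<close>

locale wmb_slices = vector_spaces K
  for K :: "('k, 'm) ring_scheme" (structure) +
  fixes A :: "('k, 'a, 'n) module_scheme"
    and mul :: "'a \<Rightarrow> 'a \<Rightarrow> 'a" (infixl \<open>\<star>\<close> 70)
    and \<epsilon> :: "'a \<Rightarrow> 'k"
    and e1 e2 t1 t2 t3 t4 :: "('a, 'a, 'k) tensor \<Rightarrow> ('a, 'a, 'k) tensor"
  fixes X Y Z W El Er Fl Fr :: "('a \<Rightarrow> 'k) \<Rightarrow> 'a \<Rightarrow> 'a \<Rightarrow> 'a"
  defines X_def: "X \<equiv> rslice K A A t1" and Y_def: "Y \<equiv> rslice K A A t3"
    and Z_def: "Z \<equiv> lslice K A A t2" and W_def: "W \<equiv> lslice K A A t4"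
    and El_def: "El \<equiv> lslice K A A e1" and Er_def: "Er \<equiv> rslice K A A e1"
    and Fl_def: "Fl \<equiv> lslice K A A e2" and Fr_def: "Fr \<equiv> rslice K A A e2"
  assumes module_A [simp]: "module K A"
    and mul_bilin: "bilin_map K A A A mul"
    and mul_assoc: "a \<in> carrier A \<Longrightarrow> b \<in> carrier A \<Longrightarrow> c \<in> carrier A \<Longrightarrow> (a \<star> b) \<star> c = a \<star> (b \<star> c)"
    and products_span: "span_of K A {a \<star> b | a b. a \<in> carrier A \<and> b \<in> carrier A} = carrier A"
    and nondeg_right: "a \<in> carrier A \<Longrightarrow> (\<And>b. b \<in> carrier A \<Longrightarrow> a \<star> b = \<zero>\<^bsub>A\<^esub>) \<Longrightarrow> a = \<zero>\<^bsub>A\<^esub>"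
    and nondeg_left: "a \<in> carrier A \<Longrightarrow> (\<And>b. b \<in> carrier A \<Longrightarrow> b \<star> a = \<zero>\<^bsub>A\<^esub>) \<Longrightarrow> a = \<zero>\<^bsub>A\<^esub>"
    and t_lin [simp]: "t1 \<in> lin_map K (A \<boxtimes> A) (A \<boxtimes> A)"
      "t2 \<in> lin_map K (A \<boxtimes> A) (A \<boxtimes> A)"
      "t3 \<in> lin_map K (A \<boxtimes> A) (A \<boxtimes> A)"
      "t4 \<in> lin_map K (A \<boxtimes> A) (A \<boxtimes> A)"
      "e1 \<in> lin_map K (A \<boxtimes> A) (A \<boxtimes> A)"
      "e2 \<in> lin_map K (A \<boxtimes> A) (A \<boxtimes> A)"
    and eps_dual [simp]: "\<epsilon> \<in> dual A"
    and T13: "\<beta> \<in> dual A \<Longrightarrow> a \<in> carrier A \<Longrightarrow> b \<in> carrier A \<Longrightarrow> c \<in> carrier A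
      \<Longrightarrow> X (\<lambda>u. \<beta> (a \<star> u)) b c = Y (\<lambda>u. \<beta> (u \<star> b)) a c"
    and T12: "\<beta> \<in> dual A \<Longrightarrow> \<gamma> \<in> dual A \<Longrightarrow> b \<in> carrier A \<Longrightarrow> c \<in> carrier A \<Longrightarrow> y \<in> carrier A
      \<Longrightarrow> \<beta> (c \<star> X \<gamma> b y) = \<gamma> (Z \<beta> c y \<star> b)"
    and T34: "\<beta> \<in> dual A \<Longrightarrow> \<gamma> \<in> dual A \<Longrightarrow> b \<in> carrier A \<Longrightarrow> c \<in> carrier A \<Longrightarrow> y \<in> carrier A
      \<Longrightarrow> \<beta> (Y \<gamma> b y \<star> c) = \<gamma> (b \<star> W \<beta> c y)"
    and T14: "\<beta> \<in> dual A \<Longrightarrow> \<gamma> \<in> dual A \<Longrightarrow> b \<in> carrier A \<Longrightarrow> c \<in> carrier A \<Longrightarrow> y \<in> carrier A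
      \<Longrightarrow> \<beta> (X \<gamma> b y \<star> c) = \<gamma> (W \<beta> c y \<star> b)"
    and T32: "\<beta> \<in> dual A \<Longrightarrow> \<gamma> \<in> dual A \<Longrightarrow> b \<in> carrier A \<Longrightarrow> c \<in> carrier A \<Longrightarrow> y \<in> carrier A
      \<Longrightarrow> \<beta> (c \<star> Y \<gamma> b y) = \<gamma> (b \<star> Z \<beta> c y)"
    and ZX: "\<beta> \<in> dual A \<Longrightarrow> \<gamma> \<in> dual A \<Longrightarrow> b \<in> carrier A \<Longrightarrow> c \<in> carrier A \<Longrightarrow> y \<in> carrier A
      \<Longrightarrow> Z \<beta> c (X \<gamma> b y) = X \<gamma> b (Z \<beta> c y)"
    and WY: "\<beta> \<in> dual A \<Longrightarrow> \<gamma> \<in> dual A \<Longrightarrow> b \<in> carrier A \<Longrightarrow> c \<in> carrier A \<Longrightarrow> y \<in> carrier A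
      \<Longrightarrow> W \<beta> c (Y \<gamma> b y) = Y \<gamma> b (W \<beta> c y)"
    and ZY: "\<beta> \<in> dual A \<Longrightarrow> \<gamma> \<in> dual A \<Longrightarrow> b \<in> carrier A \<Longrightarrow> c \<in> carrier A \<Longrightarrow> y \<in> carrier A
      \<Longrightarrow> Z \<beta> c (Y \<gamma> b y) = Y \<gamma> b (Z \<beta> c y)"
    and WX: "\<beta> \<in> dual A \<Longrightarrow> \<gamma> \<in> dual A \<Longrightarrow> b \<in> carrier A \<Longrightarrow> c \<in> carrier A \<Longrightarrow> y \<in> carrier A
      \<Longrightarrow> W \<beta> c (X \<gamma> b y) = X \<gamma> b (W \<beta> c y)"
    and eps_X: "\<beta> \<in> dual A \<Longrightarrow> b \<in> carrier A \<Longrightarrow> y \<in> carrier A \<Longrightarrow> \<epsilon> (X \<beta> b y) = \<beta> (y \<star> b)"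
    and eps_Y: "\<beta> \<in> dual A \<Longrightarrow> b \<in> carrier A \<Longrightarrow> y \<in> carrier A \<Longrightarrow> \<epsilon> (Y \<beta> b y) = \<beta> (b \<star> y)"
    and eps_Z: "\<beta> \<in> dual A \<Longrightarrow> b \<in> carrier A \<Longrightarrow> y \<in> carrier A \<Longrightarrow> \<epsilon> (Z \<beta> b y) = \<beta> (b \<star> y)"
    and eps_W: "\<beta> \<in> dual A \<Longrightarrow> b \<in> carrier A \<Longrightarrow> y \<in> carrier A \<Longrightarrow> \<epsilon> (W \<beta> b y) = \<beta> (y \<star> b)"
    and X_mult: "\<gamma> \<in> dual A \<Longrightarrow> a \<in> carrier A \<Longrightarrow> b \<in> carrier A \<Longrightarrow> c \<in> carrier A
      \<Longrightarrow> tensor_lift K A (\<lambda>p q. X \<gamma> q a \<star> p) (t1 (pure_tensor K A A b c)) = X \<gamma> c (a \<star> b)"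
    and Y_mult: "\<gamma> \<in> dual A \<Longrightarrow> a \<in> carrier A \<Longrightarrow> b \<in> carrier A \<Longrightarrow> c \<in> carrier A
      \<Longrightarrow> tensor_lift K A (\<lambda>p q. p \<star> Y \<gamma> q a) (t3 (pure_tensor K A A b c)) = Y \<gamma> c (b \<star> a)"
    and Z_mult: "\<gamma> \<in> dual A \<Longrightarrow> \<alpha> \<in> dual A \<Longrightarrow> c \<in> carrier A \<Longrightarrow> d \<in> carrier A \<Longrightarrow> y \<in> carrier A
      \<Longrightarrow> tensor_lift K (scalars K) (\<lambda>p q. \<gamma> (q \<star> Z \<alpha> p y)) (t2 (pure_tensor K A A d c)) = \<gamma> (Z \<alpha> d (c \<star> y))"
    and W_mult: "\<gamma> \<in> dual A \<Longrightarrow> \<alpha> \<in> dual A \<Longrightarrow> c \<in> carrier A \<Longrightarrow> d \<in> carrier A \<Longrightarrow> y \<in> carrier A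
      \<Longrightarrow> tensor_lift K (scalars K) (\<lambda>p q. \<gamma> (W \<alpha> p y \<star> q)) (t4 (pure_tensor K A A d c)) = \<gamma> (W \<alpha> d (y \<star> c))"
    and X_e1: "\<gamma> \<in> dual A \<Longrightarrow> a \<in> carrier A \<Longrightarrow> b \<in> carrier A \<Longrightarrow> c \<in> carrier A
      \<Longrightarrow> tensor_lift K A (\<lambda>p q. X \<gamma> q c \<star> p) (e1 (pure_tensor K A A b a)) = X \<gamma> a c \<star> b"
    and Y_e2: "\<gamma> \<in> dual A \<Longrightarrow> a \<in> carrier A \<Longrightarrow> b \<in> carrier A \<Longrightarrow> c \<in> carrier A
      \<Longrightarrow> tensor_lift K A (\<lambda>p q. p \<star> Y \<gamma> q c) (e2 (pure_tensor K A A b a)) = b \<star> Y \<gamma> a c"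
    and e1_range: "b \<in> carrier A \<Longrightarrow> c \<in> carrier A \<Longrightarrow> e1 (pure_tensor K A A b c) \<in> span_of K (A \<boxtimes> A)
      {tensor_map K A A (\<lambda>u. u \<star> y) (\<lambda>u. u) (t1 (pure_tensor K A A x z)) | x y z.
         x \<in> carrier A \<and> y \<in> carrier A \<and> z \<in> carrier A}"
    and e2_range: "b \<in> carrier A \<Longrightarrow> c \<in> carrier A \<Longrightarrow> e2 (pure_tensor K A A b c) \<in> span_of K (A \<boxtimes> A)
      {tensor_map K A A (\<lambda>u. y \<star> u) (\<lambda>u. u) (t3 (pure_tensor K A A x z)) | x y z.
         x \<in> carrier A \<and> y \<in> carrier A \<and> z \<in> carrier A}"
    and e1_t1: "a \<in> carrier A \<Longrightarrow> b \<in> carrier A \<Longrightarrow> e1 (t1 (pure_tensor K A A a b)) = t1 (pure_tensor K A A a b)"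
    and e2_t3: "a \<in> carrier A \<Longrightarrow> b \<in> carrier A \<Longrightarrow> e2 (t3 (pure_tensor K A A a b)) = t3 (pure_tensor K A A a b)"
    and El_X: "\<beta> \<in> dual A \<Longrightarrow> \<gamma> \<in> dual A \<Longrightarrow> b \<in> carrier A \<Longrightarrow> c \<in> carrier A \<Longrightarrow> y \<in> carrier A
      \<Longrightarrow> El \<beta> c (X \<gamma> b y) = X \<gamma> b (El \<beta> c y)"
    and Fl_Y: "\<beta> \<in> dual A \<Longrightarrow> \<gamma> \<in> dual A \<Longrightarrow> b \<in> carrier A \<Longrightarrow> c \<in> carrier A \<Longrightarrow> y \<in> carrier A
      \<Longrightarrow> Fl \<beta> c (Y \<gamma> b y) = Y \<gamma> b (Fl \<beta> c y)"
    and El_mul: "\<beta> \<in> dual A \<Longrightarrow> b \<in> carrier A \<Longrightarrow> u \<in> carrier A \<Longrightarrow> d \<in> carrier A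
      \<Longrightarrow> El \<beta> b (u \<star> d) = El \<beta> b u \<star> d"
    and Fl_mul: "\<beta> \<in> dual A \<Longrightarrow> b \<in> carrier A \<Longrightarrow> u \<in> carrier A \<Longrightarrow> d \<in> carrier A
      \<Longrightarrow> Fl \<beta> b (d \<star> u) = d \<star> Fl \<beta> b u"
    and E12: "\<beta> \<in> dual A \<Longrightarrow> a \<in> carrier A \<Longrightarrow> b \<in> carrier A \<Longrightarrow> c \<in> carrier A \<Longrightarrow> d \<in> carrier A
      \<Longrightarrow> a \<star> Er (\<lambda>u. \<beta> (b \<star> u)) d c = Fr (\<lambda>u. \<beta> (u \<star> d)) b a \<star> c"
    and Fl_Z: "a \<in> carrier A \<Longrightarrow> b \<in> carrier A \<Longrightarrow> c \<in> carrier A \<Longrightarrow> Fl \<epsilon> a b \<star> c = b \<star> Z \<epsilon> a c"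
    and El_W: "a \<in> carrier A \<Longrightarrow> b \<in> carrier A \<Longrightarrow> c \<in> carrier A \<Longrightarrow> c \<star> El \<epsilon> a b = W \<epsilon> a c \<star> b"
    and full_X: "span_of K A {X \<beta> d u | \<beta> d u. \<beta> \<in> dual A \<and> d \<in> carrier A \<and> u \<in> carrier A} = carrier A"
    and full_Y: "span_of K A {Y \<beta> d u | \<beta> d u. \<beta> \<in> dual A \<and> d \<in> carrier A \<and> u \<in> carrier A} = carrier A"
begin

lemma opposite: "wmb_slices K A (\<lambda>a b. b \<star> a) \<epsilon> e2 e1 t3 t4 t1 t2"
proof (rule wmb_slices.intro[OF vector_spaces_axioms], rule wmb_slices_axioms.intro)
  show "bilin_map K A A A (\<lambda>a b. b \<star> a)" using mul_bilin unfolding bilin_map_def by auto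
  have "{b \<star> a |a b. a \<in> carrier A \<and> b \<in> carrier A} = {a \<star> b |a b. a \<in> carrier A \<and> b \<in> carrier A}" by auto
  then show "span_of K A {b \<star> a |a b. a \<in> carrier A \<and> b \<in> carrier A} = carrier A" using products_span by simp
qed (simp_all add: X_def[symmetric] Y_def[symmetric] Z_def[symmetric] W_def[symmetric] El_def[symmetric]
    Er_def[symmetric] Fl_def[symmetric] Fr_def[symmetric] mul_assoc nondeg_left nondeg_right T13 T12 T34 T14 T32 ZX ZY WX WY eps_X eps_Y eps_Z eps_W X_mult Y_mult
    Z_mult W_mult X_e1 Y_e2 e1_range e2_range e1_t1 e2_t3 El_X Fl_Y El_mul Fl_mul E12 Fl_Z El_W full_X full_Y)

end

context wmb_slices
begin

interpretation A: module K A by (rule module_A)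

abbreviation AA where "AA \<equiv> A \<boxtimes> A"

lemma module_AA [simp]: "module K AA" by (rule tensor_module) simp_all

declare scalars_module [simp] dual_closed [simp] lin_id [simp]

lemma mul_closed [simp]: "a \<in> carrier A \<Longrightarrow> b \<in> carrier A \<Longrightarrow> a \<star> b \<in> carrier A"
  using lin_closed[OF bilinD1[OF mul_bilin]] .

lemma lin_mul1 [lin_intros]: "f \<in> lin_map K U A \<Longrightarrow> c \<in> carrier A \<Longrightarrow> (\<lambda>x. f x \<star> c) \<in> lin_map K U A"
  by (rule lin_comp[OF bilinD2[OF mul_bilin]])

lemma lin_mul2 [lin_intros]: "f \<in> lin_map K U A \<Longrightarrow> c \<in> carrier A \<Longrightarrow> (\<lambda>x. c \<star> f x) \<in> lin_map K U A"
  by (rule lin_comp[OF bilinD1[OF mul_bilin]])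

lemma dual_mul [simp]:
  assumes "\<beta> \<in> dual A" "a \<in> carrier A"
  shows "(\<lambda>u. \<beta> (a \<star> u)) \<in> dual A" "(\<lambda>u. \<beta> (u \<star> a)) \<in> dual A"
  using assms by (auto intro!: lin_comp[OF assms(1)] lin_intros)

lemma mul_zero [simp]: "a \<in> carrier A \<Longrightarrow> a \<star> \<zero>\<^bsub>A\<^esub> = \<zero>\<^bsub>A\<^esub>" "a \<in> carrier A \<Longrightarrow> \<zero>\<^bsub>A\<^esub> \<star> a = \<zero>\<^bsub>A\<^esub>"
  using lin_zero[OF module_A module_A bilinD1[OF mul_bilin]] lin_zero[OF module_A module_A bilinD2[OF mul_bilin]] by auto

lemma pure_AA [simp]: "a \<in> carrier A \<Longrightarrow> b \<in> carrier A \<Longrightarrow> pure_tensor K A A a b \<in> carrier AA"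
  by (rule pure_closed) simp_all

lemma t_closed [simp]:
  "x \<in> carrier AA \<Longrightarrow> t1 x \<in> carrier AA" "x \<in> carrier AA \<Longrightarrow> t2 x \<in> carrier AA"
  "x \<in> carrier AA \<Longrightarrow> t3 x \<in> carrier AA" "x \<in> carrier AA \<Longrightarrow> t4 x \<in> carrier AA"
  "x \<in> carrier AA \<Longrightarrow> e1 x \<in> carrier AA" "x \<in> carrier AA \<Longrightarrow> e2 x \<in> carrier AA"
  by (auto intro: lin_closed t_lin)

lemma slices_closed [simp]:
  assumes "\<beta> \<in> dual A" "p \<in> carrier A" "y \<in> carrier A"
  shows "X \<beta> p y \<in> carrier A" "Y \<beta> p y \<in> carrier A" "Z \<beta> p y \<in> carrier A" "W \<beta> p y \<in> carrier A"
    "El \<beta> p y \<in> carrier A" "Er \<beta> p y \<in> carrier A" "Fl \<beta> p y \<in> carrier A" "Fr \<beta> p y \<in> carrier A"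
  using assms unfolding X_def Y_def Z_def W_def El_def Er_def Fl_def Fr_def
  by (auto intro!: rslice_closed lslice_closed)

lemma slices_lin1 [lin_intros]:
  assumes "\<beta> \<in> dual A" "f \<in> lin_map K U A" "p \<in> carrier A"
  shows "(\<lambda>x. X \<beta> p (f x)) \<in> lin_map K U A" "(\<lambda>x. Y \<beta> p (f x)) \<in> lin_map K U A"
    "(\<lambda>x. Z \<beta> p (f x)) \<in> lin_map K U A" "(\<lambda>x. W \<beta> p (f x)) \<in> lin_map K U A"
    "(\<lambda>x. El \<beta> p (f x)) \<in> lin_map K U A" "(\<lambda>x. Er \<beta> p (f x)) \<in> lin_map K U A"
    "(\<lambda>x. Fl \<beta> p (f x)) \<in> lin_map K U A" "(\<lambda>x. Fr \<beta> p (f x)) \<in> lin_map K U A"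
  unfolding X_def Y_def Z_def W_def El_def Er_def Fl_def Fr_def
  by (intro lin_intros module_A t_lin assms)+

lemma slices_lin2 [lin_intros]:
  assumes "\<beta> \<in> dual A" "f \<in> lin_map K U A" "y \<in> carrier A"
  shows "(\<lambda>x. X \<beta> (f x) y) \<in> lin_map K U A" "(\<lambda>x. Y \<beta> (f x) y) \<in> lin_map K U A"
    "(\<lambda>x. Z \<beta> (f x) y) \<in> lin_map K U A" "(\<lambda>x. W \<beta> (f x) y) \<in> lin_map K U A"
    "(\<lambda>x. El \<beta> (f x) y) \<in> lin_map K U A" "(\<lambda>x. Er \<beta> (f x) y) \<in> lin_map K U A"
    "(\<lambda>x. Fl \<beta> (f x) y) \<in> lin_map K U A" "(\<lambda>x. Fr \<beta> (f x) y) \<in> lin_map K U A"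
  unfolding X_def Y_def Z_def W_def El_def Er_def Fl_def Fr_def
  by (intro lin_intros module_A t_lin assms)+

lemma A_eqI:
  assumes "x \<in> carrier A" "y \<in> carrier A" "\<And>\<beta>. \<beta> \<in> dual A \<Longrightarrow> \<beta> x = \<beta> y"
  shows "x = y"
  by (rule dual_eqI[OF module_A assms])

lemma cancel_left:
  assumes x: "x \<in> carrier A" "y \<in> carrier A" and eq: "\<And>b. b \<in> carrier A \<Longrightarrow> b \<star> x = b \<star> y"
  shows "x = y"
proof -
  have "x \<ominus>\<^bsub>A\<^esub> y = \<zero>\<^bsub>A\<^esub>"
  proof (rule nondeg_left)
    fix b assume b: "b \<in> carrier A"
    show "b \<star> (x \<ominus>\<^bsub>A\<^esub> y) = \<zero>\<^bsub>A\<^esub>"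
      using lin_minus[OF module_A module_A bilinD1[OF mul_bilin b] x] minus_zero_iff[OF module_A, of "b \<star> x" "b \<star> y"] x b eq[OF b]
      by simp
  qed (use x in simp)
  then show ?thesis using minus_zero_iff[OF module_A x] by simp
qed

lemma cancel_left_dual:
  assumes "x \<in> carrier A" "y \<in> carrier A"
    and "\<And>b \<beta>. b \<in> carrier A \<Longrightarrow> \<beta> \<in> dual A \<Longrightarrow> \<beta> (b \<star> x) = \<beta> (b \<star> y)"
  shows "x = y"
  by (rule cancel_left[OF assms(1,2)], rule A_eqI) (use assms in auto)

section \<open>Comodules\<close>

text \<open>
  The comodule axioms in terms of slices. With \<open>v\<^sub>0 \<otimes> v\<^sub>1\<close> for the coaction, the slices of
  \<open>lam\<close> and \<open>rho\<close> are \<open>\<beta> (v\<^sub>1 p) v\<^sub>0\<close> and \<open>\<beta> (p v\<^sub>1) v\<^sub>0\<close>. The axioms for \<open>e1\<close> and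
  \<open>t1\<close> are one-sided; \<open>comodule_maps_op\<close> supplies their mirror images.
\<close>

definition comodule_maps ::
    "('k, 'v, 'b) module_scheme \<Rightarrow> (('v, 'a, 'k) tensor \<Rightarrow> ('v, 'a, 'k) tensor)
      \<Rightarrow> (('v, 'a, 'k) tensor \<Rightarrow> ('v, 'a, 'k) tensor) \<Rightarrow> bool" where
  "comodule_maps V lam rho \<longleftrightarrow> module K V \<and>
     lam \<in> lin_map K (V \<boxtimes> A) (V \<boxtimes> A) \<and>
     rho \<in> lin_map K (V \<boxtimes> A) (V \<boxtimes> A) \<and>
     (\<forall>\<beta>\<in>dual A. \<forall>a\<in>carrier A. \<forall>b\<in>carrier A. \<forall>v\<in>carrier V.
        rslice K V A lam (\<lambda>u. \<beta> (a \<star> u)) b v = rslice K V A rho (\<lambda>u. \<beta> (u \<star> b)) a v) \<and>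
     (\<forall>\<beta>\<in>dual A. \<forall>\<gamma>\<in>dual A. \<forall>a\<in>carrier A. \<forall>b\<in>carrier A. \<forall>v\<in>carrier V.
        tensor_lift K V (\<lambda>p q. rslice K V A lam \<beta> p (rslice K V A lam \<gamma> q v)) (e1 (pure_tensor K A A a b))
          = rslice K V A lam \<beta> a (rslice K V A lam \<gamma> b v) \<and>
        tensor_lift K V (\<lambda>p q. rslice K V A lam \<beta> p (rslice K V A lam \<gamma> q v)) (t1 (pure_tensor K A A a b))
          = rslice K V A lam (\<lambda>u. \<beta> (X \<gamma> b u)) a v)"

definition full_slices ::
    "('k, 'v, 'b) module_scheme \<Rightarrow> (('v, 'a, 'k) tensor \<Rightarrow> ('v, 'a, 'k) tensor) \<Rightarrow> bool" where
  "full_slices V lam \<longleftrightarrow>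
     span_of K V {rslice K V A lam \<beta> a v | \<beta> a v. \<beta> \<in> dual A \<and> a \<in> carrier A \<and> v \<in> carrier V} = carrier V"

lemma eps_X_mul:
  assumes "\<beta> \<in> dual A" "b \<in> carrier A" "y \<in> carrier A" "z \<in> carrier A"
  shows "\<epsilon> (X \<beta> b y \<star> z) = \<beta> (y \<star> El \<epsilon> z b)"
  using assms by (simp add: T14 El_W)

lemma Z_eps_mul:
  assumes "c \<in> carrier A" "u \<in> carrier A" "z \<in> carrier A"
  shows "Z \<epsilon> c (u \<star> z) = Z \<epsilon> c u \<star> z"
  by (rule cancel_left) (use assms in \<open>simp_all add: Fl_Z[symmetric] mul_assoc[symmetric]\<close>)

lemma eps_mul_X_mul:
  assumes "\<beta> \<in> dual A" "b \<in> carrier A" "c \<in> carrier A" "y \<in> carrier A" "z \<in> carrier A"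
  shows "\<epsilon> (c \<star> (X \<beta> b y \<star> z)) = \<beta> (Z \<epsilon> c y \<star> El \<epsilon> z b)"
proof -
  have "\<epsilon> (c \<star> (X \<beta> b y \<star> z)) = \<epsilon> (Z \<epsilon> c (X \<beta> b y \<star> z))" using assms by (simp add: eps_Z)
  also have "\<dots> = \<epsilon> (X \<beta> b (Z \<epsilon> c y) \<star> z)" using assms by (simp add: Z_eps_mul ZX)
  also have "\<dots> = \<beta> (Z \<epsilon> c y \<star> El \<epsilon> z b)" using assms by (simp add: eps_X_mul)
  finally show ?thesis .
qed

text \<open>
  The range of \<open>e1\<close> lies in the span of these elements, by \<open>e1_range\<close>. An identity that is linear in a value of
  \<open>e1\<close> may be checked on them, and there it concerns \<open>t1\<close>.
\<close>

definition gen :: "'a \<Rightarrow> 'a \<Rightarrow> 'a \<Rightarrow> ('a, 'a, 'k) tensor" where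
  "gen x y z = tensor_map K A A (\<lambda>u. u \<star> y) (\<lambda>u. u) (t1 (pure_tensor K A A x z))"

lemma gen_closed [simp]:
  "x \<in> carrier A \<Longrightarrow> y \<in> carrier A \<Longrightarrow> z \<in> carrier A \<Longrightarrow> gen x y z \<in> carrier AA"
  unfolding gen_def
  by (rule lin_closed[OF tensor_map_lin]) (auto intro: lin_intros)

lemma lin_eq_on_e1:
  assumes U: "module K U" and fg: "f \<in> lin_map K AA U" "g \<in> lin_map K AA U"
    and eq: "\<And>x y z. x \<in> carrier A \<Longrightarrow> y \<in> carrier A \<Longrightarrow> z \<in> carrier A \<Longrightarrow> f (gen x y z) = g (gen x y z)"
    and b: "b \<in> carrier A" "c \<in> carrier A"
  shows "f (e1 (pure_tensor K A A b c)) = g (e1 (pure_tensor K A A b c))"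
  by (rule lin_eq_on_span[OF module_AA U fg _ e1_range[OF b]])
    (auto simp: gen_def[symmetric] eq)

lemma contract_right_gen:
  "\<beta> \<in> dual A \<Longrightarrow> x \<in> carrier A \<Longrightarrow> y \<in> carrier A \<Longrightarrow> z \<in> carrier A
    \<Longrightarrow> contract_right K A \<beta> (gen x y z) = X \<beta> z x \<star> y"
  unfolding gen_def X_def rslice_def by (subst contract_right_map) (auto intro: lin_intros)

lemma contract_left_gen:
  assumes "x \<in> carrier A" "y \<in> carrier A" "z \<in> carrier A"
  shows "contract_left K A \<epsilon> (gen x y z) = x \<star> El \<epsilon> y z"
proof (rule A_eqI)
  fix \<beta> assume b: "\<beta> \<in> dual A"
  have "\<beta> (contract_left K A \<epsilon> (gen x y z)) = \<epsilon> (contract_right K A \<beta> (gen x y z))"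
    using assms b by (simp add: contract_comm[of A A \<epsilon> \<beta>])
  then show "\<beta> (contract_left K A \<epsilon> (gen x y z)) = \<beta> (x \<star> El \<epsilon> y z)"
    using assms b by (simp add: contract_right_gen eps_X_mul)
qed (use assms in \<open>auto intro: lin_closed[OF contract_left_lin[OF module_A module_A eps_dual]]\<close>)

lemma lift_gen:
  assumes "module K U" "bilin_map K A A U b" "x \<in> carrier A" "y \<in> carrier A" "z \<in> carrier A"
  shows "tensor_lift K U b (gen x y z) = tensor_lift K U (\<lambda>p q. b (p \<star> y) q) (t1 (pure_tensor K A A x z))"
  unfolding gen_def by (rule tensor_lift_map) (use assms in \<open>auto intro: lin_intros\<close>)

context
  fixes V :: "('k, 'v, 'b) module_scheme" and lam rho
  assumes comodule: "comodule_maps V lam rho"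
begin

lemma comodule_lin [simp]: "module K V"
  "lam \<in> lin_map K (V \<boxtimes> A) (V \<boxtimes> A)"
  "rho \<in> lin_map K (V \<boxtimes> A) (V \<boxtimes> A)"
  using comodule unfolding comodule_maps_def by auto

private abbreviation "XV \<equiv> rslice K V A lam"
private abbreviation "YV \<equiv> rslice K V A rho"

lemma XV_closed [simp]: "\<beta> \<in> dual A \<Longrightarrow> p \<in> carrier A \<Longrightarrow> v \<in> carrier V \<Longrightarrow> XV \<beta> p v \<in> carrier V"
  and YV_closed [simp]: "\<beta> \<in> dual A \<Longrightarrow> p \<in> carrier A \<Longrightarrow> v \<in> carrier V \<Longrightarrow> YV \<beta> p v \<in> carrier V"
  by (auto intro: rslice_closed)

lemma XV_bilin:
  "\<beta> \<in> dual A \<Longrightarrow> \<gamma> \<in> dual A \<Longrightarrow> v \<in> carrier V \<Longrightarrow> bilin_map K A A V (\<lambda>p q. XV \<beta> p (XV \<gamma> q v))"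
  by (rule bilinI) (intro lin_intros module_A comodule_lin XV_closed; simp)+

lemma XV_YV: "\<beta> \<in> dual A \<Longrightarrow> a \<in> carrier A \<Longrightarrow> b \<in> carrier A \<Longrightarrow> v \<in> carrier V
    \<Longrightarrow> XV (\<lambda>u. \<beta> (a \<star> u)) b v = YV (\<lambda>u. \<beta> (u \<star> b)) a v"
  using comodule unfolding comodule_maps_def by auto

lemma XV_e1: "\<beta> \<in> dual A \<Longrightarrow> \<gamma> \<in> dual A \<Longrightarrow> a \<in> carrier A \<Longrightarrow> b \<in> carrier A \<Longrightarrow> v \<in> carrier V \<Longrightarrow>
    tensor_lift K V (\<lambda>p q. XV \<beta> p (XV \<gamma> q v)) (e1 (pure_tensor K A A a b)) = XV \<beta> a (XV \<gamma> b v)"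
  using comodule unfolding comodule_maps_def by blast

lemma XV_t1: "\<beta> \<in> dual A \<Longrightarrow> \<gamma> \<in> dual A \<Longrightarrow> a \<in> carrier A \<Longrightarrow> b \<in> carrier A \<Longrightarrow> v \<in> carrier V \<Longrightarrow>
    tensor_lift K V (\<lambda>p q. XV \<beta> p (XV \<gamma> q v)) (t1 (pure_tensor K A A a b)) = XV (\<lambda>u. \<beta> (X \<gamma> b u)) a v"
  using comodule unfolding comodule_maps_def by blast

text \<open>
  In formulas, \<open>lam (v \<otimes> p a) = lam (v \<otimes> p) (1 \<otimes> a)\<close>. Multiplied from the left by \<open>1 \<otimes> c\<close>, both
  sides are expressed by \<open>rho (v \<otimes> c)\<close>, and \<open>c\<close> can be cancelled.
\<close>

lemma XV_mul:
  assumes b: "\<beta> \<in> dual A" and p: "p \<in> carrier A" "a \<in> carrier A" and v: "v \<in> carrier V"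
  shows "XV \<beta> (p \<star> a) v = XV (\<lambda>u. \<beta> (u \<star> a)) p v"
proof (rule dual_eqI[of V])
  fix \<phi> assume f: "\<phi> \<in> dual V"
  define k where "k = (\<lambda>q. contract_left K A \<phi> (lam (pure_tensor K V A v q)))"
  have kc: "k q \<in> carrier A" if "q \<in> carrier A" for q
    unfolding k_def by (rule lin_closed[OF contract_left_lin[OF _ _ f]], simp, simp, rule lin_closed[OF comodule_lin(2)], rule pure_closed) (use that v in simp_all)
  have kX: "\<phi> (XV \<beta> q v) = \<beta> (k q)" if "\<beta> \<in> dual A" "q \<in> carrier A" for \<beta> q
    unfolding k_def rslice_def
    by (rule contract_comm[OF _ _ f that(1)]) (use that v in \<open>auto intro!: lin_closed[OF comodule_lin(2)] pure_closed\<close>)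
  have "k (p \<star> a) = k p \<star> a"
  proof (rule cancel_left_dual)
    fix c \<beta> assume c: "c \<in> carrier A" "\<beta> \<in> dual A"
    have "\<beta> (c \<star> k (p \<star> a)) = \<phi> (XV (\<lambda>u. \<beta> (c \<star> u)) (p \<star> a) v)"
      using c p by (simp add: kX)
    also have "\<dots> = \<phi> (YV (\<lambda>u. \<beta> (u \<star> (p \<star> a))) c v)"
      using c p v by (simp add: XV_YV)
    also have "\<dots> = \<phi> (YV (\<lambda>u. \<beta> ((u \<star> p) \<star> a)) c v)"
      using c p v by (intro arg_cong[of _ _ \<phi>] rslice_cong) (auto simp: mul_assoc)
    also have "\<dots> = \<phi> (XV (\<lambda>u. \<beta> ((c \<star> u) \<star> a)) p v)"
      using c p v XV_YV[of "\<lambda>u. \<beta> (u \<star> a)" c p v] by simp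
    also have "\<dots> = \<beta> ((c \<star> k p) \<star> a)"
      using c p by (subst kX) (auto intro: dual_mul(1)[of "\<lambda>u. \<beta> (u \<star> a)"])
    finally show "\<beta> (c \<star> k (p \<star> a)) = \<beta> (c \<star> (k p \<star> a))" using c p kc by (simp add: mul_assoc)
  qed (use p kc in auto)
  then show "\<phi> (XV \<beta> (p \<star> a) v) = \<phi> (XV (\<lambda>u. \<beta> (u \<star> a)) p v)" using b p by (simp add: kX)
qed (use assms in auto)

lemma XV_gen:
  assumes b: "\<beta> \<in> dual A" "\<gamma> \<in> dual A" and x: "x \<in> carrier A" "y \<in> carrier A" "z \<in> carrier A" and v: "v \<in> carrier V"
  shows "tensor_lift K V (\<lambda>p q. XV \<beta> p (XV \<gamma> q v)) (gen x y z) = XV (\<lambda>u. \<beta> (X \<gamma> z u \<star> y)) x v"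
proof -
  have "tensor_lift K V (\<lambda>p q. XV \<beta> p (XV \<gamma> q v)) (gen x y z)
      = tensor_lift K V (\<lambda>p q. XV \<beta> (p \<star> y) (XV \<gamma> q v)) (t1 (pure_tensor K A A x z))"
    using assms by (intro lift_gen XV_bilin) auto
  also have "\<dots> = tensor_lift K V (\<lambda>p q. XV (\<lambda>u. \<beta> (u \<star> y)) p (XV \<gamma> q v)) (t1 (pure_tensor K A A x z))"
    using assms by (intro tensor_lift_cong[OF module_A module_A _ XV_bilin[of "\<lambda>u. \<beta> (u \<star> y)" \<gamma> v], symmetric]) (auto simp: XV_mul)
  also have "\<dots> = XV (\<lambda>u. \<beta> (X \<gamma> z u \<star> y)) x v"
    using assms by (subst XV_t1) auto
  finally show ?thesis .
qed

text \<open>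
  Inserting \<open>e1\<close> on the left, by the comodule axiom, makes both sides linear in
  \<open>e1 (p \<otimes> q)\<close>; on the elements \<open>gen x y z\<close> the axiom for \<open>t1\<close> applies.
\<close>

lemma XV_eps_XV:
  assumes g: "\<gamma> \<in> dual A" and p: "p \<in> carrier A" "q \<in> carrier A" and v: "v \<in> carrier V"
  shows "XV \<epsilon> p (XV \<gamma> q v) = XV \<gamma> (El \<epsilon> p q) v"
proof -
  have "tensor_lift K V (\<lambda>p q. XV \<epsilon> p (XV \<gamma> q v)) (e1 (pure_tensor K A A p q))
      = XV \<gamma> (contract_left K A \<epsilon> (e1 (pure_tensor K A A p q))) v"
  proof (rule lin_eq_on_e1[of V])
    show "tensor_lift K V (\<lambda>p q. XV \<epsilon> p (XV \<gamma> q v)) \<in> lin_map K AA V"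
      using g v by (intro tensor_lift_lin XV_bilin) auto
    show "(\<lambda>t. XV \<gamma> (contract_left K A \<epsilon> t) v) \<in> lin_map K AA V"
      using g v by (intro lin_intros contract_left_lin) auto
    fix x y z assume x: "x \<in> carrier A" "y \<in> carrier A" "z \<in> carrier A"
    have "tensor_lift K V (\<lambda>p q. XV \<epsilon> p (XV \<gamma> q v)) (gen x y z) = XV (\<lambda>u. \<epsilon> (X \<gamma> z u \<star> y)) x v"
      using x g v by (simp add: XV_gen)
    also have "\<dots> = XV (\<lambda>u. \<gamma> (u \<star> El \<epsilon> y z)) x v"
      using x g v by (intro rslice_cong[symmetric]) (auto simp: eps_X_mul)
    also have "\<dots> = XV \<gamma> (contract_left K A \<epsilon> (gen x y z)) v"
      using x g v by (simp add: contract_left_gen XV_mul)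
    finally show "tensor_lift K V (\<lambda>p q. XV \<epsilon> p (XV \<gamma> q v)) (gen x y z) = XV \<gamma> (contract_left K A \<epsilon> (gen x y z)) v" .
  qed (use p in auto)
  then show ?thesis using g p v by (simp add: XV_e1 El_def lslice_def)
qed

end

end

context wmb_slices
begin

interpretation A: module K A by (rule module_A)

interpretation op: wmb_slices K A "\<lambda>a b. b \<star> a" \<epsilon> e2 e1 t3 t4 t1 t2 Y X W Z Fl Fr El Er
  by (rule opposite) (simp_all add: X_def Y_def Z_def W_def El_def Er_def Fl_def Fr_def)

lemma full_slices_op: "op.full_slices V rho \<longleftrightarrow> full_slices V rho"
  by (simp add: full_slices_def op.full_slices_def)

section \<open>The algebra as a comodule over itself\<close>

lemma XX_bilin:
  "\<beta> \<in> dual A \<Longrightarrow> \<gamma> \<in> dual A \<Longrightarrow> v \<in> carrier A \<Longrightarrow> bilin_map K A A A (\<lambda>p q. X \<beta> p (X \<gamma> q v))"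
  by (rule bilinI) (intro lin_intros slices_closed; simp)+

lemma X_mul_bilin:
  "\<gamma> \<in> dual A \<Longrightarrow> v \<in> carrier A \<Longrightarrow> bilin_map K A A A (\<lambda>p q. X \<gamma> q v \<star> p)"
  by (rule bilinI) (intro lin_intros slices_closed; simp)+

text \<open>
  Tested against \<open>\<alpha> (d _)\<close>, an iterated slice becomes a single slice times an element. So the
  comodule axioms for \<open>A\<close> over itself follow from the multiplicative identities \<open>X_e1\<close> and \<open>X_mult\<close>.
\<close>

lemma XX_lift:
  assumes "\<alpha> \<in> dual A" "\<beta> \<in> dual A" "\<gamma> \<in> dual A" and c: "c \<in> carrier A" "d \<in> carrier A"
    and t: "t \<in> carrier AA"
  shows "\<alpha> (d \<star> tensor_lift K A (\<lambda>p q. X \<beta> p (X \<gamma> q c)) t)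
    = \<beta> (tensor_lift K A (\<lambda>p q. X \<gamma> q (Z \<alpha> d c) \<star> p) t)"
proof -
  have b: "bilin_map K A A (scalars K) (\<lambda>p q. \<beta> (X \<gamma> q (Z \<alpha> d c) \<star> p))"
    using assms by (intro bilinI lin_comp[OF assms(2)]) (auto intro!: lin_intros)
  have "\<alpha> (d \<star> tensor_lift K A (\<lambda>p q. X \<beta> p (X \<gamma> q c)) t)
      = tensor_lift K (scalars K) (\<lambda>p q. \<alpha> (d \<star> X \<beta> p (X \<gamma> q c))) t"
    using assms by (intro lin_lift_comp[of A A A "scalars K" _ "\<lambda>u. \<alpha> (d \<star> u)"] XX_bilin) auto
  also have "\<dots> = tensor_lift K (scalars K) (\<lambda>p q. \<beta> (X \<gamma> q (Z \<alpha> d c) \<star> p)) t"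
    by (rule tensor_lift_cong[OF module_A module_A scalars_module b _ t, symmetric])
      (use assms in \<open>simp add: T12 ZX\<close>)
  also have "\<dots> = \<beta> (tensor_lift K A (\<lambda>p q. X \<gamma> q (Z \<alpha> d c) \<star> p) t)"
    using assms by (intro lin_lift_comp[of A A A "scalars K", symmetric] X_mul_bilin) auto
  finally show ?thesis .
qed

lemma lift_XX_closed:
  "\<beta> \<in> dual A \<Longrightarrow> \<gamma> \<in> dual A \<Longrightarrow> v \<in> carrier A \<Longrightarrow> t \<in> carrier AA
    \<Longrightarrow> tensor_lift K A (\<lambda>p q. X \<beta> p (X \<gamma> q v)) t \<in> carrier A"
  by (rule lin_closed[OF tensor_lift_lin[OF _ _ _ XX_bilin]]) auto

lemma XX_e1:
  assumes "\<beta> \<in> dual A" "\<gamma> \<in> dual A" "a \<in> carrier A" "b \<in> carrier A" "c \<in> carrier A"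
  shows "tensor_lift K A (\<lambda>p q. X \<beta> p (X \<gamma> q c)) (e1 (pure_tensor K A A a b)) = X \<beta> a (X \<gamma> b c)"
  by (rule cancel_left_dual) (use assms in \<open>simp_all add: lift_XX_closed XX_lift X_e1 T12 ZX\<close>)

lemma dual_X: "\<beta> \<in> dual A \<Longrightarrow> \<gamma> \<in> dual A \<Longrightarrow> b \<in> carrier A \<Longrightarrow> (\<lambda>u. \<beta> (X \<gamma> b u)) \<in> dual A"
  by (rule lin_comp[of \<beta> A]) (auto intro!: lin_intros)

lemma XX_t1:
  assumes "\<beta> \<in> dual A" "\<gamma> \<in> dual A" "a \<in> carrier A" "b \<in> carrier A" "c \<in> carrier A"
  shows "tensor_lift K A (\<lambda>p q. X \<beta> p (X \<gamma> q c)) (t1 (pure_tensor K A A a b)) = X (\<lambda>u. \<beta> (X \<gamma> b u)) a c"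
  by (rule cancel_left_dual)
    (use assms in \<open>simp_all add: lift_XX_closed XX_lift X_mult dual_X T12[of _ "\<lambda>u. \<beta> (X \<gamma> b u)"]\<close>)

end

context wmb_slices
begin

interpretation A: module K A by (rule module_A)

interpretation op: wmb_slices K A "\<lambda>a b. b \<star> a" \<epsilon> e2 e1 t3 t4 t1 t2 Y X W Z Fl Fr El Er
  by (rule opposite) (simp_all add: X_def Y_def Z_def W_def El_def Er_def Fl_def Fr_def)

section \<open>The opposite comodule\<close>

text \<open>
  A function of two functionals that is, in each of its arguments, the evaluation at an
  element of \<open>A\<close> is determined by its values at the functionals \<open>\<beta> (_ c)\<close>, by non-degeneracy. This
  removes the factors \<open>c\<close> and \<open>d\<close> from identities in which they were needed to pass from \<open>t3\<close> to
  \<open>t1\<close> and from \<open>rho\<close> to \<open>lam\<close>.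
\<close>

lemma dual_rep_ext:
  assumes F: "\<And>\<gamma>. \<gamma> \<in> dual A \<Longrightarrow> \<exists>s\<in>carrier A. \<forall>\<beta>\<in>dual A. F \<beta> \<gamma> = \<beta> s"
      "\<And>\<beta>. \<beta> \<in> dual A \<Longrightarrow> \<exists>s\<in>carrier A. \<forall>\<gamma>\<in>dual A. F \<beta> \<gamma> = \<gamma> s"
    and G: "\<And>\<gamma>. \<gamma> \<in> dual A \<Longrightarrow> \<exists>s\<in>carrier A. \<forall>\<beta>\<in>dual A. G \<beta> \<gamma> = \<beta> s"
      "\<And>\<beta>. \<beta> \<in> dual A \<Longrightarrow> \<exists>s\<in>carrier A. \<forall>\<gamma>\<in>dual A. G \<beta> \<gamma> = \<gamma> s"
    and eq: "\<And>\<beta> \<gamma> c d. \<beta> \<in> dual A \<Longrightarrow> \<gamma> \<in> dual A \<Longrightarrow> c \<in> carrier A \<Longrightarrow> d \<in> carrier A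
      \<Longrightarrow> F (\<lambda>u. \<beta> (u \<star> c)) (\<lambda>u. \<gamma> (u \<star> d)) = G (\<lambda>u. \<beta> (u \<star> c)) (\<lambda>u. \<gamma> (u \<star> d))"
    and b: "\<beta> \<in> dual A" "\<gamma> \<in> dual A"
  shows "F \<beta> \<gamma> = G \<beta> \<gamma>"
proof -
  have 1: "F \<beta> (\<lambda>u. \<gamma> (u \<star> d)) = G \<beta> (\<lambda>u. \<gamma> (u \<star> d))"
    if "\<beta> \<in> dual A" "\<gamma> \<in> dual A" "d \<in> carrier A" for \<beta> \<gamma> d
  proof -
    obtain s where s: "s \<in> carrier A" "\<And>\<beta>. \<beta> \<in> dual A \<Longrightarrow> F \<beta> (\<lambda>u. \<gamma> (u \<star> d)) = \<beta> s"
      using F(1)[of "\<lambda>u. \<gamma> (u \<star> d)"] \<open>\<gamma> \<in> dual A\<close> \<open>d \<in> carrier A\<close> by auto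
    obtain s' where s': "s' \<in> carrier A" "\<And>\<beta>. \<beta> \<in> dual A \<Longrightarrow> G \<beta> (\<lambda>u. \<gamma> (u \<star> d)) = \<beta> s'"
      using G(1)[of "\<lambda>u. \<gamma> (u \<star> d)"] \<open>\<gamma> \<in> dual A\<close> \<open>d \<in> carrier A\<close> by auto
    have "s = s'"
    proof (rule op.cancel_left_dual[OF s(1) s'(1)])
      fix c \<beta> assume "c \<in> carrier A" "\<beta> \<in> dual A"
      then show "\<beta> (s \<star> c) = \<beta> (s' \<star> c)"
        using s(2)[of "\<lambda>u. \<beta> (u \<star> c)"] s'(2)[of "\<lambda>u. \<beta> (u \<star> c)"] eq[of \<beta> \<gamma> c d] that by simp
    qed
    then show ?thesis using s s' that by simp
  qed
  obtain s where s: "s \<in> carrier A" "\<And>\<gamma>. \<gamma> \<in> dual A \<Longrightarrow> F \<beta> \<gamma> = \<gamma> s"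
    using F(2)[OF b(1)] by auto
  obtain s' where s': "s' \<in> carrier A" "\<And>\<gamma>. \<gamma> \<in> dual A \<Longrightarrow> G \<beta> \<gamma> = \<gamma> s'"
    using G(2)[OF b(1)] by auto
  have "s = s'"
  proof (rule op.cancel_left_dual[OF s(1) s'(1)])
    fix c \<gamma> assume "c \<in> carrier A" "\<gamma> \<in> dual A"
    then show "\<gamma> (s \<star> c) = \<gamma> (s' \<star> c)"
      using s(2)[of "\<lambda>u. \<gamma> (u \<star> c)"] s'(2)[of "\<lambda>u. \<gamma> (u \<star> c)"] 1[of \<beta> \<gamma> c] b by simp
  qed
  then show ?thesis using s s' b by simp
qed

context
  fixes V :: "('k, 'v, 'b) module_scheme" and lam rho \<phi> w
  assumes comodule: "comodule_maps V lam rho" and phi: "\<phi> \<in> dual V" and w: "w \<in> carrier V"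
begin

interpretation V: module K V by (rule comodule_lin[OF comodule])

private abbreviation "XM \<equiv> rslice K V A lam"
private abbreviation "YM \<equiv> rslice K V A rho"

private lemma cl: "module K V" "lam \<in> lin_map K (V \<boxtimes> A) (V \<boxtimes> A)"
  "rho \<in> lin_map K (V \<boxtimes> A) (V \<boxtimes> A)"
  "\<And>\<beta> p v. \<beta> \<in> dual A \<Longrightarrow> p \<in> carrier A \<Longrightarrow> v \<in> carrier V \<Longrightarrow> XM \<beta> p v \<in> carrier V"
  "\<And>\<beta> p v. \<beta> \<in> dual A \<Longrightarrow> p \<in> carrier A \<Longrightarrow> v \<in> carrier V \<Longrightarrow> YM \<beta> p v \<in> carrier V"
  using comodule_lin[OF comodule] XV_closed[OF comodule] YV_closed[OF comodule] by auto

text \<open>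
  The images of \<open>lam (w \<otimes> q)\<close> and \<open>rho (w \<otimes> q)\<close> under \<open>\<phi> \<otimes> A\<close>. They turn \<open>\<phi>\<close> of a slice of
  \<open>lam\<close> or \<open>rho\<close> into the value of a functional at an element of \<open>A\<close>.
\<close>

private definition "k q = contract_left K A \<phi> (lam (pure_tensor K V A w q))"
private definition "h q = contract_left K A \<phi> (rho (pure_tensor K V A w q))"

private lemma pure_VA: "v \<in> carrier V \<Longrightarrow> q \<in> carrier A \<Longrightarrow> pure_tensor K V A v q \<in> carrier (V \<boxtimes> A)"
  by (rule pure_closed[OF V.module_axioms module_A])

private lemma kh_closed: "q \<in> carrier A \<Longrightarrow> k q \<in> carrier A" "q \<in> carrier A \<Longrightarrow> h q \<in> carrier A"
  unfolding k_def h_def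
  by (auto intro!: lin_closed[OF contract_left_lin[OF V.module_axioms module_A phi]] lin_closed[OF cl(2)] lin_closed[OF cl(3)] pure_VA w)

private lemma phi_XM: "\<beta> \<in> dual A \<Longrightarrow> q \<in> carrier A \<Longrightarrow> \<phi> (XM \<beta> q w) = \<beta> (k q)"
  unfolding k_def rslice_def
  by (rule contract_comm[OF V.module_axioms module_A phi]) (auto intro!: lin_closed[OF cl(2)] pure_VA w)

private lemma phi_YM: "\<beta> \<in> dual A \<Longrightarrow> q \<in> carrier A \<Longrightarrow> \<phi> (YM \<beta> q w) = \<beta> (h q)"
  unfolding h_def rslice_def
  by (rule contract_comm[OF V.module_axioms module_A phi]) (auto intro!: lin_closed[OF cl(3)] pure_VA w)

private lemma mul_k: "a \<in> carrier A \<Longrightarrow> x \<in> carrier A \<Longrightarrow> a \<star> k x = h a \<star> x"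
proof (rule A_eqI)
  fix \<beta> assume "a \<in> carrier A" "x \<in> carrier A" "\<beta> \<in> dual A"
  then show "\<beta> (a \<star> k x) = \<beta> (h a \<star> x)"
    using XV_YV[OF comodule, of \<beta> a x w] w phi_XM[of "\<lambda>u. \<beta> (a \<star> u)" x] phi_YM[of "\<lambda>u. \<beta> (u \<star> x)" a] by simp
qed (simp_all add: kh_closed)

private lemma YM_bilin:
  "\<beta> \<in> dual A \<Longrightarrow> \<gamma> \<in> dual A \<Longrightarrow> bilin_map K A A V (\<lambda>p q. YM \<beta> p (YM \<gamma> q w))"
  by (rule bilinI) (intro lin_intros module_A cl w; simp)+

private lemma bilin_cov:
  assumes "\<beta> \<in> dual A" "\<gamma> \<in> dual A" "c \<in> carrier A" "d \<in> carrier A"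
  shows "bilin_map K A A V (\<lambda>p q. XM (\<lambda>u. \<beta> (p \<star> u)) c (XM (\<lambda>u. \<gamma> (q \<star> u)) d w))"
  by (rule bilin_cong[OF module_A module_A YM_bilin[of "\<lambda>u. \<beta> (u \<star> c)" "\<lambda>u. \<gamma> (u \<star> d)"]])
    (use assms w cl in \<open>simp_all add: XV_YV[OF comodule]\<close>)

text \<open>
  The value of \<open>\<phi>\<close> at an iterated slice of \<open>lam\<close>, with the legs of \<open>t\<close> as arguments and covered by \<open>p\<close> and \<open>q\<close> in
  the functionals. For \<open>t = e1 (c \<otimes> d)\<close> it comes from the iterated slice of \<open>rho\<close> at \<open>p\<close> and
  \<open>q\<close>, covered by \<open>c\<close> and \<open>d\<close>; for \<open>t = gen x y z\<close> the axiom for \<open>t1\<close> reduces it to a single slice.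
\<close>

private definition "G \<beta> \<gamma> t p q = \<phi> (tensor_lift K V (\<lambda>c d. XM (\<lambda>u. \<beta> (p \<star> u)) c (XM (\<lambda>u. \<gamma> (q \<star> u)) d w)) t)"

private lemma G_lin:
  assumes "\<beta> \<in> dual A" "\<gamma> \<in> dual A" "p \<in> carrier A" "q \<in> carrier A"
  shows "(\<lambda>t. G \<beta> \<gamma> t p q) \<in> lin_map K AA (scalars K)"
  unfolding G_def
  by (rule lin_comp[OF phi tensor_lift_lin[OF module_A module_A V.module_axioms XV_bilin[OF comodule]]]) (use assms w in simp_all)

private lemma G_bilin:
  assumes "\<beta> \<in> dual A" "\<gamma> \<in> dual A" "t \<in> carrier AA"
  shows "bilin_map K A A (scalars K) (G \<beta> \<gamma> t)"
proof (rule bilinI)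
  note cov = bilin_cov[OF assms(1,2)]
  have x: "bilin_map K A A V (\<lambda>c d. XM (\<lambda>u. \<beta> (p \<star> u)) c (XM (\<lambda>u. \<gamma> (q \<star> u)) d w))"
    if "p \<in> carrier A" "q \<in> carrier A" for p q
    using XV_bilin[OF comodule] that assms w by simp
  show "G \<beta> \<gamma> t p \<in> lin_map K A (scalars K)" if "p \<in> carrier A" for p
    unfolding G_def[abs_def]
    by (rule lin_comp[OF phi], rule lin_lift_param) (use assms that x in \<open>auto simp: V.module_axioms intro: bilinD1[OF cov]\<close>)
  show "(\<lambda>p. G \<beta> \<gamma> t p q) \<in> lin_map K A (scalars K)" if "q \<in> carrier A" for q
    unfolding G_def[abs_def]
    by (rule lin_comp[OF phi], rule lin_lift_param) (use assms that x in \<open>auto simp: V.module_axioms intro: bilinD2[OF cov]\<close>)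
qed

private lemma G_e1:
  assumes "\<beta> \<in> dual A" "\<gamma> \<in> dual A" "p \<in> carrier A" "q \<in> carrier A" "c \<in> carrier A" "d \<in> carrier A"
  shows "G \<beta> \<gamma> (e1 (pure_tensor K A A c d)) p q = \<phi> (YM (\<lambda>u. \<beta> (u \<star> c)) p (YM (\<lambda>u. \<gamma> (u \<star> d)) q w))"
  using assms w cl by (simp add: G_def XV_e1[OF comodule] XV_YV[OF comodule])

private lemma G_gen:
  assumes "\<beta> \<in> dual A" "\<gamma> \<in> dual A" "p \<in> carrier A" "q \<in> carrier A" "x \<in> carrier A" "y \<in> carrier A" "z \<in> carrier A"
  shows "G \<beta> \<gamma> (gen x y z) p q = \<beta> ((p \<star> Y (\<lambda>u. \<gamma> (u \<star> z)) q (k x)) \<star> y)"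
proof -
  have f: "(\<lambda>u. \<beta> (p \<star> (X (\<lambda>u. \<gamma> (q \<star> u)) z u \<star> y))) \<in> dual A"
    using assms by (intro lin_comp[OF assms(1)]) (auto intro!: lin_intros)
  have "G \<beta> \<gamma> (gen x y z) p q = \<phi> (XM (\<lambda>u. \<beta> (p \<star> (X (\<lambda>u. \<gamma> (q \<star> u)) z u \<star> y))) x w)"
    using assms w by (simp add: G_def XV_gen[OF comodule])
  also have "\<dots> = \<beta> (p \<star> (X (\<lambda>u. \<gamma> (q \<star> u)) z (k x) \<star> y))"
    using assms f by (simp add: phi_XM)
  finally show ?thesis using assms by (simp add: T13 mul_assoc kh_closed)
qed

private lemma H_gen:
  assumes "\<beta> \<in> dual A" "\<gamma> \<in> dual A" "s \<in> carrier AA" "x \<in> carrier A" "y \<in> carrier A" "z \<in> carrier A"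
  shows "tensor_lift K (scalars K) (G \<beta> \<gamma> (gen x y z)) s
    = \<beta> (tensor_lift K A (\<lambda>p q. p \<star> Y (\<lambda>u. \<gamma> (u \<star> z)) q (k x)) s \<star> y)"
proof -
  have "tensor_lift K (scalars K) (G \<beta> \<gamma> (gen x y z)) s
      = tensor_lift K (scalars K) (\<lambda>p q. \<beta> ((p \<star> Y (\<lambda>u. \<gamma> (u \<star> z)) q (k x)) \<star> y)) s"
    using assms by (intro tensor_lift_cong[OF module_A module_A scalars_module G_bilin]) (auto simp: G_gen)
  also have "\<dots> = \<beta> (tensor_lift K A (\<lambda>p q. p \<star> Y (\<lambda>u. \<gamma> (u \<star> z)) q (k x)) s \<star> y)"
    using assms
    by (intro lin_lift_comp[of A A A "scalars K" _ "\<lambda>u. \<beta> (u \<star> y)", symmetric]) (auto intro!: bilinI lin_intros simp: kh_closed)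
  finally show ?thesis .
qed

private lemma H_lin:
  assumes "\<beta> \<in> dual A" "\<gamma> \<in> dual A" "s \<in> carrier AA"
  shows "(\<lambda>t. tensor_lift K (scalars K) (G \<beta> \<gamma> t) s) \<in> lin_map K AA (scalars K)"
  by (rule lin_lift_param) (use assms in \<open>auto intro: G_bilin G_lin\<close>)

private lemma H_e1:
  assumes "\<beta> \<in> dual A" "\<gamma> \<in> dual A" "s \<in> carrier AA" "c \<in> carrier A" "d \<in> carrier A"
  shows "tensor_lift K (scalars K) (G \<beta> \<gamma> (e1 (pure_tensor K A A c d))) s
    = \<phi> (tensor_lift K V (\<lambda>p q. YM (\<lambda>u. \<beta> (u \<star> c)) p (YM (\<lambda>u. \<gamma> (u \<star> d)) q w)) s)"
proof -
  have "tensor_lift K (scalars K) (G \<beta> \<gamma> (e1 (pure_tensor K A A c d))) s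
      = tensor_lift K (scalars K) (\<lambda>p q. \<phi> (YM (\<lambda>u. \<beta> (u \<star> c)) p (YM (\<lambda>u. \<gamma> (u \<star> d)) q w))) s"
    using assms by (intro tensor_lift_cong[OF module_A module_A scalars_module G_bilin]) (auto simp: G_e1)
  also have "\<dots> = \<phi> (tensor_lift K V (\<lambda>p q. YM (\<lambda>u. \<beta> (u \<star> c)) p (YM (\<lambda>u. \<gamma> (u \<star> d)) q w)) s)"
    using assms by (intro lin_lift_comp[OF module_A module_A V.module_axioms scalars_module YM_bilin phi, symmetric]) auto
  finally show ?thesis .
qed

text \<open>
  Both sides are linear in \<open>e1 (c \<otimes> d)\<close>. When this is replaced by a generator of the range of
  \<open>e1\<close>, the claim reduces to \<open>Y_e2\<close>.
\<close>

private lemma e2_covered: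
  assumes bg: "\<beta> \<in> dual A" "\<gamma> \<in> dual A" and ab: "a \<in> carrier A" "b \<in> carrier A" and cd: "c \<in> carrier A" "d \<in> carrier A"
  shows "\<phi> (tensor_lift K V (\<lambda>p q. YM (\<lambda>u. \<beta> (u \<star> c)) p (YM (\<lambda>u. \<gamma> (u \<star> d)) q w)) (e2 (pure_tensor K A A a b)))
    = \<phi> (YM (\<lambda>u. \<beta> (u \<star> c)) a (YM (\<lambda>u. \<gamma> (u \<star> d)) b w))"
proof -
  have "tensor_lift K (scalars K) (G \<beta> \<gamma> (e1 (pure_tensor K A A c d))) (e2 (pure_tensor K A A a b))
      = G \<beta> \<gamma> (e1 (pure_tensor K A A c d)) a b"
  proof (rule lin_eq_on_e1[OF scalars_module _ _ _ cd,
        where f = "\<lambda>t. tensor_lift K (scalars K) (G \<beta> \<gamma> t) (e2 (pure_tensor K A A a b))" and g = "\<lambda>t. G \<beta> \<gamma> t a b"])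
    show "(\<lambda>t. tensor_lift K (scalars K) (G \<beta> \<gamma> t) (e2 (pure_tensor K A A a b))) \<in> lin_map K AA (scalars K)"
      using assms by (intro H_lin) auto
    show "(\<lambda>t. G \<beta> \<gamma> t a b) \<in> lin_map K AA (scalars K)" using assms by (intro G_lin)
    show "tensor_lift K (scalars K) (G \<beta> \<gamma> (gen x y z)) (e2 (pure_tensor K A A a b)) = G \<beta> \<gamma> (gen x y z) a b"
      if "x \<in> carrier A" "y \<in> carrier A" "z \<in> carrier A" for x y z
      using assms that by (simp add: H_gen G_gen Y_e2 kh_closed)
  qed
  then show ?thesis using assms by (simp add: H_e1 G_e1)
qed

text \<open>
  As for \<open>e2_covered\<close>, with \<open>Y_mult\<close> and \<open>X_mult\<close> in the place of \<open>Y_e2\<close>.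
\<close>

private lemma t3_covered:
  assumes bg: "\<beta> \<in> dual A" "\<gamma> \<in> dual A" and ab: "a \<in> carrier A" "b \<in> carrier A" and cd: "c \<in> carrier A" "d \<in> carrier A"
  shows "\<phi> (tensor_lift K V (\<lambda>p q. YM (\<lambda>u. \<beta> (u \<star> c)) p (YM (\<lambda>u. \<gamma> (u \<star> d)) q w)) (t3 (pure_tensor K A A a b)))
    = \<beta> (Y (\<lambda>u. \<gamma> (u \<star> d)) b (h a) \<star> c)"
proof -
  let ?x = "\<lambda>p q. X (\<lambda>u. \<gamma> (b \<star> u)) q (h a) \<star> p"
  have bil: "bilin_map K A A A ?x" using assms by (intro X_mul_bilin) (auto simp: kh_closed)
  have "tensor_lift K (scalars K) (G \<beta> \<gamma> (e1 (pure_tensor K A A c d))) (t3 (pure_tensor K A A a b))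
      = \<beta> (tensor_lift K A ?x (e1 (pure_tensor K A A c d)))"
  proof (rule lin_eq_on_e1[OF scalars_module _ _ _ cd,
        where f = "\<lambda>t. tensor_lift K (scalars K) (G \<beta> \<gamma> t) (t3 (pure_tensor K A A a b))" and g = "\<lambda>t. \<beta> (tensor_lift K A ?x t)"])
    show "(\<lambda>t. tensor_lift K (scalars K) (G \<beta> \<gamma> t) (t3 (pure_tensor K A A a b))) \<in> lin_map K AA (scalars K)"
      using assms by (intro H_lin) auto
    show "(\<lambda>t. \<beta> (tensor_lift K A ?x t)) \<in> lin_map K AA (scalars K)"
      by (rule lin_comp[OF bg(1) tensor_lift_lin[OF module_A module_A module_A bil]])
    fix x y z assume x: "x \<in> carrier A" "y \<in> carrier A" "z \<in> carrier A"
    have "tensor_lift K A ?x (gen x y z) = tensor_lift K A (\<lambda>p q. ?x (p \<star> y) q) (t1 (pure_tensor K A A x z))"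
      using x by (intro lift_gen bil) auto
    also have "\<dots> = tensor_lift K A (\<lambda>p q. ?x p q \<star> y) (t1 (pure_tensor K A A x z))"
      using assms x by (intro tensor_lift_cong[OF module_A module_A module_A]) (auto intro!: bilinI lin_intros simp: kh_closed mul_assoc)
    also have "\<dots> = tensor_lift K A ?x (t1 (pure_tensor K A A x z)) \<star> y"
      using x by (intro lin_lift_comp[OF module_A module_A module_A module_A bil, symmetric]) (auto intro!: lin_intros)
    also have "\<dots> = Y (\<lambda>u. \<gamma> (u \<star> z)) b (a \<star> k x) \<star> y"
      using assms x by (simp add: X_mult kh_closed mul_k T13)
    finally show "tensor_lift K (scalars K) (G \<beta> \<gamma> (gen x y z)) (t3 (pure_tensor K A A a b)) = \<beta> (tensor_lift K A ?x (gen x y z))"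
      using assms x by (simp add: H_gen Y_mult kh_closed)
  qed
  then show ?thesis using assms by (simp add: H_e1 X_e1 kh_closed T13)
qed

private lemma YM_rep:
  assumes s: "s \<in> carrier AA"
  shows "\<gamma> \<in> dual A \<Longrightarrow> \<exists>x\<in>carrier A. \<forall>\<beta>\<in>dual A. \<phi> (tensor_lift K V (\<lambda>p q. YM \<beta> p (YM \<gamma> q w)) s) = \<beta> x"
    and "\<beta> \<in> dual A \<Longrightarrow> \<exists>x\<in>carrier A. \<forall>\<gamma>\<in>dual A. \<phi> (tensor_lift K V (\<lambda>p q. YM \<beta> p (YM \<gamma> q w)) s) = \<gamma> x"
proof -
  assume g: "\<gamma> \<in> dual A"
  let ?b = "\<lambda>p q. contract_left K A \<phi> (rho (pure_tensor K V A (YM \<gamma> q w) p))"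
  have bil: "bilin_map K A A A ?b"
    by (rule bilinI; rule lin_comp[OF contract_left_lin[OF V.module_axioms module_A phi]]; rule lin_comp[OF cl(3)])
      (use g w cl in \<open>auto intro!: lin_intros\<close>)
  have "\<phi> (tensor_lift K V (\<lambda>p q. YM \<beta> p (YM \<gamma> q w)) s) = \<beta> (tensor_lift K A ?b s)" if b: "\<beta> \<in> dual A" for \<beta>
  proof -
    have "\<phi> (tensor_lift K V (\<lambda>p q. YM \<beta> p (YM \<gamma> q w)) s) = tensor_lift K (scalars K) (\<lambda>p q. \<phi> (YM \<beta> p (YM \<gamma> q w))) s"
      by (rule lin_lift_comp[OF module_A module_A V.module_axioms scalars_module YM_bilin[OF b g] phi s])
    also have "\<dots> = tensor_lift K (scalars K) (\<lambda>p q. \<beta> (?b p q)) s"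
    proof (rule tensor_lift_cong[OF module_A module_A scalars_module _ _ s])
      show "bilin_map K A A (scalars K) (\<lambda>p q. \<phi> (YM \<beta> p (YM \<gamma> q w)))"
        by (intro bilinI lin_comp[OF phi] bilinD1[OF YM_bilin[OF b g]] bilinD2[OF YM_bilin[OF b g]])
      fix p q assume "p \<in> carrier A" "q \<in> carrier A"
      then show "\<phi> (YM \<beta> p (YM \<gamma> q w)) = \<beta> (?b p q)"
        unfolding rslice_def[of K V A rho \<beta>]
        by (intro contract_comm[OF V.module_axioms module_A phi b]) (auto intro!: lin_closed[OF cl(3)] pure_VA cl(5) g w)
    qed
    also have "\<dots> = \<beta> (tensor_lift K A ?b s)"
      by (rule lin_lift_comp[OF module_A module_A module_A scalars_module bil b s, symmetric])
    finally show ?thesis .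
  qed
  moreover have "tensor_lift K A ?b s \<in> carrier A"
    by (rule lin_closed[OF tensor_lift_lin[OF module_A module_A module_A bil] s])
  ultimately show "\<exists>x\<in>carrier A. \<forall>\<beta>\<in>dual A. \<phi> (tensor_lift K V (\<lambda>p q. YM \<beta> p (YM \<gamma> q w)) s) = \<beta> x" by blast
next
  assume b: "\<beta> \<in> dual A"
  let ?f = "\<lambda>p v. \<phi> (YM \<beta> p v)"
  have f: "?f p \<in> dual V" if "p \<in> carrier A" for p
    by (rule lin_comp[OF phi]) (use b that cl in \<open>auto intro!: lin_intros\<close>)
  let ?b = "\<lambda>p q. contract_left K A (?f p) (rho (pure_tensor K V A w q))"
  have bil: "bilin_map K A A A ?b"
  proof (rule bilinI)
    show "?b p \<in> lin_map K A A" if "p \<in> carrier A" for p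
      by (rule lin_comp[OF contract_left_lin[OF V.module_axioms module_A f[OF that]]], rule lin_comp[OF cl(3)])
        (use w in \<open>auto intro!: lin_intros simp: V.module_axioms\<close>)
    have t: "rho (pure_tensor K V A w q) \<in> carrier (V \<boxtimes> A)" if "q \<in> carrier A" for q
      by (rule lin_closed[OF cl(3) pure_VA[OF w that]])
    show "(\<lambda>p. ?b p q) \<in> lin_map K A A" if "q \<in> carrier A" for q
      unfolding contract_left_def
      by (rule lin_lift_param[OF V.module_axioms module_A module_A module_A _ _ t[OF that]])
        (use f b cl in \<open>auto intro!: contract_left_bilin lin_intros lin_comp[OF phi]\<close>)
  qed
  have "\<phi> (tensor_lift K V (\<lambda>p q. YM \<beta> p (YM \<gamma> q w)) s) = \<gamma> (tensor_lift K A ?b s)" if g: "\<gamma> \<in> dual A" for \<gamma>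
  proof -
    have "\<phi> (tensor_lift K V (\<lambda>p q. YM \<beta> p (YM \<gamma> q w)) s) = tensor_lift K (scalars K) (\<lambda>p q. \<phi> (YM \<beta> p (YM \<gamma> q w))) s"
      by (rule lin_lift_comp[OF module_A module_A V.module_axioms scalars_module YM_bilin[OF b g] phi s])
    also have "\<dots> = tensor_lift K (scalars K) (\<lambda>p q. \<gamma> (?b p q)) s"
    proof (rule tensor_lift_cong[OF module_A module_A scalars_module _ _ s])
      show "bilin_map K A A (scalars K) (\<lambda>p q. \<phi> (YM \<beta> p (YM \<gamma> q w)))"
        by (intro bilinI lin_comp[OF phi] bilinD1[OF YM_bilin[OF b g]] bilinD2[OF YM_bilin[OF b g]])
      fix p q assume pq: "p \<in> carrier A" "q \<in> carrier A"
      have "?f p (contract_right K V \<gamma> (rho (pure_tensor K V A w q))) = \<gamma> (?b p q)"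
        by (rule contract_comm[OF V.module_axioms module_A f[OF pq(1)] g]) (auto intro!: lin_closed[OF cl(3)] pure_VA w pq)
      then show "\<phi> (YM \<beta> p (YM \<gamma> q w)) = \<gamma> (?b p q)" by (simp add: rslice_def[of K V A rho \<gamma>])
    qed
    also have "\<dots> = \<gamma> (tensor_lift K A ?b s)"
      by (rule lin_lift_comp[OF module_A module_A module_A scalars_module bil g s, symmetric])
    finally show ?thesis .
  qed
  moreover have "tensor_lift K A ?b s \<in> carrier A"
    by (rule lin_closed[OF tensor_lift_lin[OF module_A module_A module_A bil] s])
  ultimately show "\<exists>x\<in>carrier A. \<forall>\<gamma>\<in>dual A. \<phi> (tensor_lift K V (\<lambda>p q. YM \<beta> p (YM \<gamma> q w)) s) = \<gamma> x" by blast
qed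

lemma phi_YM_e2:
  assumes "\<beta> \<in> dual A" "\<gamma> \<in> dual A" and ab: "a \<in> carrier A" "b \<in> carrier A"
  shows "\<phi> (tensor_lift K V (\<lambda>p q. YM \<beta> p (YM \<gamma> q w)) (e2 (pure_tensor K A A a b))) = \<phi> (YM \<beta> a (YM \<gamma> b w))"
proof (rule dual_rep_ext[OF _ _ _ _ _ assms(1,2)])
  have *: "\<phi> (YM \<beta> a (YM \<gamma> b w)) = \<phi> (tensor_lift K V (\<lambda>p q. YM \<beta> p (YM \<gamma> q w)) (pure_tensor K A A a b))"
    if "\<beta> \<in> dual A" "\<gamma> \<in> dual A" for \<beta> \<gamma>
    using that ab by (simp add: tensor_lift_pure[OF module_A module_A V.module_axioms YM_bilin])
  show "\<exists>s\<in>carrier A. \<forall>\<beta>\<in>dual A. \<phi> (YM \<beta> a (YM \<gamma> b w)) = \<beta> s" if "\<gamma> \<in> dual A" for \<gamma>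
    using YM_rep(1)[OF pure_AA[OF ab] that] * that by simp
  show "\<exists>s\<in>carrier A. \<forall>\<gamma>\<in>dual A. \<phi> (YM \<beta> a (YM \<gamma> b w)) = \<gamma> s" if "\<beta> \<in> dual A" for \<beta>
    using YM_rep(2)[OF pure_AA[OF ab] that] * that by simp
qed (use ab in \<open>auto intro!: YM_rep e2_covered\<close>)

lemma phi_YM_t3:
  assumes "\<beta> \<in> dual A" "\<gamma> \<in> dual A" and ab: "a \<in> carrier A" "b \<in> carrier A"
  shows "\<phi> (tensor_lift K V (\<lambda>p q. YM \<beta> p (YM \<gamma> q w)) (t3 (pure_tensor K A A a b))) = \<phi> (YM (\<lambda>u. \<beta> (Y \<gamma> b u)) a w)"
proof -
  have "\<phi> (tensor_lift K V (\<lambda>p q. YM \<beta> p (YM \<gamma> q w)) (t3 (pure_tensor K A A a b))) = \<beta> (Y \<gamma> b (h a))"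
  proof (rule dual_rep_ext[OF _ _ _ _ _ assms(1,2)])
    show "\<exists>s\<in>carrier A. \<forall>\<beta>\<in>dual A. \<beta> (Y \<gamma> b (h a)) = \<beta> s" if "\<gamma> \<in> dual A" for \<gamma>
      using that ab by (intro bexI[of _ "Y \<gamma> b (h a)"]) (auto simp: kh_closed)
    show "\<exists>s\<in>carrier A. \<forall>\<gamma>\<in>dual A. \<beta> (Y \<gamma> b (h a)) = \<gamma> s" if bd: "\<beta> \<in> dual A" for \<beta>
    proof (rule bexI, rule ballI)
      show "contract_left K A \<beta> (t3 (pure_tensor K A A (h a) b)) \<in> carrier A"
        using ab by (intro lin_closed[OF contract_left_lin[OF module_A module_A bd]]) (auto simp: kh_closed)
      show "\<beta> (Y \<gamma> b (h a)) = \<gamma> (contract_left K A \<beta> (t3 (pure_tensor K A A (h a) b)))" if "\<gamma> \<in> dual A" for \<gamma>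
        unfolding Y_def rslice_def by (rule contract_comm[OF module_A module_A bd that]) (use ab in \<open>auto simp: kh_closed\<close>)
    qed
  qed (use ab in \<open>auto intro!: YM_rep t3_covered\<close>)
  then show ?thesis using assms phi_YM[OF op.dual_X[OF assms(1,2) ab(2)] ab(1)] by simp
qed

end

text \<open>
  The comodule axioms do not mention how \<open>rho\<close> interacts with \<open>e2\<close> and \<open>t3\<close>. Covered
  functionals express the slices of \<open>rho\<close> by those of \<open>lam\<close>, which gives the missing axioms up to
  factors that \<open>dual_rep_ext\<close> removes. So \<open>V\<close> is also a comodule over the opposite structure.
\<close>

lemma comodule_maps_op:
  assumes V: "comodule_maps V lam rho"
  shows "op.comodule_maps V rho lam"
proof -
  note cl = comodule_lin[OF V] YV_closed[OF V]
  have bil: "bilin_map K A A V (\<lambda>p q. rslice K V A rho \<beta> p (rslice K V A rho \<gamma> q v))"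
    if "\<beta> \<in> dual A" "\<gamma> \<in> dual A" "v \<in> carrier V" for \<beta> \<gamma> v
    by (rule bilinI) (use that cl in \<open>auto intro!: lin_intros\<close>)
  have t: "tensor_lift K V (\<lambda>p q. rslice K V A rho \<beta> p (rslice K V A rho \<gamma> q v)) s \<in> carrier V"
    if "\<beta> \<in> dual A" "\<gamma> \<in> dual A" "v \<in> carrier V" "s \<in> carrier AA" for \<beta> \<gamma> v s
    by (rule lin_closed[OF tensor_lift_lin[OF module_A module_A cl(1) bil]]) (use that in auto)
  have 1: "tensor_lift K V (\<lambda>p q. rslice K V A rho \<beta> p (rslice K V A rho \<gamma> q v)) (e2 (pure_tensor K A A a b))
      = rslice K V A rho \<beta> a (rslice K V A rho \<gamma> b v)"
    if "\<beta> \<in> dual A" "\<gamma> \<in> dual A" "v \<in> carrier V" "a \<in> carrier A" "b \<in> carrier A" for \<beta> \<gamma> v a b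
    by (rule dual_eqI[OF cl(1)]) (use that t cl in \<open>auto simp: phi_YM_e2[OF V]\<close>)
  have 2: "tensor_lift K V (\<lambda>p q. rslice K V A rho \<beta> p (rslice K V A rho \<gamma> q v)) (t3 (pure_tensor K A A a b))
      = rslice K V A rho (\<lambda>u. \<beta> (Y \<gamma> b u)) a v"
    if "\<beta> \<in> dual A" "\<gamma> \<in> dual A" "v \<in> carrier V" "a \<in> carrier A" "b \<in> carrier A" for \<beta> \<gamma> v a b
    by (rule dual_eqI[OF cl(1)]) (use that t cl op.dual_X in \<open>auto simp: phi_YM_t3[OF V]\<close>)
  show ?thesis
    unfolding op.comodule_maps_def using 1 2 cl XV_YV[OF V] by simp
qed

end

context wmb_slices
begin

interpretation A: module K A by (rule module_A)

interpretation op: wmb_slices K A "\<lambda>a b. b \<star> a" \<epsilon> e2 e1 t3 t4 t1 t2 Y X W Z Fl Fr El Er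
  by (rule opposite) (simp_all add: X_def Y_def Z_def W_def El_def Er_def Fl_def Fr_def)

lemma A_comodule: "comodule_maps A t1 t3"
  unfolding comodule_maps_def
  using T13 XX_e1 XX_t1
  by (simp add: X_def[symmetric] Y_def[symmetric])

lemma A_full: "full_slices A t1" "full_slices A t3"
  using full_X full_Y by (simp_all add: full_slices_def X_def Y_def)

lemmas X_eps_X = XV_eps_XV[OF A_comodule, folded X_def]

section \<open>The maps into the base algebra\<close>

text \<open>
  Writing \<open>Z \<alpha> d (c \<star> _)\<close> by \<open>Z_mult\<close>, with the comultiplication of \<open>c\<close> outside, brings the
  factor \<open>z\<close> next to the slice. There it can be moved into the argument \<open>b\<close>, by \<open>eps_mul_X_mul\<close>,
  after which \<open>Z_mult\<close> is applied backwards.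
\<close>

lemma X_eps_mul_generator:
  assumes b: "\<beta> \<in> dual A" "b \<in> carrier A" "c \<in> carrier A" "w \<in> carrier A" "z \<in> carrier A"
  shows "X \<epsilon> z (c \<star> X \<beta> b w) = c \<star> X \<epsilon> z (X \<beta> b w)"
proof (rule cancel_left_dual)
  fix d \<alpha> assume d: "d \<in> carrier A" "\<alpha> \<in> dual A"
  let ?e = "El \<epsilon> z b"
  have bil: "bilin_map K A A (scalars K) (\<lambda>p q. \<epsilon> (q \<star> Z \<alpha> p (X \<beta> ?e w)))"
    using assms d by (intro bilinI lin_comp[OF eps_dual]) (auto intro!: lin_intros)
  have "\<alpha> (d \<star> X \<epsilon> z (c \<star> X \<beta> b w)) = \<epsilon> (Z \<alpha> d (c \<star> X \<beta> b w) \<star> z)"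
    using assms d by (simp add: T12)
  also have "\<dots> = tensor_lift K (scalars K) (\<lambda>p q. \<epsilon> (q \<star> Z \<alpha> p (X \<beta> b w) \<star> z)) (t2 (pure_tensor K A A d c))"
    using assms d Z_mult[of "\<lambda>u. \<epsilon> (u \<star> z)" \<alpha> c d "X \<beta> b w"] by simp
  also have "\<dots> = tensor_lift K (scalars K) (\<lambda>p q. \<epsilon> (q \<star> Z \<alpha> p (X \<beta> ?e w))) (t2 (pure_tensor K A A d c))"
    by (rule tensor_lift_cong[OF module_A module_A scalars_module bil, symmetric])
      (use assms d in \<open>simp_all add: ZX mul_assoc eps_mul_X_mul T12\<close>)
  also have "\<dots> = \<epsilon> (Z \<alpha> d (c \<star> X \<beta> ?e w))"
    using assms d by (simp add: Z_mult)
  also have "\<dots> = \<alpha> (d \<star> (c \<star> X \<epsilon> z (X \<beta> b w)))"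
    using assms d by (simp add: eps_Z X_eps_X)
  finally show "\<alpha> (d \<star> X \<epsilon> z (c \<star> X \<beta> b w)) = \<alpha> (d \<star> (c \<star> X \<epsilon> z (X \<beta> b w)))" .
qed (use assms in simp_all)

text \<open>
  The slice \<open>X \<epsilon> z\<close> is the right component of a multiplier, so it has to be left linear. Since
  the slices of \<open>t1\<close> span \<open>A\<close>, the previous lemma suffices.
\<close>

lemma X_eps_mul:
  assumes c: "c \<in> carrier A" and z: "z \<in> carrier A" and x: "x \<in> carrier A"
  shows "X \<epsilon> z (c \<star> x) = c \<star> X \<epsilon> z x"
proof (rule lin_eq_on_span[OF module_A module_A,
      where f = "\<lambda>x. X \<epsilon> z (c \<star> x)" and g = "\<lambda>x. c \<star> X \<epsilon> z x"])
  show "(\<lambda>x. X \<epsilon> z (c \<star> x)) \<in> lin_map K A A" "(\<lambda>x. c \<star> X \<epsilon> z x) \<in> lin_map K A A"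
    using c z by (auto intro!: lin_intros)
  show "x \<in> span_of K A {X \<beta> d u | \<beta> d u. \<beta> \<in> dual A \<and> d \<in> carrier A \<and> u \<in> carrier A}"
    using x full_X by simp
qed (use c z X_eps_mul_generator in auto)

text \<open>
  The compatibility condition of the two components of the multiplier \<open>barR a\<close>. By \<open>X_e1\<close> both
  sides are linear in \<open>e1 (b \<otimes> a)\<close>, and on the generators the claim comes down to \<open>X_eps_mul\<close>.
\<close>

lemma mul_Er:
  assumes "a \<in> carrier A" "b \<in> carrier A" "c \<in> carrier A"
  shows "c \<star> Er \<epsilon> a b = X \<epsilon> a c \<star> b"
proof -
  have "c \<star> contract_right K A \<epsilon> (e1 (pure_tensor K A A b a))
      = tensor_lift K A (\<lambda>p q. X \<epsilon> q c \<star> p) (e1 (pure_tensor K A A b a))"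
  proof (rule lin_eq_on_e1[of A])
    show "(\<lambda>t. c \<star> contract_right K A \<epsilon> t) \<in> lin_map K AA A"
      using assms by (intro lin_intros contract_right_lin) auto
    show "tensor_lift K A (\<lambda>p q. X \<epsilon> q c \<star> p) \<in> lin_map K AA A"
      using assms by (intro tensor_lift_lin X_mul_bilin) auto
    fix x y z assume x: "x \<in> carrier A" "y \<in> carrier A" "z \<in> carrier A"
    have "tensor_lift K A (\<lambda>p q. X \<epsilon> q c \<star> p) (gen x y z)
        = tensor_lift K A (\<lambda>p q. X \<epsilon> q c \<star> (p \<star> y)) (t1 (pure_tensor K A A x z))"
      using assms x by (intro lift_gen X_mul_bilin) auto
    also have "\<dots> = tensor_lift K A (\<lambda>p q. (X \<epsilon> q c \<star> p) \<star> y) (t1 (pure_tensor K A A x z))"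
    proof (rule tensor_lift_cong[OF module_A module_A module_A])
      show "bilin_map K A A A (\<lambda>p q. X \<epsilon> q c \<star> (p \<star> y))"
        using assms x by (intro bilinI) (auto intro!: lin_intros)
    qed (use assms x in \<open>simp_all add: mul_assoc\<close>)
    also have "\<dots> = tensor_lift K A (\<lambda>p q. X \<epsilon> q c \<star> p) (t1 (pure_tensor K A A x z)) \<star> y"
      using assms x by (intro lin_lift_comp[of A A A A _ "\<lambda>u. u \<star> y", symmetric] X_mul_bilin) (auto intro!: lin_intros)
    also have "\<dots> = c \<star> contract_right K A \<epsilon> (gen x y z)"
      using assms x by (simp add: X_mult contract_right_gen X_eps_mul mul_assoc)
    finally show "c \<star> contract_right K A \<epsilon> (gen x y z) = tensor_lift K A (\<lambda>p q. X \<epsilon> q c \<star> p) (gen x y z)" by simp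
  qed (use assms in auto)
  then show ?thesis using assms by (simp add: X_e1 Er_def rslice_def)
qed

lemma El_zero:
  assumes a: "a \<in> carrier A" "b \<in> carrier A" and z: "\<And>c. c \<in> carrier A \<Longrightarrow> \<epsilon> (c \<star> a) = \<zero>"
  shows "El \<epsilon> a b = \<zero>\<^bsub>A\<^esub>"
proof (rule cancel_left_dual)
  fix c \<beta> assume "c \<in> carrier A" "\<beta> \<in> dual A"
  then show "\<beta> (c \<star> El \<epsilon> a b) = \<beta> (c \<star> \<zero>\<^bsub>A\<^esub>)"
    using a z eps_X_mul[of \<beta> b c a] lin_zero[OF module_A scalars_module, of \<beta>] by simp
qed (use a in auto)

lemma Er_eps_X:
  assumes "\<beta> \<in> dual A" "b \<in> carrier A" "d \<in> carrier A" "u \<in> carrier A"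
  shows "Er \<epsilon> (X \<beta> d u) b = Er \<beta> (u \<star> d) b"
proof (rule A_eqI)
  fix \<alpha> assume a: "\<alpha> \<in> dual A"
  have comm: "\<alpha> (Er \<beta> e b) = \<beta> (El \<alpha> b e)" if "\<beta> \<in> dual A" "e \<in> carrier A" for \<beta> e
    unfolding Er_def El_def rslice_def lslice_def
    using that a assms by (intro contract_comm) auto
  show "\<alpha> (Er \<epsilon> (X \<beta> d u) b) = \<alpha> (Er \<beta> (u \<star> d) b)"
    using assms a by (simp add: comm El_X eps_X El_mul)
qed (use assms in auto)

lemma X_Y_eps:
  assumes "x \<in> carrier A" "y \<in> carrier A" "z \<in> carrier A"
  shows "X \<epsilon> y (Y \<epsilon> z x) = Y (\<lambda>u. \<epsilon> (u \<star> y)) z x"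
proof (rule cancel_left_dual)
  fix d \<alpha> assume d: "d \<in> carrier A" "\<alpha> \<in> dual A"
  have "\<alpha> (d \<star> X \<epsilon> y (Y \<epsilon> z x)) = \<epsilon> (Y \<epsilon> z (Z \<alpha> d x) \<star> y)"
    using assms d by (simp add: T12 ZY)
  also have "\<dots> = \<epsilon> (W \<epsilon> y (z \<star> Z \<alpha> d x))"
    using assms d by (simp add: T34 op.Z_eps_mul)
  also have "\<dots> = \<alpha> (d \<star> Y (\<lambda>u. \<epsilon> (u \<star> y)) z x)"
    using assms d by (simp add: eps_W T32)
  finally show "\<alpha> (d \<star> X \<epsilon> y (Y \<epsilon> z x)) = \<alpha> (d \<star> Y (\<lambda>u. \<epsilon> (u \<star> y)) z x)" .
qed (use assms in auto)

text \<open>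
  With \<open>capR\<close> for \<open>Fr \<epsilon>\<close> and \<open>barR\<close> for \<open>X \<epsilon>\<close>, this computes the product of a multiplier \<open>capR x\<close>
  and a multiplier \<open>barR y\<close> on the right components.
\<close>

lemma Fr_mul_X_eps:
  assumes "x \<in> carrier A" "y \<in> carrier A" "w \<in> carrier A"
  shows "Fr (\<lambda>u. \<epsilon> (u \<star> y)) x w = X \<epsilon> y (Fr \<epsilon> x w)"
  unfolding Fr_def rslice_def
proof (rule op.lin_eq_on_e1[of A])
  show "contract_right K A (\<lambda>u. \<epsilon> (u \<star> y)) \<in> lin_map K AA A"
    using assms by (intro contract_right_lin) auto
  show "(\<lambda>t. X \<epsilon> y (contract_right K A \<epsilon> t)) \<in> lin_map K AA A"
    using assms by (intro lin_intros contract_right_lin) auto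
  fix x' y' z' assume "x' \<in> carrier A" "y' \<in> carrier A" "z' \<in> carrier A"
  then show "contract_right K A (\<lambda>u. \<epsilon> (u \<star> y)) (op.gen x' y' z') = X \<epsilon> y (contract_right K A \<epsilon> (op.gen x' y' z'))"
    using assms by (simp add: op.contract_right_gen X_eps_mul X_Y_eps)
qed (use assms in auto)

lemma products_induct:
  assumes a: "a \<in> carrier A"
    and prod: "\<And>b c. b \<in> carrier A \<Longrightarrow> c \<in> carrier A \<Longrightarrow> P (b \<star> c)"
    and add: "\<And>x y. x \<in> carrier A \<Longrightarrow> y \<in> carrier A \<Longrightarrow> P x \<Longrightarrow> P y \<Longrightarrow> P (x \<oplus>\<^bsub>A\<^esub> y)"
    and smult: "\<And>c x. c \<in> carrier K \<Longrightarrow> x \<in> carrier A \<Longrightarrow> P x \<Longrightarrow> P (c \<odot>\<^bsub>A\<^esub> x)"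
  shows "P a"
proof -
  have "P \<zero>\<^bsub>A\<^esub>" using prod[of "\<zero>\<^bsub>A\<^esub>" "\<zero>\<^bsub>A\<^esub>"] by simp
  from a products_span have "a \<in> span_of K A {a \<star> b | a b. a \<in> carrier A \<and> b \<in> carrier A}" by simp
  then show ?thesis
    by (rule span_induct[OF module_A, rotated 1]) (use prod add smult \<open>P \<zero>\<^bsub>A\<^esub>\<close> in auto)
qed

text \<open>
  The map \<open>\<epsilon> \<otimes> A\<close> sends the range of \<open>e1\<close> to the span of these elements, and the range contains
  that of \<open>t1\<close>, which is sent onto the products of \<open>A\<close>.
\<close>

lemma El_span: "span_of K A {El \<epsilon> p q | p q. p \<in> carrier A \<and> q \<in> carrier A} = carrier A"
proof -
  let ?S = "{El \<epsilon> p q | p q. p \<in> carrier A \<and> q \<in> carrier A}"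
  have S: "?S \<subseteq> carrier A" by auto
  have e: "contract_left K A \<epsilon> (e1 t) \<in> span_of K A ?S" if "t \<in> carrier AA" for t
    using that
  proof (induction rule: tensor_induct[OF module_A module_A, consumes 1, case_names pure add])
    case (pure v w)
    then have "contract_left K A \<epsilon> (e1 (pure_tensor K A A v w)) = El \<epsilon> v w" by (simp add: El_def lslice_def)
    then show ?case using pure by (auto intro!: subsetD[OF span_subset])
  next
    case (add x y)
    then show ?case
      by (simp add: lin_add[OF t_lin(5)] lin_add[OF contract_left_lin[OF module_A module_A eps_dual]]
          subspace_add[OF span_subspace[OF module_A S]])
  qed
  have "a \<in> span_of K A ?S" if "a \<in> carrier A" for a
    using that
  proof (rule products_induct)
    fix b c assume b: "b \<in> carrier A" "c \<in> carrier A"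
    have "contract_left K A \<epsilon> (t1 (pure_tensor K A A b c)) = b \<star> c"
    proof (rule A_eqI)
      show "contract_left K A \<epsilon> (t1 (pure_tensor K A A b c)) \<in> carrier A"
        using b by (intro lin_closed[OF contract_left_lin[OF module_A module_A eps_dual]]) auto
      fix \<beta> assume "\<beta> \<in> dual A"
      then show "\<beta> (contract_left K A \<epsilon> (t1 (pure_tensor K A A b c))) = \<beta> (b \<star> c)"
        using b eps_X[of \<beta> c b] contract_comm[of A A \<epsilon> \<beta> "t1 (pure_tensor K A A b c)"] by (simp add: X_def rslice_def)
    qed (use b in simp)
    then show "b \<star> c \<in> span_of K A ?S" using e[of "t1 (pure_tensor K A A b c)"] b by (simp add: e1_t1)
  qed (auto intro: subspace_add[OF span_subspace[OF module_A S]] subspace_smult[OF span_subspace[OF module_A S]])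
  then show ?thesis using span_in_carrier[OF module_A S] by blast
qed

section \<open>The actions on a full comodule\<close>

context
  fixes V :: "('k, 'v, 'b) module_scheme" and lam rho
  assumes comodule: "comodule_maps V lam rho"
begin

interpretation V: module K V by (rule comodule_lin[OF comodule])

private abbreviation "XS \<equiv> rslice K V A lam"

text \<open>
  As for \<open>XV_eps_XV\<close>; here \<open>mul_Er\<close> is needed to recognize the result on the generators.
\<close>

lemma XV_XV_eps:
  assumes b: "\<beta> \<in> dual A" and p: "p \<in> carrier A" "a \<in> carrier A" and v: "v \<in> carrier V"
  shows "XS \<beta> p (XS \<epsilon> a v) = XS \<beta> (Er \<epsilon> a p) v"
proof -
  note cl = XV_closed[OF comodule] comodule_lin[OF comodule]
  have "tensor_lift K V (\<lambda>p q. XS \<beta> p (XS \<epsilon> q v)) (e1 (pure_tensor K A A p a))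
      = XS \<beta> (contract_right K A \<epsilon> (e1 (pure_tensor K A A p a))) v"
  proof (rule lin_eq_on_e1[of V])
    show "tensor_lift K V (\<lambda>p q. XS \<beta> p (XS \<epsilon> q v)) \<in> lin_map K AA V"
      using b v cl by (intro tensor_lift_lin XV_bilin[OF comodule]) auto
    show "(\<lambda>t. XS \<beta> (contract_right K A \<epsilon> t) v) \<in> lin_map K AA V"
      using b v cl by (intro lin_intros contract_right_lin) auto
    fix x y z assume x: "x \<in> carrier A" "y \<in> carrier A" "z \<in> carrier A"
    have "tensor_lift K V (\<lambda>p q. XS \<beta> p (XS \<epsilon> q v)) (gen x y z) = XS (\<lambda>u. \<beta> (X \<epsilon> z u \<star> y)) x v"
      using x b v by (simp add: XV_gen[OF comodule])
    also have "\<dots> = XS (\<lambda>u. \<beta> (u \<star> Er \<epsilon> z y)) x v"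
      using x b v cl by (intro rslice_cong[symmetric]) (auto simp: mul_Er)
    also have "\<dots> = XS \<beta> (contract_right K A \<epsilon> (gen x y z)) v"
      using x b v by (simp add: contract_right_gen mul_Er[symmetric] XV_mul[OF comodule])
    finally show "tensor_lift K V (\<lambda>p q. XS \<beta> p (XS \<epsilon> q v)) (gen x y z) = XS \<beta> (contract_right K A \<epsilon> (gen x y z)) v" .
  qed (use p cl in auto)
  then show ?thesis using b p v by (simp add: XV_e1[OF comodule] Er_def rslice_def[of K A A])
qed

text \<open>
  If \<open>\<phi>\<close> kills all covered slices, then \<open>\<beta> (b k) = 0\<close> for all \<open>b\<close>, where \<open>k\<close> is the element
  with \<open>\<phi> (XS \<beta> d v) = \<beta> k\<close>; hence \<open>k = 0\<close>.
\<close>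

lemma full_covered:
  assumes full: "full_slices V lam"
  shows "span_of K V {XS (\<lambda>u. \<beta> (b \<star> u)) d v | \<beta> b d v. \<beta> \<in> dual A \<and> b \<in> carrier A \<and> d \<in> carrier A \<and> v \<in> carrier V}
    = carrier V"
proof (rule span_eq_carrierI[OF V.module_axioms _ full[unfolded full_slices_def]])
  note cl = XV_closed[OF comodule] comodule_lin[OF comodule]
  show "{XS (\<lambda>u. \<beta> (b \<star> u)) d v | \<beta> b d v. \<beta> \<in> dual A \<and> b \<in> carrier A \<and> d \<in> carrier A \<and> v \<in> carrier V} \<subseteq> carrier V"
    by (auto simp: cl)
  fix \<phi> s assume f: "\<phi> \<in> dual V"
    and van: "\<And>s. s \<in> {XS (\<lambda>u. \<beta> (b \<star> u)) d v | \<beta> b d v. \<beta> \<in> dual A \<and> b \<in> carrier A \<and> d \<in> carrier A \<and> v \<in> carrier V} \<Longrightarrow> \<phi> s = \<zero>"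
    and "s \<in> {XS \<beta> a v |\<beta> a v. \<beta> \<in> dual A \<and> a \<in> carrier A \<and> v \<in> carrier V}"
  then obtain \<beta> d v where s: "s = XS \<beta> d v" "\<beta> \<in> dual A" "d \<in> carrier A" "v \<in> carrier V" by blast
  define k where "k = contract_left K A \<phi> (lam (pure_tensor K V A v d))"
  have t: "lam (pure_tensor K V A v d) \<in> carrier (V \<boxtimes> A)"
    by (rule lin_closed[OF cl(3)], rule pure_closed) (use s cl in auto)
  have kc: "k \<in> carrier A" unfolding k_def using f t cl by (intro lin_closed[OF contract_left_lin]) auto
  have kX: "\<phi> (XS \<beta> d v) = \<beta> k" if "\<beta> \<in> dual A" for \<beta>
    unfolding k_def rslice_def by (rule contract_comm[OF _ _ f that t]) (use cl in auto)
  have "k = \<zero>\<^bsub>A\<^esub>"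
  proof (rule cancel_left_dual)
    fix b \<beta> assume b: "b \<in> carrier A" "\<beta> \<in> dual A"
    have "\<phi> (XS (\<lambda>u. \<beta> (b \<star> u)) d v) = \<zero>" using b s by (intro van) blast
    then show "\<beta> (b \<star> k) = \<beta> (b \<star> \<zero>\<^bsub>A\<^esub>)"
      using b kX[of "\<lambda>u. \<beta> (b \<star> u)"] lin_zero[OF module_A scalars_module, of \<beta>] by simp
  qed (use kc in auto)
  then show "\<phi> s = \<zero>" using s kX[of \<beta>] lin_zero[OF module_A scalars_module, of \<beta>] by simp
qed

text \<open>
  On a slice of \<open>lam\<close>, this map is the slice at \<open>El \<epsilon> a b\<close>, which is zero under the
  assumption on \<open>a\<close>.
\<close>

lemma XV_eps_zero:
  assumes full: "full_slices V lam" and a: "a \<in> carrier A" and v: "v \<in> carrier V"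
    and z: "\<And>c. c \<in> carrier A \<Longrightarrow> \<epsilon> (c \<star> a) = \<zero>"
  shows "XS \<epsilon> a v = \<zero>\<^bsub>V\<^esub>"
proof (rule lin_eq_on_span[OF V.module_axioms V.module_axioms,
      where f = "XS \<epsilon> a" and g = "\<lambda>v. \<zero>\<^bsub>V\<^esub>"])
  note cl = XV_closed[OF comodule] comodule_lin[OF comodule]
  show "XS \<epsilon> a \<in> lin_map K V V" using a cl by (intro rslice_lin1) auto
  show "(\<lambda>v. \<zero>\<^bsub>V\<^esub>) \<in> lin_map K V V" by (rule lin_const_zero[OF V.module_axioms])
  show "v \<in> span_of K V {XS \<beta> a v | \<beta> a v. \<beta> \<in> dual A \<and> a \<in> carrier A \<and> v \<in> carrier V}"
    using v full by (simp add: full_slices_def)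
  fix s assume "s \<in> {XS \<beta> a v | \<beta> a v. \<beta> \<in> dual A \<and> a \<in> carrier A \<and> v \<in> carrier V}"
  then obtain \<beta> b w where s: "s = XS \<beta> b w" "\<beta> \<in> dual A" "b \<in> carrier A" "w \<in> carrier V" by blast
  have "XS \<beta> \<zero>\<^bsub>A\<^esub> w = \<zero>\<^bsub>V\<^esub>"
    by (rule lin_zero[OF module_A V.module_axioms], rule rslice_lin2) (use s cl in auto)
  then show "s \<in> carrier V \<and> XS \<epsilon> a s = \<zero>\<^bsub>V\<^esub>"
    using s a cl by (simp add: XV_eps_XV[OF comodule] El_zero z)
qed

text \<open>
  The elements \<open>El \<epsilon> p q\<close> span \<open>A\<close>, and the slice at any of them is a slice at the counit.
\<close>

lemma XV_eps_span:
  assumes full: "full_slices V lam"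
  shows "span_of K V {XS \<epsilon> a v | a v. a \<in> carrier A \<and> v \<in> carrier V} = carrier V"
proof -
  note cl = XV_closed[OF comodule] comodule_lin[OF comodule]
  let ?S = "{XS \<epsilon> a v | a v. a \<in> carrier A \<and> v \<in> carrier V}"
  have S: "?S \<subseteq> carrier V" by (auto simp: cl)
  note sub = span_subspace[OF V.module_axioms S]
  have "XS \<beta> b w \<in> span_of K V ?S" if b: "\<beta> \<in> dual A" "b \<in> carrier A" "w \<in> carrier V" for \<beta> b w
  proof -
    have "submodule {b \<in> carrier A. XS \<beta> b w \<in> span_of K V ?S} K A"
      using b cl by (intro preimage_subspace[OF module_A V.module_axioms _ sub] rslice_lin2) auto
    moreover have "El \<epsilon> p q \<in> {b \<in> carrier A. XS \<beta> b w \<in> span_of K V ?S}" if "p \<in> carrier A" "q \<in> carrier A" for p q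
    proof -
      have "XS \<epsilon> p (XS \<beta> q w) \<in> ?S" using that b cl(1) by blast
      then have "XS \<epsilon> p (XS \<beta> q w) \<in> span_of K V ?S" by (rule subsetD[OF span_subset])
      then show ?thesis using that b by (simp add: XV_eps_XV[OF comodule])
    qed
    ultimately have "span_of K A {El \<epsilon> p q | p q. p \<in> carrier A \<and> q \<in> carrier A} \<subseteq> {b \<in> carrier A. XS \<beta> b w \<in> span_of K V ?S}"
      by (intro span_minimal) auto
    then show ?thesis using b El_span by auto
  qed
  then have "{XS \<beta> a v | \<beta> a v. \<beta> \<in> dual A \<and> a \<in> carrier A \<and> v \<in> carrier V} \<subseteq> span_of K V ?S" by auto
  from span_minimal[OF sub this] show ?thesis
    using full span_in_carrier[OF V.module_axioms S] unfolding full_slices_def by auto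
qed

end

end

context wmb_slices
begin

interpretation A: module K A by (rule module_A)

interpretation op: wmb_slices K A "\<lambda>a b. b \<star> a" \<epsilon> e2 e1 t3 t4 t1 t2 Y X W Z Fl Fr El Er
  by (rule opposite) (simp_all add: X_def Y_def Z_def W_def El_def Er_def Fl_def Fr_def)

section \<open>The base algebra\<close>

text \<open>
  Every element is a sum of products \<open>u d\<close>, and for these \<open>a = Y \<beta> u d\<close> works.
\<close>

lemma Fr_in_range:
  assumes b: "\<beta> \<in> dual A" "b \<in> carrier A"
  shows "\<exists>a\<in>carrier A. \<forall>c\<in>carrier A. Fr \<epsilon> a c = Fr \<beta> b c"
  using b(2)
proof (rule products_induct)
  fix u d assume "u \<in> carrier A" "d \<in> carrier A"
  then show "\<exists>a\<in>carrier A. \<forall>c\<in>carrier A. Fr \<epsilon> a c = Fr \<beta> (u \<star> d) c"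
    using b op.Er_eps_X[of \<beta>] by (intro bexI[of _ "Y \<beta> u d"]) auto
next
  fix x y assume x: "x \<in> carrier A" "y \<in> carrier A"
    and "\<exists>a\<in>carrier A. \<forall>c\<in>carrier A. Fr \<epsilon> a c = Fr \<beta> x c" "\<exists>a\<in>carrier A. \<forall>c\<in>carrier A. Fr \<epsilon> a c = Fr \<beta> y c"
  then obtain a a' where a: "a \<in> carrier A" "a' \<in> carrier A" "\<And>c. c \<in> carrier A \<Longrightarrow> Fr \<epsilon> a c = Fr \<beta> x c"
    "\<And>c. c \<in> carrier A \<Longrightarrow> Fr \<epsilon> a' c = Fr \<beta> y c" by blast
  have "Fr \<epsilon> (a \<oplus>\<^bsub>A\<^esub> a') c = Fr \<beta> (x \<oplus>\<^bsub>A\<^esub> y) c" if c: "c \<in> carrier A" for c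
    using x a c lin_add[OF slices_lin2(8)[OF eps_dual lin_id c] a(1,2)] lin_add[OF slices_lin2(8)[OF b(1) lin_id c] x]
    by simp
  then show "\<exists>a\<in>carrier A. \<forall>c\<in>carrier A. Fr \<epsilon> a c = Fr \<beta> (x \<oplus>\<^bsub>A\<^esub> y) c" using a(1,2) A.a_closed by blast
next
  fix k x assume x: "k \<in> carrier K" "x \<in> carrier A" and "\<exists>a\<in>carrier A. \<forall>c\<in>carrier A. Fr \<epsilon> a c = Fr \<beta> x c"
  then obtain a where a: "a \<in> carrier A" "\<And>c. c \<in> carrier A \<Longrightarrow> Fr \<epsilon> a c = Fr \<beta> x c" by blast
  have "Fr \<epsilon> (k \<odot>\<^bsub>A\<^esub> a) c = Fr \<beta> (k \<odot>\<^bsub>A\<^esub> x) c" if c: "c \<in> carrier A" for c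
    using x a c lin_smult[OF slices_lin2(8)[OF eps_dual lin_id c] x(1) a(1)] lin_smult[OF slices_lin2(8)[OF b(1) lin_id c] x]
    by simp
  then show "\<exists>a\<in>carrier A. \<forall>c\<in>carrier A. Fr \<epsilon> a c = Fr \<beta> (k \<odot>\<^bsub>A\<^esub> x) c" using a(1) x(1) A.smult_closed by blast
qed

text \<open>
  For \<open>a = X (\<beta> (b _)) d v\<close> the element \<open>Er \<epsilon> a w\<close> is \<open>\<beta> (b E\<^sub>2 v d) (E\<^sub>1 w)\<close>. Multiplied by
  \<open>c\<close> from the left it is, by \<open>E12\<close>, a value of the other slice of the idempotent, which
  \<open>Fr_in_range\<close> turns into one at the counit. Fullness extends this to all \<open>a\<close>.
\<close>

lemma Er_in_range:
  assumes "a \<in> carrier A"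
  shows "\<exists>a'\<in>carrier A. \<forall>w\<in>carrier A. Y \<epsilon> a' w = Er \<epsilon> a w"
proof -
  have "a \<in> span_of K A {X (\<lambda>u. \<beta> (b \<star> u)) d v | \<beta> b d v. \<beta> \<in> dual A \<and> b \<in> carrier A \<and> d \<in> carrier A \<and> v \<in> carrier A}"
    using full_covered[OF A_comodule A_full(1)] assms by (simp add: X_def)
  then show ?thesis
  proof (rule span_induct[OF module_A, rotated 1])
    show "{X (\<lambda>u. \<beta> (b \<star> u)) d v | \<beta> b d v. \<beta> \<in> dual A \<and> b \<in> carrier A \<and> d \<in> carrier A \<and> v \<in> carrier A} \<subseteq> carrier A"
      by auto
  next
    fix s assume "s \<in> {X (\<lambda>u. \<beta> (b \<star> u)) d v | \<beta> b d v. \<beta> \<in> dual A \<and> b \<in> carrier A \<and> d \<in> carrier A \<and> v \<in> carrier A}"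
    then obtain \<beta> b d v where s: "s = X (\<lambda>u. \<beta> (b \<star> u)) d v" "\<beta> \<in> dual A" "b \<in> carrier A" "d \<in> carrier A" "v \<in> carrier A"
      by blast
    obtain a' where a': "a' \<in> carrier A" "\<And>c. c \<in> carrier A \<Longrightarrow> Fr \<epsilon> a' c = Fr (\<lambda>u. \<beta> (u \<star> (v \<star> d))) b c"
      using Fr_in_range[of "\<lambda>u. \<beta> (u \<star> (v \<star> d))" b] s by auto
    have "Y \<epsilon> a' w = Er \<epsilon> s w" if w: "w \<in> carrier A" for w
    proof (rule cancel_left)
      fix c assume c: "c \<in> carrier A"
      have "c \<star> Y \<epsilon> a' w = Fr \<epsilon> a' c \<star> w" using op.mul_Er[of a' c w] a'(1) c w by simp
      also have "\<dots> = c \<star> Er (\<lambda>u. \<beta> (b \<star> u)) (v \<star> d) w" using a' c w s by (simp add: E12)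
      also have "\<dots> = c \<star> Er \<epsilon> s w" using s w c by (simp add: Er_eps_X)
      finally show "c \<star> Y \<epsilon> a' w = c \<star> Er \<epsilon> s w" .
    qed (use w a' s in auto)
    then show "\<exists>a'\<in>carrier A. \<forall>w\<in>carrier A. Y \<epsilon> a' w = Er \<epsilon> s w" using a' by blast
  next
    show "\<exists>a'\<in>carrier A. \<forall>w\<in>carrier A. Y \<epsilon> a' w = Er \<epsilon> \<zero>\<^bsub>A\<^esub> w"
      using lin_zero[OF module_A module_A slices_lin2(6)[OF eps_dual lin_id]]
        lin_zero[OF module_A module_A slices_lin2(2)[OF eps_dual lin_id]]
      by (intro bexI[of _ "\<zero>\<^bsub>A\<^esub>"]) auto
  next
    fix x y assume x: "x \<in> carrier A" "y \<in> carrier A"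
      and "\<exists>a'\<in>carrier A. \<forall>w\<in>carrier A. Y \<epsilon> a' w = Er \<epsilon> x w" "\<exists>a'\<in>carrier A. \<forall>w\<in>carrier A. Y \<epsilon> a' w = Er \<epsilon> y w"
    then obtain a a' where a: "a \<in> carrier A" "a' \<in> carrier A" "\<And>c. c \<in> carrier A \<Longrightarrow> Y \<epsilon> a c = Er \<epsilon> x c"
      "\<And>c. c \<in> carrier A \<Longrightarrow> Y \<epsilon> a' c = Er \<epsilon> y c" by blast
    have "Y \<epsilon> (a \<oplus>\<^bsub>A\<^esub> a') c = Er \<epsilon> (x \<oplus>\<^bsub>A\<^esub> y) c" if c: "c \<in> carrier A" for c
      using x a c lin_add[OF slices_lin2(2)[OF eps_dual lin_id c] a(1,2)] lin_add[OF slices_lin2(6)[OF eps_dual lin_id c] x]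
      by simp
    then show "\<exists>a'\<in>carrier A. \<forall>w\<in>carrier A. Y \<epsilon> a' w = Er \<epsilon> (x \<oplus>\<^bsub>A\<^esub> y) w" using a(1,2) A.a_closed by blast
  next
    fix k x assume x: "k \<in> carrier K" "x \<in> carrier A" and "\<exists>a'\<in>carrier A. \<forall>w\<in>carrier A. Y \<epsilon> a' w = Er \<epsilon> x w"
    then obtain a where a: "a \<in> carrier A" "\<And>c. c \<in> carrier A \<Longrightarrow> Y \<epsilon> a c = Er \<epsilon> x c" by blast
    have "Y \<epsilon> (k \<odot>\<^bsub>A\<^esub> a) c = Er \<epsilon> (k \<odot>\<^bsub>A\<^esub> x) c" if c: "c \<in> carrier A" for c
      using x a c lin_smult[OF slices_lin2(2)[OF eps_dual lin_id c] x(1) a(1)] lin_smult[OF slices_lin2(6)[OF eps_dual lin_id c] x]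
      by simp
    then show "\<exists>a'\<in>carrier A. \<forall>w\<in>carrier A. Y \<epsilon> a' w = Er \<epsilon> (k \<odot>\<^bsub>A\<^esub> x) w" using a(1) x(1) A.smult_closed by blast
  qed
qed

definition capR :: "'a \<Rightarrow> ('a \<Rightarrow> 'a) \<times> ('a \<Rightarrow> 'a)" where
  "capR a = (\<lambda>b\<in>carrier A. Y \<epsilon> a b, \<lambda>b\<in>carrier A. Fr \<epsilon> a b)"

definition barR :: "'a \<Rightarrow> ('a \<Rightarrow> 'a) \<times> ('a \<Rightarrow> 'a)" where
  "barR a = (\<lambda>b\<in>carrier A. Er \<epsilon> a b, \<lambda>b\<in>carrier A. X \<epsilon> a b)"

text \<open>
  The part of the definition of a multiplier that makes each component determine the other
  one. It suffices for comparing multipliers.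
\<close>

definition mul_pair :: "('a \<Rightarrow> 'a) \<times> ('a \<Rightarrow> 'a) \<Rightarrow> bool" where
  "mul_pair = (\<lambda>(l, r). l \<in> extensional (carrier A) \<and> r \<in> extensional (carrier A) \<and>
     l \<in> carrier A \<rightarrow> carrier A \<and> r \<in> carrier A \<rightarrow> carrier A \<and>
     (\<forall>b\<in>carrier A. \<forall>c\<in>carrier A. c \<star> l b = r c \<star> b))"

lemma mul_pair_barR: "a \<in> carrier A \<Longrightarrow> mul_pair (barR a)"
  by (auto simp: mul_pair_def barR_def mul_Er)

lemma mul_pair_capR: "a \<in> carrier A \<Longrightarrow> mul_pair (capR a)"
  using op.mul_Er by (auto simp: mul_pair_def capR_def)

end

context wmb_slices
begin

interpretation A: module K A by (rule module_A)

interpretation op: wmb_slices K A "\<lambda>a b. b \<star> a" \<epsilon> e2 e1 t3 t4 t1 t2 Y X W Z Fl Fr El Er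
  by (rule opposite) (simp_all add: X_def Y_def Z_def W_def El_def Er_def Fl_def Fr_def)

lemma mul_pair_op: "op.mul_pair p \<longleftrightarrow> mul_pair (prod.swap p)"
  by (cases p) (auto simp: mul_pair_def op.mul_pair_def)

lemma mul_pair_eqI1:
  assumes p: "mul_pair p" and q: "mul_pair q"
    and eq: "\<And>b. b \<in> carrier A \<Longrightarrow> fst p b = fst q b"
  shows "p = q"
proof -
  obtain l r l' r' where pq: "p = (l, r)" "q = (l', r')" by (cases p, cases q)
  have "r c = r' c" if c: "c \<in> carrier A" for c
  proof (rule op.cancel_left)
    show "r c \<in> carrier A" "r' c \<in> carrier A" using p q c by (auto simp: pq mul_pair_def)
    show "r c \<star> b = r' c \<star> b" if "b \<in> carrier A" for b
      using p q c that eq[OF that] unfolding pq mul_pair_def by simp metis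
  qed
  then have "r = r'" using p q by (auto simp: pq mul_pair_def intro: extensionalityI)
  moreover have "l = l'" using p q eq by (auto simp: pq mul_pair_def intro: extensionalityI)
  ultimately show ?thesis by (simp add: pq)
qed

end

context wmb_slices
begin

interpretation A: module K A by (rule module_A)

interpretation op: wmb_slices K A "\<lambda>a b. b \<star> a" \<epsilon> e2 e1 t3 t4 t1 t2 Y X W Z Fl Fr El Er
  by (rule opposite) (simp_all add: X_def Y_def Z_def W_def El_def Er_def Fl_def Fr_def)

lemma mul_pair_eqI2:
  assumes "mul_pair p" "mul_pair q" and "\<And>b. b \<in> carrier A \<Longrightarrow> snd p b = snd q b"
  shows "p = q"
proof -
  have "prod.swap p = prod.swap q"
    by (rule op.mul_pair_eqI1) (use assms in \<open>auto simp: mul_pair_op\<close>)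
  then show ?thesis by (metis swap_swap)
qed

lemma op_capR: "op.capR a = prod.swap (barR a)" and op_barR: "op.barR a = prod.swap (capR a)"
  by (simp_all add: capR_def barR_def op.capR_def op.barR_def)

lemma barR_in_range: "a \<in> carrier A \<Longrightarrow> barR a \<in> capR ` carrier A"
proof -
  assume a: "a \<in> carrier A"
  then obtain a' where a': "a' \<in> carrier A" "\<forall>w\<in>carrier A. Y \<epsilon> a' w = Er \<epsilon> a w" using Er_in_range by blast
  have "barR a = capR a'"
    by (rule mul_pair_eqI1) (use a a' in \<open>auto simp: mul_pair_barR mul_pair_capR\<close>, auto simp: barR_def capR_def)
  then show ?thesis using a' by blast
qed

end

context wmb_slices
begin

interpretation A: module K A by (rule module_A)

interpretation op: wmb_slices K A "\<lambda>a b. b \<star> a" \<epsilon> e2 e1 t3 t4 t1 t2 Y X W Z Fl Fr El Er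
  by (rule opposite) (simp_all add: X_def Y_def Z_def W_def El_def Er_def Fl_def Fr_def)

lemma range_eq: "capR ` carrier A = barR ` carrier A"
proof
  show "barR ` carrier A \<subseteq> capR ` carrier A" using barR_in_range by blast
  show "capR ` carrier A \<subseteq> barR ` carrier A"
  proof (rule image_subsetI)
    fix a assume "a \<in> carrier A"
    then have "prod.swap (capR a) \<in> (\<lambda>a. prod.swap (barR a)) ` carrier A"
      using op.barR_in_range[of a] by (simp add: op_barR op_capR[abs_def])
    then obtain b where "b \<in> carrier A" "prod.swap (capR a) = prod.swap (barR b)" by blast
    then have "capR a = barR b" by (metis swap_swap)
    then show "capR a \<in> barR ` carrier A" using \<open>b \<in> carrier A\<close> by simp
  qed
qed

definition B :: "('k, ('a \<Rightarrow> 'a) \<times> ('a \<Rightarrow> 'a)) module" where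
  "B = multiplier_algebra K A \<lparr>carrier := capR ` carrier A\<rparr>"

lemma B_simps:
  "carrier B = capR ` carrier A"
  "p \<otimes>\<^bsub>B\<^esub> q = (compose (carrier A) (fst p) (fst q), compose (carrier A) (snd q) (snd p))"
  "p \<oplus>\<^bsub>B\<^esub> q = (\<lambda>a\<in>carrier A. fst p a \<oplus>\<^bsub>A\<^esub> fst q a, \<lambda>a\<in>carrier A. snd p a \<oplus>\<^bsub>A\<^esub> snd q a)"
  "k \<odot>\<^bsub>B\<^esub> p = (\<lambda>a\<in>carrier A. k \<odot>\<^bsub>A\<^esub> fst p a, \<lambda>a\<in>carrier A. k \<odot>\<^bsub>A\<^esub> snd p a)"
  "\<zero>\<^bsub>B\<^esub> = (\<lambda>a\<in>carrier A. \<zero>\<^bsub>A\<^esub>, \<lambda>a\<in>carrier A. \<zero>\<^bsub>A\<^esub>)"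
  by (cases p; cases q; simp add: B_def multiplier_algebra_def)+

lemma capR_add: "a \<in> carrier A \<Longrightarrow> b \<in> carrier A \<Longrightarrow> capR (a \<oplus>\<^bsub>A\<^esub> b) = capR a \<oplus>\<^bsub>B\<^esub> capR b"
  using lin_add[OF slices_lin2(2)[OF eps_dual lin_id], of _ a b] lin_add[OF slices_lin2(8)[OF eps_dual lin_id], of _ a b]
  by (auto simp: B_simps capR_def intro!: restrict_ext)

lemma capR_smult: "k \<in> carrier K \<Longrightarrow> a \<in> carrier A \<Longrightarrow> capR (k \<odot>\<^bsub>A\<^esub> a) = k \<odot>\<^bsub>B\<^esub> capR a"
  using lin_smult[OF slices_lin2(2)[OF eps_dual lin_id], of _ k a] lin_smult[OF slices_lin2(8)[OF eps_dual lin_id], of _ k a]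
  by (auto simp: B_simps capR_def intro!: restrict_ext)

lemma capR_zero: "capR \<zero>\<^bsub>A\<^esub> = \<zero>\<^bsub>B\<^esub>"
  using lin_zero[OF module_A module_A slices_lin2(2)[OF eps_dual lin_id]] lin_zero[OF module_A module_A slices_lin2(8)[OF eps_dual lin_id]]
  by (auto simp: B_simps capR_def intro!: restrict_ext)

lemma module_B [simp]: "module K B"
  by (rule module_image[OF module_A B_simps(1) capR_add capR_smult capR_zero])

lemma capR_lin: "capR \<in> lin_map K A B"
  by (rule lin_mapI) (auto simp: B_simps(1) capR_add capR_smult)

lemma barR_lin: "barR \<in> lin_map K A B"
proof (rule lin_mapI)
  show "barR a \<in> carrier B" if "a \<in> carrier A" for a using barR_in_range[OF that] by (simp add: B_simps(1))
  show "barR (a \<oplus>\<^bsub>A\<^esub> b) = barR a \<oplus>\<^bsub>B\<^esub> barR b" if "a \<in> carrier A" "b \<in> carrier A" for a b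
    using that lin_add[OF slices_lin2(1)[OF eps_dual lin_id], of _ a b] lin_add[OF slices_lin2(6)[OF eps_dual lin_id], of _ a b]
    by (auto simp: B_simps barR_def intro!: restrict_ext)
  show "barR (k \<odot>\<^bsub>A\<^esub> a) = k \<odot>\<^bsub>B\<^esub> barR a" if "k \<in> carrier K" "a \<in> carrier A" for k a
    using that lin_smult[OF slices_lin2(1)[OF eps_dual lin_id], of _ k a] lin_smult[OF slices_lin2(6)[OF eps_dual lin_id], of _ k a]
    by (auto simp: B_simps barR_def intro!: restrict_ext)
qed

lemma B_mul_pair: "p \<in> carrier B \<Longrightarrow> mul_pair p"
  by (auto simp: B_simps(1) mul_pair_capR)

lemma mul_pair_mult: "mul_pair p \<Longrightarrow> mul_pair q \<Longrightarrow> mul_pair (p \<otimes>\<^bsub>B\<^esub> q)"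
  by (cases p; cases q) (auto simp: mul_pair_def B_simps compose_def Pi_def)

text \<open>
  The formula \<open>XV_XV_eps\<close> for \<open>A\<close> as a comodule over itself.
\<close>

lemma barR_mult:
  assumes "a \<in> carrier A" "b \<in> carrier A"
  shows "barR a \<otimes>\<^bsub>B\<^esub> barR b = barR (Er \<epsilon> a b)"
proof (rule mul_pair_eqI2)
  show "snd (barR a \<otimes>\<^bsub>B\<^esub> barR b) c = snd (barR (Er \<epsilon> a b)) c" if "c \<in> carrier A" for c
    using that assms XV_XV_eps[OF A_comodule, folded X_def, of \<epsilon> b a c]
    by (simp add: B_simps barR_def compose_def)
qed (use assms in \<open>simp_all add: mul_pair_mult mul_pair_barR mul_pair_capR\<close>)

lemma B_mult_closed: "p \<in> carrier B \<Longrightarrow> q \<in> carrier B \<Longrightarrow> p \<otimes>\<^bsub>B\<^esub> q \<in> carrier B"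
  using barR_mult lin_closed[OF barR_lin] range_eq by (auto simp: B_simps(1))

lemma capR_Y_eps:
  assumes "b \<in> carrier A" "c \<in> carrier A" "y \<in> carrier A"
  shows "capR (Y (\<lambda>u. \<epsilon> (u \<star> y)) b c) = capR (b \<star> c) \<otimes>\<^bsub>B\<^esub> barR y"
proof (rule mul_pair_eqI2)
  show "snd (capR (Y (\<lambda>u. \<epsilon> (u \<star> y)) b c)) w = snd (capR (b \<star> c) \<otimes>\<^bsub>B\<^esub> barR y) w" if "w \<in> carrier A" for w
    using that assms op.Er_eps_X[of "\<lambda>u. \<epsilon> (u \<star> y)" w b c]
    by (simp add: B_simps capR_def barR_def compose_def Fr_mul_X_eps)
qed (use assms in \<open>simp_all add: mul_pair_mult mul_pair_barR mul_pair_capR\<close>)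

lemma B_mult_bilin: "bilin_map K B B B (mult B)"
proof (rule bilinI)
  note mp = B_mul_pair[unfolded mul_pair_def]
  have 1: "fst p x \<in> carrier A \<and> snd p x \<in> carrier A" if "p \<in> carrier B" "x \<in> carrier A" for p x
    using mp[OF that(1)] that(2) by (cases p) auto
  have lin: "l \<in> lin_map K A A \<and> r \<in> lin_map K A A" if lr: "(l, r) \<in> carrier B" for l r
  proof -
    obtain a where a: "a \<in> carrier A" "(l, r) = capR a" using lr by (auto simp: B_simps(1))
    then have "\<And>x. x \<in> carrier A \<Longrightarrow> Y \<epsilon> a x = l x" "\<And>x. x \<in> carrier A \<Longrightarrow> Fr \<epsilon> a x = r x" by (auto simp: capR_def)
    then show ?thesis
      using lin_map_cong[OF module_A slices_lin1(2)[OF eps_dual lin_id a(1)]]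
        lin_map_cong[OF module_A slices_lin1(8)[OF eps_dual lin_id a(1)]] by blast
  qed
  have lin1: "fst p \<in> lin_map K A A" "snd p \<in> lin_map K A A" if "p \<in> carrier B" for p
    using lin[of "fst p" "snd p"] that by auto
  show "mult B p \<in> lin_map K B B" if p: "p \<in> carrier B" for p
    by (rule lin_mapI, rule B_mult_closed[OF p], assumption)
      (simp_all add: B_simps(2-4) compose_def 1 p lin_add[OF lin1(1)[OF p]] lin_smult[OF lin1(1)[OF p]]
          cong: restrict_cong)
  show "(\<lambda>p. p \<otimes>\<^bsub>B\<^esub> q) \<in> lin_map K B B" if q: "q \<in> carrier B" for q
    by (rule lin_mapI, rule B_mult_closed[OF _ q], assumption)
      (simp_all add: B_simps(2-4) compose_def 1 q lin_add[OF lin1(2)[OF q]] lin_smult[OF lin1(2)[OF q]]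
          cong: restrict_cong)
qed

text \<open>
  The multiplication of the base algebra has a section up to \<open>capR\<close>, namely the
  comultiplication: by the comodule axiom for \<open>t3\<close>, the composite slices at the counit collapse to
  \<open>\<epsilon> (Y \<epsilon> b u) = \<epsilon> (b \<star> u)\<close>.
\<close>

lemma capR_t3_mult:
  assumes b: "b \<in> carrier A" and c: "c \<in> carrier A"
  shows "tensor_lift K B (\<lambda>p q. capR p \<otimes>\<^bsub>B\<^esub> capR q) (t3 (pure_tensor K A A c b)) = capR (b \<star> c)"
proof -
  have bil: "bilin_map K A A B (\<lambda>p q. capR p \<otimes>\<^bsub>B\<^esub> capR q)"
    by (intro bilinI lin_comp[OF bilinD1[OF B_mult_bilin] capR_lin] lin_comp[OF bilinD2[OF B_mult_bilin] capR_lin] lin_closed[OF capR_lin])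
  have L: "tensor_lift K B (\<lambda>p q. capR p \<otimes>\<^bsub>B\<^esub> capR q) (t3 (pure_tensor K A A c b)) \<in> carrier B"
    using b c by (intro lin_closed[OF tensor_lift_lin[OF _ _ _ bil]]) auto
  show ?thesis
  proof (rule mul_pair_eqI1[OF B_mul_pair[OF L]])
    show "mul_pair (capR (b \<star> c))" using b c by (simp add: mul_pair_capR)
    fix w assume w: "w \<in> carrier A"
    have lw: "(\<lambda>p. fst p w) \<in> lin_map K B A"
    proof (rule lin_mapI)
      show "fst p w \<in> carrier A" if "p \<in> carrier B" for p using that w by (auto simp: B_simps(1) capR_def)
    qed (use w in \<open>simp_all add: B_simps\<close>)
    have "fst (tensor_lift K B (\<lambda>p q. capR p \<otimes>\<^bsub>B\<^esub> capR q) (t3 (pure_tensor K A A c b))) w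
        = tensor_lift K A (\<lambda>p q. fst (capR p \<otimes>\<^bsub>B\<^esub> capR q) w) (t3 (pure_tensor K A A c b))"
      using b c by (intro lin_lift_comp[OF module_A module_A module_B module_A bil lw]) auto
    also have "\<dots> = tensor_lift K A (\<lambda>p q. Y \<epsilon> p (Y \<epsilon> q w)) (t3 (pure_tensor K A A c b))"
      using b c w op.XX_bilin[of \<epsilon> \<epsilon> w]
      by (intro tensor_lift_cong[OF module_A module_A module_A, symmetric]) (auto simp: B_simps capR_def compose_def)
    also have "\<dots> = Y (\<lambda>u. \<epsilon> (Y \<epsilon> b u)) c w"
      using b c w by (simp add: op.XX_t1)
    also have "\<dots> = Y (\<lambda>u. \<epsilon> (b \<star> u)) c w"
      unfolding Y_def by (rule rslice_cong[symmetric]) (use b c w in \<open>auto simp: eps_Y[unfolded Y_def]\<close>)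
    also have "\<dots> = Y \<epsilon> (b \<star> c) w"
      using b c w op.XV_mul[OF op.A_comodule, of \<epsilon> c b w] by (simp add: Y_def)
    finally show "fst (tensor_lift K B (\<lambda>p q. capR p \<otimes>\<^bsub>B\<^esub> capR q) (t3 (pure_tensor K A A c b))) w = fst (capR (b \<star> c)) w"
      using w by (simp add: capR_def)
  qed
qed

end

context wmb_slices
begin

interpretation A: module K A by (rule module_A)
interpretation B: module K B by (rule module_B)

interpretation op: wmb_slices K A "\<lambda>a b. b \<star> a" \<epsilon> e2 e1 t3 t4 t1 t2 Y X W Z Fl Fr El Er
  by (rule opposite) (simp_all add: X_def Y_def Z_def W_def El_def Er_def Fl_def Fr_def)

section \<open>The bimodule structure of a full comodule\<close>

text \<open>
  An element \<open>barR a\<close> acts by the slice at the counit and \<open>a\<close>. The choice of \<open>a\<close> does not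
  matter for a full comodule, see \<open>right_act_barR\<close>.
\<close>

definition right_act ::
    "('k, 'v, 'b) module_scheme \<Rightarrow> (('v, 'a, 'k) tensor \<Rightarrow> ('v, 'a, 'k) tensor)
      \<Rightarrow> 'v \<Rightarrow> ('a \<Rightarrow> 'a) \<times> ('a \<Rightarrow> 'a) \<Rightarrow> 'v" where
  "right_act V lam v r = rslice K V A lam \<epsilon> (SOME a. a \<in> carrier A \<and> barR a = r) v"

definition left_act ::
    "('k, 'v, 'b) module_scheme \<Rightarrow> (('v, 'a, 'k) tensor \<Rightarrow> ('v, 'a, 'k) tensor)
      \<Rightarrow> ('a \<Rightarrow> 'a) \<times> ('a \<Rightarrow> 'a) \<Rightarrow> 'v \<Rightarrow> 'v" where
  "left_act V rho r v = rslice K V A rho \<epsilon> (SOME a. a \<in> carrier A \<and> capR a = r) v"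

definition right_relations ::
    "('k, 'v, 'b) module_scheme \<Rightarrow> ('v \<Rightarrow> ('a \<Rightarrow> 'a) \<times> ('a \<Rightarrow> 'a) \<Rightarrow> 'v)
      \<Rightarrow> ('v, ('a \<Rightarrow> 'a) \<times> ('a \<Rightarrow> 'a), 'k) tensor set" where
  "right_relations V act =
     {pure_tensor K V B (act m r) n \<ominus>\<^bsub>V \<boxtimes> B\<^esub> pure_tensor K V B m (r \<otimes>\<^bsub>B\<^esub> n) | m r n.
        m \<in> carrier V \<and> r \<in> carrier B \<and> n \<in> carrier B}"

definition left_relations ::
    "('k, 'v, 'b) module_scheme \<Rightarrow> (('a \<Rightarrow> 'a) \<times> ('a \<Rightarrow> 'a) \<Rightarrow> 'v \<Rightarrow> 'v)
      \<Rightarrow> (('a \<Rightarrow> 'a) \<times> ('a \<Rightarrow> 'a), 'v, 'k) tensor set" where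
  "left_relations V act =
     {pure_tensor K B V (m \<otimes>\<^bsub>B\<^esub> r) n \<ominus>\<^bsub>B \<boxtimes> V\<^esub> pure_tensor K B V m (act r n) | m r n.
        m \<in> carrier B \<and> r \<in> carrier B \<and> n \<in> carrier V}"

lemma carrier_B_barR: "carrier B = barR ` carrier A"
  by (simp only: B_simps(1) range_eq)

lemma B_barRE:
  assumes "r \<in> carrier B"
  obtains a where "a \<in> carrier A" "r = barR a"
  using assms unfolding carrier_B_barR by (elim imageE)

lemma capR_closed [simp]: "a \<in> carrier A \<Longrightarrow> capR a \<in> carrier B"
  by (rule lin_closed[OF capR_lin])

lemma barR_closed [simp]: "a \<in> carrier A \<Longrightarrow> barR a \<in> carrier B"
  by (rule lin_closed[OF barR_lin])

lemma capR_eq_zero: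
  assumes a: "a \<in> carrier A" and z: "\<And>c. c \<in> carrier A \<Longrightarrow> \<epsilon> (a \<star> c) = \<zero>"
  shows "capR a = \<zero>\<^bsub>B\<^esub>"
proof -
  have "Y \<epsilon> a w = \<zero>\<^bsub>A\<^esub>" if "w \<in> carrier A" for w
    using op.XV_eps_zero[OF op.A_comodule op.A_full(1) a that z] by (simp add: Y_def)
  then have "capR a = capR \<zero>\<^bsub>A\<^esub>"
    using a by (intro mul_pair_eqI1 mul_pair_capR) (auto simp: capR_zero, auto simp: capR_def B_simps)
  then show ?thesis by (simp add: capR_zero)
qed

context
  fixes V :: "('k, 'v, 'b) module_scheme" and lam rho
  assumes comodule: "comodule_maps V lam rho" and full: "full_slices V lam"
begin

interpretation V: module K V by (rule comodule_lin[OF comodule])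

lemma module_V [simp]: "module K V" ..

lemmas slices_closed_right = XV_closed[OF comodule] comodule_lin[OF comodule]

text \<open>
  If \<open>barR a' = barR a\<close>, then applying \<open>\<epsilon>\<close> to the right components shows \<open>\<epsilon> (c a') = \<epsilon> (c a)\<close>
  for all \<open>c\<close>, so that \<open>XV_eps_zero\<close> applies to the difference.
\<close>

lemma right_act_barR:
  assumes a: "a \<in> carrier A" and v: "v \<in> carrier V"
  shows "right_act V lam v (barR a) = rslice K V A lam \<epsilon> a v"
proof -
  define a' where "a' = (SOME a'. a' \<in> carrier A \<and> barR a' = barR a)"
  have a': "a' \<in> carrier A \<and> barR a' = barR a" unfolding a'_def by (rule someI[of _ a]) (use a in simp)
  have X: "X \<epsilon> a' c = X \<epsilon> a c" if c: "c \<in> carrier A" for c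
  proof -
    have "snd (barR a') c = snd (barR a) c" using a' by simp
    then show ?thesis using c by (simp add: barR_def)
  qed
  have lin: "(\<lambda>p. rslice K V A lam \<epsilon> p v) \<in> lin_map K A V" using v slices_closed_right by (intro rslice_lin2) auto
  have "rslice K V A lam \<epsilon> (a' \<ominus>\<^bsub>A\<^esub> a) v = \<zero>\<^bsub>V\<^esub>"
  proof (rule XV_eps_zero[OF comodule full _ v])
    show "a' \<ominus>\<^bsub>A\<^esub> a \<in> carrier A" using a a' by simp
    fix c assume c: "c \<in> carrier A"
    have l: "(\<lambda>u. \<epsilon> (c \<star> u)) \<in> dual A" using c by simp
    have "\<epsilon> (c \<star> (a' \<ominus>\<^bsub>A\<^esub> a)) = \<epsilon> (c \<star> a') \<ominus>\<^bsub>scalars K\<^esub> \<epsilon> (c \<star> a)"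
      using lin_minus[OF module_A scalars_module l] a a' by blast
    also have "\<epsilon> (c \<star> a') = \<epsilon> (c \<star> a)"
      using X[OF c] eps_X[OF eps_dual _ c, of a'] eps_X[OF eps_dual a c] a' by simp
    finally show "\<epsilon> (c \<star> (a' \<ominus>\<^bsub>A\<^esub> a)) = \<zero>"
      using minus_zero_iff[OF scalars_module, of "\<epsilon> (c \<star> a)" "\<epsilon> (c \<star> a)"]
        dual_closed[OF eps_dual mul_closed[OF c a]] by simp
  qed
  then have "rslice K V A lam \<epsilon> a' v = rslice K V A lam \<epsilon> a v"
    using lin_minus[OF module_A V.module_axioms lin, of a' a] minus_zero_iff[OF V.module_axioms] a a' v slices_closed_right by simp
  then show ?thesis by (simp add: right_act_def a'_def)
qed

lemma right_act_closed: "v \<in> carrier V \<Longrightarrow> r \<in> carrier B \<Longrightarrow> right_act V lam v r \<in> carrier V"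
proof -
  assume v: "v \<in> carrier V" and r: "r \<in> carrier B"
  obtain a where "a \<in> carrier A" "r = barR a" by (rule B_barRE[OF r])
  then show ?thesis using right_act_barR v slices_closed_right by simp
qed

lemma right_act_bilin: "bilin_map K V B V (right_act V lam)"
proof (rule bilinI)
  show "right_act V lam v \<in> lin_map K B V" if v: "v \<in> carrier V" for v
  proof -
    have lin: "(\<lambda>p. rslice K V A lam \<epsilon> p v) \<in> lin_map K A V" using v slices_closed_right by (intro rslice_lin2) auto
    show ?thesis
    proof (rule lin_mapI)
      fix r s assume r: "r \<in> carrier B" and s: "s \<in> carrier B"
      obtain a where a: "a \<in> carrier A" "r = barR a" by (rule B_barRE[OF r])
      obtain b where b: "b \<in> carrier A" "s = barR b" by (rule B_barRE[OF s])
      note ab = a(1) b(1) a(2) b(2)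
      then show "right_act V lam v (r \<oplus>\<^bsub>B\<^esub> s) = right_act V lam v r \<oplus>\<^bsub>V\<^esub> right_act V lam v s"
        using v lin_add[OF lin ab(1,2)] by (simp add: lin_add[OF barR_lin, symmetric] right_act_barR)
    next
      fix k r assume k: "k \<in> carrier K" and r: "r \<in> carrier B"
      obtain a where a: "a \<in> carrier A" "r = barR a" by (rule B_barRE[OF r])
      then show "right_act V lam v (k \<odot>\<^bsub>B\<^esub> r) = k \<odot>\<^bsub>V\<^esub> right_act V lam v r"
        using v k lin_smult[OF lin k a(1)] by (simp add: lin_smult[OF barR_lin, symmetric] right_act_barR)
    qed (use v right_act_closed in auto)
  qed
  show "(\<lambda>v. right_act V lam v r) \<in> lin_map K V V" if r: "r \<in> carrier B" for r
  proof -
    obtain a where a: "a \<in> carrier A" "r = barR a" by (rule B_barRE[OF r])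
    have "rslice K V A lam \<epsilon> a \<in> lin_map K V V" using a slices_closed_right by (intro rslice_lin1) auto
    then show ?thesis
      by (rule lin_map_cong[OF V.module_axioms]) (simp add: a right_act_barR)
  qed
qed

lemma right_act_mult:
  assumes v: "v \<in> carrier V" and r: "r \<in> carrier B" and s: "s \<in> carrier B"
  shows "right_act V lam v (r \<otimes>\<^bsub>B\<^esub> s) = right_act V lam (right_act V lam v r) s"
proof -
  obtain a where a: "a \<in> carrier A" "r = barR a" by (rule B_barRE[OF r])
  obtain b where b: "b \<in> carrier A" "s = barR b" by (rule B_barRE[OF s])
  from a b show ?thesis
    using v slices_closed_right by (simp add: barR_mult right_act_barR XV_XV_eps[OF comodule])
qed

lemma right_act_surj:
  assumes "v \<in> carrier V"
  shows "\<exists>x\<in>carrier (V \<boxtimes> B). tensor_lift K V (right_act V lam) x = v"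
proof -
  have VB: "module K (V \<boxtimes> B)" by (rule tensor_module) simp_all
  note lin = tensor_lift_lin[OF V.module_axioms module_B V.module_axioms right_act_bilin]
  have sub: "submodule (tensor_lift K V (right_act V lam) ` carrier (V \<boxtimes> B)) K V"
    by (rule image_subspace[OF VB V.module_axioms lin carrier_subspace[OF VB]])
  have "rslice K V A lam \<epsilon> a w \<in> tensor_lift K V (right_act V lam) ` carrier (V \<boxtimes> B)"
    if "a \<in> carrier A" "w \<in> carrier V" for a w
    using that by (intro image_eqI[of _ _ "pure_tensor K V B w (barR a)"])
      (simp_all add: tensor_lift_pure[OF V.module_axioms module_B V.module_axioms right_act_bilin] right_act_barR pure_closed)
  then have "{rslice K V A lam \<epsilon> a v | a v. a \<in> carrier A \<and> v \<in> carrier V}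
      \<subseteq> tensor_lift K V (right_act V lam) ` carrier (V \<boxtimes> B)" by auto
  from span_minimal[OF sub this] show ?thesis using assms XV_eps_span[OF comodule full] by auto
qed

private abbreviation "right_rels \<equiv> right_relations V (right_act V lam)"

interpretation VB: module K "V \<boxtimes> B" by (rule tensor_module) simp_all
interpretation VA: module K "V \<boxtimes> A" by (rule tensor_module) simp_all

lemma right_relsI:
  "m \<in> carrier V \<Longrightarrow> r \<in> carrier B \<Longrightarrow> n \<in> carrier B \<Longrightarrow>
    pure_tensor K V B (right_act V lam m r) n \<ominus>\<^bsub>V \<boxtimes> B\<^esub> pure_tensor K V B m (r \<otimes>\<^bsub>B\<^esub> n) \<in> right_rels"
  unfolding right_relations_def by (rule CollectI, intro exI conjI, rule refl)

lemma right_relsE: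
  assumes "s \<in> right_rels"
  obtains m r n where "m \<in> carrier V" "r \<in> carrier B" "n \<in> carrier B"
    "s = pure_tensor K V B (right_act V lam m r) n \<ominus>\<^bsub>V \<boxtimes> B\<^esub> pure_tensor K V B m (r \<otimes>\<^bsub>B\<^esub> n)"
  using assms unfolding right_relations_def by (elim CollectE exE conjE)

lemma right_rels_subset: "right_rels \<subseteq> carrier (V \<boxtimes> B)"
  by (rule subsetI, erule right_relsE) (simp add: pure_closed right_act_closed B_mult_closed)

private abbreviation "proj x \<equiv> span_of K (V \<boxtimes> B) right_rels +>\<^bsub>V \<boxtimes> B\<^esub> x"
private abbreviation "Q \<equiv> quot_space (V \<boxtimes> B) (span_of K (V \<boxtimes> B) right_rels)"

private lemma rels_sub: "submodule (span_of K (V \<boxtimes> B) right_rels) K (V \<boxtimes> B)"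
  by (rule span_subspace[OF VB.module_axioms right_rels_subset])

private lemma Q_module: "module K Q" by (rule quot_module[OF VB.module_axioms rels_sub])

private lemma proj_lin: "(\<lambda>x. proj x) \<in> lin_map K (V \<boxtimes> B) Q"
  by (rule quot_proj_lin[OF VB.module_axioms rels_sub])

private lemma proj_rel:
  assumes "m \<in> carrier V" "r \<in> carrier B" "n \<in> carrier B"
  shows "proj (pure_tensor K V B (right_act V lam m r) n) = proj (pure_tensor K V B m (r \<otimes>\<^bsub>B\<^esub> n))"
proof (subst coset_eq_iff[OF VB.module_axioms rels_sub])
  show "pure_tensor K V B (right_act V lam m r) n \<ominus>\<^bsub>V \<boxtimes> B\<^esub> pure_tensor K V B m (r \<otimes>\<^bsub>B\<^esub> n)
    \<in> span_of K (V \<boxtimes> B) right_rels"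
    by (rule subsetD[OF span_subset]) (rule right_relsI[OF assms])
qed (use assms in \<open>simp_all add: pure_closed right_act_closed B_mult_closed\<close>)

private abbreviation "tm \<equiv> tensor_map K V B (\<lambda>v. v) capR"

private lemma tm_lin: "tm \<in> lin_map K (V \<boxtimes> A) (V \<boxtimes> B)"
  by (intro tensor_map_lin capR_lin) simp_all

text \<open>
  The tensors \<open>x\<close> that are congruent to \<open>(V \<otimes> capR) z\<close> for some \<open>z\<close> in \<open>V \<otimes> A\<close> whose contractions
  with \<open>\<epsilon> (_ y)\<close> can be computed from the image of \<open>x\<close> in \<open>V\<close>. It turns out that all tensors are of
  this kind.
\<close>

private definition "S = {x \<in> carrier (V \<boxtimes> B). \<exists>z\<in>carrier (V \<boxtimes> A).
  (\<forall>y\<in>carrier A. right_act V lam (tensor_lift K V (right_act V lam) x) (barR y) = contract_right K V (\<lambda>u. \<epsilon> (u \<star> y)) z)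
  \<and> proj x = proj (tm z)}"

private lemma S_sub: "submodule S K (V \<boxtimes> B)"
  unfolding S_def
  by (rule related_subspace[where U = "\<lambda>_. V" and Q = Q])
    (auto intro!: lin_comp[OF bilinD2[OF right_act_bilin] tensor_lift_lin] right_act_bilin contract_right_lin
      proj_lin lin_comp[OF proj_lin tm_lin] Q_module VB.module_axioms VA.module_axioms)

text \<open>
  For \<open>v \<otimes> capR (b c)\<close> one takes for \<open>z\<close> the comultiplication of \<open>c\<close>, multiplied by \<open>b\<close> in the
  second leg, with the first leg acting on \<open>v\<close> through \<open>capR\<close>. Then \<open>capR_Y_eps\<close> gives the
  contractions, and \<open>capR_t3_mult\<close> the congruence.
\<close>

private lemma S_generator:
  assumes v: "v \<in> carrier V" and b: "b \<in> carrier A" and c: "c \<in> carrier A"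
  shows "pure_tensor K V B v (capR (b \<star> c)) \<in> S"
proof -
  define f where "f = (\<lambda>p. right_act V lam v (capR p))"
  have f: "f \<in> lin_map K A V" unfolding f_def by (rule lin_comp[OF bilinD1[OF right_act_bilin v] capR_lin])
  have fcl: "f p \<in> carrier V" if "p \<in> carrier A" for p using lin_closed[OF f that] .
  define z where "z = tensor_map K V A f (\<lambda>u. u) (t3 (pure_tensor K A A c b))"
  have t: "t3 (pure_tensor K A A c b) \<in> carrier AA" using b c by simp
  have fl: "tensor_map K V A f (\<lambda>u. u) \<in> lin_map K AA (V \<boxtimes> A)" by (intro tensor_map_lin f) simp_all
  have zc: "z \<in> carrier (V \<boxtimes> A)" unfolding z_def by (rule lin_closed[OF fl t])
  have p: "pure_tensor K V B v (capR (b \<star> c)) \<in> carrier (V \<boxtimes> B)" using v b c by (simp add: pure_closed)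
  have 1: "right_act V lam (tensor_lift K V (right_act V lam) (pure_tensor K V B v (capR (b \<star> c)))) (barR y)
      = contract_right K V (\<lambda>u. \<epsilon> (u \<star> y)) z" if y: "y \<in> carrier A" for y
  proof -
    have "contract_right K V (\<lambda>u. \<epsilon> (u \<star> y)) z = f (Y (\<lambda>u. \<epsilon> (u \<star> y)) b c)"
      unfolding z_def Y_def rslice_def using t y by (subst contract_right_map[OF module_A module_A _ module_A f]) simp_all
    then show ?thesis
      using v b c y by (simp add: f_def capR_Y_eps right_act_mult tensor_lift_pure[OF _ _ _ right_act_bilin])
  qed
  have bil: "bilin_map K A A B (\<lambda>p q. capR p \<otimes>\<^bsub>B\<^esub> capR q)"
    by (intro bilinI lin_comp[OF bilinD1[OF B_mult_bilin] capR_lin] lin_comp[OF bilinD2[OF B_mult_bilin] capR_lin] lin_closed[OF capR_lin])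
  have 2: "proj (tm (tensor_map K V A f (\<lambda>u. u) t)) = proj (pure_tensor K V B v (tensor_lift K B (\<lambda>p q. capR p \<otimes>\<^bsub>B\<^esub> capR q) t))"
    if "t \<in> carrier AA" for t
  proof (rule tensor_ext[OF module_A module_A Q_module _ _ _ that])
    show "(\<lambda>t. proj (tm (tensor_map K V A f (\<lambda>u. u) t))) \<in> lin_map K AA Q"
      by (intro lin_comp[OF proj_lin] lin_comp[OF tm_lin fl])
    show "(\<lambda>t. proj (pure_tensor K V B v (tensor_lift K B (\<lambda>p q. capR p \<otimes>\<^bsub>B\<^esub> capR q) t))) \<in> lin_map K AA Q"
      by (intro lin_comp[OF proj_lin] lin_intros tensor_lift_lin bil v) simp_all
    fix p q assume pq: "p \<in> carrier A" "q \<in> carrier A"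
    have "tensor_map K V A f (\<lambda>u. u) (pure_tensor K A A p q) = pure_tensor K V A (f p) q"
      by (rule tensor_map_pure) (use pq f in simp_all)
    moreover have "tm (pure_tensor K V A (f p) q) = pure_tensor K V B (f p) (capR q)"
      by (rule tensor_map_pure) (use pq fcl capR_lin in simp_all)
    ultimately show "proj (tm (tensor_map K V A f (\<lambda>u. u) (pure_tensor K A A p q)))
        = proj (pure_tensor K V B v (tensor_lift K B (\<lambda>p q. capR p \<otimes>\<^bsub>B\<^esub> capR q) (pure_tensor K A A p q)))"
      using pq v by (simp add: tensor_lift_pure[OF _ _ _ bil] f_def proj_rel)
  qed
  show ?thesis
    unfolding S_def using p zc 1 2[OF t] b c by (auto simp: z_def[symmetric] capR_t3_mult)
qed

private lemma S_all:
  assumes "x \<in> carrier (V \<boxtimes> B)"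
  shows "x \<in> S"
  using assms
proof (induction rule: tensor_induct[OF V.module_axioms module_B, consumes 1, case_names pure add])
  case (pure v r)
  from pure(2) obtain a where a: "a \<in> carrier A" "r = capR a" unfolding B_simps(1) by (elim imageE)
  have lin: "(\<lambda>a. pure_tensor K V B v (capR a)) \<in> lin_map K A (V \<boxtimes> B)"
    by (intro lin_intros capR_lin pure) simp_all
  have "submodule {a \<in> carrier A. pure_tensor K V B v (capR a) \<in> S} K A"
    by (rule preimage_subspace[OF module_A VB.module_axioms lin S_sub])
  then have "span_of K A {a \<star> b | a b. a \<in> carrier A \<and> b \<in> carrier A} \<subseteq> {a \<in> carrier A. pure_tensor K V B v (capR a) \<in> S}"
    by (rule span_minimal) (use S_generator[OF pure(1)] in auto)
  then have "carrier A \<subseteq> {a \<in> carrier A. pure_tensor K V B v (capR a) \<in> S}" by (simp only: products_span)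
  then show ?case using a by blast
next
  case (add x y)
  then show ?case using subspace_add[OF S_sub] by simp
qed

text \<open>
  For \<open>x\<close> acting as zero, all contractions of \<open>z\<close> with \<open>\<epsilon> (_ y)\<close> vanish. By \<open>capR_eq_zero\<close> this
  kills \<open>(V \<otimes> capR) z\<close>, to which \<open>x\<close> is congruent.
\<close>

lemma right_kernel:
  assumes x: "x \<in> carrier (V \<boxtimes> B)" and zero: "tensor_lift K V (right_act V lam) x = \<zero>\<^bsub>V\<^esub>"
  shows "x \<in> span_of K (V \<boxtimes> B) right_rels"
proof -
  obtain z where z: "z \<in> carrier (V \<boxtimes> A)"
    and zy: "\<And>y. y \<in> carrier A \<Longrightarrow> right_act V lam \<zero>\<^bsub>V\<^esub> (barR y) = contract_right K V (\<lambda>u. \<epsilon> (u \<star> y)) z"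
    and pz: "proj x = proj (tm z)"
    using S_all[OF x] zero unfolding S_def by auto
  have z0: "contract_right K V (\<lambda>u. \<epsilon> (u \<star> y)) z = \<zero>\<^bsub>V\<^esub>" if "y \<in> carrier A" for y
    using zy[OF that] lin_zero[OF V.module_axioms V.module_axioms bilinD2[OF right_act_bilin], of "barR y"] that by simp
  have "tm z = \<zero>\<^bsub>V \<boxtimes> B\<^esub>"
  proof (rule tensor_zeroI[OF V.module_axioms module_B lin_closed[OF tm_lin z]])
    fix \<phi> \<beta> assume f: "\<phi> \<in> dual V" and b: "\<beta> \<in> dual B"
    have a: "contract_left K A \<phi> z \<in> carrier A" by (rule lin_closed[OF contract_left_lin[OF _ _ f] z]) simp_all
    have "capR (contract_left K A \<phi> z) = \<zero>\<^bsub>B\<^esub>"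
    proof (rule capR_eq_zero[OF a])
      fix c assume c: "c \<in> carrier A"
      have "\<phi> (contract_right K V (\<lambda>u. \<epsilon> (u \<star> c)) z) = \<epsilon> (contract_left K A \<phi> z \<star> c)"
        using contract_comm[OF V.module_axioms module_A f _ z, of "\<lambda>u. \<epsilon> (u \<star> c)"] c by simp
      then show "\<epsilon> (contract_left K A \<phi> z \<star> c) = \<zero>"
        using z0[OF c] lin_zero[OF V.module_axioms scalars_module f] by simp
    qed
    then have "contract_left K B \<phi> (tm z) = \<zero>\<^bsub>B\<^esub>"
      using contract_left_map[OF V.module_axioms module_A V.module_axioms module_B lin_id capR_lin f z] by simp
    then show "\<phi> (contract_right K V \<beta> (tm z)) = \<zero>"
      using contract_comm[OF V.module_axioms module_B f b lin_closed[OF tm_lin z]] lin_zero[OF module_B scalars_module b]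
      by simp
  qed
  then have "x \<ominus>\<^bsub>V \<boxtimes> B\<^esub> \<zero>\<^bsub>V \<boxtimes> B\<^esub> \<in> span_of K (V \<boxtimes> B) right_rels"
    using pz coset_eq_iff[OF VB.module_axioms rels_sub x] by simp
  then show ?thesis using x by (simp add: a_minus_def neg_eq_smult[OF VB.module_axioms])
qed

lemma right_firm:
  "lin_iso K (quot_space (V \<boxtimes> B) (span_of K (V \<boxtimes> B) right_rels)) V
     (quot_lift (tensor_lift K V (right_act V lam)))"
proof (rule quot_lift_iso[OF VB.module_axioms V.module_axioms right_rels_subset])
  note lin = tensor_lift_lin[OF V.module_axioms module_B V.module_axioms right_act_bilin]
  show "tensor_lift K V (right_act V lam) \<in> lin_map K (V \<boxtimes> B) V" by (rule lin)
  show "tensor_lift K V (right_act V lam) s = \<zero>\<^bsub>V\<^esub>" if "s \<in> right_rels" for s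
  proof -
    from \<open>s \<in> right_rels\<close> obtain m r n where "m \<in> carrier V" "r \<in> carrier B" "n \<in> carrier B"
      "s = pure_tensor K V B (right_act V lam m r) n \<ominus>\<^bsub>V \<boxtimes> B\<^esub> pure_tensor K V B m (r \<otimes>\<^bsub>B\<^esub> n)"
      by (rule right_relsE)
    then show ?thesis
      by (simp add: lin_minus[OF VB.module_axioms V.module_axioms lin] pure_closed right_act_closed B_mult_closed
        tensor_lift_pure[OF V.module_axioms module_B V.module_axioms right_act_bilin] right_act_mult minus_zero_iff[OF V.module_axioms])
  qed
next
  show "x \<in> span_of K (V \<boxtimes> B) right_rels"
    if "x \<in> carrier (V \<boxtimes> B)" "tensor_lift K V (right_act V lam) x = \<zero>\<^bsub>V\<^esub>" for x
    by (rule right_kernel[OF that])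
  show "\<exists>x\<in>carrier (V \<boxtimes> B). tensor_lift K V (right_act V lam) x = u" if "u \<in> carrier V" for u
    by (rule right_act_surj[OF that])
qed

end

end

context wmb_slices
begin

interpretation A: module K A by (rule module_A)
interpretation B: module K B by (rule module_B)

interpretation op: wmb_slices K A "\<lambda>a b. b \<star> a" \<epsilon> e2 e1 t3 t4 t1 t2 Y X W Z Fl Fr El Er
  by (rule opposite) (simp_all add: X_def Y_def Z_def W_def El_def Er_def Fl_def Fr_def)

section \<open>The opposite base algebra\<close>

text \<open>
  The base algebra of the opposite structure consists of the same multipliers with their
  components exchanged.
\<close>

lemma swap_op_B: "r \<in> carrier op.B \<longleftrightarrow> prod.swap r \<in> carrier B"
proof -
  have eq: "carrier op.B = prod.swap ` carrier B"
    unfolding op.B_simps(1) carrier_B_barR op_capR[abs_def] by (simp add: image_image)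
  show ?thesis
    unfolding eq
  proof
    assume "r \<in> prod.swap ` carrier B"
    then obtain q where "q \<in> carrier B" "r = prod.swap q" by (elim imageE)
    then show "prod.swap r \<in> carrier B" by simp
  next
    assume "prod.swap r \<in> carrier B"
    then have "prod.swap (prod.swap r) \<in> prod.swap ` carrier B" by (rule imageI)
    then show "r \<in> prod.swap ` carrier B" by simp
  qed
qed

lemma swap_lin: "prod.swap \<in> lin_map K B op.B" "prod.swap \<in> lin_map K op.B B"
proof -
  show "prod.swap \<in> lin_map K B op.B"
    by (rule lin_mapI, simp add: swap_op_B) (simp_all add: B_simps(2-) op.B_simps(2-))
  show "prod.swap \<in> lin_map K op.B B"
    by (rule lin_mapI, simp add: swap_op_B) (simp_all add: B_simps(2-) op.B_simps(2-))
qed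

lemma swap_mult: "prod.swap (r \<otimes>\<^bsub>B\<^esub> s) = prod.swap s \<otimes>\<^bsub>op.B\<^esub> prod.swap r"
  by (simp add: B_simps op.B_simps)

lemma swap_mult': "prod.swap (r \<otimes>\<^bsub>op.B\<^esub> s) = prod.swap s \<otimes>\<^bsub>B\<^esub> prod.swap r"
  by (simp add: B_simps op.B_simps)

lemma left_act_op: "left_act V rho r v = op.right_act V rho v (prod.swap r)"
proof -
  have "(op.barR a = prod.swap r) = (capR a = r)" for a
    unfolding op_barR using swap_swap[of "capR a"] swap_swap[of r] by (auto dest: arg_cong[of _ _ prod.swap])
  then show ?thesis by (simp add: left_act_def op.right_act_def)
qed

context
  fixes V :: "('k, 'v, 'b) module_scheme" and lam rho
  assumes comodule: "comodule_maps V lam rho" and full: "full_slices V lam" and full': "full_slices V rho"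
begin

interpretation V: module K V by (rule comodule_lin[OF comodule])

private lemma oc: "op.comodule_maps V rho lam" by (rule comodule_maps_op[OF comodule])
private lemma fop: "op.full_slices V rho" by (rule iffD2[OF full_slices_op full'])

private lemmas slices_closed_V = XV_closed[OF comodule] YV_closed[OF comodule] comodule_lin[OF comodule]

lemma left_act_capR:
  assumes "a \<in> carrier A" "v \<in> carrier V"
  shows "left_act V rho (capR a) v = rslice K V A rho \<epsilon> a v"
  using op.right_act_barR[OF oc fop assms] by (simp add: left_act_op op_barR)

lemma left_act_bilin: "bilin_map K B V V (left_act V rho)"
  unfolding left_act_op[abs_def]
  by (intro bilinI lin_comp[OF bilinD1[OF op.right_act_bilin[OF oc fop]] swap_lin(1)]
      bilinD2[OF op.right_act_bilin[OF oc fop]]) (simp_all add: swap_op_B)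

lemma left_act_closed: "r \<in> carrier B \<Longrightarrow> v \<in> carrier V \<Longrightarrow> left_act V rho r v \<in> carrier V"
  by (rule lin_closed[OF bilinD1[OF left_act_bilin]])

lemma left_act_mult:
  assumes "v \<in> carrier V" "r \<in> carrier B" "s \<in> carrier B"
  shows "left_act V rho (r \<otimes>\<^bsub>B\<^esub> s) v = left_act V rho r (left_act V rho s v)"
  using op.right_act_mult[OF oc fop assms(1), of "prod.swap s" "prod.swap r"] assms
  by (simp add: left_act_op swap_mult swap_op_B)

text \<open>
  The slices \<open>\<beta> (b w\<^sub>1 d) w\<^sub>0\<close> span \<open>V\<close>. The right action changes \<open>d\<close> and the left action
  changes \<open>b\<close>.
\<close>

lemma left_right_act:
  assumes v: "v \<in> carrier V" and r: "r \<in> carrier B" and s: "s \<in> carrier B"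
  shows "right_act V lam (left_act V rho r v) s = left_act V rho r (right_act V lam v s)"
proof -
  from r obtain a' where a': "a' \<in> carrier A" "r = capR a'" unfolding B_simps(1) by (elim imageE)
  obtain a where a: "a \<in> carrier A" "s = barR a" by (rule B_barRE[OF s])
  have lin: "rslice K V A lam \<epsilon> a \<in> lin_map K V V" "rslice K V A rho \<epsilon> a' \<in> lin_map K V V"
    using a a' slices_closed_V by (auto intro!: rslice_lin1)
  have "rslice K V A lam \<epsilon> a (rslice K V A rho \<epsilon> a' v) = rslice K V A rho \<epsilon> a' (rslice K V A lam \<epsilon> a v)"
  proof (rule lin_eq_on_span[OF V.module_axioms V.module_axioms lin_comp[OF lin] lin_comp[OF lin(2) lin(1)]])
    let ?S = "{rslice K V A lam (\<lambda>u. \<beta> (b \<star> u)) d v | \<beta> b d v. \<beta> \<in> dual A \<and> b \<in> carrier A \<and> d \<in> carrier A \<and> v \<in> carrier V}"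
    show "v \<in> span_of K V ?S" using full_covered[OF comodule full] v by simp
    fix x assume "x \<in> ?S"
    then obtain \<beta> b d w where x: "x = rslice K V A lam (\<lambda>u. \<beta> (b \<star> u)) d w"
      and b: "\<beta> \<in> dual A" "b \<in> carrier A" "d \<in> carrier A" "w \<in> carrier V" by (elim CollectE exE conjE)
    \<comment> \<open>an element \<open>w_0 \<otimes> \<beta> (b w_1 d)\<close>; one action changes \<open>d\<close>, the other one \<open>b\<close>\<close>
    have R: "rslice K V A lam \<epsilon> a (rslice K V A lam (\<lambda>u. \<beta> (b \<star> u)) d w)
        = rslice K V A lam (\<lambda>u. \<beta> (b \<star> u)) (El \<epsilon> a d) w" if "b \<in> carrier A" for b
      using b that a by (simp add: XV_eps_XV[OF comodule])
    have L: "rslice K V A rho \<epsilon> a' (rslice K V A rho (\<lambda>u. \<beta> (u \<star> d)) b w)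
        = rslice K V A rho (\<lambda>u. \<beta> (u \<star> d)) (Fl \<epsilon> a' b) w" if "d \<in> carrier A" for d
      using b that a' by (simp add: op.XV_eps_XV[OF oc])
    show "x \<in> carrier V \<and> rslice K V A lam \<epsilon> a (rslice K V A rho \<epsilon> a' x) = rslice K V A rho \<epsilon> a' (rslice K V A lam \<epsilon> a x)"
      using b a a' R[of b] L[of d] R[of "Fl \<epsilon> a' b"] L[of "El \<epsilon> a d"] slices_closed_V
      by (simp add: x XV_YV[OF comodule])
  qed
  then show ?thesis
    using a a' v slices_closed_V by (simp add: right_act_barR[OF comodule full] left_act_capR)
qed

private abbreviation "left_rels \<equiv> left_relations V (left_act V rho)"

interpretation BV: module K "B \<boxtimes> V" by (rule tensor_module) (simp_all add: V.module_axioms)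

lemma left_relsI:
  "m \<in> carrier B \<Longrightarrow> r \<in> carrier B \<Longrightarrow> n \<in> carrier V \<Longrightarrow>
    pure_tensor K B V (m \<otimes>\<^bsub>B\<^esub> r) n \<ominus>\<^bsub>B \<boxtimes> V\<^esub> pure_tensor K B V m (left_act V rho r n) \<in> left_rels"
  unfolding left_relations_def by (rule CollectI, intro exI conjI, rule refl)

lemma left_relsE:
  assumes "s \<in> left_rels"
  obtains m r n where "m \<in> carrier B" "r \<in> carrier B" "n \<in> carrier V"
    "s = pure_tensor K B V (m \<otimes>\<^bsub>B\<^esub> r) n \<ominus>\<^bsub>B \<boxtimes> V\<^esub> pure_tensor K B V m (left_act V rho r n)"
  using assms unfolding left_relations_def by (elim CollectE exE conjE)

private lemma pure_BV: "r \<in> carrier B \<Longrightarrow> v \<in> carrier V \<Longrightarrow> pure_tensor K B V r v \<in> carrier (B \<boxtimes> V)"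
  by (rule pure_closed[OF module_B V.module_axioms])

private lemma pure_VB: "r \<in> carrier op.B \<Longrightarrow> v \<in> carrier V \<Longrightarrow> pure_tensor K V op.B v r \<in> carrier (V \<boxtimes> op.B)"
  by (rule pure_closed[OF V.module_axioms op.module_B])

lemma left_rels_subset: "left_rels \<subseteq> carrier (B \<boxtimes> V)"
  by (rule subsetI, erule left_relsE) (simp add: pure_BV left_act_closed B_mult_closed)

text \<open>
  The flips between \<open>R \<otimes> V\<close> and \<open>V \<otimes> R\<^sup>o\<^sup>p\<close>. They translate firmness on the right, over the
  opposite structure, into firmness on the left.
\<close>

private definition "\<tau> = tensor_lift K (V \<boxtimes> op.B) (\<lambda>r v. pure_tensor K V op.B v (prod.swap r))"
private definition "\<sigma> = tensor_lift K (B \<boxtimes> V) (\<lambda>v r. pure_tensor K B V (prod.swap r) v)"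

private lemma VopB: "module K (V \<boxtimes> op.B)" by (rule tensor_module[OF V.module_axioms op.module_B])

private lemma tau_bilin: "bilin_map K B V (V \<boxtimes> op.B) (\<lambda>r v. pure_tensor K V op.B v (prod.swap r))"
  by (rule bilinI) (intro lin_intros swap_lin V.module_axioms op.module_B; simp add: swap_op_B)+

private lemma sigma_bilin: "bilin_map K V op.B (B \<boxtimes> V) (\<lambda>v r. pure_tensor K B V (prod.swap r) v)"
  by (rule bilinI) (intro lin_intros swap_lin V.module_axioms module_B; simp add: swap_op_B)+

private lemma tau_lin: "\<tau> \<in> lin_map K (B \<boxtimes> V) (V \<boxtimes> op.B)"
  unfolding \<tau>_def by (rule tensor_lift_lin[OF module_B V.module_axioms VopB tau_bilin])

private lemma sigma_lin: "\<sigma> \<in> lin_map K (V \<boxtimes> op.B) (B \<boxtimes> V)"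
  unfolding \<sigma>_def by (rule tensor_lift_lin[OF V.module_axioms op.module_B BV.module_axioms sigma_bilin])

private lemma tau_pure: "r \<in> carrier B \<Longrightarrow> v \<in> carrier V \<Longrightarrow> \<tau> (pure_tensor K B V r v) = pure_tensor K V op.B v (prod.swap r)"
  unfolding \<tau>_def by (rule tensor_lift_pure[OF module_B V.module_axioms VopB tau_bilin])

private lemma sigma_pure: "r \<in> carrier op.B \<Longrightarrow> v \<in> carrier V \<Longrightarrow> \<sigma> (pure_tensor K V op.B v r) = pure_tensor K B V (prod.swap r) v"
  unfolding \<sigma>_def by (rule tensor_lift_pure[OF V.module_axioms op.module_B BV.module_axioms sigma_bilin])

private lemma sigma_tau: "x \<in> carrier (B \<boxtimes> V) \<Longrightarrow> \<sigma> (\<tau> x) = x"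
  by (rule tensor_ext[OF module_B V.module_axioms BV.module_axioms lin_comp[OF sigma_lin tau_lin] lin_id])
    (simp_all add: tau_pure sigma_pure swap_op_B)

private lemmas act_lin = tensor_lift_lin[OF module_B V.module_axioms V.module_axioms left_act_bilin]
private lemmas op_act_lin = tensor_lift_lin[OF V.module_axioms op.module_B V.module_axioms op.right_act_bilin[OF oc fop]]

private lemma act_sigma:
  "x \<in> carrier (V \<boxtimes> op.B) \<Longrightarrow> tensor_lift K V (left_act V rho) (\<sigma> x) = tensor_lift K V (op.right_act V rho) x"
  by (rule tensor_ext[OF V.module_axioms op.module_B V.module_axioms lin_comp[OF act_lin sigma_lin] op_act_lin])
    (simp_all add: sigma_pure tensor_lift_pure[OF module_B V.module_axioms V.module_axioms left_act_bilin]
      tensor_lift_pure[OF V.module_axioms op.module_B V.module_axioms op.right_act_bilin[OF oc fop]] left_act_op swap_op_B[symmetric])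

private lemma act_tau:
  "x \<in> carrier (B \<boxtimes> V) \<Longrightarrow> tensor_lift K V (op.right_act V rho) (\<tau> x) = tensor_lift K V (left_act V rho) x"
  using act_sigma[OF lin_closed[OF tau_lin], of x] by (simp add: sigma_tau)

private lemma sigma_rels:
  assumes "s \<in> span_of K (V \<boxtimes> op.B) (op.right_relations V (op.right_act V rho))"
  shows "\<sigma> s \<in> span_of K (B \<boxtimes> V) left_rels"
proof -
  note sub = span_subspace[OF BV.module_axioms left_rels_subset]
  have "op.right_relations V (op.right_act V rho) \<subseteq> {s \<in> carrier (V \<boxtimes> op.B). \<sigma> s \<in> span_of K (B \<boxtimes> V) left_rels}"
  proof
    fix s assume "s \<in> op.right_relations V (op.right_act V rho)"
    then obtain m r n where mrn: "m \<in> carrier V" "r \<in> carrier op.B" "n \<in> carrier op.B"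
      and s: "s = pure_tensor K V op.B (op.right_act V rho m r) n \<ominus>\<^bsub>V \<boxtimes> op.B\<^esub> pure_tensor K V op.B m (r \<otimes>\<^bsub>op.B\<^esub> n)"
      by (rule op.right_relsE[OF oc fop])
    have c: "op.right_act V rho m r \<in> carrier V" "r \<otimes>\<^bsub>op.B\<^esub> n \<in> carrier op.B"
      using mrn op.right_act_closed[OF oc fop] op.B_mult_closed by auto
    let ?a = "pure_tensor K B V (prod.swap n \<otimes>\<^bsub>B\<^esub> prod.swap r) m"
      and ?b = "pure_tensor K B V (prod.swap n) (left_act V rho (prod.swap r) m)"
    have ab: "?a \<in> carrier (B \<boxtimes> V)" "?b \<in> carrier (B \<boxtimes> V)"
      using mrn by (auto simp: swap_op_B intro!: pure_BV B_mult_closed left_act_closed)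
    have "\<sigma> s = ?b \<ominus>\<^bsub>B \<boxtimes> V\<^esub> ?a"
      using mrn c by (simp add: s lin_minus[OF VopB BV.module_axioms sigma_lin] pure_VB sigma_pure swap_mult' left_act_op)
    also have "\<dots> = \<ominus>\<^bsub>B \<boxtimes> V\<^esub> (?a \<ominus>\<^bsub>B \<boxtimes> V\<^esub> ?b)"
      using ab by (simp add: a_minus_def BV.minus_add BV.a_ac)
    also have "\<dots> \<in> span_of K (B \<boxtimes> V) left_rels"
      by (rule subspace_neg[OF BV.module_axioms sub], rule subsetD[OF span_subset], rule left_relsI)
        (use mrn in \<open>simp_all add: swap_op_B\<close>)
    finally show "s \<in> {s \<in> carrier (V \<boxtimes> op.B). \<sigma> s \<in> span_of K (B \<boxtimes> V) left_rels}"
      using subsetD[OF op.right_rels_subset[OF oc fop] \<open>s \<in> op.right_relations V (op.right_act V rho)\<close>] by simp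
  qed
  then have "span_of K (V \<boxtimes> op.B) (op.right_relations V (op.right_act V rho))
      \<subseteq> {s \<in> carrier (V \<boxtimes> op.B). \<sigma> s \<in> span_of K (B \<boxtimes> V) left_rels}"
    by (rule span_minimal[OF preimage_subspace[OF VopB BV.module_axioms sigma_lin sub]])
  then show ?thesis using assms by blast
qed

lemma left_firm:
  "lin_iso K (quot_space (B \<boxtimes> V) (span_of K (B \<boxtimes> V) left_rels)) V
     (quot_lift (tensor_lift K V (left_act V rho)))"
proof (rule quot_lift_iso[OF BV.module_axioms V.module_axioms left_rels_subset])
  show "tensor_lift K V (left_act V rho) \<in> lin_map K (B \<boxtimes> V) V" by (rule act_lin)
  show "tensor_lift K V (left_act V rho) s = \<zero>\<^bsub>V\<^esub>" if s: "s \<in> left_rels" for s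
  proof -
    obtain m r n where "m \<in> carrier B" "r \<in> carrier B" "n \<in> carrier V"
      "s = pure_tensor K B V (m \<otimes>\<^bsub>B\<^esub> r) n \<ominus>\<^bsub>B \<boxtimes> V\<^esub> pure_tensor K B V m (left_act V rho r n)"
      by (rule left_relsE[OF s])
    then show ?thesis
      by (simp add: lin_minus[OF BV.module_axioms V.module_axioms act_lin] pure_BV left_act_closed B_mult_closed
        tensor_lift_pure[OF module_B V.module_axioms V.module_axioms left_act_bilin] left_act_mult minus_zero_iff[OF V.module_axioms])
  qed
  show "x \<in> span_of K (B \<boxtimes> V) left_rels"
    if x: "x \<in> carrier (B \<boxtimes> V)" "tensor_lift K V (left_act V rho) x = \<zero>\<^bsub>V\<^esub>" for x
    using sigma_rels[OF op.right_kernel[OF oc fop lin_closed[OF tau_lin x(1)]]] x by (simp add: act_tau sigma_tau)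
  show "\<exists>x\<in>carrier (B \<boxtimes> V). tensor_lift K V (left_act V rho) x = u" if u: "u \<in> carrier V" for u
  proof -
    obtain x where "x \<in> carrier (V \<boxtimes> op.B)" "tensor_lift K V (op.right_act V rho) x = u"
      using op.right_act_surj[OF oc fop u] by (elim bexE) simp
    then show ?thesis using lin_closed[OF sigma_lin] act_sigma by (intro bexI[of _ "\<sigma> x"]) auto
  qed
qed

end

end

section \<open>Weak multiplier bialgebras\<close>

sublocale regular_weak_multiplier_bialgebra \<subseteq> vector_spaces K
  by (rule vector_spaces.intro) (rule base_field)

context regular_weak_multiplier_bialgebra
begin

abbreviation mulA (infixl \<open>\<star>\<close> 70) where "a \<star> b \<equiv> a \<otimes>\<^bsub>A\<^esub> b"
abbreviation "AA \<equiv> A \<boxtimes> A"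
abbreviation "cr \<equiv> contract_right K A"
abbreviation "cl \<equiv> contract_left K A"
abbreviation "lm1 \<equiv> lmul1 K A A"
abbreviation "lm2 \<equiv> lmul2 K A A"
abbreviation "rm1 \<equiv> rmul1 K A A"
abbreviation "rm2 \<equiv> rmul2 K A A"
abbreviation "pt \<equiv> pure_tensor K A A"

lemma A_module [simp]: "module K A" using algebra_A by (simp add: nonunital_algebra_def)
lemma AA_module [simp]: "module K AA" by (rule tensor_module) simp_all
lemma A_bilin: "bilin_map K A A A (\<star>)" using algebra_A by (simp add: nonunital_algebra_def)
lemma A_assoc: "a \<in> carrier A \<Longrightarrow> b \<in> carrier A \<Longrightarrow> c \<in> carrier A \<Longrightarrow> (a \<star> b) \<star> c = a \<star> (b \<star> c)"
  using algebra_A by (simp add: nonunital_algebra_def)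

lemmas [simp] = E1_linear E2_linear T1_linear T2_linear T3_linear T4_linear counit_linear
  scalars_module lin_id dual_closed

lemma A_mult_closed [simp]: "a \<in> carrier A \<Longrightarrow> b \<in> carrier A \<Longrightarrow> a \<star> b \<in> carrier A"
  by (rule lin_closed[OF bilinD1[OF A_bilin]])

lemma lmult_lin [simp]: "a \<in> carrier A \<Longrightarrow> (\<lambda>b. a \<star> b) \<in> lin_map K A A"
  by (rule bilinD1[OF A_bilin])

lemma rmult_lin [simp]: "a \<in> carrier A \<Longrightarrow> (\<lambda>b. b \<star> a) \<in> lin_map K A A"
  by (rule bilinD2[OF A_bilin])

lemma dual_lmult [simp]: "\<beta> \<in> dual A \<Longrightarrow> a \<in> carrier A \<Longrightarrow> (\<lambda>u. \<beta> (a \<star> u)) \<in> dual A"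
  by (rule lin_comp[OF _ lmult_lin])

lemma dual_rmult [simp]: "\<beta> \<in> dual A \<Longrightarrow> a \<in> carrier A \<Longrightarrow> (\<lambda>u. \<beta> (u \<star> a)) \<in> dual A"
  by (rule lin_comp[OF _ rmult_lin])

lemma pt_closed [simp]: "a \<in> carrier A \<Longrightarrow> b \<in> carrier A \<Longrightarrow> pt a b \<in> carrier AA"
  by (rule pure_closed) simp_all

lemma maps_closed [simp]:
  "x \<in> carrier AA \<Longrightarrow> E1 A x \<in> carrier AA" "x \<in> carrier AA \<Longrightarrow> E2 A x \<in> carrier AA"
  "x \<in> carrier AA \<Longrightarrow> T1 A x \<in> carrier AA" "x \<in> carrier AA \<Longrightarrow> T2 A x \<in> carrier AA"
  "x \<in> carrier AA \<Longrightarrow> T3 A x \<in> carrier AA" "x \<in> carrier AA \<Longrightarrow> T4 A x \<in> carrier AA"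
  by (auto intro: lin_closed[OF E1_linear] lin_closed[OF E2_linear] lin_closed[OF T1_linear]
    lin_closed[OF T2_linear] lin_closed[OF T3_linear] lin_closed[OF T4_linear])

lemma cr_lin [simp]: "\<beta> \<in> dual A \<Longrightarrow> cr \<beta> \<in> lin_map K AA A"
  and cl_lin [simp]: "\<beta> \<in> dual A \<Longrightarrow> cl \<beta> \<in> lin_map K AA A"
  by (simp_all add: contract_right_lin contract_left_lin)

lemma cr_closed [simp]: "\<beta> \<in> dual A \<Longrightarrow> x \<in> carrier AA \<Longrightarrow> cr \<beta> x \<in> carrier A"
  and cl_closed [simp]: "\<beta> \<in> dual A \<Longrightarrow> x \<in> carrier AA \<Longrightarrow> cl \<beta> x \<in> carrier A"
  by (auto intro: lin_closed[OF cr_lin] lin_closed[OF cl_lin])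

lemma cr_cl: "\<alpha> \<in> dual A \<Longrightarrow> \<beta> \<in> dual A \<Longrightarrow> x \<in> carrier AA \<Longrightarrow> \<alpha> (cr \<beta> x) = \<beta> (cl \<alpha> x)"
  using contract_comm[of A A \<alpha> \<beta> x] by simp

section \<open>Multiplying one leg\<close>

lemma mul_legs_lin [simp]:
  assumes "a \<in> carrier A"
  shows "lm1 a \<in> lin_map K AA AA" "lm2 a \<in> lin_map K AA AA" "rm1 a \<in> lin_map K AA AA" "rm2 a \<in> lin_map K AA AA"
  using assms by (auto simp: lmul1_def lmul2_def rmul1_def rmul2_def intro!: tensor_map_lin)

lemma mul_legs_closed [simp]:
  assumes "a \<in> carrier A" "x \<in> carrier AA"
  shows "lm1 a x \<in> carrier AA" "lm2 a x \<in> carrier AA" "rm1 a x \<in> carrier AA" "rm2 a x \<in> carrier AA"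
  using assms(2) by (auto intro: lin_closed[OF mul_legs_lin(1)] lin_closed[OF mul_legs_lin(2)]
    lin_closed[OF mul_legs_lin(3)] lin_closed[OF mul_legs_lin(4)] assms(1))

lemma mul_legs_pt [simp]:
  assumes "a \<in> carrier A" "b \<in> carrier A" "c \<in> carrier A"
  shows "lm1 a (pt b c) = pt (a \<star> b) c" "lm2 a (pt b c) = pt b (a \<star> c)"
    "rm1 a (pt b c) = pt (b \<star> a) c" "rm2 a (pt b c) = pt b (c \<star> a)"
  using assms by (simp_all add: lmul1_def lmul2_def rmul1_def rmul2_def tensor_map_pure)

lemma cr_mul_legs:
  assumes "\<beta> \<in> dual A" "a \<in> carrier A" "x \<in> carrier AA"
  shows "cr \<beta> (lm1 a x) = a \<star> cr \<beta> x" "cr \<beta> (lm2 a x) = cr (\<lambda>u. \<beta> (a \<star> u)) x"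
    "cr \<beta> (rm1 a x) = cr \<beta> x \<star> a" "cr \<beta> (rm2 a x) = cr (\<lambda>u. \<beta> (u \<star> a)) x"
  using assms by (simp_all add: lmul1_def lmul2_def rmul1_def rmul2_def contract_right_map[of A A A A])

lemma cl_mul_legs:
  assumes "\<beta> \<in> dual A" "a \<in> carrier A" "x \<in> carrier AA"
  shows "cl \<beta> (lm1 a x) = cl (\<lambda>u. \<beta> (a \<star> u)) x" "cl \<beta> (lm2 a x) = a \<star> cl \<beta> x"
    "cl \<beta> (rm1 a x) = cl (\<lambda>u. \<beta> (u \<star> a)) x" "cl \<beta> (rm2 a x) = cl \<beta> x \<star> a"
  using assms by (simp_all add: lmul1_def lmul2_def rmul1_def rmul2_def contract_left_map[of A A A A])

lemma AA_eqI:
  assumes "x \<in> carrier AA" "y \<in> carrier AA"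
    "\<And>\<alpha> \<beta>. \<alpha> \<in> dual A \<Longrightarrow> \<beta> \<in> dual A \<Longrightarrow> \<alpha> (cr \<beta> x) = \<alpha> (cr \<beta> y)"
  shows "x = y"
  by (rule tensor_eqI[OF A_module A_module assms])

lemma AA_eqI_cr:
  assumes "x \<in> carrier AA" "y \<in> carrier AA" "\<And>\<beta>. \<beta> \<in> dual A \<Longrightarrow> cr \<beta> x = cr \<beta> y"
  shows "x = y"
  by (rule AA_eqI[OF assms(1,2)]) (simp add: assms(3))

lemma AA_eqI_cl:
  assumes "x \<in> carrier AA" "y \<in> carrier AA" "\<And>\<beta>. \<beta> \<in> dual A \<Longrightarrow> cl \<beta> x = cl \<beta> y"
  shows "x = y"
  by (rule AA_eqI[OF assms(1,2)]) (simp add: assms cr_cl)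

lemma AA_ext:
  assumes "module K U" "f \<in> lin_map K AA U" "g \<in> lin_map K AA U"
    "\<And>a b. a \<in> carrier A \<Longrightarrow> b \<in> carrier A \<Longrightarrow> f (pt a b) = g (pt a b)" "x \<in> carrier AA"
  shows "f x = g x"
  by (rule tensor_ext[OF A_module A_module assms])

lemma mul_legs_commute:
  assumes c: "a \<in> carrier A" "b \<in> carrier A" and x: "x \<in> carrier AA"
  shows "lm1 a (rm1 b x) = rm1 b (lm1 a x)" "lm1 a (lm2 b x) = lm2 b (lm1 a x)" "lm1 a (rm2 b x) = rm2 b (lm1 a x)"
    "rm1 a (lm2 b x) = lm2 b (rm1 a x)" "rm1 a (rm2 b x) = rm2 b (rm1 a x)" "lm2 a (rm2 b x) = rm2 b (lm2 a x)"
    "lm1 (a \<star> b) x = lm1 a (lm1 b x)" "lm2 (a \<star> b) x = lm2 a (lm2 b x)"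
    "rm1 (a \<star> b) x = rm1 b (rm1 a x)" "rm2 (a \<star> b) x = rm2 b (rm2 a x)"
  by (rule AA_ext[OF AA_module _ _ _ x]; use c in \<open>simp add: A_assoc lin_comp[OF mul_legs_lin(1)] lin_comp[OF mul_legs_lin(2)]
     lin_comp[OF mul_legs_lin(3)] lin_comp[OF mul_legs_lin(4)]\<close>)+

lemma A_cancel_left:
  assumes x: "x \<in> carrier A" "y \<in> carrier A" and eq: "\<And>b. b \<in> carrier A \<Longrightarrow> b \<star> x = b \<star> y"
  shows "x = y"
proof -
  interpret A: module K A by simp
  have "x \<ominus>\<^bsub>A\<^esub> y = \<zero>\<^bsub>A\<^esub>"
    using nondegenerate_A x eq by (simp add: nondegenerate_algebra_def lin_minus[OF A_module A_module lmult_lin] minus_zero_iff)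
  then show ?thesis using minus_zero_iff[OF A_module x] by simp
qed

lemma A_cancel_right:
  assumes x: "x \<in> carrier A" "y \<in> carrier A" and eq: "\<And>b. b \<in> carrier A \<Longrightarrow> x \<star> b = y \<star> b"
  shows "x = y"
proof -
  interpret A: module K A by simp
  have "x \<ominus>\<^bsub>A\<^esub> y = \<zero>\<^bsub>A\<^esub>"
    using nondegenerate_A x eq by (simp add: nondegenerate_algebra_def lin_minus[OF A_module A_module rmult_lin] minus_zero_iff)
  then show ?thesis using minus_zero_iff[OF A_module x] by simp
qed

text \<open>
  Non-degeneracy of \<open>A \<otimes> A\<close> in each leg. Contracting the other leg reduces it to
  non-degeneracy of \<open>A\<close>.
\<close>

lemma AA_cancel:
  assumes x: "x \<in> carrier AA" "y \<in> carrier AA"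
  shows "(\<And>a. a \<in> carrier A \<Longrightarrow> lm1 a x = lm1 a y) \<Longrightarrow> x = y"
    "(\<And>a. a \<in> carrier A \<Longrightarrow> lm2 a x = lm2 a y) \<Longrightarrow> x = y"
    "(\<And>a. a \<in> carrier A \<Longrightarrow> rm1 a x = rm1 a y) \<Longrightarrow> x = y"
    "(\<And>a. a \<in> carrier A \<Longrightarrow> rm2 a x = rm2 a y) \<Longrightarrow> x = y"
proof -
  show "x = y" if h: "\<And>a. a \<in> carrier A \<Longrightarrow> lm1 a x = lm1 a y"
    by (rule AA_eqI_cr[OF x], rule A_cancel_left) (simp_all add: x h cr_mul_legs(1)[symmetric])
  show "x = y" if h: "\<And>a. a \<in> carrier A \<Longrightarrow> lm2 a x = lm2 a y"
    by (rule AA_eqI_cl[OF x], rule A_cancel_left) (simp_all add: x h cl_mul_legs(2)[symmetric])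
  show "x = y" if h: "\<And>a. a \<in> carrier A \<Longrightarrow> rm1 a x = rm1 a y"
    by (rule AA_eqI_cr[OF x], rule A_cancel_right) (simp_all add: x h cr_mul_legs(3)[symmetric])
  show "x = y" if h: "\<And>a. a \<in> carrier A \<Longrightarrow> rm2 a x = rm2 a y"
    by (rule AA_eqI_cl[OF x], rule A_cancel_right) (simp_all add: x h cl_mul_legs(4)[symmetric])
qed

abbreviation "X \<equiv> rslice K A A (T1 A)"
abbreviation "Y \<equiv> rslice K A A (T3 A)"
abbreviation "Z \<equiv> lslice K A A (T2 A)"
abbreviation "W \<equiv> lslice K A A (T4 A)"

lemma slice_closed [simp]:
  assumes "\<beta> \<in> dual A" "p \<in> carrier A" "y \<in> carrier A"
  shows "X \<beta> p y \<in> carrier A" "Y \<beta> p y \<in> carrier A" "Z \<beta> p y \<in> carrier A" "W \<beta> p y \<in> carrier A"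
  using assms by (simp_all add: rslice_def lslice_def)

section \<open>The relations between the four maps\<close>

lemma Z_X: "\<beta> \<in> dual A \<Longrightarrow> \<gamma> \<in> dual A \<Longrightarrow> b \<in> carrier A \<Longrightarrow> c \<in> carrier A \<Longrightarrow> y \<in> carrier A
    \<Longrightarrow> Z \<beta> c (X \<gamma> b y) = X \<gamma> b (Z \<beta> c y)"
  by (rule slices_commute[OF A_module T2_linear T1_linear T2_T1_commute])

lemma cl_counit_T1: "a \<in> carrier A \<Longrightarrow> b \<in> carrier A \<Longrightarrow> cl (counit A) (T1 A (pt a b)) = a \<star> b"
  and cr_counit_T2: "a \<in> carrier A \<Longrightarrow> b \<in> carrier A \<Longrightarrow> cr (counit A) (T2 A (pt a b)) = a \<star> b"
  by (simp_all add: counit_T1 counit_T2 mult_map_def tensor_lift_pure[OF A_module A_module A_module A_bilin])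

lemma counit_X: "\<beta> \<in> dual A \<Longrightarrow> b \<in> carrier A \<Longrightarrow> y \<in> carrier A \<Longrightarrow> counit A (X \<beta> b y) = \<beta> (y \<star> b)"
  by (simp add: rslice_def cr_cl cl_counit_T1)

lemma counit_Z: "\<beta> \<in> dual A \<Longrightarrow> b \<in> carrier A \<Longrightarrow> y \<in> carrier A \<Longrightarrow> counit A (Z \<beta> b y) = \<beta> (b \<star> y)"
  by (simp add: lslice_def cr_cl[symmetric] cr_counit_T2)

text \<open>
  Both sides are \<open>(c \<otimes> 1) \<Delta> (y) (1 \<otimes> b)\<close>. The identity results from applying the counit to the
  commutation of the slices of \<open>T2\<close> and \<open>T1\<close>.
\<close>

lemma T1_T2:
  assumes c: "b \<in> carrier A" "c \<in> carrier A" "y \<in> carrier A"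
  shows "lm1 c (T1 A (pt y b)) = rm2 b (T2 A (pt c y))"
proof (rule AA_eqI)
  fix \<beta> \<gamma> assume d: "\<beta> \<in> dual A" "\<gamma> \<in> dual A"
  have "\<beta> (c \<star> X \<gamma> b y) = counit A (Z \<beta> c (X \<gamma> b y))" using c d by (simp add: counit_Z)
  also have "\<dots> = \<gamma> (Z \<beta> c y \<star> b)" using c d by (simp add: Z_X counit_X)
  finally show "\<beta> (cr \<gamma> (lm1 c (T1 A (pt y b)))) = \<beta> (cr \<gamma> (rm2 b (T2 A (pt c y))))"
    using c d by (simp add: cr_mul_legs(1) rslice_def lslice_def cr_cl cl_mul_legs(4))
qed (use c in simp_all)

text \<open>
  In this and the following two identities, multiplying a leg makes it possible to exchange
  \<open>T3\<close> with \<open>T1\<close> or \<open>T4\<close> with \<open>T2\<close>; the factor is cancelled afterwards.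
\<close>

lemma T1_T4:
  assumes c: "b \<in> carrier A" "c \<in> carrier A" "y \<in> carrier A"
  shows "rm1 c (T1 A (pt y b)) = rm2 b (T4 A (pt c y))"
proof (rule AA_cancel(1))
  fix d assume d: "d \<in> carrier A"
  have "lm1 d (rm1 c (T1 A (pt y b))) = rm1 c (rm2 b (T2 A (pt d y)))"
    using c d by (simp add: mul_legs_commute T1_T2)
  also have "\<dots> = rm2 b (rm1 c (T2 A (pt d y)))" using c d by (simp add: mul_legs_commute)
  also have "\<dots> = lm1 d (rm2 b (T4 A (pt c y)))" using c d by (simp add: T2_T4 mul_legs_commute)
  finally show "lm1 d (rm1 c (T1 A (pt y b))) = lm1 d (rm2 b (T4 A (pt c y)))" .
qed (use c in simp_all)

lemma T3_T2:
  assumes c: "b \<in> carrier A" "c \<in> carrier A" "y \<in> carrier A"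
  shows "lm1 c (T3 A (pt y b)) = lm2 b (T2 A (pt c y))"
proof (rule AA_cancel(4))
  fix e assume e: "e \<in> carrier A"
  have "rm2 e (lm1 c (T3 A (pt y b))) = lm1 c (rm2 e (T3 A (pt y b)))" using c e by (simp add: mul_legs_commute)
  also have "\<dots> = lm2 b (lm1 c (T1 A (pt y e)))" using c e by (simp add: T1_T3[symmetric] mul_legs_commute)
  also have "\<dots> = rm2 e (lm2 b (T2 A (pt c y)))" using c e by (simp add: T1_T2 mul_legs_commute)
  finally show "rm2 e (lm1 c (T3 A (pt y b))) = rm2 e (lm2 b (T2 A (pt c y)))" .
qed (use c in simp_all)

lemma T3_T4:
  assumes c: "b \<in> carrier A" "c \<in> carrier A" "y \<in> carrier A"
  shows "rm1 c (T3 A (pt y b)) = lm2 b (T4 A (pt c y))"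
proof (rule AA_cancel(4))
  fix e assume e: "e \<in> carrier A"
  have "rm2 e (rm1 c (T3 A (pt y b))) = rm1 c (rm2 e (T3 A (pt y b)))" using c e by (simp add: mul_legs_commute)
  also have "\<dots> = lm2 b (rm1 c (T1 A (pt y e)))" using c e by (simp add: T1_T3[symmetric] mul_legs_commute)
  also have "\<dots> = rm2 e (lm2 b (T4 A (pt c y)))" using c e by (simp add: T1_T4 mul_legs_commute)
  finally show "rm2 e (rm1 c (T3 A (pt y b))) = rm2 e (lm2 b (T4 A (pt c y)))" .
qed (use c in simp_all)

lemma cl_counit_T3:
  assumes c: "b \<in> carrier A" "y \<in> carrier A"
  shows "cl (counit A) (T3 A (pt y b)) = b \<star> y"
proof (rule A_cancel_right)
  fix e assume e: "e \<in> carrier A"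
  have "cl (counit A) (T3 A (pt y b)) \<star> e = cl (counit A) (lm2 b (T1 A (pt y e)))"
    using c e by (simp add: T1_T3 cl_mul_legs(4))
  then show "cl (counit A) (T3 A (pt y b)) \<star> e = b \<star> y \<star> e"
    using c e by (simp add: cl_mul_legs(2) cl_counit_T1 A_assoc)
qed (use c in simp_all)

lemma cr_counit_T4:
  assumes c: "b \<in> carrier A" "y \<in> carrier A"
  shows "cr (counit A) (T4 A (pt b y)) = y \<star> b"
proof (rule A_cancel_left)
  fix d assume d: "d \<in> carrier A"
  have "d \<star> cr (counit A) (T4 A (pt b y)) = cr (counit A) (rm1 b (T2 A (pt d y)))"
    using c d by (simp add: T2_T4 cr_mul_legs(1))
  then show "d \<star> cr (counit A) (T4 A (pt b y)) = d \<star> (y \<star> b)"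
    using c d by (simp add: cr_mul_legs(3) cr_counit_T2 A_assoc)
qed (use c in simp_all)

text \<open>
  Commuting with the slices of \<open>T1\<close> implies commuting with those of \<open>T3\<close>, because the slices
  agree for covered functionals. The following lemma is the analogue for \<open>T2\<close> and \<open>T4\<close>.
\<close>

lemma commutes_with_Y:
  assumes h: "h \<in> lin_map K A A"
    and hX: "\<And>\<gamma> b y. \<gamma> \<in> dual A \<Longrightarrow> b \<in> carrier A \<Longrightarrow> y \<in> carrier A \<Longrightarrow> h (X \<gamma> b y) = X \<gamma> b (h y)"
    and c: "\<gamma> \<in> dual A" "b \<in> carrier A" "y \<in> carrier A"
  shows "h (Y \<gamma> b y) = Y \<gamma> b (h y)"
proof -
  note hc [simp] = lin_closed[OF h]
  have XY: "cr (\<lambda>u. \<gamma> (u \<star> e)) (T3 A (pt y b)) = X (\<lambda>u. \<gamma> (b \<star> u)) e y"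
    if "\<gamma> \<in> dual A" "e \<in> carrier A" "y \<in> carrier A" for \<gamma> e y
    using that c by (simp add: rslice_def cr_mul_legs(2,4)[symmetric] T1_T3)
  have "tensor_map K A A h (\<lambda>u. u) (T3 A (pt y b)) = T3 A (pt (h y) b)"
  proof (rule AA_cancel(4))
    fix e assume e: "e \<in> carrier A"
    show "rm2 e (tensor_map K A A h (\<lambda>u. u) (T3 A (pt y b))) = rm2 e (T3 A (pt (h y) b))"
      by (rule AA_eqI_cr) (use c e in \<open>simp_all add: cr_mul_legs contract_right_map[of A A A A] h hX XY
        lin_closed[OF tensor_map_lin[of A A A A]]\<close>)
  qed (use c in \<open>simp_all add: h lin_closed[OF tensor_map_lin[of A A A A]]\<close>)
  from arg_cong[OF this, of "cr \<gamma>"] show ?thesis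
    using c by (simp add: contract_right_map[of A A A A] h rslice_def)
qed

lemma commutes_with_W:
  assumes h: "h \<in> lin_map K A A"
    and hZ: "\<And>\<beta> c y. \<beta> \<in> dual A \<Longrightarrow> c \<in> carrier A \<Longrightarrow> y \<in> carrier A \<Longrightarrow> Z \<beta> c (h y) = h (Z \<beta> c y)"
    and c: "\<beta> \<in> dual A" "c \<in> carrier A" "y \<in> carrier A"
  shows "W \<beta> c (h y) = h (W \<beta> c y)"
proof -
  note hc [simp] = lin_closed[OF h]
  have ZW: "cl (\<lambda>u. \<beta> (d \<star> u)) (T4 A (pt c y)) = Z (\<lambda>u. \<beta> (u \<star> c)) d y"
    if "\<beta> \<in> dual A" "d \<in> carrier A" "y \<in> carrier A" for \<beta> d y
    using that c by (simp add: lslice_def cl_mul_legs(1,3)[symmetric] T2_T4)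
  have "tensor_map K A A (\<lambda>u. u) h (T4 A (pt c y)) = T4 A (pt c (h y))"
  proof (rule AA_cancel(1))
    fix e assume e: "e \<in> carrier A"
    show "lm1 e (tensor_map K A A (\<lambda>u. u) h (T4 A (pt c y))) = lm1 e (T4 A (pt c (h y)))"
      by (rule AA_eqI_cl) (use c e in \<open>simp_all add: cl_mul_legs contract_left_map[of A A A A] h hZ ZW
        lin_closed[OF tensor_map_lin[of A A A A]]\<close>)
  qed (use c in \<open>simp_all add: h lin_closed[OF tensor_map_lin[of A A A A]]\<close>)
  from arg_cong[OF this, of "cl \<beta>"] show ?thesis
    using c by (simp add: contract_left_map[of A A A A] h lslice_def)
qed

lemma A_lin [lin_intros]:
  "f \<in> lin_map K U A \<Longrightarrow> c \<in> carrier A \<Longrightarrow> (\<lambda>x. f x \<star> c) \<in> lin_map K U A"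
  "f \<in> lin_map K U A \<Longrightarrow> c \<in> carrier A \<Longrightarrow> (\<lambda>x. c \<star> f x) \<in> lin_map K U A"
  by (rule lin_comp[OF rmult_lin], simp_all) (rule lin_comp[OF lmult_lin])

section \<open>The multiplication of the tensor square\<close>

lemma tensor_mult_bilin: "y \<in> carrier AA \<Longrightarrow> bilin_map K A A AA (\<lambda>a b. tensor_map K A A (\<lambda>c. a \<star> c) (\<lambda>d. b \<star> d) y)"
proof -
  assume y: "y \<in> carrier AA"
  have *: "(\<lambda>u. tensor_lift K AA (\<lambda>c d. pt (f u \<star> c) (g u \<star> d)) y) \<in> lin_map K A AA"
    if "f = (\<lambda>u. u) \<and> (\<exists>b\<in>carrier A. g = (\<lambda>u. b)) \<or> g = (\<lambda>u. u) \<and> (\<exists>b\<in>carrier A. f = (\<lambda>u. b))" for f g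
  proof (rule lin_lift_param[OF A_module A_module AA_module A_module _ _ y])
    have fg: "\<And>u. u \<in> carrier A \<Longrightarrow> f u \<in> carrier A" "\<And>u. u \<in> carrier A \<Longrightarrow> g u \<in> carrier A" using that by auto
    show "bilin_map K A A AA (\<lambda>c d. pt (f p \<star> c) (g p \<star> d))" if "p \<in> carrier A" for p
      using that fg by (intro bilinI lin_intros A_module) auto
    show "(\<lambda>p. pt (f p \<star> v) (g p \<star> w)) \<in> lin_map K A AA" if "v \<in> carrier A" "w \<in> carrier A" for v w
      using \<open>f = _ \<and> _ \<or> _\<close> that by (elim disjE conjE bexE) (auto intro!: lin_intros)
  qed
  show ?thesis unfolding tensor_map_def
    by (rule bilinI) (rule *[of "\<lambda>u. _" "\<lambda>u. u"] *[of "\<lambda>u. u" "\<lambda>u. _"]; auto)+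
qed

lemma tensor_mult_pt_left:
  assumes "a \<in> carrier A" "b \<in> carrier A" "y \<in> carrier AA"
  shows "tensor_mult K A (pt a b) y = lm1 a (lm2 b y)"
proof -
  have "tensor_mult K A (pt a b) y = tensor_map K A A (\<lambda>c. a \<star> c) (\<lambda>d. b \<star> d) y"
    unfolding tensor_mult_def using assms by (simp add: tensor_lift_pure[OF A_module A_module AA_module tensor_mult_bilin])
  also have "\<dots> = lm1 a (lm2 b y)"
    by (rule AA_ext[OF AA_module _ _ _ assms(3)])
      (use assms in \<open>simp_all add: tensor_map_lin tensor_map_pure lin_comp[OF mul_legs_lin(1)]\<close>)
  finally show ?thesis .
qed

lemma tensor_mult_lin1: "y \<in> carrier AA \<Longrightarrow> (\<lambda>x. tensor_mult K A x y) \<in> lin_map K AA AA"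
  unfolding tensor_mult_def by (rule tensor_lift_lin[OF A_module A_module AA_module tensor_mult_bilin])

lemma tensor_mult_lin2: 
  assumes x: "x \<in> carrier AA"
  shows "tensor_mult K A x \<in> lin_map K AA AA"
  unfolding tensor_mult_def
  by (rule lin_lift_param[OF A_module A_module AA_module AA_module tensor_mult_bilin _ x]) (auto intro: tensor_map_lin)

lemma tensor_mult_pt_right:
  assumes x: "x \<in> carrier AA" and c: "c \<in> carrier A" "d \<in> carrier A"
  shows "tensor_mult K A x (pt c d) = rm1 c (rm2 d x)"
  by (rule AA_ext[OF AA_module tensor_mult_lin1 _ _ x])
    (use c in \<open>simp_all add: lin_comp[OF mul_legs_lin(3)] tensor_mult_pt_left\<close>)

text \<open>
  The maps \<open>E1\<close> and \<open>E2\<close> are the two components of a multiplier of \<open>A \<otimes> A\<close>. As for any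
  multiplier, this makes \<open>E1\<close> right linear and \<open>E2\<close> left linear, and \<open>E2\<close> idempotent with \<open>E1\<close>.
\<close>

lemma tensor_mult_E:
  assumes s: "s \<in> carrier AA" and t: "t \<in> carrier AA"
  shows "tensor_mult K A s (E1 A t) = tensor_mult K A (E2 A s) t"
proof (rule AA_ext[OF AA_module _ _ _ s])
  show "(\<lambda>x. tensor_mult K A x (E1 A t)) \<in> lin_map K AA AA" using t by (simp add: tensor_mult_lin1)
  show "(\<lambda>x. tensor_mult K A (E2 A x) t) \<in> lin_map K AA AA"
    by (rule lin_comp[OF tensor_mult_lin1[OF t] E2_linear])
  fix a b assume ab: "a \<in> carrier A" "b \<in> carrier A"
  show "tensor_mult K A (pt a b) (E1 A t) = tensor_mult K A (E2 A (pt a b)) t"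
    by (rule AA_ext[OF AA_module _ _ _ t], rule lin_comp[OF tensor_mult_lin2 E1_linear])
      (use ab in \<open>simp_all add: tensor_mult_lin2 E1_E2\<close>)
qed

lemma E_mul:
  assumes c: "a \<in> carrier A" "b \<in> carrier A" "c \<in> carrier A" "d \<in> carrier A"
  shows "lm1 a (lm2 b (E1 A (pt c d))) = rm1 c (rm2 d (E2 A (pt a b)))"
  using tensor_mult_E[of "pt a b" "pt c d"] c by (simp add: tensor_mult_pt_left tensor_mult_pt_right)

lemma E1_rm1:
  assumes d: "d \<in> carrier A" and t: "t \<in> carrier AA"
  shows "E1 A (rm1 d t) = rm1 d (E1 A t)"
proof (rule AA_ext[OF AA_module _ _ _ t])
  fix u v assume u: "u \<in> carrier A" "v \<in> carrier A"
  show "E1 A (rm1 d (pt u v)) = rm1 d (E1 A (pt u v))"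
  proof (rule AA_cancel(2))
    fix b assume b: "b \<in> carrier A"
    show "lm2 b (E1 A (rm1 d (pt u v))) = lm2 b (rm1 d (E1 A (pt u v)))"
    proof (rule AA_cancel(1))
      fix a assume a: "a \<in> carrier A"
      have "lm1 a (lm2 b (E1 A (rm1 d (pt u v)))) = rm1 (u \<star> d) (rm2 v (E2 A (pt a b)))"
        using a b u d by (simp add: E_mul)
      also have "\<dots> = rm1 d (rm1 u (rm2 v (E2 A (pt a b))))"
        using a b u d by (simp add: mul_legs_commute)
      also have "\<dots> = rm1 d (lm1 a (lm2 b (E1 A (pt u v))))"
        using a b u d by (simp add: E_mul)
      also have "\<dots> = lm1 a (lm2 b (rm1 d (E1 A (pt u v))))"
        using a b u d by (simp add: mul_legs_commute)
      finally show "lm1 a (lm2 b (E1 A (rm1 d (pt u v)))) = lm1 a (lm2 b (rm1 d (E1 A (pt u v))))" .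
    qed (use b u d in simp_all)
  qed (use u d in simp_all)
qed (use d in \<open>simp_all add: lin_comp[OF E1_linear] lin_comp[OF mul_legs_lin(3)]\<close>)

lemma E1_rm2:
  assumes d: "d \<in> carrier A" and t: "t \<in> carrier AA"
  shows "E1 A (rm2 d t) = rm2 d (E1 A t)"
proof (rule AA_ext[OF AA_module _ _ _ t])
  fix u v assume u: "u \<in> carrier A" "v \<in> carrier A"
  show "E1 A (rm2 d (pt u v)) = rm2 d (E1 A (pt u v))"
  proof (rule AA_cancel(2))
    fix b assume b: "b \<in> carrier A"
    show "lm2 b (E1 A (rm2 d (pt u v))) = lm2 b (rm2 d (E1 A (pt u v)))"
    proof (rule AA_cancel(1))
      fix a assume a: "a \<in> carrier A"
      have "lm1 a (lm2 b (E1 A (rm2 d (pt u v)))) = rm1 u (rm2 (v \<star> d) (E2 A (pt a b)))"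
        using a b u d by (simp add: E_mul)
      also have "\<dots> = rm2 d (rm1 u (rm2 v (E2 A (pt a b))))"
        using a b u d by (simp add: mul_legs_commute)
      also have "\<dots> = rm2 d (lm1 a (lm2 b (E1 A (pt u v))))"
        using a b u d by (simp add: E_mul)
      also have "\<dots> = lm1 a (lm2 b (rm2 d (E1 A (pt u v))))"
        using a b u d by (simp add: mul_legs_commute)
      finally show "lm1 a (lm2 b (E1 A (rm2 d (pt u v)))) = lm1 a (lm2 b (rm2 d (E1 A (pt u v))))" .
    qed (use b u d in simp_all)
  qed (use u d in simp_all)
qed (use d in \<open>simp_all add: lin_comp[OF E1_linear] lin_comp[OF mul_legs_lin(4)]\<close>)

lemma E2_lm1:
  assumes d: "d \<in> carrier A" and t: "t \<in> carrier AA"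
  shows "E2 A (lm1 d t) = lm1 d (E2 A t)"
proof (rule AA_ext[OF AA_module _ _ _ t])
  fix u v assume u: "u \<in> carrier A" "v \<in> carrier A"
  show "E2 A (lm1 d (pt u v)) = lm1 d (E2 A (pt u v))"
  proof (rule AA_cancel(4))
    fix b assume b: "b \<in> carrier A"
    show "rm2 b (E2 A (lm1 d (pt u v))) = rm2 b (lm1 d (E2 A (pt u v)))"
    proof (rule AA_cancel(3))
      fix a assume a: "a \<in> carrier A"
      have "rm1 a (rm2 b (E2 A (lm1 d (pt u v)))) = lm1 (d \<star> u) (lm2 v (E1 A (pt a b)))"
        using a b u d by (simp add: E_mul[symmetric])
      also have "\<dots> = lm1 d (lm1 u (lm2 v (E1 A (pt a b))))"
        using a b u d by (simp add: mul_legs_commute)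
      also have "\<dots> = lm1 d (rm1 a (rm2 b (E2 A (pt u v))))"
        using a b u d by (simp add: E_mul)
      also have "\<dots> = rm1 a (rm2 b (lm1 d (E2 A (pt u v))))"
        using a b u d by (simp add: mul_legs_commute)
      finally show "rm1 a (rm2 b (E2 A (lm1 d (pt u v)))) = rm1 a (rm2 b (lm1 d (E2 A (pt u v))))" .
    qed (use b u d in simp_all)
  qed (use u d in simp_all)
qed (use d in \<open>simp_all add: lin_comp[OF E2_linear] lin_comp[OF mul_legs_lin(1)]\<close>)

lemma E2_lm2:
  assumes d: "d \<in> carrier A" and t: "t \<in> carrier AA"
  shows "E2 A (lm2 d t) = lm2 d (E2 A t)"
proof (rule AA_ext[OF AA_module _ _ _ t])
  fix u v assume u: "u \<in> carrier A" "v \<in> carrier A"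
  show "E2 A (lm2 d (pt u v)) = lm2 d (E2 A (pt u v))"
  proof (rule AA_cancel(4))
    fix b assume b: "b \<in> carrier A"
    show "rm2 b (E2 A (lm2 d (pt u v))) = rm2 b (lm2 d (E2 A (pt u v)))"
    proof (rule AA_cancel(3))
      fix a assume a: "a \<in> carrier A"
      have "rm1 a (rm2 b (E2 A (lm2 d (pt u v)))) = lm1 u (lm2 (d \<star> v) (E1 A (pt a b)))"
        using a b u d by (simp add: E_mul[symmetric])
      also have "\<dots> = lm2 d (lm1 u (lm2 v (E1 A (pt a b))))"
        using a b u d by (simp add: mul_legs_commute)
      also have "\<dots> = lm2 d (rm1 a (rm2 b (E2 A (pt u v))))"
        using a b u d by (simp add: E_mul)
      also have "\<dots> = rm1 a (rm2 b (lm2 d (E2 A (pt u v))))"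
        using a b u d by (simp add: mul_legs_commute)
      finally show "rm1 a (rm2 b (E2 A (lm2 d (pt u v)))) = rm1 a (rm2 b (lm2 d (E2 A (pt u v))))" .
    qed (use b u d in simp_all)
  qed (use u d in simp_all)
qed (use d in \<open>simp_all add: lin_comp[OF E2_linear] lin_comp[OF mul_legs_lin(2)]\<close>)

lemma E2_idem:
  assumes s: "s \<in> carrier AA"
  shows "E2 A (E2 A s) = E2 A s"
proof (rule AA_cancel(4), goal_cases)
  case (3 d)
  show ?case
  proof (rule AA_cancel(3), goal_cases)
    case (3 c)
    have "rm1 c (rm2 d (E2 A (E2 A s))) = tensor_mult K A (E2 A (E2 A s)) (pt c d)"
      using s 3 \<open>d \<in> _\<close> by (simp add: tensor_mult_pt_right)
    also have "\<dots> = tensor_mult K A (E2 A s) (pt c d)"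
      using s 3 \<open>d \<in> _\<close> by (simp add: tensor_mult_E[symmetric] E1_idem)
    also have "\<dots> = rm1 c (rm2 d (E2 A s))" using s 3 \<open>d \<in> _\<close> by (simp add: tensor_mult_pt_right)
    finally show ?case .
  qed (use 3 s in simp_all)
qed (use s in simp_all)

lemma E1_fixes:
  assumes "a \<in> carrier A" "b \<in> carrier A" "c \<in> carrier A"
  shows "E1 A (rm1 b (T1 A (pt a c))) = rm1 b (T1 A (pt a c))"
proof (rule lin_eq_on_span[OF AA_module AA_module E1_linear lin_id])
  show "rm1 b (T1 A (pt a c)) \<in> span_of K AA {E1 A (pt b c) |b c. b \<in> carrier A \<and> c \<in> carrier A}"
    unfolding T1_E1_range[symmetric] by (rule subsetD[OF span_subset]) (use assms in blast)
qed (auto simp: E1_idem)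

lemma E2_fixes:
  assumes "a \<in> carrier A" "b \<in> carrier A" "c \<in> carrier A"
  shows "E2 A (lm2 c (T2 A (pt b a))) = lm2 c (T2 A (pt b a))"
proof (rule lin_eq_on_span[OF AA_module AA_module E2_linear lin_id])
  show "lm2 c (T2 A (pt b a)) \<in> span_of K AA {E2 A (pt b c) |b c. b \<in> carrier A \<and> c \<in> carrier A}"
    unfolding T2_E2_range[symmetric] by (rule subsetD[OF span_subset]) (use assms in blast)
qed (auto simp: E2_idem)

lemma E1_T1_fix: "a \<in> carrier A \<Longrightarrow> b \<in> carrier A \<Longrightarrow> E1 A (T1 A (pt a b)) = T1 A (pt a b)"
  by (rule AA_cancel(3)) (simp_all add: E1_rm1[symmetric] E1_fixes)

lemma E1_T4_fix: "a \<in> carrier A \<Longrightarrow> b \<in> carrier A \<Longrightarrow> E1 A (T4 A (pt a b)) = T4 A (pt a b)"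
  by (rule AA_cancel(4)) (simp_all add: E1_rm2[symmetric] E1_fixes T1_T4[symmetric])

lemma E2_T2_fix: "a \<in> carrier A \<Longrightarrow> b \<in> carrier A \<Longrightarrow> E2 A (T2 A (pt a b)) = T2 A (pt a b)"
  by (rule AA_cancel(2)) (simp_all add: E2_lm2[symmetric] E2_fixes)

lemma E2_T3_fix: "a \<in> carrier A \<Longrightarrow> b \<in> carrier A \<Longrightarrow> E2 A (T3 A (pt a b)) = T3 A (pt a b)"
  by (rule AA_cancel(1)) (simp_all add: E2_lm1[symmetric] E2_fixes T3_T2)

section \<open>The slice identities\<close>

lemma X_pt: "\<gamma> \<in> dual A \<Longrightarrow> b \<in> carrier A \<Longrightarrow> y \<in> carrier A \<Longrightarrow> d \<in> carrier A \<Longrightarrow>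
    d \<star> X \<gamma> b y = cr (\<lambda>u. \<gamma> (u \<star> b)) (T2 A (pt d y))"
  by (simp add: rslice_def cr_mul_legs(1,4)[symmetric] T1_T2)

lemma Y_pt: "\<gamma> \<in> dual A \<Longrightarrow> b \<in> carrier A \<Longrightarrow> y \<in> carrier A \<Longrightarrow> d \<in> carrier A \<Longrightarrow>
    Y \<gamma> b y \<star> d = cr (\<lambda>u. \<gamma> (b \<star> u)) (T4 A (pt d y))"
  by (simp add: rslice_def cr_mul_legs(2,3)[symmetric] T3_T4)

lemma X_lin [lin_intros]:
  assumes "\<gamma> \<in> dual A" "f \<in> lin_map K U A" "c \<in> carrier A"
  shows "(\<lambda>x. X \<gamma> (f x) c) \<in> lin_map K U A" "(\<lambda>x. X \<gamma> c (f x)) \<in> lin_map K U A"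
    "(\<lambda>x. Y \<gamma> (f x) c) \<in> lin_map K U A" "(\<lambda>x. Y \<gamma> c (f x)) \<in> lin_map K U A"
    "(\<lambda>x. Z \<gamma> (f x) c) \<in> lin_map K U A" "(\<lambda>x. Z \<gamma> c (f x)) \<in> lin_map K U A"
    "(\<lambda>x. W \<gamma> (f x) c) \<in> lin_map K U A" "(\<lambda>x. W \<gamma> c (f x)) \<in> lin_map K U A"
  by (intro rslice_lin1 rslice_lin2 lslice_lin1 lslice_lin2 A_module assms; simp)+

lemma XA_bilin: "\<gamma> \<in> dual A \<Longrightarrow> a \<in> carrier A \<Longrightarrow> bilin_map K A A A (\<lambda>p q. X \<gamma> q a \<star> p)"
  by (intro bilinI lin_intros) (simp_all add: lin_comp[OF lmult_lin])

lemma YA_bilin: "\<gamma> \<in> dual A \<Longrightarrow> a \<in> carrier A \<Longrightarrow> bilin_map K A A A (\<lambda>p q. p \<star> Y \<gamma> q a)"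
  by (intro bilinI lin_intros) (simp_all)

lemma ZA_bilin: "\<gamma> \<in> dual A \<Longrightarrow> a \<in> carrier A \<Longrightarrow> bilin_map K A A A (\<lambda>p q. q \<star> Z \<gamma> p a)"
  by (intro bilinI lin_intros) (simp_all)

lemma WA_bilin: "\<gamma> \<in> dual A \<Longrightarrow> a \<in> carrier A \<Longrightarrow> bilin_map K A A A (\<lambda>p q. W \<gamma> p a \<star> q)"
  by (intro bilinI lin_intros) (simp_all)

lemma lift_lin: "module K U \<Longrightarrow> bilin_map K A A U b \<Longrightarrow> tensor_lift K U b \<in> lin_map K AA U"
  by (rule tensor_lift_lin[OF A_module A_module])

lemma lift_closed: "bilin_map K A A A b \<Longrightarrow> x \<in> carrier AA \<Longrightarrow> tensor_lift K A b x \<in> carrier A"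
  by (rule lin_closed[OF lift_lin]) simp_all

lemma lift_comp:
  "bilin_map K A A A b \<Longrightarrow> x \<in> carrier AA \<Longrightarrow> module K U \<Longrightarrow> h \<in> lin_map K A U \<Longrightarrow>
    h (tensor_lift K A b x) = tensor_lift K U (\<lambda>p q. h (b p q)) x"
  by (rule lin_lift_comp[OF A_module A_module A_module])

text \<open>
  The axiom \<open>T1_mult\<close> at \<open>a \<otimes> b \<otimes> c\<close>, with the last leg contracted.
\<close>

lemma X_product:
  assumes g: "\<gamma> \<in> dual A" and c: "a \<in> carrier A" "b \<in> carrier A" "c \<in> carrier A"
  shows "tensor_lift K A (\<lambda>p q. X \<gamma> q a \<star> p) (T1 A (pt b c)) = X \<gamma> c (a \<star> b)"
proof -
  note m = A_module
  note mm = tensor_lift_pure[OF m m m A_bilin, folded mult_map_def]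
  have mml: "mult_map K A \<in> lin_map K AA A" unfolding mult_map_def by (rule lift_lin[OF m A_bilin])
  note mmm = tensor_map_lin[OF AA_module m m m mml lin_id[of A]]
  have leg: "mult_map K A (contract_right K AA \<gamma> (leg13 K A A A (T1 A) (tensor_unassoc K A A A (pure_tensor K A AA a t))))
      = tensor_lift K A (\<lambda>p q. X \<gamma> q a \<star> p) t" if "t \<in> carrier AA" for t
  proof (rule AA_ext[OF m _ lift_lin[OF m XA_bilin[OF g c(1)]] _ that])
    show "(\<lambda>t. mult_map K A (contract_right K AA \<gamma> (leg13 K A A A (T1 A) (tensor_unassoc K A A A (pure_tensor K A AA a t)))))
       \<in> lin_map K AA A"
      by (intro lin_comp[OF mml] lin_comp[OF contract_right_lin[OF AA_module m g]] lin_comp[OF leg13_lin[OF m m m T1_linear]]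
        lin_comp[OF tensor_unassoc_lin[OF m m m]] pure_lin2[OF m AA_module c(1)])
  qed (use g c in \<open>simp add: tensor_unassoc_pure contract_right_leg13_pure mm rslice_def
      tensor_lift_pure[OF m m m XA_bilin[OF g c(1), unfolded rslice_def]]\<close>)
  let ?x = "pure_tensor K AA A (pt a b) c"
  have x: "?x \<in> carrier (AA \<boxtimes> A)" using c by (simp add: pure_closed)
  have "cr \<gamma> (tensor_map K A A (mult_map K A) (\<lambda>a. a) (leg13 K A A A (T1 A) (leg23 K A A A A A (T1 A) ?x)))
      = cr \<gamma> (T1 A (tensor_map K A A (mult_map K A) (\<lambda>a. a) ?x))"
    using T1_mult[OF x] by simp
  moreover have "cr \<gamma> (tensor_map K A A (mult_map K A) (\<lambda>a. a) (leg13 K A A A (T1 A) (leg23 K A A A A A (T1 A) ?x)))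
      = tensor_lift K A (\<lambda>p q. X \<gamma> q a \<star> p) (T1 A (pt b c))"
    using c leg[of "T1 A (pt b c)"]
    by (simp add: contract_right_map[OF AA_module m m m mml lin_id g] leg23_pure_left
      lin_closed[OF leg13_lin[OF m m m T1_linear] lin_closed[OF tensor_unassoc_lin[OF m m m]]] pure_closed)
  moreover have "cr \<gamma> (T1 A (tensor_map K A A (mult_map K A) (\<lambda>a. a) ?x)) = X \<gamma> c (a \<star> b)"
    using c by (simp add: tensor_map_pure[OF AA_module m m m mml lin_id] mm rslice_def)
  ultimately show ?thesis by simp
qed

lemma X_Z: "\<beta> \<in> dual A \<Longrightarrow> \<gamma> \<in> dual A \<Longrightarrow> b \<in> carrier A \<Longrightarrow> c \<in> carrier A \<Longrightarrow> y \<in> carrier A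
      \<Longrightarrow> \<beta> (c \<star> X \<gamma> b y) = \<gamma> (Z \<beta> c y \<star> b)"
  by (simp add: rslice_def lslice_def cr_mul_legs(1)[symmetric] cl_mul_legs(4)[symmetric] cr_cl T1_T2)

lemma Y_W: "\<beta> \<in> dual A \<Longrightarrow> \<gamma> \<in> dual A \<Longrightarrow> b \<in> carrier A \<Longrightarrow> c \<in> carrier A \<Longrightarrow> y \<in> carrier A
      \<Longrightarrow> \<beta> (Y \<gamma> b y \<star> c) = \<gamma> (b \<star> W \<beta> c y)"
  by (simp add: rslice_def lslice_def cr_mul_legs(3)[symmetric] cl_mul_legs(2)[symmetric] cr_cl T3_T4)

lemma X_W: "\<beta> \<in> dual A \<Longrightarrow> \<gamma> \<in> dual A \<Longrightarrow> b \<in> carrier A \<Longrightarrow> c \<in> carrier A \<Longrightarrow> y \<in> carrier A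
      \<Longrightarrow> \<beta> (X \<gamma> b y \<star> c) = \<gamma> (W \<beta> c y \<star> b)"
  by (simp add: rslice_def lslice_def cr_mul_legs(3)[symmetric] cl_mul_legs(4)[symmetric] cr_cl T1_T4)

lemma Y_Z: "\<beta> \<in> dual A \<Longrightarrow> \<gamma> \<in> dual A \<Longrightarrow> b \<in> carrier A \<Longrightarrow> c \<in> carrier A \<Longrightarrow> y \<in> carrier A
      \<Longrightarrow> \<beta> (c \<star> Y \<gamma> b y) = \<gamma> (b \<star> Z \<beta> c y)"
  by (simp add: rslice_def lslice_def cr_mul_legs(1)[symmetric] cl_mul_legs(2)[symmetric] cr_cl T3_T2)

lemmas lift_pt = tensor_lift_pure[OF A_module A_module A_module]

text \<open>
  The product in \<open>A \<otimes> A\<close> of a value of \<open>T2\<close> or of \<open>T1\<close>, \<open>T4\<close> with an arbitrary tensor can be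
  evaluated by expanding that tensor. Comparing two such expansions transfers the multiplicativity
  of \<open>T1\<close> to the other three maps, and \<open>tensor_mult_E\<close> moves the idempotent from one factor to the
  other.
\<close>

lemma lift_X_tensor_mult:
  assumes g: "\<gamma> \<in> dual A" and c: "c \<in> carrier A" "d \<in> carrier A" and t: "t \<in> carrier AA"
  shows "d \<star> tensor_lift K A (\<lambda>p q. X \<gamma> q c \<star> p) t = cr \<gamma> (tensor_mult K A (T2 A (pt d c)) t)"
  by (rule AA_ext[OF A_module lin_comp[OF lmult_lin lift_lin] lin_comp[OF cr_lin tensor_mult_lin2] _ t])
    (use g c in \<open>simp_all add: XA_bilin lift_pt[OF XA_bilin] tensor_mult_pt_right cr_mul_legs X_pt[symmetric] A_assoc\<close>)

lemma lift_Y_tensor_mult: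
  assumes g: "\<gamma> \<in> dual A" and c: "c \<in> carrier A" "d \<in> carrier A" and t: "t \<in> carrier AA"
  shows "tensor_lift K A (\<lambda>p q. p \<star> Y \<gamma> q c) t \<star> d = cr \<gamma> (tensor_mult K A t (T4 A (pt d c)))"
  by (rule AA_ext[OF A_module lin_comp[OF rmult_lin lift_lin] lin_comp[OF cr_lin tensor_mult_lin1] _ t])
    (use g c in \<open>simp_all add: YA_bilin lift_pt[OF YA_bilin] tensor_mult_pt_left cr_mul_legs Y_pt[symmetric] A_assoc\<close>)

lemma lift_Z_tensor_mult:
  assumes g: "\<gamma> \<in> dual A" "\<alpha> \<in> dual A" and c: "y \<in> carrier A" "e \<in> carrier A" and s: "s \<in> carrier AA"
  shows "\<gamma> (tensor_lift K A (\<lambda>p q. q \<star> Z \<alpha> p y) s \<star> e) = \<alpha> (cr \<gamma> (tensor_mult K A s (T1 A (pt y e))))"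
proof (rule AA_ext[OF scalars_module _ _ _ s])
  fix p q assume "p \<in> carrier A" "q \<in> carrier A"
  then show "\<gamma> (tensor_lift K A (\<lambda>p q. q \<star> Z \<alpha> p y) (pt p q) \<star> e) = \<alpha> (cr \<gamma> (tensor_mult K A (pt p q) (T1 A (pt y e))))"
    using X_Z[of \<alpha> "\<lambda>u. \<gamma> (q \<star> u)" e p y] g c
    by (simp add: lift_pt[OF ZA_bilin] tensor_mult_pt_left cr_mul_legs A_assoc rslice_def)
qed (use g c in \<open>simp_all add: lin_comp[OF g(1)] lin_comp[OF g(2)] lin_comp[OF rmult_lin lift_lin] ZA_bilin lin_comp[OF cr_lin tensor_mult_lin1]\<close>)

lemma lift_Z_Y:
  assumes g: "\<gamma> \<in> dual A" "\<beta> \<in> dual A" and c: "a \<in> carrier A" "c \<in> carrier A" and s: "s \<in> carrier AA"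
  shows "\<beta> (tensor_lift K A (\<lambda>p q. p \<star> Y \<gamma> q a) (lm2 c s)) = \<gamma> (c \<star> tensor_lift K A (\<lambda>p q. q \<star> Z \<beta> p a) s)"
proof (rule AA_ext[OF scalars_module _ _ _ s])
  fix p q assume "p \<in> carrier A" "q \<in> carrier A"
  then show "\<beta> (tensor_lift K A (\<lambda>p q. p \<star> Y \<gamma> q a) (lm2 c (pt p q))) = \<gamma> (c \<star> tensor_lift K A (\<lambda>p q. q \<star> Z \<beta> p a) (pt p q))"
    using g c by (simp add: lift_pt[OF ZA_bilin] lift_pt[OF YA_bilin] Y_Z A_assoc)
qed (use g c in \<open>simp_all add: lin_comp[OF g(1)] lin_comp[OF g(2)] lin_comp[OF lmult_lin lift_lin] ZA_bilin YA_bilin lin_comp[OF lift_lin mul_legs_lin(2)]\<close>)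

lemma lift_W_X:
  assumes g: "\<gamma> \<in> dual A" "\<alpha> \<in> dual A" and c: "y \<in> carrier A" "e \<in> carrier A" and s: "s \<in> carrier AA"
  shows "\<gamma> (tensor_lift K A (\<lambda>p q. W \<alpha> p y \<star> q) s \<star> e) = \<alpha> (tensor_lift K A (\<lambda>p q. X \<gamma> q y \<star> p) (rm2 e s))"
proof (rule AA_ext[OF scalars_module _ _ _ s])
  fix p q assume "p \<in> carrier A" "q \<in> carrier A"
  then show "\<gamma> (tensor_lift K A (\<lambda>p q. W \<alpha> p y \<star> q) (pt p q) \<star> e) = \<alpha> (tensor_lift K A (\<lambda>p q. X \<gamma> q y \<star> p) (rm2 e (pt p q)))"
    using g c by (simp add: lift_pt[OF WA_bilin] lift_pt[OF XA_bilin] X_W A_assoc)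
qed (use g c in \<open>simp_all add: lin_comp[OF g(1)] lin_comp[OF g(2)] lin_comp[OF rmult_lin lift_lin] WA_bilin XA_bilin lin_comp[OF lift_lin mul_legs_lin(4)]\<close>)

lemma lift_Y_lm1:
  assumes g: "\<gamma> \<in> dual A" and c: "c \<in> carrier A" "d \<in> carrier A" and t: "t \<in> carrier AA"
  shows "tensor_lift K A (\<lambda>p q. p \<star> Y \<gamma> q c) (lm1 d t) = d \<star> tensor_lift K A (\<lambda>p q. p \<star> Y \<gamma> q c) t"
  by (rule AA_ext[OF A_module lin_comp[OF lift_lin mul_legs_lin(1)] lin_comp[OF lmult_lin lift_lin] _ t])
    (use g c in \<open>simp_all add: YA_bilin lift_pt[OF YA_bilin] A_assoc\<close>)

lemma lift_X_rm1:
  assumes g: "\<gamma> \<in> dual A" and c: "c \<in> carrier A" "d \<in> carrier A" and t: "t \<in> carrier AA"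
  shows "tensor_lift K A (\<lambda>p q. X \<gamma> q c \<star> p) (rm1 d t) = tensor_lift K A (\<lambda>p q. X \<gamma> q c \<star> p) t \<star> d"
  by (rule AA_ext[OF A_module lin_comp[OF lift_lin mul_legs_lin(3)] lin_comp[OF rmult_lin lift_lin] _ t])
    (use g c in \<open>simp_all add: XA_bilin lift_pt[OF XA_bilin] A_assoc\<close>)

lemma Z_product:
  assumes d: "\<alpha> \<in> dual A" and c: "c \<in> carrier A" "d \<in> carrier A" "y \<in> carrier A"
  shows "tensor_lift K A (\<lambda>p q. q \<star> Z \<alpha> p y) (T2 A (pt d c)) = Z \<alpha> d (c \<star> y)" (is "?l = ?r")
proof (rule A_cancel_right)
  show l: "?l \<in> carrier A" and r: "?r \<in> carrier A" using c d by (simp_all add: lift_closed ZA_bilin)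
  fix e assume e: "e \<in> carrier A"
  show "?l \<star> e = ?r \<star> e"
  proof (rule dual_eqI[OF A_module])
    fix \<gamma> assume g: "\<gamma> \<in> dual A"
    show "\<gamma> (?l \<star> e) = \<gamma> (?r \<star> e)"
      using c d e g by (simp add: lift_Z_tensor_mult lift_X_tensor_mult[symmetric] X_product X_Z)
  qed (use l r e in simp_all)
qed

lemma Y_product:
  assumes g: "\<gamma> \<in> dual A" and c: "a \<in> carrier A" "b \<in> carrier A" "c \<in> carrier A"
  shows "tensor_lift K A (\<lambda>p q. p \<star> Y \<gamma> q a) (T3 A (pt b c)) = Y \<gamma> c (b \<star> a)" (is "?l = ?r")
proof (rule A_cancel_left)
  show l: "?l \<in> carrier A" and r: "?r \<in> carrier A" using c g by (simp_all add: lift_closed YA_bilin)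
  fix d assume d: "d \<in> carrier A"
  show "d \<star> ?l = d \<star> ?r"
  proof (rule dual_eqI[OF A_module])
    fix \<beta> assume b: "\<beta> \<in> dual A"
    show "\<beta> (d \<star> ?l) = \<beta> (d \<star> ?r)"
      using c d b g by (simp add: lift_Y_lm1[symmetric] T3_T2 lift_Z_Y Z_product Y_Z)
  qed (use l r d in simp_all)
qed

lemma W_product:
  assumes d: "\<alpha> \<in> dual A" and c: "c \<in> carrier A" "d \<in> carrier A" "y \<in> carrier A"
  shows "tensor_lift K A (\<lambda>p q. W \<alpha> p y \<star> q) (T4 A (pt d c)) = W \<alpha> d (y \<star> c)" (is "?l = ?r")
proof (rule A_cancel_right)
  show l: "?l \<in> carrier A" and r: "?r \<in> carrier A" using c d by (simp_all add: lift_closed WA_bilin)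
  fix e assume e: "e \<in> carrier A"
  show "?l \<star> e = ?r \<star> e"
  proof (rule dual_eqI[OF A_module])
    fix \<gamma> assume g: "\<gamma> \<in> dual A"
    show "\<gamma> (?l \<star> e) = \<gamma> (?r \<star> e)"
      using c d e g by (simp add: lift_W_X T1_T4[symmetric] lift_X_rm1 X_product X_W)
  qed (use l r e in simp_all)
qed

lemma X_E1:
  assumes g: "\<gamma> \<in> dual A" and c: "a \<in> carrier A" "b \<in> carrier A" "c \<in> carrier A"
  shows "tensor_lift K A (\<lambda>p q. X \<gamma> q c \<star> p) (E1 A (pt b a)) = X \<gamma> a c \<star> b"
  by (rule A_cancel_left)
    (use g c in \<open>simp_all add: lift_closed XA_bilin lift_X_tensor_mult tensor_mult_E E2_T2_fix lift_X_tensor_mult[symmetric]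
      lift_pt[OF XA_bilin]\<close>)

lemma Y_E2:
  assumes g: "\<gamma> \<in> dual A" and c: "a \<in> carrier A" "b \<in> carrier A" "c \<in> carrier A"
  shows "tensor_lift K A (\<lambda>p q. p \<star> Y \<gamma> q c) (E2 A (pt b a)) = b \<star> Y \<gamma> a c"
proof (rule A_cancel_right)
  fix d assume d: "d \<in> carrier A"
  have "tensor_lift K A (\<lambda>p q. p \<star> Y \<gamma> q c) (E2 A (pt b a)) \<star> d = cr \<gamma> (tensor_mult K A (pt b a) (T4 A (pt d c)))"
    using g c d by (simp add: lift_Y_tensor_mult tensor_mult_E[symmetric] E1_T4_fix)
  also have "\<dots> = tensor_lift K A (\<lambda>p q. p \<star> Y \<gamma> q c) (pt b a) \<star> d"
    using g c d by (simp add: lift_Y_tensor_mult)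
  finally show "tensor_lift K A (\<lambda>p q. p \<star> Y \<gamma> q c) (E2 A (pt b a)) \<star> d = b \<star> Y \<gamma> a c \<star> d"
    using g c by (simp add: lift_pt[OF YA_bilin])
qed (use g c in \<open>simp_all add: lift_closed YA_bilin\<close>)

text \<open>
  The axiom \<open>E2_T2\<close> at \<open>c \<otimes> a \<otimes> y\<close>, with both outer legs contracted, is this identity
  multiplied by \<open>a\<close> from the left.
\<close>

lemma E2_Y:
  assumes d: "\<beta> \<in> dual A" "\<gamma> \<in> dual A" and c: "b \<in> carrier A" "c \<in> carrier A" "y \<in> carrier A"
  shows "lslice K A A (E2 A) \<beta> c (Y \<gamma> b y) = Y \<gamma> b (lslice K A A (E2 A) \<beta> c y)"
proof (rule A_cancel_left)
  note m = A_module
  let ?F = "lslice K A A (E2 A) \<beta> c"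
  have Fc: "u \<in> carrier A \<Longrightarrow> ?F u \<in> carrier A" for u using d c by (simp add: lslice_def)
  then show "?F (Y \<gamma> b y) \<in> carrier A" "Y \<gamma> b (?F y) \<in> carrier A" using d c by simp_all
  fix a assume a: "a \<in> carrier A"
  let ?x = "pure_tensor K AA A (pt c a) y"
  have x: "?x \<in> carrier (AA \<boxtimes> A)" using a c by (simp add: pure_closed)
  have g: "(\<lambda>u. \<gamma> (b \<star> u)) \<in> dual A" using d c by simp
  have T2Y: "cr (\<lambda>u. \<gamma> (b \<star> u)) (T2 A (pt a u)) = a \<star> Y \<gamma> b u" if "u \<in> carrier A" for u
    using that a c d by (simp add: rslice_def cr_mul_legs(1,2)[symmetric] T3_T2)
  have "cl \<beta> (contract_right K AA (\<lambda>u. \<gamma> (b \<star> u)) (leg12 K A A A (E2 A) (leg23 K A A A A A (T2 A) ?x)))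
      = ?F (a \<star> Y \<gamma> b y)"
    using a c d g x by (simp add: contract_right_leg12[OF m m m m m E2_linear] leg23_pure_left
      contract_right_unassoc lin_closed[OF tensor_unassoc_lin] T2Y lslice_def[symmetric] pure_closed)
  also have "\<dots> = a \<star> ?F (Y \<gamma> b y)"
    using a c d E2_lm2[of a "pt c (Y \<gamma> b y)"] by (simp add: lslice_def cl_mul_legs(2)[symmetric])
  finally have 1: "cl \<beta> (contract_right K AA (\<lambda>u. \<gamma> (b \<star> u)) (leg12 K A A A (E2 A) (leg23 K A A A A A (T2 A) ?x)))
      = a \<star> ?F (Y \<gamma> b y)" .
  have "cl \<beta> (contract_right K AA (\<lambda>u. \<gamma> (b \<star> u)) (leg23 K A A A A A (T2 A) (leg13 K A A A (E2 A) ?x)))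
      = cr (\<lambda>u. \<gamma> (b \<star> u)) (T2 A (contract_first K A A \<beta> (leg13 K A A A (E2 A) ?x)))"
    by (subst contract_first_right[OF m m m d(1) g lin_closed[OF leg23_lin[OF m m m m m T2_linear] lin_closed[OF leg13_lin[OF m m m E2_linear] x]]])
      (simp only: contract_first_leg23[OF m m m m m T2_linear d(1) lin_closed[OF leg13_lin[OF m m m E2_linear] x]])
  also have "\<dots> = a \<star> Y \<gamma> b (?F y)"
    using a c d by (simp add: contract_first_leg13_pure T2Y lslice_def[symmetric] Fc)
  finally have 2: "cl \<beta> (contract_right K AA (\<lambda>u. \<gamma> (b \<star> u)) (leg23 K A A A A A (T2 A) (leg13 K A A A (E2 A) ?x)))
      = a \<star> Y \<gamma> b (?F y)" .
  show "a \<star> ?F (Y \<gamma> b y) = a \<star> Y \<gamma> b (?F y)" using 1 2 E2_T2[OF x] by simp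
qed

section \<open>Fullness\<close>

text \<open>
  If \<open>\<alpha>\<close> kills the slices of \<open>rho\<close>, then it kills those slices of \<open>lam\<close> for which the
  functional is covered, and the covering factor is cancelled as usual.
\<close>

lemma full_other_side:
  assumes V: "module K V" and l: "lam \<in> lin_map K (V \<boxtimes> A) (V \<boxtimes> A)"
    "rho \<in> lin_map K (V \<boxtimes> A) (V \<boxtimes> A)"
    and compat: "\<And>\<beta> a b v. \<beta> \<in> dual A \<Longrightarrow> a \<in> carrier A \<Longrightarrow> b \<in> carrier A \<Longrightarrow> v \<in> carrier V \<Longrightarrow>
      rslice K V A lam (\<lambda>u. \<beta> (a \<star> u)) b v = rslice K V A rho (\<lambda>u. \<beta> (u \<star> b)) a v"
    and full: "span_of K V {rslice K V A lam \<beta> a v | \<beta> a v. \<beta> \<in> dual A \<and> a \<in> carrier A \<and> v \<in> carrier V} = carrier V"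
  shows "span_of K V {rslice K V A rho \<beta> a v | \<beta> a v. \<beta> \<in> dual A \<and> a \<in> carrier A \<and> v \<in> carrier V} = carrier V"
proof (rule span_eq_carrierI[OF V _ full])
  show "{rslice K V A rho \<beta> a v | \<beta> a v. \<beta> \<in> dual A \<and> a \<in> carrier A \<and> v \<in> carrier V} \<subseteq> carrier V"
    by (auto intro: rslice_closed V l)
  fix \<alpha> s assume a: "\<alpha> \<in> dual V"
    and z: "\<And>s. s \<in> {rslice K V A rho \<beta> a v | \<beta> a v. \<beta> \<in> dual A \<and> a \<in> carrier A \<and> v \<in> carrier V} \<Longrightarrow> \<alpha> s = \<zero>\<^bsub>K\<^esub>"
    and s: "s \<in> {rslice K V A lam \<beta> a v | \<beta> a v. \<beta> \<in> dual A \<and> a \<in> carrier A \<and> v \<in> carrier V}"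
  from s obtain \<beta> d u where u: "\<beta> \<in> dual A" "d \<in> carrier A" "u \<in> carrier V" "s = rslice K V A lam \<beta> d u" by blast
  let ?w = "contract_left K A \<alpha> (lam (pure_tensor K V A u d))"
  have p: "lam (pure_tensor K V A u d) \<in> carrier (V \<boxtimes> A)"
    using u by (intro lin_closed[OF l(1)] pure_closed V A_module)
  have w: "?w \<in> carrier A" by (rule lin_closed[OF contract_left_lin[OF V A_module a] p])
  have ev: "\<gamma> ?w = \<alpha> (rslice K V A lam \<gamma> d u)" if "\<gamma> \<in> dual A" for \<gamma>
    unfolding rslice_def by (rule contract_comm[OF V A_module a that p, symmetric])
  interpret A: module K A by simp
  have "?w = \<zero>\<^bsub>A\<^esub>"
  proof (rule A_cancel_left)
    fix b assume b: "b \<in> carrier A"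
    show "b \<star> ?w = b \<star> \<zero>\<^bsub>A\<^esub>"
    proof (rule dual_eqI[OF A_module])
      fix \<gamma> assume g: "\<gamma> \<in> dual A"
      have "\<gamma> (b \<star> ?w) = \<alpha> (rslice K V A rho (\<lambda>v. \<gamma> (v \<star> d)) b u)"
        using ev[of "\<lambda>v. \<gamma> (b \<star> v)"] compat[of \<gamma> b d u] b g u by simp
      also have "\<dots> = \<zero>\<^bsub>K\<^esub>" by (rule z) (use g u b dual_rmult in blast)
      finally show "\<gamma> (b \<star> ?w) = \<gamma> (b \<star> \<zero>\<^bsub>A\<^esub>)"
        using lin_zero[OF A_module A_module lmult_lin[OF b]] lin_zero[OF A_module scalars_module g] by simp
    qed (use w b in simp_all)
  qed (use w in simp_all)
  then show "\<alpha> s = \<zero>\<^bsub>K\<^esub>"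
    using ev[OF u(1)] u lin_zero[OF A_module scalars_module u(1)] by simp
qed

lemma products_span_A: "span_of K A {a \<star> b | a b. a \<in> carrier A \<and> b \<in> carrier A} = carrier A" (is "span_of K A ?S = _")
proof
  have S: "?S \<subseteq> carrier A" by auto
  then show "span_of K A ?S \<subseteq> carrier A" by (rule span_in_carrier[OF A_module])
  note sub = span_subspace[OF A_module S]
  have "mult_map K A x \<in> span_of K A ?S" if "x \<in> carrier AA" for x
    using that
  proof (induction rule: tensor_induct[OF A_module A_module, consumes 1, case_names pure add])
    case (pure v w)
    then show ?case unfolding mult_map_def lift_pt[OF A_bilin pure]
      by (intro subsetD[OF span_subset]) blast
  next
    case (add x y)
    then show ?case
      by (simp add: mult_map_def lin_add[OF lift_lin[OF A_module A_bilin]] subspace_add[OF sub])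
  qed
  then show "carrier A \<subseteq> span_of K A ?S"
    unfolding idempotent_A[unfolded idempotent_algebra_def, symmetric] by (rule image_subsetI)
qed

lemma wmb_slices:
  assumes full: "right_full K A"
  shows "wmb_slices K A (mult A) (counit A) (E1 A) (E2 A) (T1 A) (T2 A) (T3 A) (T4 A)"
proof (rule wmb_slices.intro[OF vector_spaces_axioms], rule wmb_slices_axioms.intro)
  show T13: "X (\<lambda>u. \<beta> (a \<star> u)) b c = Y (\<lambda>u. \<beta> (u \<star> b)) a c"
    if "\<beta> \<in> dual A" "a \<in> carrier A" "b \<in> carrier A" "c \<in> carrier A" for \<beta> a b c
    using that by (simp add: rslice_def cr_mul_legs(2,4)[symmetric] T1_T3)
  have full_X: "span_of K A {X \<beta> d u | \<beta> d u. \<beta> \<in> dual A \<and> d \<in> carrier A \<and> u \<in> carrier A} = carrier A"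
  proof -
    have "{X \<beta> d u | \<beta> d u. \<beta> \<in> dual A \<and> d \<in> carrier A \<and> u \<in> carrier A}
      = {cr \<omega> (T1 A (pt a b)) | \<omega> a b. a \<in> carrier A \<and> b \<in> carrier A \<and> \<omega> \<in> dual A}"
      unfolding rslice_def by blast
    then show ?thesis using full by (simp add: right_full_def)
  qed
  then show "span_of K A {X \<beta> d u | \<beta> d u. \<beta> \<in> dual A \<and> d \<in> carrier A \<and> u \<in> carrier A} = carrier A" .
  show "span_of K A {Y \<beta> d u | \<beta> d u. \<beta> \<in> dual A \<and> d \<in> carrier A \<and> u \<in> carrier A} = carrier A"
    by (rule full_other_side[OF A_module T1_linear T3_linear T13 full_X])
  show "Z \<beta> c (Y \<gamma> b y) = Y \<gamma> b (Z \<beta> c y)"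
    if "\<beta> \<in> dual A" "\<gamma> \<in> dual A" "b \<in> carrier A" "c \<in> carrier A" "y \<in> carrier A" for \<beta> \<gamma> b c y
    by (rule commutes_with_Y) (use that in \<open>simp_all add: Z_X X_lin[OF _ lin_id]\<close>)
  show "W \<beta> c (X \<gamma> b y) = X \<gamma> b (W \<beta> c y)"
    if "\<beta> \<in> dual A" "\<gamma> \<in> dual A" "b \<in> carrier A" "c \<in> carrier A" "y \<in> carrier A" for \<beta> \<gamma> b c y
    by (rule commutes_with_W) (use that in \<open>simp_all add: Z_X X_lin[OF _ lin_id]\<close>)
  show "W \<beta> c (Y \<gamma> b y) = Y \<gamma> b (W \<beta> c y)"
    if "\<beta> \<in> dual A" "\<gamma> \<in> dual A" "b \<in> carrier A" "c \<in> carrier A" "y \<in> carrier A" for \<beta> \<gamma> b c y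
    by (rule commutes_with_W) (use that in \<open>simp_all add: commutes_with_Y Z_X X_lin[OF _ lin_id]\<close>)
  show "lslice K A A (E1 A) \<beta> c (X \<gamma> b y) = X \<gamma> b (lslice K A A (E1 A) \<beta> c y)"
    if "\<beta> \<in> dual A" "\<gamma> \<in> dual A" "b \<in> carrier A" "c \<in> carrier A" "y \<in> carrier A" for \<beta> \<gamma> b c y
    by (rule slices_commute[OF A_module E1_linear T1_linear E1_T1 that])
  show "lslice K A A (E2 A) \<beta> c (Y \<gamma> b y) = Y \<gamma> b (lslice K A A (E2 A) \<beta> c y)"
    if "\<beta> \<in> dual A" "\<gamma> \<in> dual A" "b \<in> carrier A" "c \<in> carrier A" "y \<in> carrier A" for \<beta> \<gamma> b c y
    by (rule E2_Y[OF that])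
  show "E1 A (pt b c) \<in> span_of K AA {tensor_map K A A (\<lambda>u. u \<star> y) (\<lambda>u. u) (T1 A (pt x z)) | x y z.
      x \<in> carrier A \<and> y \<in> carrier A \<and> z \<in> carrier A}" if "b \<in> carrier A" "c \<in> carrier A" for b c
    unfolding T1_E1_range[unfolded rmul1_def]
    by (rule subsetD[OF span_subset]) (use that in blast)
  show "E2 A (pt b c) \<in> span_of K AA {tensor_map K A A (\<lambda>u. y \<star> u) (\<lambda>u. u) (T3 A (pt x z)) | x y z.
      x \<in> carrier A \<and> y \<in> carrier A \<and> z \<in> carrier A}" (is "_ \<in> span_of K AA ?S") if "b \<in> carrier A" "c \<in> carrier A" for b c
  proof -
    have "?S = {lm2 c (T2 A (pt b a)) | a b c. a \<in> carrier A \<and> b \<in> carrier A \<and> c \<in> carrier A}"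
    proof (intro equalityI subsetI)
      fix s assume "s \<in> ?S"
      then obtain x y z where x: "x \<in> carrier A" "y \<in> carrier A" "z \<in> carrier A"
        and s: "s = tensor_map K A A (\<lambda>u. y \<star> u) (\<lambda>u. u) (T3 A (pt x z))" by (elim CollectE exE conjE)
      have "s = lm2 z (T2 A (pt y x))" using T3_T2[OF x(3,2,1)] unfolding s lmul1_def .
      then show "s \<in> {lm2 c (T2 A (pt b a)) | a b c. a \<in> carrier A \<and> b \<in> carrier A \<and> c \<in> carrier A}" using x by blast
    next
      fix s assume "s \<in> {lm2 c (T2 A (pt b a)) | a b c. a \<in> carrier A \<and> b \<in> carrier A \<and> c \<in> carrier A}"
      then obtain a b c where x: "a \<in> carrier A" "b \<in> carrier A" "c \<in> carrier A"
        and s: "s = lm2 c (T2 A (pt b a))" by (elim CollectE exE conjE)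
      have "s = tensor_map K A A (\<lambda>u. b \<star> u) (\<lambda>u. u) (T3 A (pt a c))"
        using T3_T2[OF x(3,2,1)] unfolding s lmul1_def by simp
      then show "s \<in> ?S" using x by blast
    qed
    then show ?thesis
      by (simp only: T2_E2_range) (rule subsetD[OF span_subset], use that in blast)
  qed
  show "a = \<zero>\<^bsub>A\<^esub>" if "a \<in> carrier A" "\<And>b. b \<in> carrier A \<Longrightarrow> a \<star> b = \<zero>\<^bsub>A\<^esub>" for a
    using nondegenerate_A that unfolding nondegenerate_algebra_def by blast
  show "a = \<zero>\<^bsub>A\<^esub>" if "a \<in> carrier A" "\<And>b. b \<in> carrier A \<Longrightarrow> b \<star> a = \<zero>\<^bsub>A\<^esub>" for a
    using nondegenerate_A that unfolding nondegenerate_algebra_def by blast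
  show "tensor_lift K (scalars K) (\<lambda>p q. \<gamma> (q \<star> Z \<alpha> p y)) (T2 A (pt d c)) = \<gamma> (Z \<alpha> d (c \<star> y))"
    if "\<gamma> \<in> dual A" "\<alpha> \<in> dual A" "c \<in> carrier A" "d \<in> carrier A" "y \<in> carrier A" for \<gamma> \<alpha> c d y
    unfolding Z_product[OF that(2-5), symmetric]
    by (rule lift_comp[OF ZA_bilin[OF that(2,5)] _ scalars_module that(1), symmetric]) (use that in simp)
  show "tensor_lift K (scalars K) (\<lambda>p q. \<gamma> (W \<alpha> p y \<star> q)) (T4 A (pt d c)) = \<gamma> (W \<alpha> d (y \<star> c))"
    if "\<gamma> \<in> dual A" "\<alpha> \<in> dual A" "c \<in> carrier A" "d \<in> carrier A" "y \<in> carrier A" for \<gamma> \<alpha> c d y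
    unfolding W_product[OF that(2-5), symmetric]
    by (rule lift_comp[OF WA_bilin[OF that(2,5)] _ scalars_module that(1), symmetric]) (use that in simp)
  show "lslice K A A (E1 A) \<beta> b (u \<star> d) = lslice K A A (E1 A) \<beta> b u \<star> d"
    if "\<beta> \<in> dual A" "b \<in> carrier A" "u \<in> carrier A" "d \<in> carrier A" for \<beta> b u d
    using that E1_rm2[of d "pt b u"] by (simp add: lslice_def cl_mul_legs(4)[symmetric])
  show "lslice K A A (E2 A) \<beta> b (d \<star> u) = d \<star> lslice K A A (E2 A) \<beta> b u"
    if "\<beta> \<in> dual A" "b \<in> carrier A" "u \<in> carrier A" "d \<in> carrier A" for \<beta> b u d
    using that E2_lm2[of d "pt b u"] by (simp add: lslice_def cl_mul_legs(2)[symmetric])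
  show "a \<star> rslice K A A (E1 A) (\<lambda>u. \<beta> (b \<star> u)) d c = rslice K A A (E2 A) (\<lambda>u. \<beta> (u \<star> d)) b a \<star> c"
    if "\<beta> \<in> dual A" "a \<in> carrier A" "b \<in> carrier A" "c \<in> carrier A" "d \<in> carrier A" for \<beta> a b c d
    using that by (simp add: rslice_def cr_mul_legs[symmetric] E_mul)
  show "lslice K A A (E2 A) (counit A) a b \<star> c = b \<star> Z (counit A) a c"
    if "a \<in> carrier A" "b \<in> carrier A" "c \<in> carrier A" for a b c
    using that counit_E2[OF that] by (simp add: lslice_def cl_mul_legs)
  show "c \<star> lslice K A A (E1 A) (counit A) a b = W (counit A) a c \<star> b"
    if "a \<in> carrier A" "b \<in> carrier A" "c \<in> carrier A" for a b c
    using that counit_E1[of c a b] by (simp add: lslice_def cl_mul_legs(2,4)[symmetric] T1_T4[symmetric])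
qed (simp_all add: A_bilin A_assoc products_span_A X_Z Y_W X_W Y_Z Z_X counit_X counit_Z X_product Y_product X_E1 Y_E2
  E1_T1_fix E2_T3_fix, simp_all add: rslice_def lslice_def cr_cl cl_counit_T3, simp add: cr_cl[symmetric] cr_counit_T4)

end

section \<open>Vector spaces with the same underlying operations\<close>

text \<open>
  The bimodule associated with a comodule is a different record with the same vector space
  operations. All constructions depend on the operations only.
\<close>

lemma same_space:
  fixes K :: "('k, 'm) ring_scheme" and M :: "('k, 'v, 'a) module_scheme" and V :: "('k, 'v, 'b) module_scheme"
    and W :: "('k, 'w, 'c) module_scheme"
  assumes eq: "carrier M = carrier V" "zero M = zero V" "add M = add V" "smult M = smult V"
  shows "module K M \<longleftrightarrow> module K V" "lin_map K M W = lin_map K V W" "lin_map K W M = lin_map K W V"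
    "tensor_space K M W = tensor_space K V W" "tensor_space K W M = tensor_space K W V"
    "pure_tensor K M W = pure_tensor K V W" "pure_tensor K W M = pure_tensor K W V"
    "tensor_lift K M = tensor_lift K V"
proof -
  have ag: "abelian_group M \<longleftrightarrow> abelian_group V"
    by (simp add: abelian_group_def abelian_group_axioms_def abelian_monoid_def comm_group_def group_def
      group_axioms_def comm_monoid_def comm_monoid_axioms_def monoid_def Units_def eq)
  show "module K M \<longleftrightarrow> module K V"
    unfolding module_def module_axioms_def ag by (simp add: eq)
  show "lin_map K M W = lin_map K V W" "lin_map K W M = lin_map K W V"
    by (simp_all add: lin_map_def eq)
  have r: "tensor_rels K M W = tensor_rels K V W" "tensor_rels K W M = tensor_rels K W V"
    by (simp_all only: tensor_rels_def eq)
  have k: "tensor_kernel K M W = tensor_kernel K V W" "tensor_kernel K W M = tensor_kernel K W V"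
    by (simp_all only: tensor_kernel_def r eq)
  show "tensor_space K M W = tensor_space K V W" "tensor_space K W M = tensor_space K W V"
    by (simp_all only: tensor_space_def k eq)
  show "pure_tensor K M W = pure_tensor K V W" "pure_tensor K W M = pure_tensor K W V"
    by (simp_all add: fun_eq_iff pure_tensor_def k eq)
  have fs: "finsum M f S = finsum V f S" for f :: "'x \<Rightarrow> 'v" and S by (simp add: finsum_def finprod_def eq)
  show "tensor_lift K M = tensor_lift K V"
    by (simp add: fun_eq_iff tensor_lift_def fs eq)
qed

section \<open>The two categories\<close>

lemma firm_bimodule_category:
  fixes K :: "('k, 'm) ring_scheme" and R :: "('k, 'r) module"
  shows "is_category (firm_bimodule_category K R :: (('k, 'r, 'v) bimodule, 'v \<Rightarrow> 'v) category)"
proof -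
  have act: "lact M r x \<in> carrier M" "ract M x r \<in> carrier M"
    if "firm_bimodule K R M" "r \<in> carrier R" "x \<in> carrier M" for M :: "('k, 'r, 'v) bimodule" and r x
  proof -
    have l: "bilin_map K R M M (lact M)" and r: "bilin_map K M R M (ract M)"
      using that(1) by (auto simp: firm_bimodule_def is_bimodule_def)
    have "lact M r \<in> carrier M \<rightarrow> carrier M" using l that(2) unfolding bilin_map_def lin_map_def by simp
    moreover have "(\<lambda>x. ract M x r) \<in> carrier M \<rightarrow> carrier M" using r that(2) unfolding bilin_map_def lin_map_def by simp
    ultimately show "lact M r x \<in> carrier M" "ract M x r \<in> carrier M" using that(3) by auto
  qed
  have m: "module K M" if "firm_bimodule K R M" for M :: "('k, 'r, 'v) bimodule"
    using that by (simp add: firm_bimodule_def is_bimodule_def)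
  have add: "x \<oplus>\<^bsub>M\<^esub> y \<in> carrier M"
    if "firm_bimodule K R M" "x \<in> carrier M" "y \<in> carrier M" for M :: "('k, 'r, 'v) bimodule" and x y
  proof -
    interpret M: module K M by (rule m[OF that(1)])
    show ?thesis using that by simp
  qed
  have smult: "c \<odot>\<^bsub>M\<^esub> x \<in> carrier M"
    if "firm_bimodule K R M" "x \<in> carrier M" "c \<in> carrier K" for M :: "('k, 'r, 'v) bimodule" and x c
  proof -
    interpret M: module K M by (rule m[OF that(1)])
    show ?thesis using that by simp
  qed
  have id: "(\<lambda>x\<in>carrier M. x) \<in> bimodule_hom K R M M" if "firm_bimodule K R M" for M :: "('k, 'r, 'v) bimodule"
    using act[OF that] add[OF that] smult[OF that] by (auto simp: bimodule_hom_def lin_map_def)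
  have comp: "compose (carrier L) g f \<in> bimodule_hom K R L N"
    if L: "firm_bimodule K R L" and fg: "f \<in> bimodule_hom K R L M" "g \<in> bimodule_hom K R M N"
    for L M N :: "('k, 'r, 'v) bimodule" and f g
    using fg act[OF L] add[OF L] smult[OF L] by (auto simp: bimodule_hom_def lin_map_def compose_def Pi_def)
  show ?thesis
    unfolding is_category_def firm_bimodule_category_def category.simps mem_Collect_eq
  proof (intro conjI ballI)
    fix X Y Z :: "('k, 'r, 'v) bimodule" and f g
    assume o: "X \<in> Collect (firm_bimodule K R)" "Y \<in> Collect (firm_bimodule K R)" "Z \<in> Collect (firm_bimodule K R)"
    show "(\<lambda>m\<in>carrier X. m) \<in> bimodule_hom K R X X" using o by (simp add: id)
    assume f: "f \<in> bimodule_hom K R X Y"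
    show "compose (carrier X) f (\<lambda>m\<in>carrier X. m) = f" "compose (carrier X) (\<lambda>m\<in>carrier Y. m) f = f"
      using f by (auto simp: bimodule_hom_def lin_map_def intro: compose_Id Id_compose)
    assume g: "g \<in> bimodule_hom K R Y Z"
    show "compose (carrier X) g f \<in> bimodule_hom K R X Z" using o f g by (simp add: comp)
  next
    fix W X Y Z :: "('k, 'r, 'v) bimodule" and f g h
    assume "f \<in> bimodule_hom K R W X"
    then show "compose (carrier W) h (compose (carrier W) g f) = compose (carrier W) (compose (carrier X) h g) f"
      by (auto simp: bimodule_hom_def lin_map_def intro: compose_assoc)
  qed
qed

context regular_weak_multiplier_bialgebra
begin

text \<open>
  The definition of a morphism mentions \<open>\<lambda>\<close> only. The statement about \<open>\<rho>\<close> follows from it for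
  covered functionals, and the covering factor is cancelled.
\<close>

lemma comodule_hom_slice:
  assumes V: "right_comodule K A V" and V': "right_comodule K A V'" and f: "f \<in> comodule_hom K A V V'"
    and c: "\<beta> \<in> dual A" "p \<in> carrier A" "v \<in> carrier V"
  shows "f (rslice K V A (colam V) \<beta> p v) = rslice K V' A (colam V') \<beta> p (f v)"
    "f (rslice K V A (corho V) \<beta> p v) = rslice K V' A (corho V') \<beta> p (f v)"
proof -
  have m: "module K V" "module K V'" using V V' by (auto simp: right_comodule_def)
  have l: "colam V \<in> lin_map K (V \<boxtimes> A) (V \<boxtimes> A)" "corho V \<in> lin_map K (V \<boxtimes> A) (V \<boxtimes> A)"
    "colam V' \<in> lin_map K (V' \<boxtimes> A) (V' \<boxtimes> A)" "corho V' \<in> lin_map K (V' \<boxtimes> A) (V' \<boxtimes> A)"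
    using V V' by (auto simp: right_comodule_def)
  have fl: "f \<in> lin_map K V V'" using f by (simp add: comodule_hom_def)
  note fc [simp] = lin_closed[OF fl]
  note mA = A_module
  have pV: "pure_tensor K V A v p \<in> carrier (V \<boxtimes> A)" if "v \<in> carrier V" "p \<in> carrier A" for v p
    using that by (intro pure_closed m mA)
  have X: "f (rslice K V A (colam V) \<beta> p v) = rslice K V' A (colam V') \<beta> p (f v)"
    if c: "\<beta> \<in> dual A" "p \<in> carrier A" "v \<in> carrier V" for \<beta> p v
  proof -
    have "colam V' (tensor_map K V' A f (\<lambda>a. a) (pure_tensor K V A v p)) = tensor_map K V' A f (\<lambda>a. a) (colam V (pure_tensor K V A v p))"
      using f pV[OF c(3,2)] by (simp add: comodule_hom_def)
    then have "colam V' (pure_tensor K V' A (f v) p) = tensor_map K V' A f (\<lambda>a. a) (colam V (pure_tensor K V A v p))"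
      using c by (simp add: tensor_map_pure[OF m(1) mA m(2) mA fl lin_id])
    then show ?thesis
      using c by (simp add: rslice_def contract_right_map[OF m(1) mA m(2) mA fl lin_id] lin_closed[OF l(1) pV])
  qed
  then show "f (rslice K V A (colam V) \<beta> p v) = rslice K V' A (colam V') \<beta> p (f v)" by (simp add: c)
  have XY: "rslice K V A (colam V) (\<lambda>u. \<beta> (a \<star> u)) b v = rslice K V A (corho V) (\<lambda>u. \<beta> (u \<star> b)) a v"
    if V: "right_comodule K A V" and c: "\<beta> \<in> dual A" "a \<in> carrier A" "b \<in> carrier A" "v \<in> carrier V"
    for \<beta> a b v and V :: "('k, 'v, 'a) comodule"
  proof -
    have m: "module K V" and l: "colam V \<in> lin_map K (V \<boxtimes> A) (V \<boxtimes> A)"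
      "corho V \<in> lin_map K (V \<boxtimes> A) (V \<boxtimes> A)"
      and eq: "lmul2 K V A a (colam V (pure_tensor K V A v b)) = rmul2 K V A b (corho V (pure_tensor K V A v a))"
      using V c by (auto simp: right_comodule_def)
    note cl = lin_closed[OF l(1) pure_closed[OF m mA c(4,3)]] lin_closed[OF l(2) pure_closed[OF m mA c(4,2)]]
    from arg_cong[OF eq, of "contract_right K V \<beta>"] show ?thesis
      using c cl by (simp add: lmul2_def rmul2_def rslice_def contract_right_map[OF m mA m mA lin_id])
  qed
  let ?s = "tensor_map K V' A f (\<lambda>a. a) (corho V (pure_tensor K V A v p))" and ?t = "corho V' (pure_tensor K V' A (f v) p)"
  have st: "?s \<in> carrier (V' \<boxtimes> A)" "?t \<in> carrier (V' \<boxtimes> A)"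
    using c by (simp_all add: lin_closed[OF tensor_map_lin[OF m(1) mA m(2) mA fl lin_id]] lin_closed[OF l(2)] lin_closed[OF l(4)] pure_closed m)
  have cs: "contract_right K V' \<gamma> ?s = f (rslice K V A (corho V) \<gamma> p v)" if "\<gamma> \<in> dual A" for \<gamma>
    using that c by (simp add: rslice_def contract_right_map[OF m(1) mA m(2) mA fl lin_id] lin_closed[OF l(2) pV])
  have st': "contract_left K A \<phi> ?s = contract_left K A \<phi> ?t" if ph: "\<phi> \<in> dual V'" for \<phi>
  proof (rule A_cancel_right)
    note cl = lin_closed[OF contract_left_lin[OF m(2) mA ph]]
    show "contract_left K A \<phi> ?s \<in> carrier A" "contract_left K A \<phi> ?t \<in> carrier A" using st by (simp_all add: cl)
    fix b assume b: "b \<in> carrier A"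
    show "contract_left K A \<phi> ?s \<star> b = contract_left K A \<phi> ?t \<star> b"
    proof (rule dual_eqI[OF mA])
      fix \<gamma> assume g: "\<gamma> \<in> dual A"
      have g': "(\<lambda>u. \<gamma> (u \<star> b)) \<in> dual A" using g b by simp
      have "\<gamma> (contract_left K A \<phi> ?s \<star> b) = \<phi> (f (rslice K V A (corho V) (\<lambda>u. \<gamma> (u \<star> b)) p v))"
        using contract_comm[OF m(2) mA ph g' st(1)] by (simp add: cs[OF g'])
      also have "\<dots> = \<phi> (contract_right K V' (\<lambda>u. \<gamma> (u \<star> b)) ?t)"
        using X[OF dual_lmult[OF g c(2)] b c(3)] by (simp add: XY V V' g b c rslice_def[symmetric])
      also have "\<dots> = \<gamma> (contract_left K A \<phi> ?t \<star> b)" by (rule contract_comm[OF m(2) mA ph g' st(2)])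
      finally show "\<gamma> (contract_left K A \<phi> ?s \<star> b) = \<gamma> (contract_left K A \<phi> ?t \<star> b)" .
    qed (use st b cl in simp_all)
  qed
  show "f (rslice K V A (corho V) \<beta> p v) = rslice K V' A (corho V') \<beta> p (f v)"
  proof (rule dual_eqI[OF m(2)])
    show "f (rslice K V A (corho V) \<beta> p v) \<in> carrier V'" "rslice K V' A (corho V') \<beta> p (f v) \<in> carrier V'"
      using c by (simp_all add: rslice_closed m l)
    fix \<phi> assume ph: "\<phi> \<in> dual V'"
    show "\<phi> (f (rslice K V A (corho V) \<beta> p v)) = \<phi> (rslice K V' A (corho V') \<beta> p (f v))"
      unfolding cs[OF c(1), symmetric] unfolding rslice_def
      using contract_comm[OF m(2) mA ph c(1) st(1)] contract_comm[OF m(2) mA ph c(1) st(2)] st'[OF ph] by simp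
  qed
qed

lemma full_comodule_category:
  "is_category (full_comodule_category K A :: (('k, 'v, 'a) comodule, 'v \<Rightarrow> 'v) category)"
proof -
  note mA = A_module
  have co: "module K V" "colam V \<in> lin_map K (V \<boxtimes> A) (V \<boxtimes> A)"
    if "full_comodule K A V" for V :: "('k, 'v, 'a) comodule"
    using that by (auto simp: full_comodule_def right_comodule_def)
  have id: "(\<lambda>x\<in>carrier V. x) \<in> comodule_hom K A V V" if V: "full_comodule K A V" for V :: "('k, 'v, 'a) comodule"
  proof -
    have l: "(\<lambda>x\<in>carrier V. x) \<in> lin_map K V V"
      by (rule lin_map_cong[OF co(1)[OF V] lin_id]) simp
    have "tensor_map K V A (\<lambda>x\<in>carrier V. x) (\<lambda>a. a) x = x" if "x \<in> carrier (V \<boxtimes> A)" for x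
      by (rule tensor_ext[OF co(1)[OF V] mA tensor_module[OF co(1)[OF V] mA] tensor_map_lin[OF co(1)[OF V] mA co(1)[OF V] mA l lin_id] lin_id _ that])
        (simp add: tensor_map_pure[OF co(1)[OF V] mA co(1)[OF V] mA l lin_id])
    then show ?thesis using l lin_closed[OF co(2)[OF V]] by (simp add: comodule_hom_def)
  qed
  have comp: "compose (carrier U) g f \<in> comodule_hom K A U W"
    if o: "full_comodule K A U" "full_comodule K A V" "full_comodule K A W" and fg: "f \<in> comodule_hom K A U V" "g \<in> comodule_hom K A V W"
    for U V W :: "('k, 'v, 'a) comodule" and f g
  proof -
    have f: "f \<in> lin_map K U V" and g: "g \<in> lin_map K V W" using fg by (simp_all add: comodule_hom_def)
    have l: "compose (carrier U) g f \<in> lin_map K U W"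
      by (rule lin_map_cong[OF co(1)[OF o(1)] lin_comp[OF g f]]) (simp add: compose_eq)
    note U = co[OF o(1)] and V = co[OF o(2)] and W = co[OF o(3)]
    note fm = tensor_map_lin[OF U(1) mA V(1) mA f lin_id] and gm = tensor_map_lin[OF V(1) mA W(1) mA g lin_id]
    have t: "tensor_map K W A (compose (carrier U) g f) (\<lambda>a. a) x = tensor_map K W A g (\<lambda>a. a) (tensor_map K V A f (\<lambda>a. a) x)"
      if "x \<in> carrier (U \<boxtimes> A)" for x
      by (rule tensor_ext[OF U(1) mA tensor_module[OF W(1) mA] tensor_map_lin[OF U(1) mA W(1) mA l lin_id] lin_comp[OF gm fm] _ that])
        (simp add: tensor_map_pure[OF U(1) mA W(1) mA l lin_id] tensor_map_pure[OF U(1) mA V(1) mA f lin_id]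
          tensor_map_pure[OF V(1) mA W(1) mA g lin_id] lin_closed[OF f] compose_eq)
    show ?thesis
      using fg l by (simp add: comodule_hom_def t lin_closed[OF U(2)] lin_closed[OF fm])
  qed
  show ?thesis
    unfolding is_category_def full_comodule_category_def category.simps mem_Collect_eq
  proof (intro conjI ballI)
    fix X Y Z :: "('k, 'v, 'a) comodule" and f g
    assume o: "X \<in> {V. full_comodule K A V}" "Y \<in> {V. full_comodule K A V}" "Z \<in> {V. full_comodule K A V}"
    show "(\<lambda>v\<in>carrier X. v) \<in> comodule_hom K A X X" using o by (simp add: id)
    assume f: "f \<in> comodule_hom K A X Y"
    show "compose (carrier X) f (\<lambda>v\<in>carrier X. v) = f" "compose (carrier X) (\<lambda>v\<in>carrier Y. v) f = f"
      using f by (auto simp: comodule_hom_def lin_map_def intro: compose_Id Id_compose)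
    assume g: "g \<in> comodule_hom K A Y Z"
    show "compose (carrier X) g f \<in> comodule_hom K A X Z" using o f g by (auto intro: comp)
  next
    fix W X Y Z :: "('k, 'v, 'a) comodule" and f g h
    assume "f \<in> comodule_hom K A W X"
    then show "compose (carrier W) h (compose (carrier W) g f) = compose (carrier W) (compose (carrier X) h g) f"
      by (auto simp: comodule_hom_def lin_map_def intro: compose_assoc)
  qed
qed

end

context regular_weak_multiplier_bialgebra
begin

context
  assumes full_A: "right_full K A"
begin

interpretation S: wmb_slices K A "mult A" "counit A" "E1 A" "E2 A" "T1 A" "T2 A" "T3 A" "T4 A"
  "rslice K A A (T1 A)" "rslice K A A (T3 A)" "lslice K A A (T2 A)" "lslice K A A (T4 A)"
  "lslice K A A (E1 A)" "rslice K A A (E1 A)" "lslice K A A (E2 A)" "rslice K A A (E2 A)"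
  by (rule wmb_slices[OF full_A]) simp_all

section \<open>Comodules over a weak multiplier bialgebra\<close>

lemma base_algebra_eq: "S.B = base_algebra K A"
  by (simp add: S.B_def base_algebra_def S.capR_def[abs_def] sqcap_R_def[abs_def] rslice_def[abs_def])

context
  fixes V :: "('k, 'v, 'a) comodule"
  assumes V: "right_comodule K A V"
begin

private lemma m: "module K V"
  and lam: "colam V \<in> lin_map K (V \<boxtimes> A) (V \<boxtimes> A)"
  and rho: "corho V \<in> lin_map K (V \<boxtimes> A) (V \<boxtimes> A)"
  using V by (auto simp: right_comodule_def)

private abbreviation "XV \<equiv> rslice K V A (colam V)"

private lemma XV_bilin:
  "\<beta> \<in> dual A \<Longrightarrow> \<gamma> \<in> dual A \<Longrightarrow> v \<in> carrier V \<Longrightarrow> bilin_map K A A V (\<lambda>p q. XV \<beta> p (XV \<gamma> q v))"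
  by (rule bilinI) (intro lin_intros m lam A_module rslice_closed; simp)+

text \<open>
  Contracting the last two legs of the left-hand sides of the comodule axioms gives iterated
  slices, the arguments of which are the legs of \<open>t\<close>.
\<close>

private lemma slice_legs:
  assumes d: "\<beta> \<in> dual A" "\<gamma> \<in> dual A" and v: "v \<in> carrier V" and t: "t \<in> carrier AA"
  shows "contract_right K V \<beta> (contract_right K (V \<boxtimes> A) \<gamma>
      (leg12 K V A A (colam V) (leg13 K V A A (colam V) (tensor_unassoc K V A A (pure_tensor K V AA v t)))))
    = tensor_lift K V (\<lambda>p q. XV \<beta> p (XV \<gamma> q v)) t"
proof (rule AA_ext[OF m _ tensor_lift_lin[OF A_module A_module m XV_bilin[OF d v]] _ t])
  note mA = A_module
  note VA = tensor_module[OF m mA]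
  show "(\<lambda>t. contract_right K V \<beta> (contract_right K (V \<boxtimes> A) \<gamma>
      (leg12 K V A A (colam V) (leg13 K V A A (colam V) (tensor_unassoc K V A A (pure_tensor K V AA v t))))))
    \<in> lin_map K AA V"
    by (intro lin_comp[OF contract_right_lin[OF m mA d(1)]] lin_comp[OF contract_right_lin[OF VA mA d(2)]]
      lin_comp[OF leg12_lin[OF m mA m mA mA lam]] lin_comp[OF leg13_lin[OF m mA mA lam]] lin_comp[OF tensor_unassoc_lin[OF m mA mA]]
      pure_lin2[OF m AA_module v])
  fix p q assume p: "p \<in> carrier A" "q \<in> carrier A"
  have x: "leg13 K V A A (colam V) (pure_tensor K (V \<boxtimes> A) A (pure_tensor K V A v p) q) \<in> carrier ((V \<boxtimes> A) \<boxtimes> A)"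
    using p v by (intro lin_closed[OF leg13_lin[OF m mA mA lam]] pure_closed VA mA m)
  show "contract_right K V \<beta> (contract_right K (V \<boxtimes> A) \<gamma>
      (leg12 K V A A (colam V) (leg13 K V A A (colam V) (tensor_unassoc K V A A (pure_tensor K V AA v (pt p q))))))
    = tensor_lift K V (\<lambda>p q. XV \<beta> p (XV \<gamma> q v)) (pt p q)"
    using p v d x by (simp add: tensor_unassoc_pure[OF m mA mA] contract_right_leg12[OF m mA m mA mA lam]
      contract_right_leg13_pure[OF m mA mA lam] tensor_lift_pure[OF mA mA m XV_bilin[OF d v, unfolded rslice_def]] rslice_def)
qed

lemma comodule_maps_colam: "S.comodule_maps V (colam V) (corho V)"
  unfolding S.comodule_maps_def
proof (intro conjI ballI m lam rho)
  note mA = A_module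
  note VA = tensor_module[OF m mA]
  fix \<beta> a b v assume b: "\<beta> \<in> dual A" and c: "a \<in> carrier A" "b \<in> carrier A" "v \<in> carrier V"
  have x: "pure_tensor K (V \<boxtimes> A) A (pure_tensor K V A v a) b \<in> carrier ((V \<boxtimes> A) \<boxtimes> A)"
    using c by (intro pure_closed VA mA m)
  have cl: "colam V (pure_tensor K V A v p) \<in> carrier (V \<boxtimes> A)"
    "corho V (pure_tensor K V A v p) \<in> carrier (V \<boxtimes> A)" if "p \<in> carrier A" for p
    using that c by (simp_all add: lin_closed[OF lam] lin_closed[OF rho] pure_closed m)
  have "lmul2 K V A a (colam V (pure_tensor K V A v b)) = rmul2 K V A b (corho V (pure_tensor K V A v a))"
    using V c by (simp add: right_comodule_def)
  from arg_cong[OF this, of "contract_right K V \<beta>"]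
  show "XV (\<lambda>u. \<beta> (a \<star> u)) b v = rslice K V A (corho V) (\<lambda>u. \<beta> (u \<star> b)) a v"
    using c b cl by (simp add: lmul2_def rmul2_def rslice_def contract_right_map[OF m mA m mA lin_id])
  fix \<gamma> assume g: "\<gamma> \<in> dual A"
  show "tensor_lift K V (\<lambda>p q. XV \<beta> p (XV \<gamma> q v)) (E1 A (pt a b)) = XV \<beta> a (XV \<gamma> b v)"
  proof -
    have "leg12 K V A A (colam V) (leg13 K V A A (colam V) (tensor_unassoc K V A A (pure_tensor K V AA v (E1 A (pt a b))))) =
        leg12 K V A A (colam V) (leg13 K V A A (colam V) (tensor_unassoc K V A A (pure_tensor K V AA v (pt a b))))"
      using V x c by (simp add: right_comodule_def leg23_pure_left[OF m mA mA mA mA E1_linear, symmetric] tensor_unassoc_pure m)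
    then have "tensor_lift K V (\<lambda>p q. XV \<beta> p (XV \<gamma> q v)) (E1 A (pt a b)) = tensor_lift K V (\<lambda>p q. XV \<beta> p (XV \<gamma> q v)) (pt a b)"
      using c by (simp add: slice_legs[OF b g c(3), symmetric])
    then show ?thesis using c by (simp add: tensor_lift_pure[OF mA mA m XV_bilin[OF b g c(3)]])
  qed
  show "tensor_lift K V (\<lambda>p q. XV \<beta> p (XV \<gamma> q v)) (T1 A (pt a b)) = XV (\<lambda>u. \<beta> (rslice K A A (T1 A) \<gamma> b u)) a v"
  proof -
    have h: "rslice K A A (T1 A) \<gamma> b \<in> lin_map K A A" using X_lin(2)[OF g lin_id c(2)] .
    have leg: "contract_right K V \<beta> (contract_right K (V \<boxtimes> A) \<gamma> (leg23 K V A A A A (T1 A) (pure_tensor K (V \<boxtimes> A) A y b)))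
        = contract_right K V (\<lambda>u. \<beta> (rslice K A A (T1 A) \<gamma> b u)) y" if y: "y \<in> carrier (V \<boxtimes> A)" for y
    proof (rule tensor_ext[OF m mA m _ contract_right_lin[OF m mA lin_comp[OF b h]] _ y])
      show "(\<lambda>y. contract_right K V \<beta> (contract_right K (V \<boxtimes> A) \<gamma> (leg23 K V A A A A (T1 A) (pure_tensor K (V \<boxtimes> A) A y b))))
         \<in> lin_map K (V \<boxtimes> A) V"
        by (intro lin_comp[OF contract_right_lin[OF m mA b]] lin_comp[OF contract_right_lin[OF VA mA g]]
          lin_comp[OF leg23_lin[OF m mA mA mA mA T1_linear]] pure_lin1[OF VA mA c(2)])
    qed (use b g c in \<open>simp add: leg23_pure_left[OF m mA mA mA mA T1_linear] contract_right_unassoc[OF m mA mA]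
        contract_right_pure m lin_comp[OF b h] rslice_def[symmetric]\<close>)
    have "leg12 K V A A (colam V) (leg13 K V A A (colam V) (tensor_unassoc K V A A (pure_tensor K V AA v (T1 A (pt a b))))) =
        leg23 K V A A A A (T1 A) (pure_tensor K (V \<boxtimes> A) A (colam V (pure_tensor K V A v a)) b)"
      using V x c by (simp add: right_comodule_def leg23_pure_left[OF m mA mA mA mA T1_linear, symmetric] leg12_pure[OF m mA m mA mA lam] pure_closed m)
    then show ?thesis
      using c by (simp add: slice_legs[OF b g c(3), symmetric] leg cl) (simp add: rslice_def)
  qed
qed

lemma full_slices_colam_corho:
  assumes "full_comodule K A V"
  shows "S.full_slices V (colam V)" "S.full_slices V (corho V)"
proof -
  have "{XV \<beta> a v | \<beta> a v. \<beta> \<in> dual A \<and> a \<in> carrier A \<and> v \<in> carrier V}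
      = {contract_right K V \<omega> (colam V (pure_tensor K V A v a)) | \<omega> v a. v \<in> carrier V \<and> a \<in> carrier A \<and> \<omega> \<in> dual A}"
    unfolding rslice_def by blast
  then have f: "span_of K V {XV \<beta> a v | \<beta> a v. \<beta> \<in> dual A \<and> a \<in> carrier A \<and> v \<in> carrier V} = carrier V"
    using assms by (simp add: full_comodule_def)
  then show "S.full_slices V (colam V)" unfolding S.full_slices_def .
  show "S.full_slices V (corho V)" unfolding S.full_slices_def
    by (rule full_other_side[OF m lam rho _ f]) (rule S.XV_YV[OF comodule_maps_colam])
qed

end

section \<open>The functor\<close>

definition base_bimodule :: "('k, 'v, 'a) comodule \<Rightarrow> ('k, ('a \<Rightarrow> 'a) \<times> ('a \<Rightarrow> 'a), 'v) bimodule" where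
  "base_bimodule V = \<lparr>carrier = carrier V, mult = undefined, one = undefined, zero = zero V, add = add V,
     smult = smult V, lact = S.left_act V (corho V), ract = S.right_act V (colam V)\<rparr>"

lemma base_bimodule_same:
  "carrier (base_bimodule V) = carrier V" "zero (base_bimodule V) = zero V" "add (base_bimodule V) = add V"
  "smult (base_bimodule V) = smult V" "lact (base_bimodule V) = S.left_act V (corho V)"
  "ract (base_bimodule V) = S.right_act V (colam V)"
  by (simp_all add: base_bimodule_def)

lemmas base_bimodule_space = same_space[OF base_bimodule_same(1-4)]

lemma base_bimodule_firm:
  assumes "full_comodule K A V"
  shows "firm_bimodule K (base_algebra K A) (base_bimodule V)"
proof -
  have V: "right_comodule K A V" using assms by (simp add: full_comodule_def)
  note cm = comodule_maps_colam[OF V] and fs = full_slices_colam_corho[OF V assms]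
  note [simp] = base_bimodule_same base_bimodule_space
  have "is_bimodule K S.B (base_bimodule V)"
    unfolding is_bimodule_def bilin_map_def
    using S.left_act_bilin[OF cm fs] S.right_act_bilin[OF cm fs(1)] S.module_V[OF cm fs(1)]
    by (simp add: bilin_map_def S.left_act_mult[OF cm fs] S.right_act_mult[OF cm fs(1)] S.left_right_act[OF cm fs])
  moreover have "lin_iso K (balanced_tensor K S.B (base_bimodule V) (ract (base_bimodule V)) S.B (mult S.B)) (base_bimodule V)
      (quot_lift (tensor_lift K (base_bimodule V) (ract (base_bimodule V))))"
    using S.right_firm[OF cm fs(1)] by (simp add: balanced_tensor_def lin_iso_def S.right_relations_def)
  moreover have "lin_iso K (balanced_tensor K S.B S.B (mult S.B) (base_bimodule V) (lact (base_bimodule V))) (base_bimodule V)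
      (quot_lift (tensor_lift K (base_bimodule V) (lact (base_bimodule V))))"
    using S.left_firm[OF cm fs] by (simp add: balanced_tensor_def lin_iso_def S.left_relations_def)
  ultimately show ?thesis unfolding firm_bimodule_def base_algebra_eq by blast
qed

lemma base_bimodule_hom:
  assumes V: "full_comodule K A V" and V': "full_comodule K A V'" and f: "f \<in> comodule_hom K A V V'"
  shows "f \<in> bimodule_hom K (base_algebra K A) (base_bimodule V) (base_bimodule V')"
proof -
  have c: "right_comodule K A V" "right_comodule K A V'" using V V' by (simp_all add: full_comodule_def)
  note cm = comodule_maps_colam[OF c(1)] and cm' = comodule_maps_colam[OF c(2)]
  note fs = full_slices_colam_corho[OF c(1) V] and fs' = full_slices_colam_corho[OF c(2) V']
  have fl: "f \<in> lin_map K V V'" "f \<in> extensional (carrier V)" using f by (simp_all add: comodule_hom_def)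
  have "f (S.left_act V (corho V) r v) = S.left_act V' (corho V') r (f v)"
    if r: "r \<in> carrier S.B" and v: "v \<in> carrier V" for r v
  proof -
    obtain a where "a \<in> carrier A" "r = S.capR a" using r unfolding S.B_simps(1) by (elim imageE)
    then show ?thesis
      using v by (simp add: S.left_act_capR[OF cm fs] S.left_act_capR[OF cm' fs'] lin_closed[OF fl(1)]
        comodule_hom_slice(2)[OF c f])
  qed
  moreover have "f (S.right_act V (colam V) v r) = S.right_act V' (colam V') (f v) r"
    if r: "r \<in> carrier S.B" and v: "v \<in> carrier V" for r v
  proof -
    obtain a where "a \<in> carrier A" "r = S.barR a" using r unfolding S.carrier_B_barR by (elim imageE)
    then show ?thesis
      using v by (simp add: S.right_act_barR[OF cm fs(1)] S.right_act_barR[OF cm' fs'(1)] lin_closed[OF fl(1)]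
        comodule_hom_slice(1)[OF c f])
  qed
  ultimately show ?thesis
    using fl by (simp add: bimodule_hom_def base_algebra_eq[symmetric] base_bimodule_same base_bimodule_space)
qed

lemma base_bimodule_functor:
  "is_functor (full_comodule_category K A :: (('k, 'v, 'a) comodule, 'v \<Rightarrow> 'v) category)
     (firm_bimodule_category K (base_algebra K A)) base_bimodule (\<lambda>V V' f. f)"
  unfolding is_functor_def
proof (intro conjI)
  show "is_category (full_comodule_category K A :: (('k, 'v, 'a) comodule, 'v \<Rightarrow> 'v) category)"
    by (rule full_comodule_category)
  show "is_category (firm_bimodule_category K (base_algebra K A)
      :: (('k, ('a \<Rightarrow> 'a) \<times> ('a \<Rightarrow> 'a), 'v) bimodule, 'v \<Rightarrow> 'v) category)"
    by (rule firm_bimodule_category)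
qed (auto simp: full_comodule_category_def firm_bimodule_category_def base_bimodule_same(1) base_bimodule_firm base_bimodule_hom)

end

end

theorem theorem4p5:
  fixes K :: "('k, 'm) ring_scheme"
    and A :: "('k, 'a, 'n) wmb_scheme"
  assumes "regular_weak_multiplier_bialgebra K A"
    and "right_full K A"
  shows "\<exists>Fo Fm.
    is_functor
      (full_comodule_category K A :: (('k, 'v, 'a) comodule, 'v \<Rightarrow> 'v) category)
      (firm_bimodule_category K (base_algebra K A)
        :: (('k, ('a \<Rightarrow> 'a) \<times> ('a \<Rightarrow> 'a), 'v) bimodule, 'v \<Rightarrow> 'v) category)
      Fo Fm \<and>
    is_faithful
      (full_comodule_category K A :: (('k, 'v, 'a) comodule, 'v \<Rightarrow> 'v) category) Fm"
proof (intro exI conjI)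
  interpret regular_weak_multiplier_bialgebra K A by fact
  show "is_functor (full_comodule_category K A :: (('k, 'v, 'a) comodule, 'v \<Rightarrow> 'v) category)
     (firm_bimodule_category K (base_algebra K A)) (base_bimodule :: ('k, 'v, 'a) comodule \<Rightarrow> _) (\<lambda>V V' f. f)"
    by (rule base_bimodule_functor) fact
  show "is_faithful (full_comodule_category K A :: (('k, 'v, 'a) comodule, 'v \<Rightarrow> 'v) category) (\<lambda>V V' f. f)"
    by (simp add: is_faithful_def inj_on_def)
qed

end
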